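(* Let $R$ be a commutative unital ring, $A$ an Albert algebra over $R$ with cubic norm $N_A$, and $B=B^A$ the associated reduced Brown algebra. The map $\iota$, given for each $R$-ring $S$ and $\rho\in\mathbf{Isom}(N_A)(S)$ by $$\iota_S(\rho)=\widehat\rho:\begin{pmatrix} r&a\\ b&s\end{pmatrix}\mapsto\begin{pmatrix} r&\rho(a)\\ \rho^\dagger(b)&s\end{pmatrix},$$ defines a homomorphism of affine group schemes $\mathbf{Isom}(N_A)\to\mathbf{Aut}(B)$. If $2\in R^*$, then the sequence $$\mathbf{1}\to\mathbf{Isom}(N_A)\xrightarrow{\ \iota\ }\mathbf{Aut}(B)\xrightarrow{\ \pi\ }\boldsymbol{\mu}_2\to\mathbf{1}$$ is split exact.
   Context: An $R$-ring is a commutative unital $R$-algebra; $M_S=M\otimes_R S$. Group schemes are given by their functors of points. Albert algebra: a cubic Jordan algebra $A$ over $R$ whose underlying module is projective of constant rank 27 and such that $A\otimes_R k$ is simple for every $R$-field $k$; it has a cubic norm $N=N_A$, a quadratic adjoint $\sharp$, the (non-degenerate) bilinear trace $T(x,y)=N(1,x)N(1,y)-N(1,x,y)$ (where $N(x,y)$ is the coefficient of $t$ in $N(x+ty)$ and $N(x,y,z)$ is the full linearization of $N$) and the cross product $y\times z=(y+z)^\sharp-y^\sharp-z^\sharp$. $\mathbf{Isom}(N_A)$ is the $R$-group scheme of linear automorphisms of $A$ preserving the cubic form $N_A$. For $\rho\in\mathbf{GL}(A)(S)$, $\rho^\dagger\in\mathbf{GL}(A)(S)$ is determined by $T_S(\rho(x),\rho^\dagger(y))=T_S(x,y)$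 for all $x,y\in A_S$. Reduced Brown algebra $B^A$: the module of matrices $\begin{pmatrix} r&a\\ b&s\end{pmatrix}$, $r,s\in R$, $a,b\in A$, with multiplication $$\begin{pmatrix} r&a\\ b&s\end{pmatrix}\begin{pmatrix} r'&a'\\ b'&s'\end{pmatrix}=\begin{pmatrix} rr'+T(a,b')&ra'+s'a+b\times b'\\ r'b+sb'+a\times a'&ss'+T(a',b)\end{pmatrix}$$ and involution $\begin{pmatrix} r&a\\ b&s\end{pmatrix}^*=\begin{pmatrix} s&a\\ b&r\end{pmatrix}$. $\mathbf{Aut}(B)$ is the group scheme of automorphisms of $B$ as an algebra with involution. If $2\in R^*$, then for each $R$-ring $S$ and $\rho\in\mathbf{Aut}(B)(S)$ the element $j=\mathrm{diag}(1,-1)\in B_S$ satisfies $\rho(j)=\pi(\rho)j$ for a unique $\pi(\rho)\in\boldsymbol{\mu}_2(S)=\{\epsilon\in S\mid\epsilon^2=1\}$; this defines the homomorphism $\pi:\mathbf{Aut}(B)\to\boldsymbol{\mu}_2$. *)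

theory Defs
  imports "HOL-Algebra.Free_Abelian_Groups" "HOL-Algebra.UnivPoly" "HOL-Algebra.Bij"
begin

section \<open>R-rings and scalar extension\<close>

text \<open>
  An R-ring is a commutative unital R-algebra, i.e. a record \<open>S\<close> with \<^term>\<open>algebra R S\<close>.
  The type \<open>'u\<close> plays the role of the universe: the base ring and all R-rings have their carriers
  in \<open>'u\<close>. When \<open>'u\<close> is infinite, this universe contains, up to isomorphism, the polynomial rings
  in finitely many variables over each of its members, and an R-algebra of any cardinality is
  reached by choosing \<open>'u\<close> large enough.
\<close>

type_synonym 'u rring = "('u, 'u) module"

type_synonym ('a, 'u) tensor = "('a \<times> 'u \<Rightarrow>\<^sub>0 int) set"

definition rring_hom :: "('u, 'm) ring_scheme \<Rightarrow> 'u rring \<Rightarrow> 'u rring \<Rightarrow> ('u \<Rightarrow> 'u) set" where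
  "rring_hom R S S' =
    {\<phi> \<in> ring_hom S S'. \<forall>r\<in>carrier R. \<forall>s\<in>carrier S. \<phi> (r \<odot>\<^bsub>S\<^esub> s) = r \<odot>\<^bsub>S'\<^esub> \<phi> s}"

definition base_rring :: "('u, 'm) ring_scheme \<Rightarrow> 'u rring" where
  "base_rring R = \<lparr>carrier = carrier R, monoid.mult = (\<otimes>\<^bsub>R\<^esub>), one = \<one>\<^bsub>R\<^esub>, ring.zero = \<zero>\<^bsub>R\<^esub>,
     ring.add = (\<oplus>\<^bsub>R\<^esub>), smult = (\<otimes>\<^bsub>R\<^esub>)\<rparr>"

text \<open>
  The tensor product of \<open>M\<close> and \<open>S\<close> over \<open>R\<close> is the quotient of the free abelian group on
  \<open>M \<times> S\<close> by the usual relations; its elements are cosets.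
\<close>

abbreviation tensor_free ::
    "('u, 'a, 'n) module_scheme \<Rightarrow> 'u rring \<Rightarrow> ('a \<times> 'u \<Rightarrow>\<^sub>0 int) monoid" where
  "tensor_free M S \<equiv> free_Abelian_group (carrier M \<times> carrier S)"

definition tensor_null ::
    "('u, 'm) ring_scheme \<Rightarrow> ('u, 'a, 'n) module_scheme \<Rightarrow> 'u rring \<Rightarrow> ('a, 'u) tensor" where
  "tensor_null R M S = generate (tensor_free M S)
    ({frag_of (x \<oplus>\<^bsub>M\<^esub> y, s) - frag_of (x, s) - frag_of (y, s) | x y s.
        x \<in> carrier M \<and> y \<in> carrier M \<and> s \<in> carrier S} \<union>
     {frag_of (x, s \<oplus>\<^bsub>S\<^esub> t) - frag_of (x, s) - frag_of (x, t) | x s t.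
        x \<in> carrier M \<and> s \<in> carrier S \<and> t \<in> carrier S} \<union>
     {frag_of (r \<odot>\<^bsub>M\<^esub> x, s) - frag_of (x, r \<odot>\<^bsub>S\<^esub> s) | r x s.
        r \<in> carrier R \<and> x \<in> carrier M \<and> s \<in> carrier S})"

definition tensor ::
    "('u, 'm) ring_scheme \<Rightarrow> ('u, 'a, 'n) module_scheme \<Rightarrow> 'u rring \<Rightarrow> 'a \<Rightarrow> 'u \<Rightarrow> ('a, 'u) tensor"
  where "tensor R M S x s = tensor_null R M S #>\<^bsub>tensor_free M S\<^esub> frag_of (x, s)"

text \<open>
  The map induced on scalar extensions by \<open>x \<otimes> s \<mapsto> x \<otimes> \<phi> s\<close>: the set product of the
  null subgroup with the image of a coset is the coset of the image of any representative.
\<close>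

definition tensor_map ::
    "('u, 'm) ring_scheme \<Rightarrow> ('u, 'a, 'n) module_scheme \<Rightarrow> 'u rring \<Rightarrow> ('u \<Rightarrow> 'u) \<Rightarrow>
     ('a, 'u) tensor \<Rightarrow> ('a, 'u) tensor" where
  "tensor_map R M S' \<phi> c =
     set_mult (tensor_free M S') (tensor_null R M S') (frag_extend (\<lambda>(x, s). frag_of (x, \<phi> s)) ` c)"

text \<open>
  The S-module \<open>M\<^sub>S\<close>. The field \<^const>\<open>one\<close> carries \<open>1 \<otimes> 1\<close>, which is used when
  \<open>M\<close> has a distinguished element; the field \<^const>\<open>monoid.mult\<close> has no meaning.
\<close>

definition base_change ::
    "('u, 'm) ring_scheme \<Rightarrow> ('u, 'a, 'n) module_scheme \<Rightarrow> 'u rring \<Rightarrow> ('u, ('a, 'u) tensor) module"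
  where
  "base_change R M S =
    \<lparr>carrier = carrier (tensor_free M S Mod tensor_null R M S),
     monoid.mult = (\<lambda>_ _. undefined),
     one = tensor R M S \<one>\<^bsub>M\<^esub> \<one>\<^bsub>S\<^esub>,
     ring.zero = one (tensor_free M S Mod tensor_null R M S),
     ring.add = monoid.mult (tensor_free M S Mod tensor_null R M S),
     smult = (\<lambda>s. tensor_map R M S (\<lambda>t. s \<otimes>\<^bsub>S\<^esub> t))\<rparr>"


section \<open>Linear maps, projective modules\<close>

definition linear_maps ::
    "('u, 'm) ring_scheme \<Rightarrow> ('u, 'a, 'n) module_scheme \<Rightarrow> ('u, 'b, 'k) module_scheme \<Rightarrow> ('a \<Rightarrow> 'b) set"
  where
  "linear_maps S M M' = {f \<in> carrier M \<rightarrow>\<^sub>E carrier M'.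
     (\<forall>x\<in>carrier M. \<forall>y\<in>carrier M. f (x \<oplus>\<^bsub>M\<^esub> y) = f x \<oplus>\<^bsub>M'\<^esub> f y) \<and>
     (\<forall>s\<in>carrier S. \<forall>x\<in>carrier M. f (s \<odot>\<^bsub>M\<^esub> x) = s \<odot>\<^bsub>M'\<^esub> f x)}"

definition general_linear ::
    "('u, 'm) ring_scheme \<Rightarrow> ('u, 'a, 'n) module_scheme \<Rightarrow> ('a \<Rightarrow> 'a) set" where
  "general_linear S M = linear_maps S M M \<inter> Bij (carrier M)"

text \<open>
  For \<open>i : M \<rightarrow> M'\<close> exhibiting the S'-module \<open>M'\<close> as a scalar extension of \<open>M\<close>, the
  S'-linear endomorphism of \<open>M'\<close> that extends the endomorphism \<open>f\<close> of \<open>M\<close>.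
\<close>

definition extend_endo ::
    "('u, 'm) ring_scheme \<Rightarrow> ('u, 'a, 'n) module_scheme \<Rightarrow> ('u, 'a, 'k) module_scheme \<Rightarrow>
     ('a \<Rightarrow> 'a) \<Rightarrow> ('a \<Rightarrow> 'a) \<Rightarrow> ('a \<Rightarrow> 'a)" where
  "extend_endo S' M M' i f =
     (THE g. g \<in> linear_maps S' M' M' \<and> (\<forall>x\<in>carrier M. g (i x) = i (f x)))"

definition free_module :: "('u, 'm) ring_scheme \<Rightarrow> nat \<Rightarrow> ('u, nat \<Rightarrow> 'u) module" where
  "free_module S n =
    \<lparr>carrier = {..<n} \<rightarrow>\<^sub>E carrier S,
     monoid.mult = (\<lambda>_ _. undefined), one = undefined,
     ring.zero = (\<lambda>i\<in>{..<n}. \<zero>\<^bsub>S\<^esub>),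
     ring.add = (\<lambda>v w. \<lambda>i\<in>{..<n}. v i \<oplus>\<^bsub>S\<^esub> w i),
     smult = (\<lambda>s v. \<lambda>i\<in>{..<n}. s \<otimes>\<^bsub>S\<^esub> v i)\<rparr>"

definition fg_projective :: "('u, 'm) ring_scheme \<Rightarrow> ('u, 'a, 'n) module_scheme \<Rightarrow> bool" where
  "fg_projective R M \<longleftrightarrow> module R M \<and>
    (\<exists>n. \<exists>i\<in>linear_maps R M (free_module R n). \<exists>p\<in>linear_maps R (free_module R n) M.
       \<forall>x\<in>carrier M. p (i x) = x)"

text \<open>
  The rank of \<open>M\<close> at a prime ideal is the dimension of \<open>M\<^sub>k\<close> for \<open>k\<close> the residue field, or
  equally any R-field over it; so all R-fields may be used.
\<close>

definition constant_rank ::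
    "('u, 'm) ring_scheme \<Rightarrow> ('u, 'a, 'n) module_scheme \<Rightarrow> nat \<Rightarrow> bool" where
  "constant_rank R M d \<longleftrightarrow> (\<forall>k :: 'u rring. algebra R k \<and> field k \<longrightarrow>
     (\<exists>f\<in>linear_maps k (base_change R M k) (free_module k d).
        bij_betw f (carrier (base_change R M k)) (carrier (free_module k d))))"


section \<open>Cubic Jordan algebras\<close>

text \<open>
  The data of a cubic Jordan algebra: a module whose field \<^const>\<open>one\<close> is the base point
  (\<^const>\<open>monoid.mult\<close> is not used, the product being given by the U-operator below),
  together with the norm and the adjoint. These are polynomial laws: for each R-ring \<open>S\<close>, maps
  \<open>A\<^sub>S \<rightarrow> S\<close> and \<open>A\<^sub>S \<rightarrow> A\<^sub>S\<close>, compatible with homomorphisms of R-rings.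
\<close>

record ('u, 'a) cubic_algebra = "('u, 'a) module" +
  cnorm :: "'u rring \<Rightarrow> ('a, 'u) tensor \<Rightarrow> 'u"
  adjoint :: "'u rring \<Rightarrow> ('a, 'u) tensor \<Rightarrow> ('a, 'u) tensor"

definition cubic_form :: "('u, 'm) ring_scheme \<Rightarrow> ('u, 'a) cubic_algebra \<Rightarrow> bool" where
  "cubic_form R A \<longleftrightarrow>
    (\<forall>S. algebra R S \<longrightarrow> (\<forall>x\<in>carrier (base_change R A S). cnorm A S x \<in> carrier S \<and>
       (\<forall>s\<in>carrier S. cnorm A S (s \<odot>\<^bsub>base_change R A S\<^esub> x) = s [^]\<^bsub>S\<^esub> (3::nat) \<otimes>\<^bsub>S\<^esub> cnorm A S x))) \<and>
    (\<forall>S S' \<phi>. algebra R S \<and> algebra R S' \<and> \<phi> \<in> rring_hom R S S' \<longrightarrow>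
       (\<forall>x\<in>carrier (base_change R A S). cnorm A S' (tensor_map R A S' \<phi> x) = \<phi> (cnorm A S x)))"

definition quadratic_adjoint :: "('u, 'm) ring_scheme \<Rightarrow> ('u, 'a) cubic_algebra \<Rightarrow> bool" where
  "quadratic_adjoint R A \<longleftrightarrow>
    (\<forall>S. algebra R S \<longrightarrow> (\<forall>x\<in>carrier (base_change R A S).
       adjoint A S x \<in> carrier (base_change R A S) \<and>
       (\<forall>s\<in>carrier S. adjoint A S (s \<odot>\<^bsub>base_change R A S\<^esub> x) =
          s [^]\<^bsub>S\<^esub> (2::nat) \<odot>\<^bsub>base_change R A S\<^esub> adjoint A S x))) \<and>
    (\<forall>S S' \<phi>. algebra R S \<and> algebra R S' \<and> \<phi> \<in> rring_hom R S S' \<longrightarrow>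
       (\<forall>x\<in>carrier (base_change R A S).
          adjoint A S' (tensor_map R A S' \<phi> x) = tensor_map R A S' \<phi> (adjoint A S x)))"

text \<open>\<open>P\<close> is a polynomial ring over \<open>S\<close> in the variable \<open>t\<close>, with structure map \<open>i\<close>. The ring
  \<^term>\<open>UP S\<close> is not itself in the universe, but an isomorphic copy is.\<close>

definition polynomial_rring ::
    "('u, 'm) ring_scheme \<Rightarrow> 'u rring \<Rightarrow> 'u rring \<Rightarrow> ('u \<Rightarrow> 'u) \<Rightarrow> 'u \<Rightarrow> bool" where
  "polynomial_rring R S P i t \<longleftrightarrow> algebra R P \<and> i \<in> rring_hom R S P \<and> t \<in> carrier P \<and>
     bij_betw (UnivPoly.eval S P i t) (carrier (UP S)) (carrier P)"

text \<open>\<open>N(x,y)\<close>: the coefficient of \<open>t\<close> in \<open>N(x + t y)\<close>, for \<open>x, y \<in> A\<^sub>S\<close>.\<close>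

definition norm_lin ::
    "('u, 'm) ring_scheme \<Rightarrow> ('u, 'a) cubic_algebra \<Rightarrow> 'u rring \<Rightarrow>
     ('a, 'u) tensor \<Rightarrow> ('a, 'u) tensor \<Rightarrow> 'u" where
  "norm_lin R A S x y = (THE c. \<exists>P i t p. polynomial_rring R S P i t \<and> p \<in> carrier (UP S) \<and>
     UnivPoly.eval S P i t p =
       cnorm A P (tensor_map R A P i x \<oplus>\<^bsub>base_change R A P\<^esub>
                  t \<odot>\<^bsub>base_change R A P\<^esub> tensor_map R A P i y) \<and>
     c = up_ring.coeff (UP S) p 1)"

text \<open>The full linearization \<open>N(x,y,z)\<close>, i.e. the linearization of \<open>N(x,y)\<close> in \<open>x\<close>.\<close>

definition norm_trilin ::
    "('u, 'm) ring_scheme \<Rightarrow> ('u, 'a) cubic_algebra \<Rightarrow> 'u rring \<Rightarrow>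
     ('a, 'u) tensor \<Rightarrow> ('a, 'u) tensor \<Rightarrow> ('a, 'u) tensor \<Rightarrow> 'u" where
  "norm_trilin R A S x y z =
     norm_lin R A S (x \<oplus>\<^bsub>base_change R A S\<^esub> z) y \<ominus>\<^bsub>S\<^esub> norm_lin R A S x y \<ominus>\<^bsub>S\<^esub> norm_lin R A S z y"

definition bil_trace ::
    "('u, 'm) ring_scheme \<Rightarrow> ('u, 'a) cubic_algebra \<Rightarrow> 'u rring \<Rightarrow>
     ('a, 'u) tensor \<Rightarrow> ('a, 'u) tensor \<Rightarrow> 'u" where
  "bil_trace R A S x y = (let e = \<one>\<^bsub>base_change R A S\<^esub> in
     norm_lin R A S e x \<otimes>\<^bsub>S\<^esub> norm_lin R A S e y \<ominus>\<^bsub>S\<^esub> norm_trilin R A S e x y)"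

definition cross ::
    "('u, 'm) ring_scheme \<Rightarrow> ('u, 'a) cubic_algebra \<Rightarrow> 'u rring \<Rightarrow>
     ('a, 'u) tensor \<Rightarrow> ('a, 'u) tensor \<Rightarrow> ('a, 'u) tensor" where
  "cross R A S x y = adjoint A S (x \<oplus>\<^bsub>base_change R A S\<^esub> y)
     \<ominus>\<^bsub>base_change R A S\<^esub> adjoint A S x \<ominus>\<^bsub>base_change R A S\<^esub> adjoint A S y"

text \<open>The axioms of a cubic norm structure, imposed in all scalar extensions: base point
  identities, unit identity, gradient identity and adjoint identity.\<close>

definition cubic_jordan_algebra :: "('u, 'm) ring_scheme \<Rightarrow> ('u, 'a) cubic_algebra \<Rightarrow> bool" where
  "cubic_jordan_algebra R A \<longleftrightarrow>
    module R A \<and> \<one>\<^bsub>A\<^esub> \<in> carrier A \<and> cubic_form R A \<and> quadratic_adjoint R A \<and>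
    (\<forall>S. algebra R S \<longrightarrow> (let A\<^sub>S = base_change R A S; e = \<one>\<^bsub>A\<^sub>S\<^esub> in
       cnorm A S e = \<one>\<^bsub>S\<^esub> \<and> adjoint A S e = e \<and>
       (\<forall>x\<in>carrier A\<^sub>S.
          cross R A S e x = bil_trace R A S x e \<odot>\<^bsub>A\<^sub>S\<^esub> e \<ominus>\<^bsub>A\<^sub>S\<^esub> x \<and>
          adjoint A S (adjoint A S x) = cnorm A S x \<odot>\<^bsub>A\<^sub>S\<^esub> x \<and>
          (\<forall>y\<in>carrier A\<^sub>S. bil_trace R A S (adjoint A S x) y = norm_lin R A S x y))))"

text \<open>The quadratic Jordan structure: \<open>U\<^sub>x y = T(x,y) x - x\<^sup>\<sharp> \<times> y\<close>.\<close>

definition U_op ::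
    "('u, 'm) ring_scheme \<Rightarrow> ('u, 'a) cubic_algebra \<Rightarrow> 'u rring \<Rightarrow>
     ('a, 'u) tensor \<Rightarrow> ('a, 'u) tensor \<Rightarrow> ('a, 'u) tensor" where
  "U_op R A S x y = bil_trace R A S x y \<odot>\<^bsub>base_change R A S\<^esub> x
     \<ominus>\<^bsub>base_change R A S\<^esub> cross R A S (adjoint A S x) y"

definition jordan_triple ::
    "('u, 'm) ring_scheme \<Rightarrow> ('u, 'a) cubic_algebra \<Rightarrow> 'u rring \<Rightarrow>
     ('a, 'u) tensor \<Rightarrow> ('a, 'u) tensor \<Rightarrow> ('a, 'u) tensor \<Rightarrow> ('a, 'u) tensor" where
  "jordan_triple R A S x y z = U_op R A S (x \<oplus>\<^bsub>base_change R A S\<^esub> z) y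
     \<ominus>\<^bsub>base_change R A S\<^esub> U_op R A S x y \<ominus>\<^bsub>base_change R A S\<^esub> U_op R A S z y"

definition jordan_ideal ::
    "('u, 'm) ring_scheme \<Rightarrow> ('u, 'a) cubic_algebra \<Rightarrow> 'u rring \<Rightarrow> ('a, 'u) tensor set \<Rightarrow> bool" where
  "jordan_ideal R A S I \<longleftrightarrow> submodule I S (base_change R A S) \<and>
    (\<forall>x\<in>I. \<forall>y\<in>carrier (base_change R A S). U_op R A S x y \<in> I \<and> U_op R A S y x \<in> I \<and>
       (\<forall>z\<in>carrier (base_change R A S). jordan_triple R A S x y z \<in> I))"

definition simple_over ::
    "('u, 'm) ring_scheme \<Rightarrow> ('u, 'a) cubic_algebra \<Rightarrow> 'u rring \<Rightarrow> bool" where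
  "simple_over R A k \<longleftrightarrow> carrier (base_change R A k) \<noteq> {\<zero>\<^bsub>base_change R A k\<^esub>} \<and>
    (\<forall>I. jordan_ideal R A k I \<longrightarrow>
       I = {\<zero>\<^bsub>base_change R A k\<^esub>} \<or> I = carrier (base_change R A k))"

text \<open>Non-degeneracy over \<open>R\<close>: \<open>y \<mapsto> T(_, y)\<close> is a bijection from \<open>A\<close> to its dual module. This
  holds for every Albert algebra; it is recorded in the definition below.\<close>

definition trace_nondegenerate :: "('u, 'm) ring_scheme \<Rightarrow> ('u, 'a) cubic_algebra \<Rightarrow> bool" where
  "trace_nondegenerate R A \<longleftrightarrow>
    (\<forall>l\<in>linear_maps R A (base_rring R). \<exists>!y. y \<in> carrier A \<and>
       (\<forall>x\<in>carrier A. bil_trace R A (base_rring R)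
            (tensor R A (base_rring R) x \<one>\<^bsub>R\<^esub>) (tensor R A (base_rring R) y \<one>\<^bsub>R\<^esub>) = l x))"

definition albert_algebra :: "('u, 'm) ring_scheme \<Rightarrow> ('u, 'a) cubic_algebra \<Rightarrow> bool" where
  "albert_algebra R A \<longleftrightarrow> cubic_jordan_algebra R A \<and>
     fg_projective R A \<and> constant_rank R A 27 \<and>
     (\<forall>k :: 'u rring. algebra R k \<and> field k \<longrightarrow> simple_over R A k) \<and>
     trace_nondegenerate R A"


section \<open>Group functors\<close>

text \<open>A group scheme is given by its functor of points: the groups of S-points, and the maps
  between them induced by homomorphisms \<open>\<phi> : S \<rightarrow> S'\<close> of R-rings.\<close>

record ('u, 'g) group_functor =
  points :: "'u rring \<Rightarrow> 'g monoid"
  induced :: "'u rring \<Rightarrow> 'u rring \<Rightarrow> ('u \<Rightarrow> 'u) \<Rightarrow> 'g \<Rightarrow> 'g"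

definition is_group_functor :: "('u, 'm) ring_scheme \<Rightarrow> ('u, 'g) group_functor \<Rightarrow> bool" where
  "is_group_functor R G \<longleftrightarrow>
    (\<forall>S. algebra R S \<longrightarrow> group (points G S) \<and>
       (\<forall>g\<in>carrier (points G S). induced G S S (\<lambda>s. s) g = g)) \<and>
    (\<forall>S S' \<phi>. algebra R S \<and> algebra R S' \<and> \<phi> \<in> rring_hom R S S' \<longrightarrow>
       induced G S S' \<phi> \<in> hom (points G S) (points G S')) \<and>
    (\<forall>S S' S'' \<phi> \<psi>. algebra R S \<and> algebra R S' \<and> algebra R S'' \<and>
       \<phi> \<in> rring_hom R S S' \<and> \<psi> \<in> rring_hom R S' S'' \<longrightarrow>
       (\<forall>g\<in>carrier (points G S).
          induced G S S'' (\<lambda>s. \<psi> (\<phi> s)) g = induced G S' S'' \<psi> (induced G S S' \<phi> g)))"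

definition group_functor_hom ::
    "('u, 'm) ring_scheme \<Rightarrow> ('u, 'g) group_functor \<Rightarrow> ('u, 'h) group_functor \<Rightarrow>
     ('u rring \<Rightarrow> 'g \<Rightarrow> 'h) \<Rightarrow> bool" where
  "group_functor_hom R G H \<eta> \<longleftrightarrow> is_group_functor R G \<and> is_group_functor R H \<and>
    (\<forall>S. algebra R S \<longrightarrow> \<eta> S \<in> hom (points G S) (points H S)) \<and>
    (\<forall>S S' \<phi>. algebra R S \<and> algebra R S' \<and> \<phi> \<in> rring_hom R S S' \<longrightarrow>
       (\<forall>g\<in>carrier (points G S). \<eta> S' (induced G S S' \<phi> g) = induced H S S' \<phi> (\<eta> S g)))"

text \<open>
  Split exactness of \<open>1 \<rightarrow> G \<rightarrow> H \<rightarrow> K \<rightarrow> 1\<close>: \<open>\<iota>\<close> is a kernel of \<open>\<pi>\<close>, and \<open>\<pi>\<close> has a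
  section which is a homomorphism. As the section makes \<open>\<pi>\<close> surjective on S-points for every S,
  exactness on S-points and exactness as fppf sheaves agree here.
\<close>

definition split_exact ::
    "('u, 'm) ring_scheme \<Rightarrow> ('u, 'g) group_functor \<Rightarrow> ('u, 'h) group_functor \<Rightarrow>
     ('u, 'k) group_functor \<Rightarrow> ('u rring \<Rightarrow> 'g \<Rightarrow> 'h) \<Rightarrow> ('u rring \<Rightarrow> 'h \<Rightarrow> 'k) \<Rightarrow> bool" where
  "split_exact R G H K \<iota> \<pi> \<longleftrightarrow> group_functor_hom R G H \<iota> \<and> group_functor_hom R H K \<pi> \<and>
    (\<forall>S. algebra R S \<longrightarrow>
       inj_on (\<iota> S) (carrier (points G S)) \<and>
       \<iota> S ` carrier (points G S) = kernel (points H S) (points K S) (\<pi> S) \<and>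
       \<pi> S ` carrier (points H S) = carrier (points K S)) \<and>
    (\<exists>\<sigma>. group_functor_hom R K H \<sigma> \<and>
       (\<forall>S. algebra R S \<longrightarrow> (\<forall>g\<in>carrier (points K S). \<pi> S (\<sigma> S g) = g)))"


section \<open>Isometries of the norm\<close>

text \<open>Preserving the cubic form \<open>N\<close> over \<open>S\<close> means preserving the polynomial law, i.e.
  the values of \<open>N\<close> over every S-ring \<open>S'\<close>.\<close>

definition Isom_norm ::
    "('u, 'm) ring_scheme \<Rightarrow> ('u, 'a) cubic_algebra \<Rightarrow>
     ('u, ('a, 'u) tensor \<Rightarrow> ('a, 'u) tensor) group_functor" where
  "Isom_norm R A =
    \<lparr>points = (\<lambda>S. BijGroup (carrier (base_change R A S))
       \<lparr>carrier := {\<rho> \<in> general_linear S (base_change R A S).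
          \<forall>S' \<phi>. algebra R S' \<and> \<phi> \<in> rring_hom R S S' \<longrightarrow>
            (\<forall>x\<in>carrier (base_change R A S').
               cnorm A S' (extend_endo S' (base_change R A S) (base_change R A S')
                             (tensor_map R A S' \<phi>) \<rho> x) = cnorm A S' x)}\<rparr>),
     induced = (\<lambda>S S' \<phi>. extend_endo S' (base_change R A S) (base_change R A S')
                             (tensor_map R A S' \<phi>))\<rparr>"

definition dagger ::
    "('u, 'm) ring_scheme \<Rightarrow> ('u, 'a) cubic_algebra \<Rightarrow> 'u rring \<Rightarrow>
     (('a, 'u) tensor \<Rightarrow> ('a, 'u) tensor) \<Rightarrow> (('a, 'u) tensor \<Rightarrow> ('a, 'u) tensor)" where
  "dagger R A S \<rho> = (THE \<rho>'. \<rho>' \<in> general_linear S (base_change R A S) \<and>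
     (\<forall>x\<in>carrier (base_change R A S). \<forall>y\<in>carrier (base_change R A S).
        bil_trace R A S (\<rho> x) (\<rho>' y) = bil_trace R A S x y))"


section \<open>The reduced Brown algebra\<close>

text \<open>The quadruple \<open>(r, a, b, s)\<close> is the matrix with rows \<open>r a\<close> and \<open>b s\<close>. The scalar extension
  \<open>B\<^sub>S\<close> is given directly by matrices over \<open>S\<close> and \<open>A\<^sub>S\<close>.\<close>

type_synonym ('a, 'u) brown_matrix = "'u \<times> ('a, 'u) tensor \<times> ('a, 'u) tensor \<times> 'u"

definition brown ::
    "('u, 'm) ring_scheme \<Rightarrow> ('u, 'a) cubic_algebra \<Rightarrow> 'u rring \<Rightarrow>
     ('u, ('a, 'u) brown_matrix) module" where
  "brown R A S = (let A\<^sub>S = base_change R A S; T = bil_trace R A S; c = cross R A S in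
    \<lparr>carrier = carrier S \<times> carrier A\<^sub>S \<times> carrier A\<^sub>S \<times> carrier S,
     monoid.mult = (\<lambda>(r, a, b, s) (r', a', b', s').
       (r \<otimes>\<^bsub>S\<^esub> r' \<oplus>\<^bsub>S\<^esub> T a b',
        r \<odot>\<^bsub>A\<^sub>S\<^esub> a' \<oplus>\<^bsub>A\<^sub>S\<^esub> s' \<odot>\<^bsub>A\<^sub>S\<^esub> a \<oplus>\<^bsub>A\<^sub>S\<^esub> c b b',
        r' \<odot>\<^bsub>A\<^sub>S\<^esub> b \<oplus>\<^bsub>A\<^sub>S\<^esub> s \<odot>\<^bsub>A\<^sub>S\<^esub> b' \<oplus>\<^bsub>A\<^sub>S\<^esub> c a a',
        s \<otimes>\<^bsub>S\<^esub> s' \<oplus>\<^bsub>S\<^esub> T a' b)),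
     one = (\<one>\<^bsub>S\<^esub>, \<zero>\<^bsub>A\<^sub>S\<^esub>, \<zero>\<^bsub>A\<^sub>S\<^esub>, \<one>\<^bsub>S\<^esub>),
     ring.zero = (\<zero>\<^bsub>S\<^esub>, \<zero>\<^bsub>A\<^sub>S\<^esub>, \<zero>\<^bsub>A\<^sub>S\<^esub>, \<zero>\<^bsub>S\<^esub>),
     ring.add = (\<lambda>(r, a, b, s) (r', a', b', s').
       (r \<oplus>\<^bsub>S\<^esub> r', a \<oplus>\<^bsub>A\<^sub>S\<^esub> a', b \<oplus>\<^bsub>A\<^sub>S\<^esub> b', s \<oplus>\<^bsub>S\<^esub> s')),
     smult = (\<lambda>u (r, a, b, s). (u \<otimes>\<^bsub>S\<^esub> r, u \<odot>\<^bsub>A\<^sub>S\<^esub> a, u \<odot>\<^bsub>A\<^sub>S\<^esub> b, u \<otimes>\<^bsub>S\<^esub> s))\<rparr>)"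

definition brown_involution :: "('a, 'u) brown_matrix \<Rightarrow> ('a, 'u) brown_matrix" where
  "brown_involution = (\<lambda>(r, a, b, s). (s, a, b, r))"

definition brown_map ::
    "('u, 'm) ring_scheme \<Rightarrow> ('u, 'a) cubic_algebra \<Rightarrow> 'u rring \<Rightarrow> ('u \<Rightarrow> 'u) \<Rightarrow>
     ('a, 'u) brown_matrix \<Rightarrow> ('a, 'u) brown_matrix" where
  "brown_map R A S' \<phi> =
     (\<lambda>(r, a, b, s). (\<phi> r, tensor_map R A S' \<phi> a, tensor_map R A S' \<phi> b, \<phi> s))"

definition Aut_brown ::
    "('u, 'm) ring_scheme \<Rightarrow> ('u, 'a) cubic_algebra \<Rightarrow>
     ('u, ('a, 'u) brown_matrix \<Rightarrow> ('a, 'u) brown_matrix) group_functor" where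
  "Aut_brown R A =
    \<lparr>points = (\<lambda>S. BijGroup (carrier (brown R A S))
       \<lparr>carrier := {\<rho> \<in> general_linear S (brown R A S).
          (\<forall>x\<in>carrier (brown R A S). \<forall>y\<in>carrier (brown R A S).
             \<rho> (x \<otimes>\<^bsub>brown R A S\<^esub> y) = \<rho> x \<otimes>\<^bsub>brown R A S\<^esub> \<rho> y) \<and>
          \<rho> \<one>\<^bsub>brown R A S\<^esub> = \<one>\<^bsub>brown R A S\<^esub> \<and>
          (\<forall>x\<in>carrier (brown R A S). \<rho> (brown_involution x) = brown_involution (\<rho> x))}\<rparr>),
     induced = (\<lambda>S S' \<phi>. extend_endo S' (brown R A S) (brown R A S') (brown_map R A S' \<phi>))\<rparr>"

definition brown_iota ::
    "('u, 'm) ring_scheme \<Rightarrow> ('u, 'a) cubic_algebra \<Rightarrow> 'u rring \<Rightarrow>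
     (('a, 'u) tensor \<Rightarrow> ('a, 'u) tensor) \<Rightarrow>
     (('a, 'u) brown_matrix \<Rightarrow> ('a, 'u) brown_matrix)" where
  "brown_iota R A S \<rho> = (\<lambda>(r, a, b, s)\<in>carrier (brown R A S). (r, \<rho> a, dagger R A S \<rho> b, s))"

definition mu2 :: "('u, 'u) group_functor" where
  "mu2 = \<lparr>points = (\<lambda>S. \<lparr>carrier = {\<epsilon> \<in> carrier S. \<epsilon> [^]\<^bsub>S\<^esub> (2::nat) = \<one>\<^bsub>S\<^esub>},
                         monoid.mult = (\<otimes>\<^bsub>S\<^esub>), one = \<one>\<^bsub>S\<^esub>\<rparr>),
          induced = (\<lambda>S S' \<phi>. \<phi>)\<rparr>"

definition brown_j ::
    "('u, 'm) ring_scheme \<Rightarrow> ('u, 'a) cubic_algebra \<Rightarrow> 'u rring \<Rightarrow> ('a, 'u) brown_matrix" where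
  "brown_j R A S = (\<one>\<^bsub>S\<^esub>, \<zero>\<^bsub>base_change R A S\<^esub>, \<zero>\<^bsub>base_change R A S\<^esub>, \<ominus>\<^bsub>S\<^esub> \<one>\<^bsub>S\<^esub>)"

definition brown_pi ::
    "('u, 'm) ring_scheme \<Rightarrow> ('u, 'a) cubic_algebra \<Rightarrow> 'u rring \<Rightarrow>
     (('a, 'u) brown_matrix \<Rightarrow> ('a, 'u) brown_matrix) \<Rightarrow> 'u" where
  "brown_pi R A S \<rho> = (THE \<epsilon>. \<epsilon> \<in> carrier (points mu2 S) \<and>
     \<rho> (brown_j R A S) = \<epsilon> \<odot>\<^bsub>brown R A S\<^esub> brown_j R A S)"

end

theory Submission
  imports Defs "HOL-Algebra.QuotRing"
begin

text \<open>
  Homogeneity forces \<open>N(a x + b y)\<close> to be a binary cubic form in \<open>a\<close> and \<open>b\<close>, which makes the trace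
  and the cross product bilinear. As \<open>A\<close> is projective and \<open>T\<close> is non-degenerate, \<open>A\<close> has a dual basis
  given by \<open>T\<close>, and it remains one after every scalar extension; hence \<open>\<rho>\<^sup>\<dagger>\<close> exists and is functorial.

  An isometry satisfies \<open>(\<rho> x)\<^sup>\<sharp> = \<rho>\<^sup>\<dagger>(x\<^sup>\<sharp>)\<close> by differentiating the norm, and the linearized adjoint
  identity then yields \<open>(\<rho>\<^sup>\<dagger> b)\<^sup>\<sharp> = \<rho>(b\<^sup>\<sharp>)\<close>, so that \<open>diag(\<rho>, \<rho>\<^sup>\<dagger>)\<close> is an automorphism of \<open>B\<close>.

  If 2 is invertible, the skew elements of \<open>B\<close> are the multiples of \<open>j\<close>, and an automorphism fixing
  \<open>j\<close> has the form \<open>diag(f, g)\<close> with \<open>g = f\<^sup>\<dagger>\<close>. Its compatibility with the cross product gives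
  \<open>(N(f z) - N(z)) T(z, w) = 0\<close> for all \<open>z\<close> and \<open>w\<close>, and a polynomial argument removes the factor
  \<open>T(z, w)\<close>. The section of \<open>\<pi>\<close> is \<open>\<epsilon> \<mapsto> (1 + \<epsilon>)/2 id + (1 - \<epsilon>)/2 swap\<close>, where the swap exchanges
  \<open>r\<close> with \<open>s\<close> and \<open>a\<close> with \<open>b\<close>.
\<close>

section \<open>Scalar extension\<close>

text \<open>The norm and the adjoint are known only through their values over R-rings; there are no
  coefficients to differentiate. Every linearization is therefore obtained over a polynomial ring
  S[t], by expanding at a generic point such as x + t y and comparing coefficients. The infinite
  type serves this purpose: it contains a copy of S[t] for every S. Extensions of endomorphisms are
  given by a description operator, so their existence has to be produced explicitly. The dual basis
  supplies the formula, for A as well as for B. Exactness meets an obstacle over general rings: a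
  diagonal automorphism satisfies N(f x) f x = N(x) f x, but f x cannot be cancelled. Pairing with
  the trace replaces f x by the scalar T(x, w), and moving x to the line t e + x with T(e, w) = 1
  turns this scalar into the monic polynomial t + T(x, w), which can be cancelled. For the
  splitting, \<epsilon> need not be 1 or -1 when S has idempotents; the orthogonal idempotents (1 +
  \<epsilon>)/2 and (1 - \<epsilon>)/2 replace the case distinction.\<close>

definition scalar_linear ::
    "('u, 'm) ring_scheme \<Rightarrow> 'u rring \<Rightarrow> 'u rring \<Rightarrow> ('u \<Rightarrow> 'u) \<Rightarrow> bool" where
  "scalar_linear R S S' \<phi> \<longleftrightarrow> \<phi> \<in> carrier S \<rightarrow> carrier S' \<and>
     (\<forall>s\<in>carrier S. \<forall>t\<in>carrier S. \<phi> (s \<oplus>\<^bsub>S\<^esub> t) = \<phi> s \<oplus>\<^bsub>S'\<^esub> \<phi> t) \<and>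
     (\<forall>r\<in>carrier R. \<forall>s\<in>carrier S. \<phi> (r \<odot>\<^bsub>S\<^esub> s) = r \<odot>\<^bsub>S'\<^esub> \<phi> s)"

lemma rring_hom_scalar_linear: "\<phi> \<in> rring_hom R S S' \<Longrightarrow> scalar_linear R S S' \<phi>"
  by (auto simp: rring_hom_def scalar_linear_def ring_hom_def)

text \<open>Multiplication by \<open>s\<close> is not a ring homomorphism, yet it induces the action
  of S on the extended module. This case is the reason for \<open>scalar_linear\<close>, which asks
  for additivity and R-linearity only.\<close>

lemma mult_scalar_linear:
  assumes "algebra R S" "s \<in> carrier S"
  shows "scalar_linear R S S (\<lambda>t. s \<otimes>\<^bsub>S\<^esub> t)"
proof -
  interpret A: algebra R S by fact
  show ?thesis
    using assms(2) A.smult_assoc2[of _ _ s]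
    by (auto simp: scalar_linear_def A.r_distr A.m_comm[of s])
qed

context module
begin

definition tensor_relations :: "'a rring \<Rightarrow> ('c \<times> 'a \<Rightarrow>\<^sub>0 int) set" where
  "tensor_relations S =
    {frag_of (x \<oplus>\<^bsub>M\<^esub> y, s) - frag_of (x, s) - frag_of (y, s) | x y s.
        x \<in> carrier M \<and> y \<in> carrier M \<and> s \<in> carrier S} \<union>
     {frag_of (x, s \<oplus>\<^bsub>S\<^esub> t) - frag_of (x, s) - frag_of (x, t) | x s t.
        x \<in> carrier M \<and> s \<in> carrier S \<and> t \<in> carrier S} \<union>
     {frag_of (r \<odot>\<^bsub>M\<^esub> x, s) - frag_of (x, r \<odot>\<^bsub>S\<^esub> s) | r x s.
        r \<in> carrier R \<and> x \<in> carrier M \<and> s \<in> carrier S}"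

lemma tensor_null_eq: "tensor_null R M S = generate (tensor_free M S) (tensor_relations S)"
  by (simp add: tensor_null_def tensor_relations_def)

text \<open>The class of an arbitrary formal sum; a pure \<open>tensor\<close> is the class of a
  single generator. Computations with cosets become computations with representatives.\<close>

definition tclass :: "'a rring \<Rightarrow> ('c \<times> 'a \<Rightarrow>\<^sub>0 int) \<Rightarrow> ('c, 'a) tensor" where
  "tclass S c = tensor_null R M S #>\<^bsub>tensor_free M S\<^esub> c"

lemma tensor_relations_closed:
  assumes "algebra R S"
  shows "tensor_relations S \<subseteq> carrier (tensor_free M S)"
proof -
  interpret S: algebra R S by fact
  show ?thesis
    by (auto simp: tensor_relations_def dest!: subsetD[OF keys_diff])
qed

lemma tensor_null_subgroup:
  assumes "algebra R S"
  shows "subgroup (tensor_null R M S) (tensor_free M S)"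
  unfolding tensor_null_eq
  by (rule group.generate_is_subgroup[OF group_free_Abelian_group tensor_relations_closed[OF assms]])

lemma tensor_null_normal:
  assumes "algebra R S"
  shows "normal (tensor_null R M S) (tensor_free M S)"
  using comm_group.subgroup_imp_normal[OF abelian_free_Abelian_group tensor_null_subgroup[OF assms]] .

lemma tclass_add:
  assumes "algebra R S" "Poly_Mapping.keys c \<subseteq> carrier M \<times> carrier S"
    "Poly_Mapping.keys d \<subseteq> carrier M \<times> carrier S"
  shows "tclass S c \<oplus>\<^bsub>base_change R M S\<^esub> tclass S d = tclass S (c + d)"
  using normal.rcos_sum[OF tensor_null_normal[OF assms(1)]] assms(2,3)
  by (simp add: tclass_def base_change_def FactGroup_def)

lemma tclass_zero:
  assumes "algebra R S"
  shows "\<zero>\<^bsub>base_change R M S\<^esub> = tclass S 0"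
proof -
  interpret N: subgroup "tensor_null R M S" "tensor_free M S"
    by (rule tensor_null_subgroup[OF assms])
  show ?thesis
    using group.coset_mult_one[OF group_free_Abelian_group N.subset]
    by (simp add: tclass_def base_change_def FactGroup_def)
qed

lemma carrier_base_change:
  "carrier (base_change R M S) = tclass S ` {c. Poly_Mapping.keys c \<subseteq> carrier M \<times> carrier S}"
  by (auto simp: base_change_def FactGroup_def RCOSETS_def tclass_def)

lemma tclass_eqI:
  assumes "algebra R S" "Poly_Mapping.keys c \<subseteq> carrier M \<times> carrier S"
    "Poly_Mapping.keys d \<subseteq> carrier M \<times> carrier S" "c - d \<in> tensor_null R M S"
  shows "tclass S c = tclass S d"
proof -
  have "c \<in> tensor_null R M S #>\<^bsub>tensor_free M S\<^esub> d"
    using assms(4) by (force simp: r_coset_def)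
  then show ?thesis
    unfolding tclass_def
    using group.repr_independence[OF group_free_Abelian_group _ _ tensor_null_subgroup[OF assms(1)], of c d]
      assms(3) by simp
qed

lemma tensor_tclass: "tensor R M S x s = tclass S (frag_of (x, s))"
  by (simp add: tensor_def tclass_def)

lemma base_change_abelian_group:
  assumes "algebra R S"
  shows "abelian_group (base_change R M S)"
proof -
  interpret F: comm_group "tensor_free M S" by (rule abelian_free_Abelian_group)
  have "comm_group (tensor_free M S Mod tensor_null R M S)"
    by (rule F.abelian_FactGroup[OF tensor_null_subgroup[OF assms]])
  then interpret Q: comm_group "tensor_free M S Mod tensor_null R M S" .
  have "comm_group (add_monoid (base_change R M S))"
    by (rule comm_groupI)
      (simp_all add: base_change_def Q.m_assoc Q.l_inv_ex del: one_FactGroup mult_FactGroup, rule Q.m_comm)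
  then show ?thesis
    using abelian_group_def abelian_group_axioms_def abelian_monoid_def comm_group.axioms(1) by auto
qed

lemma frag_extend_closed:
  assumes "scalar_linear R S S' \<phi>" "Poly_Mapping.keys c \<subseteq> carrier M \<times> carrier S"
  shows "Poly_Mapping.keys (frag_extend (\<lambda>(x, s). frag_of (x, \<phi> s)) c) \<subseteq> carrier M \<times> carrier S'"
  using keys_frag_extend[of "\<lambda>(x, s). frag_of (x, \<phi> s)" c] assms
  by (force simp: scalar_linear_def)

text \<open>Additivity and R-linearity of \<phi> carry each of the three kinds of relation to a
  relation of the same kind, and these generate the null subgroup. This is the well-definedness of
  the induced map.\<close>

lemma frag_extend_null:
  assumes S: "algebra R S" and S': "algebra R S'" and \<phi>: "scalar_linear R S S' \<phi>"
    and c: "c \<in> tensor_null R M S"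
  shows "frag_extend (\<lambda>(x, s). frag_of (x, \<phi> s)) c \<in> tensor_null R M S'"
proof -
  interpret N': subgroup "tensor_null R M S'" "tensor_free M S'"
    by (rule tensor_null_subgroup[OF S'])
  have gen: "d \<in> tensor_null R M S'" if "d \<in> tensor_relations S'" for d
    unfolding tensor_null_eq by (rule generate.incl[OF that])
  have rel: "frag_extend (\<lambda>(x, s). frag_of (x, \<phi> s)) d \<in> tensor_null R M S'" if "d \<in> tensor_relations S" for d
    apply (rule gen)
    using that \<phi> unfolding tensor_relations_def
    apply (elim UnE)
      apply (auto simp: frag_extend_diff scalar_linear_def Pi_iff)
      apply blast
    done
  show ?thesis
    using c unfolding tensor_null_eq[of S]
  proof (induction rule: generate.induct)
    case one
    then show ?case using N'.one_closed by simp
  next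
    case (incl h)
    then show ?case by (rule rel)
  next
    case (inv h)
    have k: "Poly_Mapping.keys h \<subseteq> carrier M \<times> carrier S"
      using subsetD[OF tensor_relations_closed[OF S] inv] by simp
    have "- frag_extend (\<lambda>(x, s). frag_of (x, \<phi> s)) h \<in> tensor_null R M S'"
      using N'.m_inv_closed[OF rel[OF inv]] frag_extend_closed[OF \<phi> k] by simp
    then show ?case using k by (simp add: frag_extend_minus)
  next
    case (eng h1 h2)
    then show ?case using N'.m_closed by (simp add: frag_extend_add)
  qed
qed

text \<open>The pointwise image of a coset is in general only part of a coset, because the null
  subgroup need not map onto the target null subgroup. The set product with the latter fills up the
  coset, and by \<open>frag_extend_null\<close> it adds nothing else.\<close>

lemma tensor_map_tclass:
  assumes S: "algebra R S" and S': "algebra R S'" and \<phi>: "scalar_linear R S S' \<phi>"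
    and c: "Poly_Mapping.keys c \<subseteq> carrier M \<times> carrier S"
  shows "tensor_map R M S' \<phi> (tclass S c) = tclass S' (frag_extend (\<lambda>(x, s). frag_of (x, \<phi> s)) c)"
proof -
  interpret N: subgroup "tensor_null R M S" "tensor_free M S"
    by (rule tensor_null_subgroup[OF S])
  interpret N': subgroup "tensor_null R M S'" "tensor_free M S'"
    by (rule tensor_null_subgroup[OF S'])
  let ?g = "frag_extend (\<lambda>(x, s). frag_of (x, \<phi> s))"
  have "tensor_map R M S' \<phi> (tclass S c) = {h + ?g (k + c) | h k. h \<in> tensor_null R M S' \<and> k \<in> tensor_null R M S}"
    by (auto simp: tensor_map_def set_mult_def tclass_def r_coset_def)
  also have "\<dots> = {h + ?g c | h. h \<in> tensor_null R M S'}"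
  proof (intro equalityI subsetI)
    fix z assume "z \<in> {h + ?g (k + c) | h k. h \<in> tensor_null R M S' \<and> k \<in> tensor_null R M S}"
    then obtain h k where z: "z = h + ?g (k + c)" "h \<in> tensor_null R M S'" "k \<in> tensor_null R M S"
      by blast
    have "h + ?g k \<in> tensor_null R M S'"
      using N'.m_closed[OF z(2) frag_extend_null[OF S S' \<phi> z(3)]] by simp
    then show "z \<in> {h + ?g c | h. h \<in> tensor_null R M S'}"
      using z(1) by (auto simp: frag_extend_add add.assoc intro!: exI[of _ "h + ?g k"])
  next
    fix z assume "z \<in> {h + ?g c | h. h \<in> tensor_null R M S'}"
    then show "z \<in> {h + ?g (k + c) | h k. h \<in> tensor_null R M S' \<and> k \<in> tensor_null R M S}"
      using N.one_closed by auto (metis add_0)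
  qed
  also have "\<dots> = tclass S' (?g c)"
    by (auto simp: tclass_def r_coset_def)
  finally show ?thesis .
qed

lemma tensor_closed [simp]:
  "x \<in> carrier M \<Longrightarrow> s \<in> carrier S \<Longrightarrow> tensor R M S x s \<in> carrier (base_change R M S)"
  by (auto simp: tensor_tclass carrier_base_change)

lemma tensor_map_tensor:
  assumes "algebra R S" "algebra R S'" "scalar_linear R S S' \<phi>" "x \<in> carrier M" "s \<in> carrier S"
  shows "tensor_map R M S' \<phi> (tensor R M S x s) = tensor R M S' x (\<phi> s)"
  using assms by (simp add: tensor_tclass tensor_map_tclass)

lemma tensor_map_closed:
  assumes "algebra R S" "algebra R S'" "scalar_linear R S S' \<phi>" "x \<in> carrier (base_change R M S)"
  shows "tensor_map R M S' \<phi> x \<in> carrier (base_change R M S')"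
  using assms frag_extend_closed[OF assms(3)]
  by (auto simp: carrier_base_change tensor_map_tclass)

lemma tensor_map_add:
  assumes "algebra R S" "algebra R S'" "scalar_linear R S S' \<phi>"
    "x \<in> carrier (base_change R M S)" "y \<in> carrier (base_change R M S)"
  shows "tensor_map R M S' \<phi> (x \<oplus>\<^bsub>base_change R M S\<^esub> y) =
    tensor_map R M S' \<phi> x \<oplus>\<^bsub>base_change R M S'\<^esub> tensor_map R M S' \<phi> y"
proof -
  obtain c d where cd: "x = tclass S c" "y = tclass S d" "Poly_Mapping.keys c \<subseteq> carrier M \<times> carrier S"
    "Poly_Mapping.keys d \<subseteq> carrier M \<times> carrier S" 
    using assms(4,5) by (auto simp: carrier_base_change)
  have "Poly_Mapping.keys (c + d) \<subseteq> carrier M \<times> carrier S"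
    using cd keys_add[of c d] by auto
  then show ?thesis
    using cd assms(1-3) 
    by (simp add: tclass_add tensor_map_tclass frag_extend_add frag_extend_closed[OF assms(3)])
qed

lemma tensor_add_left:
  assumes "algebra R S" "x \<in> carrier M" "y \<in> carrier M" "s \<in> carrier S"
  shows "tensor R M S (x \<oplus>\<^bsub>M\<^esub> y) s = tensor R M S x s \<oplus>\<^bsub>base_change R M S\<^esub> tensor R M S y s"
proof -
  have "frag_of (x \<oplus>\<^bsub>M\<^esub> y, s) - (frag_of (x, s) + frag_of (y, s)) \<in> tensor_null R M S"
    unfolding tensor_null_eq diff_diff_eq[symmetric] by (rule generate.incl) (use assms in \<open>unfold tensor_relations_def, blast\<close>)
  then show ?thesis
    using assms keys_add[of "frag_of (x, s)" "frag_of (y, s)"]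
    by (simp add: tensor_tclass tclass_add) (rule tclass_eqI, auto)
qed

lemma tensor_add_right:
  assumes "algebra R S" "x \<in> carrier M" "s \<in> carrier S" "t \<in> carrier S"
  shows "tensor R M S x (s \<oplus>\<^bsub>S\<^esub> t) = tensor R M S x s \<oplus>\<^bsub>base_change R M S\<^esub> tensor R M S x t"
proof -
  interpret S: algebra R S by fact
  have "frag_of (x, s \<oplus>\<^bsub>S\<^esub> t) - (frag_of (x, s) + frag_of (x, t)) \<in> tensor_null R M S"
    unfolding tensor_null_eq diff_diff_eq[symmetric] by (rule generate.incl) (use assms in \<open>unfold tensor_relations_def, blast\<close>)
  then show ?thesis
    using assms keys_add[of "frag_of (x, s)" "frag_of (x, t)"]
    by (simp add: tensor_tclass tclass_add) (rule tclass_eqI, auto)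
qed

lemma tensor_smult_left:
  assumes "algebra R S" "r \<in> carrier R" "x \<in> carrier M" "s \<in> carrier S"
  shows "tensor R M S (r \<odot>\<^bsub>M\<^esub> x) s = tensor R M S x (r \<odot>\<^bsub>S\<^esub> s)"
proof -
  interpret S: algebra R S by fact
  have "frag_of (r \<odot>\<^bsub>M\<^esub> x, s) - frag_of (x, r \<odot>\<^bsub>S\<^esub> s) \<in> tensor_null R M S"
    unfolding tensor_null_eq by (rule generate.incl) (use assms in \<open>unfold tensor_relations_def, blast\<close>)
  then show ?thesis
    unfolding tensor_tclass by (rule tclass_eqI[rotated 3]) (use assms in auto)
qed

lemma tensor_zero_right:
  assumes "algebra R S" "x \<in> carrier M"
  shows "tensor R M S x \<zero>\<^bsub>S\<^esub> = \<zero>\<^bsub>base_change R M S\<^esub>"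
proof -
  interpret S: algebra R S by fact
  interpret B: abelian_group "base_change R M S" by (rule base_change_abelian_group[OF assms(1)])
  have "tensor R M S x \<zero>\<^bsub>S\<^esub> \<oplus>\<^bsub>base_change R M S\<^esub> tensor R M S x \<zero>\<^bsub>S\<^esub> = tensor R M S x \<zero>\<^bsub>S\<^esub>"
    using assms by (simp flip: tensor_add_right)
  then show ?thesis
    using assms B.add.r_cancel_one'[of "tensor R M S x \<zero>\<^bsub>S\<^esub>" "tensor R M S x \<zero>\<^bsub>S\<^esub>"] by simp
qed

lemma base_change_induct [consumes 2, case_names tensor add]:
  assumes S: "algebra R S" and x: "x \<in> carrier (base_change R M S)"
    and tensor: "\<And>x s. x \<in> carrier M \<Longrightarrow> s \<in> carrier S \<Longrightarrow> P (tensor R M S x s)"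
    and add: "\<And>x y. x \<in> carrier (base_change R M S) \<Longrightarrow> y \<in> carrier (base_change R M S) \<Longrightarrow>
      P x \<Longrightarrow> P y \<Longrightarrow> P (x \<oplus>\<^bsub>base_change R M S\<^esub> y)"
  shows "P x"
proof -
  interpret S: algebra R S by fact
  interpret B: abelian_group "base_change R M S" by (rule base_change_abelian_group[OF S])
  have zero: "P \<zero>\<^bsub>base_change R M S\<^esub>"
    using tensor[OF M.zero_closed S.zero_closed] S by (simp add: tensor_zero_right)
  obtain c where c: "x = tclass S c" "Poly_Mapping.keys c \<subseteq> carrier M \<times> carrier S"
    using x by (auto simp: carrier_base_change)
  \<comment> \<open>The free abelian group is built up by differences, so the property has to be
    carried along for the negative as well.\<close>
  have "P (tclass S c) \<and> P (tclass S (- c))"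
    using c(2)
  proof (induction c rule: free_Abelian_group_induct[consumes 1, case_names zero diff gen])
    case zero
    then show ?case using \<open>P \<zero>\<^bsub>base_change R M S\<^esub>\<close> S by (simp add: tclass_zero)
  next
    case (diff x y)
    have "P (tclass S x \<oplus>\<^bsub>base_change R M S\<^esub> tclass S (- y))"
      "P (tclass S y \<oplus>\<^bsub>base_change R M S\<^esub> tclass S (- x))"
      using diff by (auto intro!: add simp: carrier_base_change)
    then show ?case using diff S by (simp add: tclass_add)
  next
    case (gen a)
    obtain y s where a: "a = (y, s)" "y \<in> carrier M" "s \<in> carrier S" using gen by auto
    \<comment> \<open>The negative of a pure tensor is again pure, with the sign moved into the
      second factor; so the hypothesis on pure tensors covers it.\<close>
    have "tensor R M S y (\<ominus>\<^bsub>S\<^esub> s) \<oplus>\<^bsub>base_change R M S\<^esub> tensor R M S y s = \<zero>\<^bsub>base_change R M S\<^esub>"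
      using a S by (simp flip: tensor_add_right add: S.l_neg tensor_zero_right)
    moreover have "tclass S (- frag_of a) \<oplus>\<^bsub>base_change R M S\<^esub> tensor R M S y s = \<zero>\<^bsub>base_change R M S\<^esub>"
      using a S by (simp add: tensor_tclass tclass_add tclass_zero)
    moreover have "tclass S (- frag_of a) \<in> carrier (base_change R M S)"
      using a by (simp add: carrier_base_change)
    ultimately have "tclass S (- frag_of a) = tensor R M S y (\<ominus>\<^bsub>S\<^esub> s)"
      using a B.add.right_cancel[of "tensor R M S y s"] by (metis S.a_inv_closed tensor_closed)
    then show ?case
      using tensor[OF a(2,3)] tensor[OF a(2) S.a_inv_closed[OF a(3)]] a by (simp add: tensor_tclass)
  qed
  then show ?thesis using c by blast
qed

lemma base_change_smult:
  "s \<odot>\<^bsub>base_change R M S\<^esub> x = tensor_map R M S (\<lambda>t. s \<otimes>\<^bsub>S\<^esub> t) x"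
  by (simp add: base_change_def)

lemma smult_tensor:
  assumes "algebra R S" "x \<in> carrier M" "s \<in> carrier S" "t \<in> carrier S"
  shows "s \<odot>\<^bsub>base_change R M S\<^esub> tensor R M S x t = tensor R M S x (s \<otimes>\<^bsub>S\<^esub> t)"
  using assms by (simp add: base_change_smult tensor_map_tensor mult_scalar_linear)

lemma base_change_module:
  assumes S: "algebra R S"
  shows "module S (base_change R M S)"
proof -
  interpret S: algebra R S by fact
  interpret B: abelian_group "base_change R M S" by (rule base_change_abelian_group[OF S])
  have smult_add: "s \<odot>\<^bsub>base_change R M S\<^esub> (x \<oplus>\<^bsub>base_change R M S\<^esub> y) =
      s \<odot>\<^bsub>base_change R M S\<^esub> x \<oplus>\<^bsub>base_change R M S\<^esub> s \<odot>\<^bsub>base_change R M S\<^esub> y"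
    if "s \<in> carrier S" "x \<in> carrier (base_change R M S)" "y \<in> carrier (base_change R M S)" for s x y
    using that S by (simp add: base_change_smult tensor_map_add mult_scalar_linear)
  have closed: "s \<odot>\<^bsub>base_change R M S\<^esub> x \<in> carrier (base_change R M S)"
    if "s \<in> carrier S" "x \<in> carrier (base_change R M S)" for s x
    using that S by (simp add: base_change_smult tensor_map_closed mult_scalar_linear)
  show ?thesis
  proof (rule moduleI)
    show "cring S" by (rule S.M_cring)
    fix a b x
    assume a: "a \<in> carrier S" and b: "b \<in> carrier S" and x: "x \<in> carrier (base_change R M S)"
    show "(a \<oplus>\<^bsub>S\<^esub> b) \<odot>\<^bsub>base_change R M S\<^esub> x =
        a \<odot>\<^bsub>base_change R M S\<^esub> x \<oplus>\<^bsub>base_change R M S\<^esub> b \<odot>\<^bsub>base_change R M S\<^esub> x"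
      using S x
    proof (induction rule: base_change_induct)
      case (tensor x s)
      then show ?case using S a b by (simp add: smult_tensor tensor_add_right S.l_distr)
    next
      case (add x y)
      then show ?case using a b by (simp add: smult_add closed B.a_ac)
    qed
    show "(a \<otimes>\<^bsub>S\<^esub> b) \<odot>\<^bsub>base_change R M S\<^esub> x = a \<odot>\<^bsub>base_change R M S\<^esub> (b \<odot>\<^bsub>base_change R M S\<^esub> x)"
      using S x
    proof (induction rule: base_change_induct)
      case (tensor x s)
      then show ?case using S a b by (simp add: smult_tensor S.m_assoc)
    next
      case (add x y)
      then show ?case using a b by (simp add: smult_add closed)
    qed
  next
    fix x assume x: "x \<in> carrier (base_change R M S)"
    show "\<one>\<^bsub>S\<^esub> \<odot>\<^bsub>base_change R M S\<^esub> x = x"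
      using S x
      by (induction rule: base_change_induct) (use S in \<open>simp_all add: smult_tensor smult_add\<close>)
  qed (use B.abelian_group_axioms smult_add closed in auto)
qed

lemma tensor_map_id:
  assumes "algebra R S" "x \<in> carrier (base_change R M S)"
  shows "tensor_map R M S (\<lambda>s. s) x = x"
proof -
  have id: "scalar_linear R S S (\<lambda>s. s)" by (auto simp: scalar_linear_def)
  show ?thesis
    using assms(1,2)
    by (induction rule: base_change_induct[consumes 2])
      (use id assms in \<open>simp_all add: tensor_map_tensor tensor_map_add\<close>)
qed

lemma tensor_map_comp:
  assumes "algebra R S" "algebra R S'" "algebra R S''" "scalar_linear R S S' \<phi>"
    "scalar_linear R S' S'' \<psi>" "x \<in> carrier (base_change R M S)"
  shows "tensor_map R M S'' (\<lambda>s. \<psi> (\<phi> s)) x = tensor_map R M S'' \<psi> (tensor_map R M S' \<phi> x)"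
proof -
  have c: "scalar_linear R S S'' (\<lambda>s. \<psi> (\<phi> s))"
    using assms(4,5) by (auto simp: scalar_linear_def Pi_iff)
  have p: "\<phi> s \<in> carrier S'" if "s \<in> carrier S" for s
    using assms(4) that by (auto simp: scalar_linear_def)
  show ?thesis
    using assms(1,6)
    by (induction rule: base_change_induct)
      (use assms(1-5) in \<open>simp_all add: tensor_map_tensor[OF _ _ c] tensor_map_tensor[OF _ _ assms(4)]
        tensor_map_tensor[OF _ _ assms(5)] tensor_map_add[OF _ _ c] tensor_map_add[OF _ _ assms(4)]
        tensor_map_add[OF _ _ assms(5)] p tensor_map_closed[OF _ _ assms(4)]\<close>)
qed

lemma tensor_map_smult:
  assumes S: "algebra R S" and S': "algebra R S'" and \<phi>: "\<phi> \<in> rring_hom R S S'"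
    and s: "s \<in> carrier S" and x: "x \<in> carrier (base_change R M S)"
  shows "tensor_map R M S' \<phi> (s \<odot>\<^bsub>base_change R M S\<^esub> x) =
    \<phi> s \<odot>\<^bsub>base_change R M S'\<^esub> tensor_map R M S' \<phi> x"
proof -
  interpret S: algebra R S by fact
  interpret B: module S "base_change R M S" by (rule base_change_module[OF S])
  interpret B': module S' "base_change R M S'" by (rule base_change_module[OF S'])
  note \<phi>' = rring_hom_scalar_linear[OF \<phi>]
  have c: "\<phi> t \<in> carrier S'" if "t \<in> carrier S" for t
    using \<phi> that by (auto simp: rring_hom_def ring_hom_def)
  show ?thesis
    using S x
  proof (induction rule: base_change_induct)
    case (tensor x t)
    then show ?case
      using S S' \<phi> s ring_hom_mult[of \<phi> S S' s t]
      by (simp add: smult_tensor tensor_map_tensor[OF S S' \<phi>'] c rring_hom_def)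
  next
    case (add x y)
    then show ?case
      using s by (simp add: B.smult_r_distr tensor_map_add[OF S S' \<phi>'] B'.smult_r_distr c
          tensor_map_closed[OF S S' \<phi>'])
  qed
qed

text \<open>A pure tensor x \<otimes> s over S' is s times the image of x \<otimes> 1, so the image
  of the module over S spans the one over S'. Uniqueness of S'-linear extensions rests on
  this.\<close>

lemma base_change_span_induct [consumes 4, case_names image add smult]:
  assumes S: "algebra R S" and S': "algebra R S'" and \<phi>: "\<phi> \<in> rring_hom R S S'"
    and x: "x \<in> carrier (base_change R M S')"
    and image: "\<And>x. x \<in> carrier (base_change R M S) \<Longrightarrow> P (tensor_map R M S' \<phi> x)"
    and add: "\<And>x y. x \<in> carrier (base_change R M S') \<Longrightarrow> y \<in> carrier (base_change R M S') \<Longrightarrow>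
      P x \<Longrightarrow> P y \<Longrightarrow> P (x \<oplus>\<^bsub>base_change R M S'\<^esub> y)"
    and smult: "\<And>s x. s \<in> carrier S' \<Longrightarrow> x \<in> carrier (base_change R M S') \<Longrightarrow>
      P x \<Longrightarrow> P (s \<odot>\<^bsub>base_change R M S'\<^esub> x)"
  shows "P x"
  using S' x
proof (induction rule: base_change_induct)
  case (tensor x s)
  interpret S: algebra R S by fact
  interpret S': algebra R S' by fact
  have one: "\<phi> \<one>\<^bsub>S\<^esub> = \<one>\<^bsub>S'\<^esub>" using \<phi> by (auto simp: rring_hom_def ring_hom_def)
  have "tensor R M S' x s = s \<odot>\<^bsub>base_change R M S'\<^esub> tensor_map R M S' \<phi> (tensor R M S x \<one>\<^bsub>S\<^esub>)"
    using tensor S S' rring_hom_scalar_linear[OF \<phi>] by (simp add: tensor_map_tensor one smult_tensor)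
  moreover have "P (s \<odot>\<^bsub>base_change R M S'\<^esub> tensor_map R M S' \<phi> (tensor R M S x \<one>\<^bsub>S\<^esub>))"
    using tensor S S' rring_hom_scalar_linear[OF \<phi>] by (intro smult image tensor_map_closed) auto
  ultimately show ?case by simp
qed (use add in auto)

end

section \<open>R-rings given by ring homomorphisms\<close>

lemma algebra_of_ring_hom:
  assumes R: "cring R" and P: "cring P" and h: "h \<in> ring_hom R P"
    and smult: "\<And>r x. r \<in> carrier R \<Longrightarrow> x \<in> carrier P \<Longrightarrow> r \<odot>\<^bsub>P\<^esub> x = h r \<otimes>\<^bsub>P\<^esub> x"
  shows "algebra R P"
proof -
  interpret P: cring P by fact
  interpret R: cring R by fact
  interpret h: ring_hom_cring R P h
    using h by unfold_locales
  show ?thesis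
    by (rule algebraI) (simp_all add: R P smult P.l_distr P.r_distr P.m_assoc)
qed

lemma algebra_ring_hom:
  assumes "algebra R S"
  shows "(\<lambda>r. r \<odot>\<^bsub>S\<^esub> \<one>\<^bsub>S\<^esub>) \<in> ring_hom R S"
proof -
  interpret algebra R S by fact
  show ?thesis
    by (rule ring_hom_memI) (simp_all add: smult_l_distr smult_assoc1 smult_assoc2)
qed

lemma algebra_smult_one:
  assumes "algebra R S" "r \<in> carrier R" "s \<in> carrier S"
  shows "(r \<odot>\<^bsub>S\<^esub> \<one>\<^bsub>S\<^esub>) \<otimes>\<^bsub>S\<^esub> s = r \<odot>\<^bsub>S\<^esub> s"
proof -
  interpret algebra R S by fact
  show ?thesis using assms(2,3) by (simp add: smult_assoc2)
qed

section \<open>Polynomial rings as R-rings\<close>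

text \<open>A polynomial is recovered from the list of its coefficients up to its degree, the length
  of the list giving the degree. Lists over an infinite type inject into that type, so polynomials
  can be coded by single elements.\<close>

lemma polynomial_carrier_inj:
  assumes "infinite (UNIV :: 'u set)" "cring (S :: 'u rring)"
  shows "\<exists>f :: (nat \<Rightarrow> 'u) \<Rightarrow> 'u. inj_on f (carrier (UP S))"
proof -
  interpret UP_cring S "UP S" by (simp_all add: UP_cring_def assms(2))
  let ?l = "\<lambda>p. map (coeff (UP S) p) [0..<Suc (deg S p)]"
  have l: "inj_on ?l (carrier (UP S))"
  proof (rule inj_onI)
    fix p q assume p: "p \<in> carrier (UP S)" and q: "q \<in> carrier (UP S)" and eq: "?l p = ?l q"
    have d: "deg S p = deg S q"
      using eq by (metis Suc_inject diff_zero length_map length_upt)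
    have "coeff (UP S) p k = coeff (UP S) q k" for k
    proof (cases "k \<le> deg S p")
      case True
      then have "k < Suc (deg S p)" by simp
      then have "?l p ! k = coeff (UP S) p k" "?l q ! k = coeff (UP S) q k"
        unfolding d by (simp_all del: upt_Suc)
      then show ?thesis unfolding eq by (rule trans[OF sym])
    next
      case False
      then show ?thesis using d p q by (simp add: deg_aboveD)
    qed
    then show "p = q" using p q by (auto intro: up_eqI)
  qed
  have "|lists (UNIV :: 'u set)| \<le>o |UNIV :: 'u set|"
    by (rule ordIso_imp_ordLeq[OF card_of_lists_infinite[OF assms(1)]])
  then obtain g :: "'u list \<Rightarrow> 'u" where g: "inj_on g (lists UNIV)"
    using card_of_ordLeq[of "lists (UNIV :: 'u set)" "UNIV :: 'u set"] by blast
  have "inj_on (g \<circ> ?l) (carrier (UP S))"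
    by (rule comp_inj_on[OF l inj_on_subset[OF g]]) simp
  then show ?thesis by blast
qed

text \<open>The ring structure of \<open>UP S\<close> is transported to the codes of polynomials,
  which places S[t] inside the universe.\<close>

lemma polynomial_rring_exists:
  assumes inf: "infinite (UNIV :: 'u set)" and S: "algebra R (S :: 'u rring)"
  shows "\<exists>P i t. polynomial_rring R S P i t"
proof -
  interpret S: algebra R S by fact
  interpret UP_cring S "UP S" by (simp_all add: UP_cring_def S.M_cring)
  obtain f :: "(nat \<Rightarrow> 'u) \<Rightarrow> 'u" where f: "inj_on f (carrier (UP S))"
    using polynomial_carrier_inj[OF inf S.M_cring] by blast
  let ?g = "inv_into (carrier (UP S)) f"
  define i where "i = (\<lambda>s. f (monom (UP S) s 0))"
  \<comment> \<open>The inverse of the coding map decodes the arguments; R acts through the constant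
    polynomials r . 1.\<close>
  define P :: "'u rring" where "P = \<lparr>carrier = f ` carrier (UP S),
    monoid.mult = (\<lambda>a b. f (?g a \<otimes>\<^bsub>UP S\<^esub> ?g b)), one = f \<one>\<^bsub>UP S\<^esub>, ring.zero = f \<zero>\<^bsub>UP S\<^esub>,
    ring.add = (\<lambda>a b. f (?g a \<oplus>\<^bsub>UP S\<^esub> ?g b)),
    smult = (\<lambda>r x. f (monom (UP S) (r \<odot>\<^bsub>S\<^esub> \<one>\<^bsub>S\<^esub>) 0 \<otimes>\<^bsub>UP S\<^esub> ?g x))\<rparr>"
  have iso: "f \<in> ring_iso (UP S) P"
    using f by (auto simp: ring_iso_def ring_hom_def bij_betw_def P_def)
  have "cring (P\<lparr>zero := f \<zero>\<^bsub>UP S\<^esub>\<rparr>)"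
    by (rule P.ring_iso_imp_img_cring[OF iso])
  then have P: "cring P" by (simp add: P_def)
  have fhom: "f \<in> ring_hom (UP S) P" using iso by (simp add: ring_iso_def)
  have gf: "?g (f p) = p" if "p \<in> carrier (UP S)" for p using f that by simp
  have ihom: "i \<in> ring_hom S P"
    unfolding i_def
    using ring_hom_trans[OF const_ring_hom fhom] by (simp add: comp_def)
  have "algebra R P"
  proof (rule algebra_of_ring_hom[OF S.R_cring P])
    show "(\<lambda>r. i (r \<odot>\<^bsub>S\<^esub> \<one>\<^bsub>S\<^esub>)) \<in> ring_hom R P"
      using ring_hom_trans[OF algebra_ring_hom[OF S] ihom] by (simp add: comp_def)
  qed (auto simp: P_def i_def gf)
  moreover have "i \<in> rring_hom R S P"
  proof -
    have "i (r \<odot>\<^bsub>S\<^esub> s) = r \<odot>\<^bsub>P\<^esub> i s" if "r \<in> carrier R" "s \<in> carrier S" for r s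
      using monom_mult[of "r \<odot>\<^bsub>S\<^esub> \<one>\<^bsub>S\<^esub>" s 0 0] that algebra_smult_one[OF S that]
      by (simp add: P_def i_def gf del: monom_mult)
    then show ?thesis using ihom by (simp add: rring_hom_def)
  qed
  moreover have "f (monom (UP S) \<one>\<^bsub>S\<^esub> 1) \<in> carrier P" by (simp add: P_def)
  moreover have "bij_betw (UnivPoly.eval S P i (f (monom (UP S) \<one>\<^bsub>S\<^esub> 1))) (carrier (UP S)) (carrier P)"
  proof -
    interpret E: UP_pre_univ_prop S P i "UP S"
      by (rule UP_pre_univ_propI) (rule S.M_cring P ihom)+
    \<comment> \<open>Evaluation and coding are ring homomorphisms that agree on constants and on
      the indeterminate, hence they are equal; so evaluation is bijective because coding is.\<close>
    have "UnivPoly.eval S P i (f (monom (UP S) \<one>\<^bsub>S\<^esub> 1)) p = f p" if "p \<in> carrier (UP S)" for p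
    proof (rule E.UP_hom_unique[OF _ _ _ _ _ _ that])
      show "ring_hom_cring (UP S) P (UnivPoly.eval S P i (f (monom (UP S) \<one>\<^bsub>S\<^esub> 1)))"
        by (rule E.ring_homD, rule E.eval_ring_hom) (simp add: P_def)
      show "ring_hom_cring (UP S) P f" by (rule E.ring_homD[OF fhom])
    qed (use E.eval_monom1 E.eval_const in \<open>auto simp: P_def i_def\<close>)
    then show ?thesis
      using iso by (simp add: ring_iso_def cong: bij_betw_cong)
  qed
  ultimately show ?thesis unfolding polynomial_rring_def by blast
qed

locale polynomial_ext =
  fixes R :: "('u, 'm) ring_scheme" and S P :: "'u rring" and i :: "'u \<Rightarrow> 'u" and t :: 'u
  assumes S_algebra: "algebra R S" and poly: "polynomial_rring R S P i t"
begin

lemma P_algebra: "algebra R P" and i_hom: "i \<in> rring_hom R S P" and t_closed [simp]: "t \<in> carrier P"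
  and eval_bij: "bij_betw (UnivPoly.eval S P i t) (carrier (UP S)) (carrier P)"
  using poly by (auto simp: polynomial_rring_def)

lemma i_ring_hom: "i \<in> ring_hom S P"
  using i_hom by (simp add: rring_hom_def)

end

sublocale polynomial_ext \<subseteq> S: cring S
  using S_algebra by (rule algebra.M_cring)

sublocale polynomial_ext \<subseteq> P: cring P
  using P_algebra by (rule algebra.M_cring)

sublocale polynomial_ext \<subseteq> E: UP_pre_univ_prop S P i "UP S"
  by (rule UP_pre_univ_propI) (rule S.is_cring P.is_cring i_ring_hom)+

context polynomial_ext
begin

abbreviation "ev \<equiv> UnivPoly.eval S P i t"

lemma ev_hom: "ring_hom_cring (UP S) P ev"
  by (rule E.ring_homD, rule E.eval_ring_hom) simp

lemma ev_eq_iff: "p \<in> carrier (UP S) \<Longrightarrow> q \<in> carrier (UP S) \<Longrightarrow> ev p = ev q \<longleftrightarrow> p = q"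
  using eval_bij by (auto simp: bij_betw_def inj_on_def)

lemma ev_surj:
  assumes "f \<in> carrier P"
  obtains p where "p \<in> carrier (UP S)" "f = ev p"
  using eval_bij assms by (auto simp: bij_betw_def)

lemma poly_repr:
  assumes "f \<in> carrier P"
  obtains n c where "\<And>k. c k \<in> carrier S" "\<And>k. n < k \<Longrightarrow> c k = \<zero>\<^bsub>S\<^esub>"
    "f = (\<Oplus>\<^bsub>P\<^esub>k\<in>{..n::nat}. i (c k) \<otimes>\<^bsub>P\<^esub> t [^]\<^bsub>P\<^esub> k)"
proof -
  obtain p where p: "p \<in> carrier (UP S)" "f = ev p" using ev_surj[OF assms] .
  show thesis
    by (rule that[of "coeff (UP S) p" "deg S p"])
      (simp_all only: p E.eval_on_carrier[OF p(1)] E.coeff_closed E.deg_aboveD)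
qed

lemma ev_sum:
  assumes "\<And>k. c k \<in> carrier S"
  shows "ev (\<Oplus>\<^bsub>UP S\<^esub>k\<in>{..n::nat}. monom (UP S) (c k) k) = (\<Oplus>\<^bsub>P\<^esub>k\<in>{..n}. i (c k) \<otimes>\<^bsub>P\<^esub> t [^]\<^bsub>P\<^esub> k)"
proof -
  interpret ev: ring_hom_cring "UP S" P ev by (rule ev_hom)
  show ?thesis
    using assms by (simp add: comp_def E.eval_monom Pi_iff)
qed

lemma coeff_sum:
  assumes "\<And>k. c k \<in> carrier S" "k \<le> n"
  shows "coeff (UP S) (\<Oplus>\<^bsub>UP S\<^esub>j\<in>{..n::nat}. monom (UP S) (c j) j) k = c k"
proof -
  have "coeff (UP S) (\<Oplus>\<^bsub>UP S\<^esub>j\<in>{..n}. monom (UP S) (c j) j) k = (\<Oplus>\<^bsub>S\<^esub>j\<in>{..n}. if j = k then c j else \<zero>\<^bsub>S\<^esub>)"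
    using assms(1) by (simp add: E.coeff_finsum Pi_iff)
  also have "\<dots> = c k"
    by (rule S.add.finprod_singleton_swap) (use assms in auto)
  finally show ?thesis .
qed

lemma poly_unique:
  assumes "\<And>k. c k \<in> carrier S" "\<And>k. d k \<in> carrier S" "k \<le> n"
    "(\<Oplus>\<^bsub>P\<^esub>k\<in>{..n::nat}. i (c k) \<otimes>\<^bsub>P\<^esub> t [^]\<^bsub>P\<^esub> k) = (\<Oplus>\<^bsub>P\<^esub>k\<in>{..n}. i (d k) \<otimes>\<^bsub>P\<^esub> t [^]\<^bsub>P\<^esub> k)"
  shows "c k = d k"
proof -
  have "(\<Oplus>\<^bsub>UP S\<^esub>k\<in>{..n}. monom (UP S) (c k) k) = (\<Oplus>\<^bsub>UP S\<^esub>k\<in>{..n}. monom (UP S) (d k) k)"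
    using assms by (subst ev_eq_iff[symmetric]) (auto simp: ev_sum intro!: E.P.finsum_closed)
  then show ?thesis
    using coeff_sum[of c k n] coeff_sum[of d k n] assms by simp
qed

text \<open>Only the polynomial modulo t^2 matters. The remainder \<open>f\<close> is left
  arbitrary, so that later expansions may be sorted by divisibility by t^2 without bounding their
  degree.\<close>

lemma linear_coeff:
  assumes "p \<in> carrier (UP S)" "a \<in> carrier S" "b \<in> carrier S" "f \<in> carrier P"
    "ev p = i a \<oplus>\<^bsub>P\<^esub> i b \<otimes>\<^bsub>P\<^esub> t \<oplus>\<^bsub>P\<^esub> t \<otimes>\<^bsub>P\<^esub> t \<otimes>\<^bsub>P\<^esub> f"
  shows "coeff (UP S) p 1 = b"
proof -
  interpret ev: ring_hom_cring "UP S" P ev by (rule ev_hom)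
  obtain q where q: "q \<in> carrier (UP S)" "f = ev q" using ev_surj[OF assms(4)] .
  have e: "ev (monom (UP S) a 0) = i a" "ev (monom (UP S) b 1) = i b \<otimes>\<^bsub>P\<^esub> t"
    "ev (monom (UP S) \<one>\<^bsub>S\<^esub> 2) = t \<otimes>\<^bsub>P\<^esub> t"
    using assms(2,3) by (simp_all add: E.eval_monom numeral_2_eq_2)
  have "ev p = ev (monom (UP S) a 0 \<oplus>\<^bsub>UP S\<^esub> monom (UP S) b 1 \<oplus>\<^bsub>UP S\<^esub> monom (UP S) \<one>\<^bsub>S\<^esub> 2 \<otimes>\<^bsub>UP S\<^esub> q)"
    using assms(1-3) q(1) by (simp add: e assms(5) q(2) del: One_nat_def)
  then have p: "p = monom (UP S) a 0 \<oplus>\<^bsub>UP S\<^esub> monom (UP S) b 1 \<oplus>\<^bsub>UP S\<^esub> monom (UP S) \<one>\<^bsub>S\<^esub> 2 \<otimes>\<^bsub>UP S\<^esub> q"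
    by (rule ev_eq_iff[THEN iffD1, rotated 2]) (use assms(1-3) q(1) in simp_all)
  \<comment> \<open>The coefficient at 1 of a product is a sum over j \<le> 1, where the
    coefficients of t^2 vanish.\<close>
  have "coeff (UP S) (monom (UP S) \<one>\<^bsub>S\<^esub> 2 \<otimes>\<^bsub>UP S\<^esub> q) 1 = \<zero>\<^bsub>S\<^esub>"
  proof -
    have "coeff (UP S) (monom (UP S) \<one>\<^bsub>S\<^esub> 2) j \<otimes>\<^bsub>S\<^esub> coeff (UP S) q (1 - j) = \<zero>\<^bsub>S\<^esub>" if "j \<in> {..1}" for j
      using that q(1) by auto
    then have "(\<Oplus>\<^bsub>S\<^esub>j\<in>{..1}. coeff (UP S) (monom (UP S) \<one>\<^bsub>S\<^esub> 2) j \<otimes>\<^bsub>S\<^esub> coeff (UP S) q (1 - j)) = \<zero>\<^bsub>S\<^esub>"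
      by (rule S.add.finprod_one_eqI)
    then show ?thesis
      using q(1) by (simp only: E.coeff_mult E.monom_closed S.one_closed)
  qed
  then show ?thesis
    unfolding p using assms(2,3) q(1) by (simp del: E.coeff_mult)
qed

lemma linear_coeff_unique:
  assumes "a \<in> carrier S" "b \<in> carrier S" "f \<in> carrier P" "a' \<in> carrier S" "b' \<in> carrier S" "f' \<in> carrier P"
    "i a \<oplus>\<^bsub>P\<^esub> i b \<otimes>\<^bsub>P\<^esub> t \<oplus>\<^bsub>P\<^esub> t \<otimes>\<^bsub>P\<^esub> t \<otimes>\<^bsub>P\<^esub> f = i a' \<oplus>\<^bsub>P\<^esub> i b' \<otimes>\<^bsub>P\<^esub> t \<oplus>\<^bsub>P\<^esub> t \<otimes>\<^bsub>P\<^esub> t \<otimes>\<^bsub>P\<^esub> f'"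
  shows "b = b'"
proof -
  have "i a \<oplus>\<^bsub>P\<^esub> i b \<otimes>\<^bsub>P\<^esub> t \<oplus>\<^bsub>P\<^esub> t \<otimes>\<^bsub>P\<^esub> t \<otimes>\<^bsub>P\<^esub> f \<in> carrier P" using assms by simp
  then obtain p where "p \<in> carrier (UP S)" "i a \<oplus>\<^bsub>P\<^esub> i b \<otimes>\<^bsub>P\<^esub> t \<oplus>\<^bsub>P\<^esub> t \<otimes>\<^bsub>P\<^esub> t \<otimes>\<^bsub>P\<^esub> f = ev p"
    using ev_surj by blast
  then show ?thesis
    using linear_coeff[of p a b f] linear_coeff[of p a' b' f'] assms by simp
qed

text \<open>Monic linear polynomials are no zero divisors: the coefficient at k + 1 of the product
  gives p_k = - c p_(k+1), and as all coefficients above the degree vanish, the vanishing descends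
  to the others.\<close>

lemma linear_nonzerodivisor:
  assumes "f \<in> carrier P" "c \<in> carrier S" "(t \<oplus>\<^bsub>P\<^esub> i c) \<otimes>\<^bsub>P\<^esub> f = \<zero>\<^bsub>P\<^esub>"
  shows "f = \<zero>\<^bsub>P\<^esub>"
proof -
  interpret ev: ring_hom_cring "UP S" P ev by (rule ev_hom)
  obtain p where p: "p \<in> carrier (UP S)" "f = ev p" using ev_surj[OF assms(1)] .
  have "ev (monom (UP S) \<one>\<^bsub>S\<^esub> 1 \<otimes>\<^bsub>UP S\<^esub> p \<oplus>\<^bsub>UP S\<^esub> c \<odot>\<^bsub>UP S\<^esub> p) = ev \<zero>\<^bsub>UP S\<^esub>"
    using assms p by (simp add: E.eval_monom P.l_distr flip: E.monom_mult_is_smult)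
  then have eq: "monom (UP S) \<one>\<^bsub>S\<^esub> 1 \<otimes>\<^bsub>UP S\<^esub> p \<oplus>\<^bsub>UP S\<^esub> c \<odot>\<^bsub>UP S\<^esub> p = \<zero>\<^bsub>UP S\<^esub>"
    using assms p by (subst (asm) ev_eq_iff) auto
  have step: "coeff (UP S) p k = \<ominus>\<^bsub>S\<^esub> (c \<otimes>\<^bsub>S\<^esub> coeff (UP S) p (Suc k))" for k
  proof -
    have "coeff (UP S) p k \<oplus>\<^bsub>S\<^esub> c \<otimes>\<^bsub>S\<^esub> coeff (UP S) p (Suc k) = \<zero>\<^bsub>S\<^esub>"
      using arg_cong[OF eq, of "\<lambda>q. coeff (UP S) q (Suc k)"] E.coeff_monom_mult[of "\<one>\<^bsub>S\<^esub>" p 1 k] p assms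
      by (simp del: E.coeff_mult)
    then show ?thesis using p assms by (simp add: S.sum_zero_eq_neg)
  qed
  \<comment> \<open>\<open>j\<close> measures how far the vanishing has been pushed down from the
    degree.\<close>
  have "\<forall>k. deg S p < k + j \<longrightarrow> coeff (UP S) p k = \<zero>\<^bsub>S\<^esub>" for j
  proof (induction j)
    case 0
    then show ?case using p by (simp add: E.deg_aboveD)
  next
    case (Suc j)
    show ?case
    proof (intro allI impI)
      fix k assume "deg S p < k + Suc j"
      then have "coeff (UP S) p (Suc k) = \<zero>\<^bsub>S\<^esub>" using Suc by simp
      then show "coeff (UP S) p k = \<zero>\<^bsub>S\<^esub>" unfolding step[of k] using assms(2) by simp
    qed
  qed
  then have "coeff (UP S) p k = \<zero>\<^bsub>S\<^esub>" for k
    using less_add_Suc2 by blast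
  then have "p = \<zero>\<^bsub>UP S\<^esub>" using p by (intro E.up_eqI) auto
  then show ?thesis using p by simp
qed

text \<open>The universal property of S[t] among R-rings. Such specializations transfer an identity
  at a generic point to every point.\<close>

lemma poly_hom:
  assumes S': "algebra R S'" and \<phi>: "\<phi> \<in> rring_hom R S S'" and s: "s \<in> carrier S'"
  shows "\<exists>\<psi>\<in>rring_hom R P S'. (\<forall>x\<in>carrier S. \<psi> (i x) = \<phi> x) \<and> \<psi> t = s"
proof -
  interpret A: algebra R S by (rule S_algebra)
  interpret A': algebra R S' by fact
  interpret AP: algebra R P by (rule P_algebra)
  have hom: "\<phi> \<in> ring_hom S S'" using \<phi> by (simp add: rring_hom_def)
  interpret F: UP_pre_univ_prop S S' \<phi> "UP S"
    by (rule UP_pre_univ_propI) (rule S.is_cring A'.M_cring hom)+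
  interpret ev: ring_hom_cring "UP S" P ev by (rule ev_hom)
  let ?e = "UnivPoly.eval S S' \<phi> s"
  interpret e: ring_hom_cring "UP S" S' ?e
    by (rule F.ring_homD, rule F.eval_ring_hom) (rule s)
  define \<psi> where "\<psi> = (\<lambda>f. ?e (inv_into (carrier (UP S)) ev f))"
  have \<psi>: "\<psi> (ev p) = ?e p" if "p \<in> carrier (UP S)" for p
    using that eval_bij by (simp add: \<psi>_def bij_betw_def)
  have i: "i x = ev (monom (UP S) x 0)" if "x \<in> carrier S" for x
    using that by (simp add: E.eval_const)
  have \<psi>i: "\<psi> (i x) = \<phi> x" if "x \<in> carrier S" for x
    using that s i[OF that] by (simp add: \<psi> F.eval_const)
  have t: "t = ev (monom (UP S) \<one>\<^bsub>S\<^esub> 1)"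
    by (rule E.eval_monom1[symmetric]) simp
  have \<psi>t: "\<psi> t = s"
    by (subst t) (simp only: \<psi> E.monom_closed S.one_closed F.eval_monom1[OF s])
  have mult: "\<psi> (f \<otimes>\<^bsub>P\<^esub> g) = \<psi> f \<otimes>\<^bsub>S'\<^esub> \<psi> g" if fg: "f \<in> carrier P" "g \<in> carrier P" for f g
  proof -
    obtain p q where "p \<in> carrier (UP S)" "f = ev p" "q \<in> carrier (UP S)" "g = ev q"
      using fg ev_surj by metis
    then show ?thesis by (simp add: \<psi> flip: ev.hom_mult)
  qed
  have "\<psi> \<in> ring_hom P S'"
  proof (rule ring_hom_memI)
    fix f g assume fg: "f \<in> carrier P" "g \<in> carrier P"
    obtain p q where "p \<in> carrier (UP S)" "f = ev p" "q \<in> carrier (UP S)" "g = ev q"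
      using fg ev_surj by metis
    then show "\<psi> (f \<oplus>\<^bsub>P\<^esub> g) = \<psi> f \<oplus>\<^bsub>S'\<^esub> \<psi> g" by (simp add: \<psi> flip: ev.hom_add)
  next
    fix f assume "f \<in> carrier P"
    then show "\<psi> f \<in> carrier S'" using ev_surj \<psi> by (metis e.hom_closed)
  next
    show "\<psi> \<one>\<^bsub>P\<^esub> = \<one>\<^bsub>S'\<^esub>" using \<psi>i[OF S.one_closed] by simp
  qed (rule mult)
  moreover have "\<psi> (r \<odot>\<^bsub>P\<^esub> f) = r \<odot>\<^bsub>S'\<^esub> \<psi> f" if "r \<in> carrier R" "f \<in> carrier P" for r f
  proof -
    have "\<psi> f \<in> carrier S'" using that ev_surj \<psi> by (metis e.hom_closed)
    have "r \<odot>\<^bsub>P\<^esub> f = i (r \<odot>\<^bsub>S\<^esub> \<one>\<^bsub>S\<^esub>) \<otimes>\<^bsub>P\<^esub> f"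
      using that i_hom by (simp add: rring_hom_def AP.smult_assoc2)
    then have "\<psi> (r \<odot>\<^bsub>P\<^esub> f) = \<phi> (r \<odot>\<^bsub>S\<^esub> \<one>\<^bsub>S\<^esub>) \<otimes>\<^bsub>S'\<^esub> \<psi> f"
      using that by (simp add: mult \<psi>i)
    also have "\<dots> = r \<odot>\<^bsub>S'\<^esub> \<psi> f"
      using that \<phi> \<open>\<psi> f \<in> carrier S'\<close> by (simp add: rring_hom_def A'.smult_assoc2)
    finally show ?thesis .
  qed
  ultimately show ?thesis using \<psi>i \<psi>t by (auto simp: rring_hom_def)
qed

end

lemma rring_hom_cring:
  assumes "algebra R S" "algebra R S'" "\<phi> \<in> rring_hom R S S'"
  shows "ring_hom_cring S S' \<phi>"
  using assms by (intro ring_hom_cringI algebra.M_cring) (auto simp: rring_hom_def)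

lemma rring_hom_closed: "\<phi> \<in> rring_hom R S S' \<Longrightarrow> s \<in> carrier S \<Longrightarrow> \<phi> s \<in> carrier S'"
  by (auto simp: rring_hom_def ring_hom_def)

lemma rring_hom_comp:
  "\<phi> \<in> rring_hom R S S' \<Longrightarrow> \<psi> \<in> rring_hom R S' S'' \<Longrightarrow> (\<lambda>s. \<psi> (\<phi> s)) \<in> rring_hom R S S''"
  by (auto simp: rring_hom_def ring_hom_def Pi_iff)

lemma rring_hom_id: "(\<lambda>s. s) \<in> rring_hom R S S"
  by (auto simp: rring_hom_def ring_hom_def)

lemma (in abelian_group) minus_zero_iff:
  assumes "a \<in> carrier G" "b \<in> carrier G"
  shows "a \<ominus> b = \<zero> \<longleftrightarrow> a = b"
  using assms by (metis a_minus_def add.inv_closed minus_equality minus_minus r_neg)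

lemma (in ring) r_distr_minus:
  assumes "x \<in> carrier R" "y \<in> carrier R" "z \<in> carrier R"
  shows "x \<otimes> (y \<ominus> z) = x \<otimes> y \<ominus> x \<otimes> z"
  using assms by (simp add: minus_eq r_distr r_minus)

lemma (in abelian_monoid) finsum_four:
  assumes "f \<in> UNIV \<rightarrow> carrier G" "\<And>k. 3 < k \<Longrightarrow> f k = \<zero>" "3 \<le> (n::nat)"
  shows "(\<Oplus>k\<in>{..n}. f k) = f 0 \<oplus> f 1 \<oplus> f 2 \<oplus> f 3"
  using assms(3)
proof (induction n rule: dec_induct)
  case base
  have f: "f k \<in> carrier G" for k using assms(1) by auto
  have "(\<Oplus>k\<in>{..Suc (Suc (Suc 0))}. f k) = f 0 \<oplus> f (Suc 0) \<oplus> f (Suc (Suc 0)) \<oplus> f (Suc (Suc (Suc 0)))"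
    using f by (simp add: a_ac)
  then show ?case by (simp add: numeral_2_eq_2 numeral_3_eq_3)
next
  case (step n)
  have f: "f k \<in> carrier G" for k using assms(1) by auto
  have "(\<Oplus>k\<in>{..Suc n}. f k) = f (Suc n) \<oplus> (\<Oplus>k\<in>{..n}. f k)" using f by simp
  also have "f (Suc n) = \<zero>" using step by (intro assms(2)) simp
  finally show ?case using step f by simp
qed

lemma (in abelian_monoid) finsum_pad:
  assumes "f \<in> UNIV \<rightarrow> carrier G" "\<And>k. n < k \<Longrightarrow> f k = \<zero>" "(n::nat) \<le> m"
  shows "(\<Oplus>k\<in>{..m}. f k) = (\<Oplus>k\<in>{..n}. f k)"
  using assms(3)
proof (induction m rule: dec_induct)
  case (step m)
  have f: "f k \<in> carrier G" for k using assms(1) by auto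
  have "(\<Oplus>k\<in>{..Suc m}. f k) = f (Suc m) \<oplus> (\<Oplus>k\<in>{..m}. f k)" using f by simp
  also have "f (Suc m) = \<zero>" using step by (intro assms(2)) simp
  finally show ?case using step f by simp
qed simp

section \<open>Cancelling and splitting off powers of the indeterminate\<close>

context polynomial_ext
begin

sublocale i: ring_hom_cring S P i
  by (rule rring_hom_cring[OF S_algebra P_algebra i_hom])

text \<open>The indeterminate is the case c = 0 of \<open>linear_nonzerodivisor\<close>; this is
  iterated k times.\<close>

lemma power_cancel:
  assumes "f \<in> carrier P" "g \<in> carrier P" "t [^]\<^bsub>P\<^esub> (k::nat) \<otimes>\<^bsub>P\<^esub> f = t [^]\<^bsub>P\<^esub> k \<otimes>\<^bsub>P\<^esub> g"
  shows "f = g"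
proof -
  have c: "h = \<zero>\<^bsub>P\<^esub>" if "h \<in> carrier P" "t \<otimes>\<^bsub>P\<^esub> h = \<zero>\<^bsub>P\<^esub>" for h
    using linear_nonzerodivisor[of h "\<zero>\<^bsub>S\<^esub>"] that by simp
  have p: "h = \<zero>\<^bsub>P\<^esub>" if "h \<in> carrier P" "t [^]\<^bsub>P\<^esub> k \<otimes>\<^bsub>P\<^esub> h = \<zero>\<^bsub>P\<^esub>" for h and k :: nat
    using that
  proof (induction k)
    case (Suc k)
    have "t [^]\<^bsub>P\<^esub> k \<otimes>\<^bsub>P\<^esub> h = \<zero>\<^bsub>P\<^esub>"
      by (rule c) (use Suc.prems in \<open>simp_all add: P.m_ac\<close>)
    then show ?case by (rule Suc.IH[OF Suc.prems(1)])
  qed simp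
  have "f \<ominus>\<^bsub>P\<^esub> g = \<zero>\<^bsub>P\<^esub>"
  proof (rule p[of _ k])
    have "t [^]\<^bsub>P\<^esub> k \<otimes>\<^bsub>P\<^esub> (f \<ominus>\<^bsub>P\<^esub> g) = t [^]\<^bsub>P\<^esub> k \<otimes>\<^bsub>P\<^esub> f \<ominus>\<^bsub>P\<^esub> t [^]\<^bsub>P\<^esub> k \<otimes>\<^bsub>P\<^esub> g"
      by (rule P.r_distr_minus) (use assms(1,2) in auto)
    then show "t [^]\<^bsub>P\<^esub> k \<otimes>\<^bsub>P\<^esub> (f \<ominus>\<^bsub>P\<^esub> g) = \<zero>\<^bsub>P\<^esub>"
      using assms(1,2) unfolding assms(3) by (simp add: P.minus_zero_iff)
  qed (use assms(1,2) in simp)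
  then show ?thesis using assms by (simp add: P.minus_zero_iff)
qed

lemma const_term:
  assumes "f \<in> carrier P"
  shows "\<exists>c\<in>carrier S. \<exists>g\<in>carrier P. f = i c \<oplus>\<^bsub>P\<^esub> t \<otimes>\<^bsub>P\<^esub> g"
proof -
  obtain n c where c: "\<And>k. c k \<in> carrier S" "\<And>k. n < k \<Longrightarrow> c k = \<zero>\<^bsub>S\<^esub>" "f = (\<Oplus>\<^bsub>P\<^esub>k\<in>{..n::nat}. i (c k) \<otimes>\<^bsub>P\<^esub> t [^]\<^bsub>P\<^esub> k)"
    by (rule poly_repr[OF assms]) (rule that; assumption)
  have "\<exists>g\<in>carrier P. (\<Oplus>\<^bsub>P\<^esub>k\<in>{..n}. i (c k) \<otimes>\<^bsub>P\<^esub> t [^]\<^bsub>P\<^esub> k) = i (c 0) \<oplus>\<^bsub>P\<^esub> t \<otimes>\<^bsub>P\<^esub> g" for n :: nat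
  proof (induction n)
    case 0
    show ?case using c(1) by (intro bexI[of _ "\<zero>\<^bsub>P\<^esub>"]) simp_all
  next
    case (Suc n)
    then obtain g where g: "g \<in> carrier P"
      "(\<Oplus>\<^bsub>P\<^esub>k\<in>{..n}. i (c k) \<otimes>\<^bsub>P\<^esub> t [^]\<^bsub>P\<^esub> k) = i (c 0) \<oplus>\<^bsub>P\<^esub> t \<otimes>\<^bsub>P\<^esub> g" by blast
    have "(\<Oplus>\<^bsub>P\<^esub>k\<in>{..Suc n}. i (c k) \<otimes>\<^bsub>P\<^esub> t [^]\<^bsub>P\<^esub> k) =
        i (c 0) \<oplus>\<^bsub>P\<^esub> t \<otimes>\<^bsub>P\<^esub> (g \<oplus>\<^bsub>P\<^esub> i (c (Suc n)) \<otimes>\<^bsub>P\<^esub> t [^]\<^bsub>P\<^esub> n)"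
      using c(1) g by (simp add: P.r_distr P.a_ac P.m_ac)
    then show ?case using g(1) c(1) by (intro bexI[of _ "g \<oplus>\<^bsub>P\<^esub> i (c (Suc n)) \<otimes>\<^bsub>P\<^esub> t [^]\<^bsub>P\<^esub> n"]) simp_all
  qed
  then show ?thesis using c by blast
qed

end

lemma polynomial_extI:
  assumes "infinite (UNIV :: 'u set)" "algebra R (S :: 'u rring)"
  obtains P i t where "polynomial_ext R S P i t"
  using polynomial_rring_exists[OF assms] assms(2) by (auto simp: polynomial_ext_def)

section \<open>The norm and its linearizations\<close>

text \<open>The general binary cubic form in a and b. Products in place of powers let the AC rules
  of a commutative ring normalize it.\<close>

abbreviation cubic_poly :: "'u rring \<Rightarrow> 'u \<Rightarrow> 'u \<Rightarrow> 'u \<Rightarrow> 'u \<Rightarrow> 'u \<Rightarrow> 'u \<Rightarrow> 'u" where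
  "cubic_poly S a b p q r s \<equiv> a \<otimes>\<^bsub>S\<^esub> a \<otimes>\<^bsub>S\<^esub> a \<otimes>\<^bsub>S\<^esub> p \<oplus>\<^bsub>S\<^esub> a \<otimes>\<^bsub>S\<^esub> a \<otimes>\<^bsub>S\<^esub> b \<otimes>\<^bsub>S\<^esub> q
     \<oplus>\<^bsub>S\<^esub> a \<otimes>\<^bsub>S\<^esub> b \<otimes>\<^bsub>S\<^esub> b \<otimes>\<^bsub>S\<^esub> r \<oplus>\<^bsub>S\<^esub> b \<otimes>\<^bsub>S\<^esub> b \<otimes>\<^bsub>S\<^esub> b \<otimes>\<^bsub>S\<^esub> s"

locale cubic =
  fixes R :: "('u, 'm) ring_scheme" and A :: "('u, 'a) cubic_algebra"
  assumes infinite_universe: "infinite (UNIV :: 'u set)"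
    and cubic: "cubic_jordan_algebra R A"

sublocale cubic \<subseteq> module R A
  using cubic by (simp add: cubic_jordan_algebra_def)

context cubic
begin

abbreviation "AA S \<equiv> base_change R A S"
abbreviation "N S \<equiv> cnorm A S"
abbreviation "D S \<equiv> norm_lin R A S"
abbreviation "T S \<equiv> bil_trace R A S"
abbreviation "X S \<equiv> cross R A S"
abbreviation "sharp S \<equiv> adjoint A S"
abbreviation "tm S' \<phi> \<equiv> tensor_map R A S' \<phi>"

lemma N_closed [simp]: "algebra R S \<Longrightarrow> x \<in> carrier (AA S) \<Longrightarrow> N S x \<in> carrier S"
  using cubic by (simp add: cubic_jordan_algebra_def cubic_form_def)

lemma N_smult: "algebra R S \<Longrightarrow> x \<in> carrier (AA S) \<Longrightarrow> s \<in> carrier S \<Longrightarrow>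
    N S (s \<odot>\<^bsub>AA S\<^esub> x) = s \<otimes>\<^bsub>S\<^esub> s \<otimes>\<^bsub>S\<^esub> s \<otimes>\<^bsub>S\<^esub> N S x"
proof -
  assume a: "algebra R S" "x \<in> carrier (AA S)" "s \<in> carrier S"
  interpret S: cring S by (rule algebra.M_cring[OF a(1)])
  show ?thesis
    using a cubic by (simp add: cubic_jordan_algebra_def cubic_form_def numeral_3_eq_3)
qed

lemma N_map: "algebra R S \<Longrightarrow> algebra R S' \<Longrightarrow> \<phi> \<in> rring_hom R S S' \<Longrightarrow> x \<in> carrier (AA S) \<Longrightarrow>
    N S' (tm S' \<phi> x) = \<phi> (N S x)"
  using cubic unfolding cubic_jordan_algebra_def cubic_form_def by blast

lemma tm_closed [simp]: "algebra R S \<Longrightarrow> algebra R S' \<Longrightarrow> \<phi> \<in> rring_hom R S S' \<Longrightarrow> x \<in> carrier (AA S) \<Longrightarrow>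
    tm S' \<phi> x \<in> carrier (AA S')"
  by (rule tensor_map_closed) (auto intro: rring_hom_scalar_linear)

lemma tm_add: "algebra R S \<Longrightarrow> algebra R S' \<Longrightarrow> \<phi> \<in> rring_hom R S S' \<Longrightarrow> x \<in> carrier (AA S) \<Longrightarrow>
    y \<in> carrier (AA S) \<Longrightarrow> tm S' \<phi> (x \<oplus>\<^bsub>AA S\<^esub> y) = tm S' \<phi> x \<oplus>\<^bsub>AA S'\<^esub> tm S' \<phi> y"
  by (rule tensor_map_add) (auto intro: rring_hom_scalar_linear)

lemmas tm_smult = tensor_map_smult
lemmas tm_id = tensor_map_id

lemma tm_comp: "algebra R S \<Longrightarrow> algebra R S' \<Longrightarrow> algebra R S'' \<Longrightarrow> \<phi> \<in> rring_hom R S S' \<Longrightarrow>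
    \<psi> \<in> rring_hom R S' S'' \<Longrightarrow> x \<in> carrier (AA S) \<Longrightarrow>
    tm S'' \<psi> (tm S' \<phi> x) = tm S'' (\<lambda>s. \<psi> (\<phi> s)) x"
  by (rule tensor_map_comp[symmetric]) (auto intro: rring_hom_scalar_linear)

text \<open>\<open>\<phi>\<close> is a total function, while homomorphisms obtained from universal
  properties, such as a specialization composed with the inclusion of constants, are known on the
  carrier only.\<close>

lemma tm_cong:
  assumes "algebra R S" "algebra R S'" "\<phi> \<in> rring_hom R S S'" "\<psi> \<in> rring_hom R S S'"
    "\<And>s. s \<in> carrier S \<Longrightarrow> \<phi> s = \<psi> s" "x \<in> carrier (AA S)"
  shows "tm S' \<phi> x = tm S' \<psi> x"
  using assms(1,6)
proof (induction rule: base_change_induct)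
  case (tensor x s)
  then show ?case
    using assms tensor_map_tensor[OF assms(1,2) rring_hom_scalar_linear[OF assms(3)]]
      tensor_map_tensor[OF assms(1,2) rring_hom_scalar_linear[OF assms(4)]] by simp
next
  case (add x y)
  then show ?case using assms(1-4) by (simp add: tm_add)
qed

lemma AA_module: "algebra R S \<Longrightarrow> module S (AA S)"
  by (rule base_change_module)

text \<open>The coefficients are read off at the generic point x + t y over S[t]. Any other value
  arises by specializing t to b along \<phi>, and the norm commutes with that
  specialization.\<close>

lemma norm_polynomial:
  assumes S: "algebra R S" and x: "x \<in> carrier (AA S)" and y: "y \<in> carrier (AA S)"
  obtains n c where "\<And>k. c k \<in> carrier S" "\<And>k. n < k \<Longrightarrow> c k = \<zero>\<^bsub>S\<^esub>"
    "\<And>S' \<phi> b. algebra R S' \<Longrightarrow> \<phi> \<in> rring_hom R S S' \<Longrightarrow> b \<in> carrier S' \<Longrightarrow>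
      N S' (tm S' \<phi> x \<oplus>\<^bsub>AA S'\<^esub> b \<odot>\<^bsub>AA S'\<^esub> tm S' \<phi> y) =
      (\<Oplus>\<^bsub>S'\<^esub>k\<in>{..n::nat}. \<phi> (c k) \<otimes>\<^bsub>S'\<^esub> b [^]\<^bsub>S'\<^esub> k)"
proof -
  obtain P i t where "polynomial_ext R S P i t"
    using polynomial_extI[OF infinite_universe S] by blast
  then interpret P: polynomial_ext R S P i t .
  note P = P.P_algebra
  interpret AP: module P "AA P" by (rule AA_module[OF P])
  let ?v = "tm P i x \<oplus>\<^bsub>AA P\<^esub> t \<odot>\<^bsub>AA P\<^esub> tm P i y"
  have v: "?v \<in> carrier (AA P)" using S P P.i_hom x y by simp
  obtain n c where c: "\<And>k. c k \<in> carrier S" "\<And>k. n < k \<Longrightarrow> c k = \<zero>\<^bsub>S\<^esub>"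
    "N P ?v = (\<Oplus>\<^bsub>P\<^esub>k\<in>{..n::nat}. i (c k) \<otimes>\<^bsub>P\<^esub> t [^]\<^bsub>P\<^esub> k)"
    by (rule P.poly_repr[OF N_closed[OF P v]]) (rule that; assumption)
  have main: "N S' (tm S' \<phi> x \<oplus>\<^bsub>AA S'\<^esub> b \<odot>\<^bsub>AA S'\<^esub> tm S' \<phi> y) =
      (\<Oplus>\<^bsub>S'\<^esub>k\<in>{..n::nat}. \<phi> (c k) \<otimes>\<^bsub>S'\<^esub> b [^]\<^bsub>S'\<^esub> k)"
    if S': "algebra R S'" and \<phi>: "\<phi> \<in> rring_hom R S S'" and b: "b \<in> carrier S'" for S' \<phi> b
  proof -
    obtain \<psi> where \<psi>: "\<psi> \<in> rring_hom R P S'" "\<And>s. s \<in> carrier S \<Longrightarrow> \<psi> (i s) = \<phi> s" "\<psi> t = b"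
      using P.poly_hom[OF S' \<phi> b] by blast
    interpret psi: ring_hom_cring P S' \<psi> by (rule rring_hom_cring[OF P S' \<psi>(1)])
    have tm: "tm S' \<psi> (tm P i z) = tm S' \<phi> z" if "z \<in> carrier (AA S)" for z
      unfolding tm_comp[OF S P S' P.i_hom \<psi>(1) that]
      by (rule tm_cong[OF S S' rring_hom_comp[OF P.i_hom \<psi>(1)] \<phi> \<psi>(2) that])
    have "N S' (tm S' \<phi> x \<oplus>\<^bsub>AA S'\<^esub> b \<odot>\<^bsub>AA S'\<^esub> tm S' \<phi> y) = N S' (tm S' \<psi> ?v)"
      using x y b by (simp add: tm_add[OF P S' \<psi>(1)] tm_smult[OF P S' \<psi>(1)] tm \<psi>(3) tm_closed[OF S P P.i_hom])
    also have "\<dots> = \<psi> (N P ?v)"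
      by (rule N_map[OF P S' \<psi>(1) v])
    also have "\<dots> = (\<Oplus>\<^bsub>S'\<^esub>k\<in>{..n}. \<psi> (i (c k) \<otimes>\<^bsub>P\<^esub> t [^]\<^bsub>P\<^esub> k))"
      unfolding c(3) by (subst psi.hom_finsum) (auto simp: c(1) comp_def)
    also have "\<dots> = (\<Oplus>\<^bsub>S'\<^esub>k\<in>{..n}. \<phi> (c k) \<otimes>\<^bsub>S'\<^esub> b [^]\<^bsub>S'\<^esub> k)"
      by (rule psi.S.finsum_cong') (auto simp: c(1) \<psi> rring_hom_closed[OF \<phi>] b)
    finally show ?thesis .
  qed
  show thesis by (rule that[where c = c and n = n]) (rule c main; assumption)+
qed

text \<open>Homogeneity makes \<open>N(u x + w y)\<close>, a polynomial in \<open>w\<close> over \<open>S[u]\<close>, satisfy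
  \<open>N(u x + u w y) = u\<^sup>3 N(x + w y)\<close>; comparing coefficients gives the cubic shape.\<close>

lemma norm_cubic:
  assumes S: "algebra R S" and x: "x \<in> carrier (AA S)" and y: "y \<in> carrier (AA S)"
  obtains c1 c2 where "c1 \<in> carrier S" "c2 \<in> carrier S"
    "\<And>S' \<phi> a b. algebra R S' \<Longrightarrow> \<phi> \<in> rring_hom R S S' \<Longrightarrow> a \<in> carrier S' \<Longrightarrow> b \<in> carrier S' \<Longrightarrow>
      N S' (a \<odot>\<^bsub>AA S'\<^esub> tm S' \<phi> x \<oplus>\<^bsub>AA S'\<^esub> b \<odot>\<^bsub>AA S'\<^esub> tm S' \<phi> y) =
      cubic_poly S' a b (\<phi> (N S x)) (\<phi> c1) (\<phi> c2) (\<phi> (N S y))"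
proof -
  obtain n c where c: "\<And>k. c k \<in> carrier S" "\<And>k. n < k \<Longrightarrow> c k = \<zero>\<^bsub>S\<^esub>"
    and Nc: "\<And>S' \<phi> b. algebra R S' \<Longrightarrow> \<phi> \<in> rring_hom R S S' \<Longrightarrow> b \<in> carrier S' \<Longrightarrow>
      N S' (tm S' \<phi> x \<oplus>\<^bsub>AA S'\<^esub> b \<odot>\<^bsub>AA S'\<^esub> tm S' \<phi> y) =
      (\<Oplus>\<^bsub>S'\<^esub>k\<in>{..n::nat}. \<phi> (c k) \<otimes>\<^bsub>S'\<^esub> b [^]\<^bsub>S'\<^esub> k)"
    by (rule norm_polynomial[OF S x y]) (rule that; assumption)
  obtain P i u where "polynomial_ext R S P i u"
    using polynomial_extI[OF infinite_universe S] by blast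
  then interpret P: polynomial_ext R S P i u .
  note P = P.P_algebra
  interpret AP: module P "AA P" by (rule AA_module[OF P])
  obtain Q j w where "polynomial_ext R P Q j w"
    using polynomial_extI[OF infinite_universe P] by blast
  then interpret Q: polynomial_ext R P Q j w .
  note Q = Q.P_algebra
  interpret AQ: module Q "AA Q" by (rule AA_module[OF Q])
  let ?x = "tm P i x" and ?y = "tm P i y"
  have x1: "?x \<in> carrier (AA P)" and y1: "?y \<in> carrier (AA P)"
    using x y by (simp_all add: tm_closed[OF S P P.i_hom])
  have ux: "u \<odot>\<^bsub>AA P\<^esub> ?x \<in> carrier (AA P)" using x1 by simp
  obtain m h where h: "\<And>k. h k \<in> carrier P" "\<And>k. m < k \<Longrightarrow> h k = \<zero>\<^bsub>P\<^esub>"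
    and Nh: "\<And>S' \<phi> b. algebra R S' \<Longrightarrow> \<phi> \<in> rring_hom R P S' \<Longrightarrow> b \<in> carrier S' \<Longrightarrow>
      N S' (tm S' \<phi> (u \<odot>\<^bsub>AA P\<^esub> ?x) \<oplus>\<^bsub>AA S'\<^esub> b \<odot>\<^bsub>AA S'\<^esub> tm S' \<phi> ?y) =
      (\<Oplus>\<^bsub>S'\<^esub>k\<in>{..m::nat}. \<phi> (h k) \<otimes>\<^bsub>S'\<^esub> b [^]\<^bsub>S'\<^esub> k)"
    by (rule norm_polynomial[OF P ux y1]) (rule that; assumption)
  \<comment> \<open>A common bound for both expansions, at least 3 so that the comparison reaches
    all four coefficients that survive.\<close>
  define l where "l = max (max n m) 3"
  have l: "n \<le> l" "m \<le> l" "3 \<le> l" by (auto simp: l_def)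
  \<comment> \<open>\<open>c\<close> belongs to N(x + w y) over S and \<open>h\<close> to N(u x + w
    y) over S[u]; they are compared over S[u][w], after substituting u w for w in the second
    expansion.\<close>
  have key: "h k \<otimes>\<^bsub>P\<^esub> u [^]\<^bsub>P\<^esub> k = u [^]\<^bsub>P\<^esub> (3::nat) \<otimes>\<^bsub>P\<^esub> i (c k)" if "k \<le> l" for k
  proof (rule Q.poly_unique[OF _ _ that])
    let ?X = "tm Q j ?x" and ?Y = "tm Q j ?y"
    have X: "?X \<in> carrier (AA Q)" and Y: "?Y \<in> carrier (AA Q)"
      using x1 y1 by (simp_all add: tm_closed[OF P Q Q.i_hom])
    have ji: "(\<lambda>s. j (i s)) \<in> rring_hom R S Q" by (rule rring_hom_comp[OF P.i_hom Q.i_hom])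
    have ju: "j u \<in> carrier Q" by simp
    have "(\<Oplus>\<^bsub>Q\<^esub>k\<in>{..l}. j (h k \<otimes>\<^bsub>P\<^esub> u [^]\<^bsub>P\<^esub> k) \<otimes>\<^bsub>Q\<^esub> w [^]\<^bsub>Q\<^esub> k) =
        (\<Oplus>\<^bsub>Q\<^esub>k\<in>{..m}. j (h k \<otimes>\<^bsub>P\<^esub> u [^]\<^bsub>P\<^esub> k) \<otimes>\<^bsub>Q\<^esub> w [^]\<^bsub>Q\<^esub> k)"
      by (rule Q.P.finsum_pad) (use h l in auto)
    also have "\<dots> = (\<Oplus>\<^bsub>Q\<^esub>k\<in>{..m}. j (h k) \<otimes>\<^bsub>Q\<^esub> (j u \<otimes>\<^bsub>Q\<^esub> w) [^]\<^bsub>Q\<^esub> k)"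
      by (rule Q.P.finsum_cong') (use h in \<open>auto simp: Q.P.m_assoc Q.P.nat_pow_distrib\<close>)
    also have "\<dots> = N Q (tm Q j (u \<odot>\<^bsub>AA P\<^esub> ?x) \<oplus>\<^bsub>AA Q\<^esub> (j u \<otimes>\<^bsub>Q\<^esub> w) \<odot>\<^bsub>AA Q\<^esub> ?Y)"
      by (rule Nh[OF Q Q.i_hom, symmetric]) simp
    also have "\<dots> = N Q (j u \<odot>\<^bsub>AA Q\<^esub> (?X \<oplus>\<^bsub>AA Q\<^esub> w \<odot>\<^bsub>AA Q\<^esub> ?Y))"
      using X Y by (simp add: tm_smult[OF P Q Q.i_hom P.t_closed x1] AQ.smult_r_distr AQ.smult_assoc1)
    also have "\<dots> = j u [^]\<^bsub>Q\<^esub> (3::nat) \<otimes>\<^bsub>Q\<^esub> N Q (?X \<oplus>\<^bsub>AA Q\<^esub> w \<odot>\<^bsub>AA Q\<^esub> ?Y)"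
      using X Y by (simp add: N_smult[OF Q _ ju] numeral_3_eq_3)
    also have "?X \<oplus>\<^bsub>AA Q\<^esub> w \<odot>\<^bsub>AA Q\<^esub> ?Y = tm Q (\<lambda>s. j (i s)) x \<oplus>\<^bsub>AA Q\<^esub> w \<odot>\<^bsub>AA Q\<^esub> tm Q (\<lambda>s. j (i s)) y"
      by (simp only: tm_comp[OF S P Q P.i_hom Q.i_hom] x y)
    also have "N Q \<dots> = (\<Oplus>\<^bsub>Q\<^esub>k\<in>{..n}. j (i (c k)) \<otimes>\<^bsub>Q\<^esub> w [^]\<^bsub>Q\<^esub> k)"
      by (rule Nc[OF Q ji Q.t_closed])
    also have "\<dots> = (\<Oplus>\<^bsub>Q\<^esub>k\<in>{..l}. j (i (c k)) \<otimes>\<^bsub>Q\<^esub> w [^]\<^bsub>Q\<^esub> k)"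
      by (rule Q.P.finsum_pad[symmetric]) (use c l in auto)
    also have "j u [^]\<^bsub>Q\<^esub> (3::nat) \<otimes>\<^bsub>Q\<^esub> \<dots> = (\<Oplus>\<^bsub>Q\<^esub>k\<in>{..l}. j u [^]\<^bsub>Q\<^esub> (3::nat) \<otimes>\<^bsub>Q\<^esub> (j (i (c k)) \<otimes>\<^bsub>Q\<^esub> w [^]\<^bsub>Q\<^esub> k))"
      by (rule Q.P.finsum_rdistr) (use c in auto)
    also have "\<dots> = (\<Oplus>\<^bsub>Q\<^esub>k\<in>{..l}. j (u [^]\<^bsub>P\<^esub> (3::nat) \<otimes>\<^bsub>P\<^esub> i (c k)) \<otimes>\<^bsub>Q\<^esub> w [^]\<^bsub>Q\<^esub> k)"
      by (rule Q.P.finsum_cong') (use c in \<open>auto simp: Q.P.m_assoc\<close>)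
    finally show "(\<Oplus>\<^bsub>Q\<^esub>k\<in>{..l}. j (h k \<otimes>\<^bsub>P\<^esub> u [^]\<^bsub>P\<^esub> k) \<otimes>\<^bsub>Q\<^esub> w [^]\<^bsub>Q\<^esub> k) =
      (\<Oplus>\<^bsub>Q\<^esub>k\<in>{..l}. j (u [^]\<^bsub>P\<^esub> (3::nat) \<otimes>\<^bsub>P\<^esub> i (c k)) \<otimes>\<^bsub>Q\<^esub> w [^]\<^bsub>Q\<^esub> k)" .
  qed (use c h in auto)
  have pow: "u [^]\<^bsub>P\<^esub> (a + b) \<otimes>\<^bsub>P\<^esub> f = u [^]\<^bsub>P\<^esub> a \<otimes>\<^bsub>P\<^esub> (u [^]\<^bsub>P\<^esub> b \<otimes>\<^bsub>P\<^esub> f)"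
    if "f \<in> carrier P" for a b :: nat and f
    using that by (simp add: P.P.m_assoc flip: P.P.nat_pow_mult)
  \<comment> \<open>Up to degree 3, u^k divides both sides of \<open>key\<close> and is
    cancelled.\<close>
  have low: "h k = u [^]\<^bsub>P\<^esub> d \<otimes>\<^bsub>P\<^esub> i (c k)" if "k + d = 3" for k d
  proof (rule P.power_cancel[of _ _ k])
    have "u [^]\<^bsub>P\<^esub> k \<otimes>\<^bsub>P\<^esub> h k = u [^]\<^bsub>P\<^esub> (k + d) \<otimes>\<^bsub>P\<^esub> i (c k)"
      using key[of k] l that h(1) by (simp add: P.P.m_comm)
    then show "u [^]\<^bsub>P\<^esub> k \<otimes>\<^bsub>P\<^esub> h k = u [^]\<^bsub>P\<^esub> k \<otimes>\<^bsub>P\<^esub> (u [^]\<^bsub>P\<^esub> d \<otimes>\<^bsub>P\<^esub> i (c k))"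
      using c(1) by (simp add: pow)
  qed (use c h in auto)
  \<comment> \<open>Above degree 3, cancelling u^3 leaves u^(k-3) h_k = c_k with a positive
    exponent, which is why it is written as \<open>Suc d\<close>. At u = 0 the constant c_k is seen
    to vanish, and then so does h_k.\<close>
  have high: "h k = \<zero>\<^bsub>P\<^esub>" if k: "3 < k" for k
  proof (cases "k \<le> l")
    case True
    define d where "d = k - 4"
    have d: "k = 3 + Suc d" using k by (simp add: d_def)
    have "u [^]\<^bsub>P\<^esub> (3::nat) \<otimes>\<^bsub>P\<^esub> (u [^]\<^bsub>P\<^esub> (Suc d) \<otimes>\<^bsub>P\<^esub> h k) = u [^]\<^bsub>P\<^esub> (3::nat) \<otimes>\<^bsub>P\<^esub> i (c k)"
      unfolding pow[OF h(1), symmetric] d[symmetric] key[OF True, symmetric]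
      by (rule P.P.m_comm) (simp_all add: h(1))
    then have e: "u [^]\<^bsub>P\<^esub> (Suc d) \<otimes>\<^bsub>P\<^esub> h k = i (c k)"
      by (rule P.power_cancel[rotated 2]) (use h(1) c(1) in auto)
    obtain \<psi> where \<psi>: "\<psi> \<in> rring_hom R P S" "\<And>s. s \<in> carrier S \<Longrightarrow> \<psi> (i s) = s" "\<psi> u = \<zero>\<^bsub>S\<^esub>"
      using P.poly_hom[OF S rring_hom_id P.S.zero_closed] by blast
    interpret psi: ring_hom_cring P S \<psi> by (rule rring_hom_cring[OF P S \<psi>(1)])
    have "\<psi> (u [^]\<^bsub>P\<^esub> (Suc d) \<otimes>\<^bsub>P\<^esub> h k) = \<zero>\<^bsub>S\<^esub>"
      using h(1) by (simp add: \<psi>(3))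
    then have "c k = \<zero>\<^bsub>S\<^esub>" unfolding e using \<psi>(2)[OF c(1)] by simp
    then have "u [^]\<^bsub>P\<^esub> (Suc d) \<otimes>\<^bsub>P\<^esub> h k = u [^]\<^bsub>P\<^esub> (Suc d) \<otimes>\<^bsub>P\<^esub> \<zero>\<^bsub>P\<^esub>" using e by simp
    then show ?thesis by (rule P.power_cancel[rotated 2]) (use h(1) in auto)
  next
    case False
    then show ?thesis using h l by simp
  qed
  have main: "N S' (a \<odot>\<^bsub>AA S'\<^esub> tm S' \<phi> x \<oplus>\<^bsub>AA S'\<^esub> b \<odot>\<^bsub>AA S'\<^esub> tm S' \<phi> y) =
      cubic_poly S' a b (\<phi> (c 0)) (\<phi> (c 1)) (\<phi> (c 2)) (\<phi> (c 3))"
    if S': "algebra R S'" and \<phi>: "\<phi> \<in> rring_hom R S S'" and a: "a \<in> carrier S'" and b: "b \<in> carrier S'" for S' \<phi> a b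
  proof -
    obtain \<psi> where \<psi>: "\<psi> \<in> rring_hom R P S'" "\<And>s. s \<in> carrier S \<Longrightarrow> \<psi> (i s) = \<phi> s" "\<psi> u = a"
      using P.poly_hom[OF S' \<phi> a] by blast
    interpret psi: ring_hom_cring P S' \<psi> by (rule rring_hom_cring[OF P S' \<psi>(1)])
    have tm: "tm S' \<psi> (tm P i z) = tm S' \<phi> z" if "z \<in> carrier (AA S)" for z
      unfolding tm_comp[OF S P S' P.i_hom \<psi>(1) that]
      by (rule tm_cong[OF S S' rring_hom_comp[OF P.i_hom \<psi>(1)] \<phi> \<psi>(2) that])
    have "N S' (a \<odot>\<^bsub>AA S'\<^esub> tm S' \<phi> x \<oplus>\<^bsub>AA S'\<^esub> b \<odot>\<^bsub>AA S'\<^esub> tm S' \<phi> y) =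
        N S' (tm S' \<psi> (u \<odot>\<^bsub>AA P\<^esub> ?x) \<oplus>\<^bsub>AA S'\<^esub> b \<odot>\<^bsub>AA S'\<^esub> tm S' \<psi> ?y)"
      by (simp only: tm_smult[OF P S' \<psi>(1) P.t_closed x1] tm \<psi>(3) x y)
    also have "\<dots> = (\<Oplus>\<^bsub>S'\<^esub>k\<in>{..m}. \<psi> (h k) \<otimes>\<^bsub>S'\<^esub> b [^]\<^bsub>S'\<^esub> k)"
      by (rule Nh[OF S' \<psi>(1) b])
    also have "\<dots> = (\<Oplus>\<^bsub>S'\<^esub>k\<in>{..l}. \<psi> (h k) \<otimes>\<^bsub>S'\<^esub> b [^]\<^bsub>S'\<^esub> k)"
      by (rule psi.S.finsum_pad[symmetric]) (use h l b in auto)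
    also have "\<dots> = \<psi> (h 0) \<otimes>\<^bsub>S'\<^esub> b [^]\<^bsub>S'\<^esub> (0::nat) \<oplus>\<^bsub>S'\<^esub> \<psi> (h 1) \<otimes>\<^bsub>S'\<^esub> b [^]\<^bsub>S'\<^esub> (1::nat)
        \<oplus>\<^bsub>S'\<^esub> \<psi> (h 2) \<otimes>\<^bsub>S'\<^esub> b [^]\<^bsub>S'\<^esub> (2::nat) \<oplus>\<^bsub>S'\<^esub> \<psi> (h 3) \<otimes>\<^bsub>S'\<^esub> b [^]\<^bsub>S'\<^esub> (3::nat)"
      by (rule psi.S.finsum_four) (use h l b high in auto)
    also have "\<psi> (h 0) = a [^]\<^bsub>S'\<^esub> (3::nat) \<otimes>\<^bsub>S'\<^esub> \<phi> (c 0)"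
      using low[of 0 3] c(1) by (simp add: \<psi>)
    also have "\<psi> (h 1) = a [^]\<^bsub>S'\<^esub> (2::nat) \<otimes>\<^bsub>S'\<^esub> \<phi> (c 1)"
      using low[of 1 2] c(1) by (simp add: \<psi>)
    also have "\<psi> (h 2) = a [^]\<^bsub>S'\<^esub> (1::nat) \<otimes>\<^bsub>S'\<^esub> \<phi> (c 2)"
      using low[of 2 1] c(1) a by (simp add: \<psi>)
    also have "\<psi> (h 3) = \<phi> (c 3)"
      using low[of 3 0] c(1) rring_hom_closed[OF \<phi> c(1)] by (simp add: \<psi>)
    finally show ?thesis
      using a b rring_hom_closed[OF \<phi> c(1)]
      by (simp add: numeral_2_eq_2 numeral_3_eq_3 psi.S.m_ac)
  qed
  interpret AS: module S "AA S" by (rule AA_module[OF S])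
  \<comment> \<open>The outer coefficients are the values at (a, b) = (1, 0) and (0, 1).\<close>
  have "c 0 = N S x"
    using main[OF S rring_hom_id P.S.one_closed P.S.zero_closed] x y c(1) by (simp add: tm_id S)
  moreover have "c 3 = N S y"
    using main[OF S rring_hom_id P.S.zero_closed P.S.one_closed] x y c(1) by (simp add: tm_id S)
  ultimately show thesis
    by (intro that[OF c(1) c(1), of 1 2]) (simp only: main)
qed

text \<open>The definition of \<open>norm_lin\<close> quantifies over all copies of S[t]. The cubic
  expansion has the coefficient \<open>c1\<close> at t in each of them, so the description is
  unambiguous.\<close>

lemma norm_lin_eq:
  assumes S: "algebra R S" and x: "x \<in> carrier (AA S)" and y: "y \<in> carrier (AA S)"
    and c: "c1 \<in> carrier S" "c2 \<in> carrier S"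
    and main: "\<And>S' \<phi> a b. algebra R S' \<Longrightarrow> \<phi> \<in> rring_hom R S S' \<Longrightarrow> a \<in> carrier S' \<Longrightarrow> b \<in> carrier S' \<Longrightarrow>
      N S' (a \<odot>\<^bsub>AA S'\<^esub> tm S' \<phi> x \<oplus>\<^bsub>AA S'\<^esub> b \<odot>\<^bsub>AA S'\<^esub> tm S' \<phi> y) =
      cubic_poly S' a b (\<phi> (N S x)) (\<phi> c1) (\<phi> c2) (\<phi> (N S y))"
  shows "D S x y = c1"
proof -
  have coeff: "coeff (UP S) p 1 = c1"
    if poly: "polynomial_rring R S P i t" and p: "p \<in> carrier (UP S)"
      and ev: "UnivPoly.eval S P i t p = N P (tm P i x \<oplus>\<^bsub>AA P\<^esub> t \<odot>\<^bsub>AA P\<^esub> tm P i y)" for P i t p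
  proof -
    interpret P: polynomial_ext R S P i t by (rule polynomial_ext.intro[OF S poly])
    note P = P.P_algebra
    interpret AP: module P "AA P" by (rule AA_module[OF P])
    have x1: "tm P i x \<in> carrier (AA P)" using x by (simp add: tm_closed[OF S P P.i_hom])
    show ?thesis
    proof (rule P.linear_coeff[OF p _ c(1)])
      show "UnivPoly.eval S P i t p = i (N S x) \<oplus>\<^bsub>P\<^esub> i c1 \<otimes>\<^bsub>P\<^esub> t \<oplus>\<^bsub>P\<^esub>
          t \<otimes>\<^bsub>P\<^esub> t \<otimes>\<^bsub>P\<^esub> (i c2 \<oplus>\<^bsub>P\<^esub> t \<otimes>\<^bsub>P\<^esub> i (N S y))"
        using main[OF P P.i_hom P.P.one_closed P.t_closed] x1 c S x y unfolding ev
        by (simp add: P.P.r_distr P.P.a_assoc P.P.m_ac)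
    qed (use S x y c in auto)
  qed
  obtain P i t where "polynomial_ext R S P i t"
    using polynomial_extI[OF infinite_universe S] by blast
  then interpret P: polynomial_ext R S P i t .
  note P = P.P_algebra
  interpret AP: module P "AA P" by (rule AA_module[OF P])
  have "tm P i x \<oplus>\<^bsub>AA P\<^esub> t \<odot>\<^bsub>AA P\<^esub> tm P i y \<in> carrier (AA P)"
    using x y by (simp add: tm_closed[OF S P P.i_hom])
  then obtain p where p: "p \<in> carrier (UP S)"
      "N P (tm P i x \<oplus>\<^bsub>AA P\<^esub> t \<odot>\<^bsub>AA P\<^esub> tm P i y) = UnivPoly.eval S P i t p"
    using P.ev_surj[OF N_closed[OF P]] by blast
  show ?thesis
    unfolding norm_lin_def
  proof (rule the_equality)
    show "\<exists>P i t p. polynomial_rring R S P i t \<and> p \<in> carrier (UP S) \<and>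
       UnivPoly.eval S P i t p = N P (tm P i x \<oplus>\<^bsub>AA P\<^esub> t \<odot>\<^bsub>AA P\<^esub> tm P i y) \<and>
       c1 = up_ring.coeff (UP S) p 1"
      using p coeff[OF P.poly p(1) p(2)[symmetric]] P.poly by metis
  qed (use coeff in blast)
qed

lemma D_closed [simp]:
  assumes "algebra R S" "x \<in> carrier (AA S)" "y \<in> carrier (AA S)"
  shows "D S x y \<in> carrier S"
  using norm_cubic[OF assms] norm_lin_eq[OF assms] by metis

text \<open>The coefficient of a b^2 is D(y, x), since the expansion is symmetric under exchanging
  (a, x) with (b, y).\<close>

lemma N_linear_comb:
  assumes S: "algebra R S" and x: "x \<in> carrier (AA S)" and y: "y \<in> carrier (AA S)"
    and S': "algebra R S'" and \<phi>: "\<phi> \<in> rring_hom R S S'" and a: "a \<in> carrier S'" and b: "b \<in> carrier S'"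
  shows "N S' (a \<odot>\<^bsub>AA S'\<^esub> tm S' \<phi> x \<oplus>\<^bsub>AA S'\<^esub> b \<odot>\<^bsub>AA S'\<^esub> tm S' \<phi> y) =
      cubic_poly S' a b (\<phi> (N S x)) (\<phi> (D S x y)) (\<phi> (D S y x)) (\<phi> (N S y))"
proof -
  obtain c1 c2 where c: "c1 \<in> carrier S" "c2 \<in> carrier S"
    and main: "\<And>S' \<phi> a b. algebra R S' \<Longrightarrow> \<phi> \<in> rring_hom R S S' \<Longrightarrow> a \<in> carrier S' \<Longrightarrow> b \<in> carrier S' \<Longrightarrow>
      N S' (a \<odot>\<^bsub>AA S'\<^esub> tm S' \<phi> x \<oplus>\<^bsub>AA S'\<^esub> b \<odot>\<^bsub>AA S'\<^esub> tm S' \<phi> y) =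
      cubic_poly S' a b (\<phi> (N S x)) (\<phi> c1) (\<phi> c2) (\<phi> (N S y))"
    by (rule norm_cubic[OF S x y]) (rule that; assumption)
  have "D S x y = c1" by (rule norm_lin_eq[OF S x y c main])
  moreover have "D S y x = c2"
  proof (rule norm_lin_eq[OF S y x c(2,1)])
    fix S' \<phi> a b
    assume h: "algebra R S'" "\<phi> \<in> rring_hom R S S'" "a \<in> carrier S'" "b \<in> carrier S'"
    interpret S': cring S' by (rule algebra.M_cring[OF h(1)])
    interpret A': module S' "AA S'" by (rule AA_module[OF h(1)])
    have "N S' (a \<odot>\<^bsub>AA S'\<^esub> tm S' \<phi> y \<oplus>\<^bsub>AA S'\<^esub> b \<odot>\<^bsub>AA S'\<^esub> tm S' \<phi> x) =
        N S' (b \<odot>\<^bsub>AA S'\<^esub> tm S' \<phi> x \<oplus>\<^bsub>AA S'\<^esub> a \<odot>\<^bsub>AA S'\<^esub> tm S' \<phi> y)"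
      using h x y by (simp add: A'.a_comm tm_closed[OF S h(1,2)])
    also have "\<dots> = cubic_poly S' b a (\<phi> (N S x)) (\<phi> c1) (\<phi> c2) (\<phi> (N S y))"
      by (rule main[OF h(1,2,4,3)])
    also have "\<dots> = cubic_poly S' a b (\<phi> (N S y)) (\<phi> c2) (\<phi> c1) (\<phi> (N S x))"
      using h c x y S by (simp add: rring_hom_closed[OF h(2)] S'.a_ac S'.m_ac)
    finally show "N S' (a \<odot>\<^bsub>AA S'\<^esub> tm S' \<phi> y \<oplus>\<^bsub>AA S'\<^esub> b \<odot>\<^bsub>AA S'\<^esub> tm S' \<phi> x) =
      cubic_poly S' a b (\<phi> (N S y)) (\<phi> c2) (\<phi> c1) (\<phi> (N S x))" .
  qed
  ultimately show ?thesis using main[OF S' \<phi> a b] by simp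
qed

lemma N_comb:
  assumes S: "algebra R S" and "x \<in> carrier (AA S)" "y \<in> carrier (AA S)" "a \<in> carrier S" "b \<in> carrier S"
  shows "N S (a \<odot>\<^bsub>AA S\<^esub> x \<oplus>\<^bsub>AA S\<^esub> b \<odot>\<^bsub>AA S\<^esub> y) =
      cubic_poly S a b (N S x) (D S x y) (D S y x) (N S y)"
  using N_linear_comb[OF S assms(2,3) S rring_hom_id assms(4,5)] assms by (simp add: tm_id)

lemma N_add:
  assumes S: "algebra R S" and x: "x \<in> carrier (AA S)" "y \<in> carrier (AA S)"
  shows "N S (x \<oplus>\<^bsub>AA S\<^esub> y) = N S x \<oplus>\<^bsub>S\<^esub> D S x y \<oplus>\<^bsub>S\<^esub> D S y x \<oplus>\<^bsub>S\<^esub> N S y"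
proof -
  interpret S: cring S by (rule algebra.M_cring[OF S])
  interpret AS: module S "AA S" by (rule AA_module[OF S])
  show ?thesis using N_comb[OF S x S.one_closed S.one_closed] S x by simp
qed

text \<open>The working criterion for D: any expansion of N(x + t y) modulo t^2, in any one copy of
  S[t], determines it.\<close>

lemma D_eqI:
  assumes P: "polynomial_ext R S P i t" and x: "x \<in> carrier (AA S)" and y: "y \<in> carrier (AA S)"
    and a: "a \<in> carrier S" and b: "b \<in> carrier S" and f: "f \<in> carrier P"
    and eq: "N P (tm P i x \<oplus>\<^bsub>AA P\<^esub> t \<odot>\<^bsub>AA P\<^esub> tm P i y) = i a \<oplus>\<^bsub>P\<^esub> i b \<otimes>\<^bsub>P\<^esub> t \<oplus>\<^bsub>P\<^esub> t \<otimes>\<^bsub>P\<^esub> t \<otimes>\<^bsub>P\<^esub> f"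
  shows "D S x y = b"
proof -
  interpret P: polynomial_ext R S P i t by fact
  note S = P.S_algebra and P = P.P_algebra
  interpret AP: module P "AA P" by (rule AA_module[OF P])
  have x1: "tm P i x \<in> carrier (AA P)" using x by (simp add: tm_closed[OF S P P.i_hom])
  show ?thesis
  proof (rule P.linear_coeff_unique[OF _ _ _ a b f])
    show "i (N S x) \<oplus>\<^bsub>P\<^esub> i (D S x y) \<otimes>\<^bsub>P\<^esub> t \<oplus>\<^bsub>P\<^esub> t \<otimes>\<^bsub>P\<^esub> t \<otimes>\<^bsub>P\<^esub> (i (D S y x) \<oplus>\<^bsub>P\<^esub> t \<otimes>\<^bsub>P\<^esub> i (N S y)) =
      i a \<oplus>\<^bsub>P\<^esub> i b \<otimes>\<^bsub>P\<^esub> t \<oplus>\<^bsub>P\<^esub> t \<otimes>\<^bsub>P\<^esub> t \<otimes>\<^bsub>P\<^esub> f"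
      using N_linear_comb[OF S x y P P.i_hom P.P.one_closed P.t_closed] x1 S x y unfolding eq[symmetric]
      by (simp add: P.P.r_distr P.P.a_assoc P.P.m_ac)
  qed (use S x y in auto)
qed

text \<open>The expansion of N along the composite S to S' to S'[t] is at the same time the
  expansion over S'[t] that defines D over S'.\<close>

lemma D_map:
  assumes S: "algebra R S" and S': "algebra R S'" and \<phi>: "\<phi> \<in> rring_hom R S S'"
    and x: "x \<in> carrier (AA S)" and y: "y \<in> carrier (AA S)"
  shows "D S' (tm S' \<phi> x) (tm S' \<phi> y) = \<phi> (D S x y)"
proof -
  obtain P i t where P': "polynomial_ext R S' P i t"
    using polynomial_extI[OF infinite_universe S'] by blast
  then interpret P: polynomial_ext R S' P i t .
  note P = P.P_algebra
  interpret AP: module P "AA P" by (rule AA_module[OF P])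
  have c: "\<phi> (N S x) \<in> carrier S'" "\<phi> (N S y) \<in> carrier S'" "\<phi> (D S x y) \<in> carrier S'" "\<phi> (D S y x) \<in> carrier S'"
    using S x y by (simp_all add: rring_hom_closed[OF \<phi>])
  have x1: "tm P i (tm S' \<phi> x) \<in> carrier (AA P)"
    using x by (simp add: tm_closed[OF S' P P.i_hom] tm_closed[OF S S' \<phi>])
  show ?thesis
  proof (rule D_eqI[OF P' _ _ c(1,3)])
    have h: "(\<lambda>s. i (\<phi> s)) \<in> rring_hom R S P" by (rule rring_hom_comp[OF \<phi> P.i_hom])
    have "N P (\<one>\<^bsub>P\<^esub> \<odot>\<^bsub>AA P\<^esub> tm P i (tm S' \<phi> x) \<oplus>\<^bsub>AA P\<^esub> t \<odot>\<^bsub>AA P\<^esub> tm P i (tm S' \<phi> y)) =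
      cubic_poly P \<one>\<^bsub>P\<^esub> t (i (\<phi> (N S x))) (i (\<phi> (D S x y))) (i (\<phi> (D S y x))) (i (\<phi> (N S y)))"
      unfolding tm_comp[OF S S' P \<phi> P.i_hom x] tm_comp[OF S S' P \<phi> P.i_hom y]
      by (rule N_linear_comb[OF S x y P h]) auto
    then show "N P (tm P i (tm S' \<phi> x) \<oplus>\<^bsub>AA P\<^esub> t \<odot>\<^bsub>AA P\<^esub> tm P i (tm S' \<phi> y)) =
      i (\<phi> (N S x)) \<oplus>\<^bsub>P\<^esub> i (\<phi> (D S x y)) \<otimes>\<^bsub>P\<^esub> t \<oplus>\<^bsub>P\<^esub> t \<otimes>\<^bsub>P\<^esub> t \<otimes>\<^bsub>P\<^esub> (i (\<phi> (D S y x)) \<oplus>\<^bsub>P\<^esub> t \<otimes>\<^bsub>P\<^esub> i (\<phi> (N S y)))"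
      using x1 c by (simp add: P.P.r_distr P.P.a_assoc P.P.m_ac)
  qed (use c x y in \<open>simp_all add: tm_closed[OF S S' \<phi>]\<close>)
qed

text \<open>Expand N(x + (t s) y) instead of N(x + t y).\<close>

lemma D_smult_right:
  assumes S: "algebra R S" and x: "x \<in> carrier (AA S)" and y: "y \<in> carrier (AA S)" and s: "s \<in> carrier S"
  shows "D S x (s \<odot>\<^bsub>AA S\<^esub> y) = s \<otimes>\<^bsub>S\<^esub> D S x y"
proof -
  obtain P i t where P': "polynomial_ext R S P i t"
    using polynomial_extI[OF infinite_universe S] by blast
  then interpret P: polynomial_ext R S P i t .
  note P = P.P_algebra
  interpret AP: module P "AA P" by (rule AA_module[OF P])
  interpret AS: module S "AA S" by (rule AA_module[OF S])
  have c: "N S x \<in> carrier S" "N S y \<in> carrier S" "D S x y \<in> carrier S" "D S y x \<in> carrier S"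
    using S x y by simp_all
  have x1: "tm P i x \<in> carrier (AA P)" "tm P i y \<in> carrier (AA P)"
    using x y by (simp_all add: tm_closed[OF S P P.i_hom])
  show ?thesis
  proof (rule D_eqI[OF P' x _ c(1)])
    have "N P (\<one>\<^bsub>P\<^esub> \<odot>\<^bsub>AA P\<^esub> tm P i x \<oplus>\<^bsub>AA P\<^esub> (t \<otimes>\<^bsub>P\<^esub> i s) \<odot>\<^bsub>AA P\<^esub> tm P i y) =
      cubic_poly P \<one>\<^bsub>P\<^esub> (t \<otimes>\<^bsub>P\<^esub> i s) (i (N S x)) (i (D S x y)) (i (D S y x)) (i (N S y))"
      by (rule N_linear_comb[OF S x y P P.i_hom]) (use s in auto)
    then show "N P (tm P i x \<oplus>\<^bsub>AA P\<^esub> t \<odot>\<^bsub>AA P\<^esub> tm P i (s \<odot>\<^bsub>AA S\<^esub> y)) =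
      i (N S x) \<oplus>\<^bsub>P\<^esub> i (s \<otimes>\<^bsub>S\<^esub> D S x y) \<otimes>\<^bsub>P\<^esub> t \<oplus>\<^bsub>P\<^esub> t \<otimes>\<^bsub>P\<^esub> t \<otimes>\<^bsub>P\<^esub>
        (i s \<otimes>\<^bsub>P\<^esub> i s \<otimes>\<^bsub>P\<^esub> i (D S y x) \<oplus>\<^bsub>P\<^esub> t \<otimes>\<^bsub>P\<^esub> i s \<otimes>\<^bsub>P\<^esub> i s \<otimes>\<^bsub>P\<^esub> i s \<otimes>\<^bsub>P\<^esub> i (N S y))"
      using x1 c s y by (simp add: P.P.r_distr P.P.a_assoc P.P.m_ac AP.smult_assoc1 tm_smult[OF S P P.i_hom])
  qed (use c x y s in simp_all)
qed

text \<open>N((x + t y) + t z) is expanded in two stages over S[t]. Modulo t^2 the second stage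
  contributes t D(x + t y, z), of which only the constant term of D(x + t y, z) counts.\<close>

lemma D_add_right:
  assumes S: "algebra R S" and x: "x \<in> carrier (AA S)" and y: "y \<in> carrier (AA S)" and z: "z \<in> carrier (AA S)"
  shows "D S x (y \<oplus>\<^bsub>AA S\<^esub> z) = D S x y \<oplus>\<^bsub>S\<^esub> D S x z"
proof -
  obtain P i t where P': "polynomial_ext R S P i t"
    using polynomial_extI[OF infinite_universe S] by blast
  then interpret P: polynomial_ext R S P i t .
  note P = P.P_algebra
  interpret AP: module P "AA P" by (rule AA_module[OF P])
  interpret AS: module S "AA S" by (rule AA_module[OF S])
  let ?x = "tm P i x" and ?y = "tm P i y" and ?z = "tm P i z"
  let ?v = "?x \<oplus>\<^bsub>AA P\<^esub> t \<odot>\<^bsub>AA P\<^esub> ?y"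
  have x1: "?x \<in> carrier (AA P)" "?y \<in> carrier (AA P)" "?z \<in> carrier (AA P)"
    using x y z by (simp_all add: tm_closed[OF S P P.i_hom])
  then have v: "?v \<in> carrier (AA P)" by simp
  have c: "N S x \<in> carrier S" "N S y \<in> carrier S" "D S x y \<in> carrier S" "D S y x \<in> carrier S"
    "D S x z \<in> carrier S"
    using S x y z by simp_all
  have d: "N P ?z \<in> carrier P" "D P ?v ?z \<in> carrier P" "D P ?z ?v \<in> carrier P"
    using P v x1 by simp_all
  obtain d0 g where g: "d0 \<in> carrier S" "g \<in> carrier P" "D P ?v ?z = i d0 \<oplus>\<^bsub>P\<^esub> t \<otimes>\<^bsub>P\<^esub> g"
    using P.const_term[OF d(2)] by blast
  \<comment> \<open>The constant term is found by specializing t to 0, which turns x + t y into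
    x.\<close>
  have "d0 = D S x z"
  proof -
    obtain \<psi> where \<psi>: "\<psi> \<in> rring_hom R P S" "\<And>s. s \<in> carrier S \<Longrightarrow> \<psi> (i s) = s" "\<psi> t = \<zero>\<^bsub>S\<^esub>"
      using P.poly_hom[OF S rring_hom_id P.S.zero_closed] by blast
    interpret psi: ring_hom_cring P S \<psi> by (rule rring_hom_cring[OF P S \<psi>(1)])
    have tm: "tm S \<psi> (tm P i w) = w" if w: "w \<in> carrier (AA S)" for w
    proof -
      have "tm S \<psi> (tm P i w) = tm S (\<lambda>s. s) w"
        unfolding tm_comp[OF S P S P.i_hom \<psi>(1) w]
        by (rule tm_cong[OF S S rring_hom_comp[OF P.i_hom \<psi>(1)] rring_hom_id \<psi>(2) w])
      then show ?thesis by (simp add: tm_id[OF S w])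
    qed
    have "\<psi> (D P ?v ?z) = D S (tm S \<psi> ?v) (tm S \<psi> ?z)"
      by (rule D_map[OF P S \<psi>(1) v x1(3), symmetric])
    also have "tm S \<psi> ?v = x"
      using x1 x y by (simp add: tm_add[OF P S \<psi>(1)] tm_smult[OF P S \<psi>(1)] tm \<psi>(3))
    also have "tm S \<psi> ?z = z" by (rule tm[OF z])
    finally show ?thesis using g by (simp add: \<psi>)
  qed
  note g = g[unfolded this]
  show ?thesis
  proof (rule D_eqI[OF P' x _ c(1)])
    have Nv: "N P ?v = cubic_poly P \<one>\<^bsub>P\<^esub> t (i (N S x)) (i (D S x y)) (i (D S y x)) (i (N S y))"
      using N_linear_comb[OF S x y P P.i_hom P.P.one_closed P.t_closed] x1 by simp
    have "N P (\<one>\<^bsub>P\<^esub> \<odot>\<^bsub>AA P\<^esub> ?v \<oplus>\<^bsub>AA P\<^esub> t \<odot>\<^bsub>AA P\<^esub> ?z) =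
      cubic_poly P \<one>\<^bsub>P\<^esub> t (N P ?v) (D P ?v ?z) (D P ?z ?v) (N P ?z)"
      by (rule N_comb[OF P v x1(3)]) auto
    moreover have "\<one>\<^bsub>P\<^esub> \<odot>\<^bsub>AA P\<^esub> ?v \<oplus>\<^bsub>AA P\<^esub> t \<odot>\<^bsub>AA P\<^esub> ?z = ?x \<oplus>\<^bsub>AA P\<^esub> t \<odot>\<^bsub>AA P\<^esub> tm P i (y \<oplus>\<^bsub>AA S\<^esub> z)"
      using x1 by (simp add: tm_add[OF S P P.i_hom y z] AP.smult_r_distr AP.a_assoc)
    ultimately show "N P (?x \<oplus>\<^bsub>AA P\<^esub> t \<odot>\<^bsub>AA P\<^esub> tm P i (y \<oplus>\<^bsub>AA S\<^esub> z)) =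
      i (N S x) \<oplus>\<^bsub>P\<^esub> i (D S x y \<oplus>\<^bsub>S\<^esub> D S x z) \<otimes>\<^bsub>P\<^esub> t \<oplus>\<^bsub>P\<^esub> t \<otimes>\<^bsub>P\<^esub> t \<otimes>\<^bsub>P\<^esub>
        (i (D S y x) \<oplus>\<^bsub>P\<^esub> t \<otimes>\<^bsub>P\<^esub> i (N S y) \<oplus>\<^bsub>P\<^esub> g \<oplus>\<^bsub>P\<^esub> D P ?z ?v \<oplus>\<^bsub>P\<^esub> t \<otimes>\<^bsub>P\<^esub> N P ?z)"
      unfolding g(3) Nv using c d g(2) by (simp add: P.P.l_distr P.P.r_distr P.P.a_ac P.P.m_ac)
  qed (use c d g y z in simp_all)
qed

end

lemma additive_finsum:
  assumes G: "abelian_group G" and H: "abelian_group H"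
    and closed: "\<And>x. x \<in> carrier G \<Longrightarrow> f x \<in> carrier H"
    and add: "\<And>x y. x \<in> carrier G \<Longrightarrow> y \<in> carrier G \<Longrightarrow> f (x \<oplus>\<^bsub>G\<^esub> y) = f x \<oplus>\<^bsub>H\<^esub> f y"
    and I: "finite I" and g: "\<And>k. k \<in> I \<Longrightarrow> g k \<in> carrier G"
  shows "f (finsum G g I) = (\<Oplus>\<^bsub>H\<^esub>k\<in>I. f (g k))"
proof -
  interpret G: abelian_group G by fact
  interpret H: abelian_group H by fact
  have zero: "f \<zero>\<^bsub>G\<^esub> = \<zero>\<^bsub>H\<^esub>"
    using add[OF G.zero_closed G.zero_closed] closed[OF G.zero_closed]
    by (metis G.l_zero G.zero_closed H.add.l_cancel_one')
  show ?thesis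
    using I g
  proof (induction I rule: finite_induct)
    case empty
    then show ?case by (simp add: zero)
  next
    case (insert k I)
    then have "g \<in> I \<rightarrow> carrier G" "(\<lambda>k. f (g k)) \<in> I \<rightarrow> carrier H" using closed by auto
    then show ?case using insert closed by (simp add: add)
  qed
qed

lemma (in abelian_group) sum_left_cancel:
  assumes "z \<oplus> x = z \<oplus> y" "x \<in> carrier G" "y \<in> carrier G" "z \<in> carrier G"
  shows "x = y"
  using assms by (metis r_neg1)

lemma (in abelian_group) minus_add_distrib:
  assumes "a \<in> carrier G" "b \<in> carrier G" "c \<in> carrier G" "d \<in> carrier G"
  shows "(a \<oplus> b) \<ominus> (c \<oplus> d) = (a \<ominus> c) \<oplus> (b \<ominus> d)"
  using assms by (simp add: minus_eq minus_add a_ac)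

lemma (in abelian_group) minus_eq_iff:
  assumes "a \<in> carrier G" "b \<in> carrier G" "c \<in> carrier G"
  shows "a \<ominus> b = c \<longleftrightarrow> a = c \<oplus> b"
proof
  assume "a \<ominus> b = c"
  then have "c \<oplus> b = (a \<oplus> \<ominus> b) \<oplus> b" by (simp add: minus_eq)
  then show "a = c \<oplus> b" using assms by (simp add: a_assoc l_neg)
next
  assume "a = c \<oplus> b"
  then show "a \<ominus> b = c" using assms by (simp add: minus_eq a_assoc r_neg)
qed

section \<open>The symmetric trilinear form, the trace and the cross product\<close>

context cubic
begin

abbreviation "TL S \<equiv> norm_trilin R A S"
abbreviation "e S \<equiv> \<one>\<^bsub>AA S\<^esub>"

text \<open>Both sides are what remains of N(x + y + z) after removing common terms, once with z and
  once with y added last.\<close>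

lemma D_exchange:
  assumes S: "algebra R S" and x: "x \<in> carrier (AA S)" and y: "y \<in> carrier (AA S)" and z: "z \<in> carrier (AA S)"
  shows "D S x y \<oplus>\<^bsub>S\<^esub> D S (x \<oplus>\<^bsub>AA S\<^esub> y) z \<oplus>\<^bsub>S\<^esub> D S z y = D S x z \<oplus>\<^bsub>S\<^esub> D S (x \<oplus>\<^bsub>AA S\<^esub> z) y \<oplus>\<^bsub>S\<^esub> D S y z"
proof -
  interpret S: cring S by (rule algebra.M_cring[OF S])
  interpret AS: module S "AA S" by (rule AA_module[OF S])
  \<comment> \<open>The terms that occur literally in both expansions.\<close>
  let ?K = "N S x \<oplus>\<^bsub>S\<^esub> N S y \<oplus>\<^bsub>S\<^esub> N S z \<oplus>\<^bsub>S\<^esub> D S y x \<oplus>\<^bsub>S\<^esub> D S z x"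
  have "?K \<oplus>\<^bsub>S\<^esub> (D S x y \<oplus>\<^bsub>S\<^esub> D S (x \<oplus>\<^bsub>AA S\<^esub> y) z \<oplus>\<^bsub>S\<^esub> D S z y) = N S ((x \<oplus>\<^bsub>AA S\<^esub> y) \<oplus>\<^bsub>AA S\<^esub> z)"
    using x y z S by (simp add: N_add[OF S] D_add_right[OF S] S.a_ac)
  also have "(x \<oplus>\<^bsub>AA S\<^esub> y) \<oplus>\<^bsub>AA S\<^esub> z = (x \<oplus>\<^bsub>AA S\<^esub> z) \<oplus>\<^bsub>AA S\<^esub> y"
    using x y z by (simp add: AS.a_ac)
  also have "N S \<dots> = ?K \<oplus>\<^bsub>S\<^esub> (D S x z \<oplus>\<^bsub>S\<^esub> D S (x \<oplus>\<^bsub>AA S\<^esub> z) y \<oplus>\<^bsub>S\<^esub> D S y z)"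
    using x y z S by (simp add: N_add[OF S] D_add_right[OF S] S.a_ac)
  finally show ?thesis
    using x y z S by (elim S.sum_left_cancel) simp_all
qed

lemma TL_closed [simp]:
  assumes S: "algebra R S" and "x \<in> carrier (AA S)" "y \<in> carrier (AA S)" "z \<in> carrier (AA S)"
  shows "TL S x y z \<in> carrier S"
proof -
  interpret S: cring S by (rule algebra.M_cring[OF S])
  interpret AS: module S "AA S" by (rule AA_module[OF S])
  show ?thesis using assms by (simp add: norm_trilin_def)
qed

lemma D_add_left:
  assumes S: "algebra R S" and "x \<in> carrier (AA S)" "y \<in> carrier (AA S)" "z \<in> carrier (AA S)"
  shows "D S (x \<oplus>\<^bsub>AA S\<^esub> z) y = TL S x y z \<oplus>\<^bsub>S\<^esub> D S z y \<oplus>\<^bsub>S\<^esub> D S x y"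
proof -
  interpret S: cring S by (rule algebra.M_cring[OF S])
  interpret AS: module S "AA S" by (rule AA_module[OF S])
  have "TL S x y z = D S (x \<oplus>\<^bsub>AA S\<^esub> z) y \<ominus>\<^bsub>S\<^esub> D S x y \<ominus>\<^bsub>S\<^esub> D S z y"
    by (simp add: norm_trilin_def)
  then show ?thesis
    using assms by (simp add: S.minus_eq S.a_assoc S.l_neg)
qed

lemma TL_swap_outer:
  assumes S: "algebra R S" and "x \<in> carrier (AA S)" "y \<in> carrier (AA S)" "z \<in> carrier (AA S)"
  shows "TL S x y z = TL S z y x"
proof -
  interpret S: cring S by (rule algebra.M_cring[OF S])
  interpret AS: module S "AA S" by (rule AA_module[OF S])
  show ?thesis using assms by (simp add: norm_trilin_def S.minus_eq S.a_ac AS.a_comm)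
qed

text \<open>The asymmetric definition of the trilinear form is symmetric by
  \<open>D_exchange\<close>. Together with \<open>TL_swap_outer\<close> this transposition generates
  all permutations of the arguments.\<close>

lemma TL_swap_right:
  assumes S: "algebra R S" and x: "x \<in> carrier (AA S)" and y: "y \<in> carrier (AA S)" and z: "z \<in> carrier (AA S)"
  shows "TL S x y z = TL S x z y"
proof -
  interpret S: cring S by (rule algebra.M_cring[OF S])
  interpret AS: module S "AA S" by (rule AA_module[OF S])
  let ?K = "D S x y \<oplus>\<^bsub>S\<^esub> D S x z \<oplus>\<^bsub>S\<^esub> D S y z \<oplus>\<^bsub>S\<^esub> D S z y"
  have "?K \<oplus>\<^bsub>S\<^esub> TL S x y z = ?K \<oplus>\<^bsub>S\<^esub> TL S x z y"
    using D_exchange[OF S x y z] x y z S by (simp add: D_add_left[OF S] S.a_ac)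
  then show ?thesis using x y z S by (elim S.sum_left_cancel) simp_all
qed

text \<open>Linearity is visible only in the middle argument, where it is that of D in its second
  argument; symmetry carries it to the other arguments.\<close>

lemma TL_add_mid:
  assumes S: "algebra R S" and "x \<in> carrier (AA S)" "y \<in> carrier (AA S)" "y' \<in> carrier (AA S)" "z \<in> carrier (AA S)"
  shows "TL S x (y \<oplus>\<^bsub>AA S\<^esub> y') z = TL S x y z \<oplus>\<^bsub>S\<^esub> TL S x y' z"
proof -
  interpret S: cring S by (rule algebra.M_cring[OF S])
  interpret AS: module S "AA S" by (rule AA_module[OF S])
  show ?thesis using assms
    by (simp add: norm_trilin_def D_add_right[OF S] S.minus_eq S.minus_add S.a_ac)
qed

lemma TL_smult_mid:
  assumes S: "algebra R S" and "x \<in> carrier (AA S)" "y \<in> carrier (AA S)" "s \<in> carrier S" "z \<in> carrier (AA S)"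
  shows "TL S x (s \<odot>\<^bsub>AA S\<^esub> y) z = s \<otimes>\<^bsub>S\<^esub> TL S x y z"
proof -
  interpret S: cring S by (rule algebra.M_cring[OF S])
  interpret AS: module S "AA S" by (rule AA_module[OF S])
  show ?thesis using assms
    by (simp add: norm_trilin_def D_smult_right[OF S] S.r_distr_minus)
qed

lemma TL_swap_left:
  assumes S: "algebra R S" and "x \<in> carrier (AA S)" "y \<in> carrier (AA S)" "z \<in> carrier (AA S)"
  shows "TL S x y z = TL S y x z"
  using assms TL_swap_outer TL_swap_right by metis

lemma TL_map:
  assumes S: "algebra R S" and S': "algebra R S'" and \<phi>: "\<phi> \<in> rring_hom R S S'"
    and "x \<in> carrier (AA S)" "y \<in> carrier (AA S)" "z \<in> carrier (AA S)"
  shows "TL S' (tm S' \<phi> x) (tm S' \<phi> y) (tm S' \<phi> z) = \<phi> (TL S x y z)"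
proof -
  interpret S: cring S by (rule algebra.M_cring[OF S])
  interpret AS: module S "AA S" by (rule AA_module[OF S])
  interpret phi: ring_hom_cring S S' \<phi> by (rule rring_hom_cring[OF S S' \<phi>])
  show ?thesis
    using assms(4-) S by (simp add: norm_trilin_def D_map[OF S S' \<phi>] S.minus_eq phi.S.minus_eq flip: tm_add[OF S S' \<phi>])
qed

lemma e_closed [simp]: "algebra R S \<Longrightarrow> e S \<in> carrier (AA S)"
proof -
  assume S: "algebra R S"
  interpret S: cring S by (rule algebra.M_cring[OF S])
  have "\<one>\<^bsub>A\<^esub> \<in> carrier A" using cubic by (simp add: cubic_jordan_algebra_def)
  moreover have "e S = tensor R A S \<one>\<^bsub>A\<^esub> \<one>\<^bsub>S\<^esub>" by (simp add: base_change_def)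
  ultimately show ?thesis by simp
qed

lemma tm_e:
  assumes S: "algebra R S" and S': "algebra R S'" and \<phi>: "\<phi> \<in> rring_hom R S S'"
  shows "tm S' \<phi> (e S) = e S'"
proof -
  interpret S: cring S by (rule algebra.M_cring[OF S])
  interpret phi: ring_hom_cring S S' \<phi> by (rule rring_hom_cring[OF S S' \<phi>])
  have "\<one>\<^bsub>A\<^esub> \<in> carrier A" using cubic by (simp add: cubic_jordan_algebra_def)
  moreover have "e S = tensor R A S \<one>\<^bsub>A\<^esub> \<one>\<^bsub>S\<^esub>" "e S' = tensor R A S' \<one>\<^bsub>A\<^esub> \<one>\<^bsub>S'\<^esub>"
    by (simp_all add: base_change_def)
  ultimately show ?thesis
    using tensor_map_tensor[OF S S' rring_hom_scalar_linear[OF \<phi>]] by simp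
qed

lemma T_closed [simp]:
  assumes S: "algebra R S" and "x \<in> carrier (AA S)" "y \<in> carrier (AA S)"
  shows "T S x y \<in> carrier S"
proof -
  interpret S: cring S by (rule algebra.M_cring[OF S])
  show ?thesis using assms by (simp add: bil_trace_def Let_def)
qed

lemma T_comm:
  assumes S: "algebra R S" and "x \<in> carrier (AA S)" "y \<in> carrier (AA S)"
  shows "T S x y = T S y x"
proof -
  interpret S: cring S by (rule algebra.M_cring[OF S])
  show ?thesis using assms TL_swap_right[OF S e_closed[OF S] assms(2,3)]
    by (simp add: bil_trace_def Let_def S.m_comm)
qed

lemma T_add_left:
  assumes S: "algebra R S" and "x \<in> carrier (AA S)" "x' \<in> carrier (AA S)" "y \<in> carrier (AA S)"
  shows "T S (x \<oplus>\<^bsub>AA S\<^esub> x') y = T S x y \<oplus>\<^bsub>S\<^esub> T S x' y"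
proof -
  interpret S: cring S by (rule algebra.M_cring[OF S])
  show ?thesis using assms
    by (simp add: bil_trace_def Let_def D_add_right TL_add_mid S.l_distr S.minus_add_distrib)
qed

lemma T_smult_left:
  assumes S: "algebra R S" and "x \<in> carrier (AA S)" "s \<in> carrier S" "y \<in> carrier (AA S)"
  shows "T S (s \<odot>\<^bsub>AA S\<^esub> x) y = s \<otimes>\<^bsub>S\<^esub> T S x y"
proof -
  interpret S: cring S by (rule algebra.M_cring[OF S])
  show ?thesis using assms
    by (simp add: bil_trace_def Let_def D_smult_right TL_smult_mid S.r_distr_minus S.m_assoc)
qed

lemma T_add_right:
  assumes S: "algebra R S" and "x \<in> carrier (AA S)" "y \<in> carrier (AA S)" "y' \<in> carrier (AA S)"
  shows "T S x (y \<oplus>\<^bsub>AA S\<^esub> y') = T S x y \<oplus>\<^bsub>S\<^esub> T S x y'"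
proof -
  interpret AS: module S "AA S" by (rule AA_module[OF S])
  show ?thesis using assms T_comm[OF S, of x] by (simp add: T_add_left)
qed

lemma T_smult_right:
  assumes S: "algebra R S" and "x \<in> carrier (AA S)" "s \<in> carrier S" "y \<in> carrier (AA S)"
  shows "T S x (s \<odot>\<^bsub>AA S\<^esub> y) = s \<otimes>\<^bsub>S\<^esub> T S x y"
proof -
  interpret AS: module S "AA S" by (rule AA_module[OF S])
  show ?thesis using assms T_comm[OF S, of x] by (simp add: T_smult_left)
qed

lemma T_map:
  assumes S: "algebra R S" and S': "algebra R S'" and \<phi>: "\<phi> \<in> rring_hom R S S'"
    and "x \<in> carrier (AA S)" "y \<in> carrier (AA S)"
  shows "T S' (tm S' \<phi> x) (tm S' \<phi> y) = \<phi> (T S x y)"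
proof -
  interpret S: cring S by (rule algebra.M_cring[OF S])
  interpret phi: ring_hom_cring S S' \<phi> by (rule rring_hom_cring[OF S S' \<phi>])
  show ?thesis
    using assms(4-) S by (simp add: bil_trace_def Let_def D_map[OF S S' \<phi>] TL_map[OF S S' \<phi>] S.minus_eq
      phi.S.minus_eq flip: tm_e[OF S S' \<phi>])
qed

lemma sharp_closed [simp]: "algebra R S \<Longrightarrow> x \<in> carrier (AA S) \<Longrightarrow> sharp S x \<in> carrier (AA S)"
  using cubic by (simp add: cubic_jordan_algebra_def quadratic_adjoint_def)

lemma sharp_smult: "algebra R S \<Longrightarrow> x \<in> carrier (AA S) \<Longrightarrow> s \<in> carrier S \<Longrightarrow>
    sharp S (s \<odot>\<^bsub>AA S\<^esub> x) = (s \<otimes>\<^bsub>S\<^esub> s) \<odot>\<^bsub>AA S\<^esub> sharp S x"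
proof -
  assume a: "algebra R S" "x \<in> carrier (AA S)" "s \<in> carrier S"
  interpret S: cring S by (rule algebra.M_cring[OF a(1)])
  show ?thesis
    using a cubic by (simp add: cubic_jordan_algebra_def quadratic_adjoint_def numeral_2_eq_2)
qed

lemma sharp_map: "algebra R S \<Longrightarrow> algebra R S' \<Longrightarrow> \<phi> \<in> rring_hom R S S' \<Longrightarrow> x \<in> carrier (AA S) \<Longrightarrow>
    sharp S' (tm S' \<phi> x) = tm S' \<phi> (sharp S x)"
  using cubic unfolding cubic_jordan_algebra_def quadratic_adjoint_def by blast

lemma gradient: "algebra R S \<Longrightarrow> x \<in> carrier (AA S) \<Longrightarrow> y \<in> carrier (AA S) \<Longrightarrow> T S (sharp S x) y = D S x y"
  using cubic unfolding cubic_jordan_algebra_def Let_def by blast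

lemma sharp_sharp: "algebra R S \<Longrightarrow> x \<in> carrier (AA S) \<Longrightarrow> sharp S (sharp S x) = N S x \<odot>\<^bsub>AA S\<^esub> x"
  using cubic unfolding cubic_jordan_algebra_def Let_def by blast

lemma N_e: "algebra R S \<Longrightarrow> N S (e S) = \<one>\<^bsub>S\<^esub>"
  using cubic unfolding cubic_jordan_algebra_def Let_def by blast

lemma sharp_e: "algebra R S \<Longrightarrow> sharp S (e S) = e S"
  using cubic unfolding cubic_jordan_algebra_def Let_def by blast

lemma X_e: "algebra R S \<Longrightarrow> x \<in> carrier (AA S) \<Longrightarrow>
    X S (e S) x = T S x (e S) \<odot>\<^bsub>AA S\<^esub> e S \<ominus>\<^bsub>AA S\<^esub> x"
  using cubic unfolding cubic_jordan_algebra_def Let_def by blast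

lemma X_closed [simp]:
  assumes S: "algebra R S" and "x \<in> carrier (AA S)" "y \<in> carrier (AA S)"
  shows "X S x y \<in> carrier (AA S)"
proof -
  interpret AS: module S "AA S" by (rule AA_module[OF S])
  show ?thesis using assms by (simp add: cross_def)
qed

lemma sharp_add:
  assumes S: "algebra R S" and "x \<in> carrier (AA S)" "y \<in> carrier (AA S)"
  shows "sharp S (x \<oplus>\<^bsub>AA S\<^esub> y) = sharp S x \<oplus>\<^bsub>AA S\<^esub> X S x y \<oplus>\<^bsub>AA S\<^esub> sharp S y"
proof -
  interpret AS: module S "AA S" by (rule AA_module[OF S])
  have "X S x y = sharp S (x \<oplus>\<^bsub>AA S\<^esub> y) \<ominus>\<^bsub>AA S\<^esub> sharp S x \<ominus>\<^bsub>AA S\<^esub> sharp S y"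
    by (simp add: cross_def)
  then have "X S x y \<oplus>\<^bsub>AA S\<^esub> sharp S y \<oplus>\<^bsub>AA S\<^esub> sharp S x = sharp S (x \<oplus>\<^bsub>AA S\<^esub> y)"
    using assms by (simp add: AS.minus_eq AS.a_assoc AS.l_neg)
  then show ?thesis using assms by (simp add: AS.a_ac flip: \<open>_ = sharp S (x \<oplus>\<^bsub>AA S\<^esub> y)\<close>)
qed

lemma X_comm:
  assumes S: "algebra R S" and "x \<in> carrier (AA S)" "y \<in> carrier (AA S)"
  shows "X S x y = X S y x"
proof -
  interpret AS: module S "AA S" by (rule AA_module[OF S])
  show ?thesis using assms by (simp add: cross_def AS.minus_eq AS.a_ac)
qed

lemma X_map:
  assumes S: "algebra R S" and S': "algebra R S'" and \<phi>: "\<phi> \<in> rring_hom R S S'"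
    and x: "x \<in> carrier (AA S)" and y: "y \<in> carrier (AA S)"
  shows "X S' (tm S' \<phi> x) (tm S' \<phi> y) = tm S' \<phi> (X S x y)"
proof -
  interpret AS: module S "AA S" by (rule AA_module[OF S])
  interpret AS': module S' "AA S'" by (rule AA_module[OF S'])
  let ?x = "tm S' \<phi> x" and ?y = "tm S' \<phi> y"
  have c: "?x \<in> carrier (AA S')" "?y \<in> carrier (AA S')" "tm S' \<phi> (X S x y) \<in> carrier (AA S')"
    using x y S by (simp_all add: tm_closed[OF S S' \<phi>])
  have "sharp S' ?x \<oplus>\<^bsub>AA S'\<^esub> X S' ?x ?y \<oplus>\<^bsub>AA S'\<^esub> sharp S' ?y = sharp S' (tm S' \<phi> (x \<oplus>\<^bsub>AA S\<^esub> y))"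
    using c S' by (simp add: tm_add[OF S S' \<phi> x y] sharp_add)
  also have "\<dots> = tm S' \<phi> (sharp S x \<oplus>\<^bsub>AA S\<^esub> X S x y \<oplus>\<^bsub>AA S\<^esub> sharp S y)"
    using x y S by (simp add: sharp_map[OF S S' \<phi>] sharp_add)
  also have "\<dots> = sharp S' ?x \<oplus>\<^bsub>AA S'\<^esub> tm S' \<phi> (X S x y) \<oplus>\<^bsub>AA S'\<^esub> sharp S' ?y"
    using x y S by (simp add: sharp_map[OF S S' \<phi>] tm_add[OF S S' \<phi>])
  finally show ?thesis using c S' by simp
qed

lemma T_minus_left:
  assumes S: "algebra R S" and "x \<in> carrier (AA S)" "x' \<in> carrier (AA S)" "y \<in> carrier (AA S)"
  shows "T S (x \<ominus>\<^bsub>AA S\<^esub> x') y = T S x y \<ominus>\<^bsub>S\<^esub> T S x' y"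
proof -
  interpret S: cring S by (rule algebra.M_cring[OF S])
  interpret AS: module S "AA S" by (rule AA_module[OF S])
  have "T S (x \<ominus>\<^bsub>AA S\<^esub> x') y \<oplus>\<^bsub>S\<^esub> T S x' y = T S x y"
    using assms by (simp flip: T_add_left add: AS.minus_eq AS.a_assoc AS.l_neg)
  then show ?thesis using assms by (metis AS.minus_closed S.minus_eq_iff T_closed)
qed

text \<open>The gradient identity, linearized. It expresses the cross product by the trilinear form,
  whose linearity is already available.\<close>

lemma T_X:
  assumes S: "algebra R S" and x: "x \<in> carrier (AA S)" and y: "y \<in> carrier (AA S)" and z: "z \<in> carrier (AA S)"
  shows "T S (X S x y) z = TL S x z y"
proof -
  interpret AS: module S "AA S" by (rule AA_module[OF S])
  show ?thesis
    using S x y z by (simp add: cross_def norm_trilin_def T_minus_left gradient)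
qed

end

section \<open>Non-degeneracy of the trace\<close>

lemma base_rring_algebra:
  assumes "cring R"
  shows "algebra R (base_rring R)"
proof -
  interpret R: cring R by fact
  have "(\<lambda>x. x) \<in> ring_iso R (base_rring R)"
    by (auto simp: ring_iso_def ring_hom_def base_rring_def bij_betw_def)
  from R.ring_iso_imp_img_cring[OF this] have "cring (base_rring R)"
    by (simp add: base_rring_def)
  then show ?thesis
    by (rule algebra_of_ring_hom[OF assms, where h = "\<lambda>x. x"])
      (auto simp: ring_hom_def base_rring_def)
qed

lemma base_rring_hom:
  assumes S: "algebra R S"
  shows "(\<lambda>r. r \<odot>\<^bsub>S\<^esub> \<one>\<^bsub>S\<^esub>) \<in> rring_hom R (base_rring R) S"
proof -
  interpret algebra R S by fact
  show ?thesis
    using algebra_ring_hom[OF S] by (auto simp: rring_hom_def ring_hom_def base_rring_def smult_assoc1)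
qed

locale albert =
  fixes R :: "('u, 'm) ring_scheme" and A :: "('u, 'a) cubic_algebra"
  assumes infinite_univ: "infinite (UNIV :: 'u set)"
    and albert: "albert_algebra R A"

sublocale albert \<subseteq> cubic
  using albert infinite_univ by unfold_locales (simp_all add: albert_algebra_def)

context albert
begin

text \<open>Projectivity gives coordinate functions, which non-degeneracy represents by the trace.\<close>

lemma dual_basis_base:
  obtains n :: nat and ee yy where "\<And>k. k < n \<Longrightarrow> ee k \<in> carrier A" "\<And>k. k < n \<Longrightarrow> yy k \<in> carrier A"
    "\<And>x. x \<in> carrier A \<Longrightarrow> x = (\<Oplus>\<^bsub>A\<^esub>k\<in>{..<n}. T (base_rring R) (tensor R A (base_rring R) x \<one>\<^bsub>R\<^esub>)
       (tensor R A (base_rring R) (yy k) \<one>\<^bsub>R\<^esub>) \<odot>\<^bsub>A\<^esub> ee k)"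
    "\<And>x k. x \<in> carrier A \<Longrightarrow> k < n \<Longrightarrow> T (base_rring R) (tensor R A (base_rring R) x \<one>\<^bsub>R\<^esub>)
       (tensor R A (base_rring R) (yy k) \<one>\<^bsub>R\<^esub>) \<in> carrier R"
proof -
  let ?R = "base_rring R"
  obtain n i p where i: "i \<in> linear_maps R A (free_module R n)" and p: "p \<in> linear_maps R (free_module R n) A"
    and pi: "\<And>x. x \<in> carrier A \<Longrightarrow> p (i x) = x"
    using albert unfolding albert_algebra_def fg_projective_def by blast
  let ?F = "free_module R n"
  have ic: "i x k \<in> carrier R" if "x \<in> carrier A" "k < n" for x k
  proof -
    have "i x \<in> carrier ?F" using i that by (auto simp: linear_maps_def)
    then show ?thesis using that by (auto simp: free_module_def)
  qed
  have pc: "p v \<in> carrier A" if "v \<in> carrier ?F" for v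
    using p that by (auto simp: linear_maps_def)
  have padd: "p (v \<oplus>\<^bsub>?F\<^esub> w) = p v \<oplus>\<^bsub>A\<^esub> p w" if "v \<in> carrier ?F" "w \<in> carrier ?F" for v w
    using p that by (auto simp: linear_maps_def)
  have psmult: "p (r \<odot>\<^bsub>?F\<^esub> v) = r \<odot>\<^bsub>A\<^esub> p v" if "r \<in> carrier R" "v \<in> carrier ?F" for r v
    using p that by (auto simp: linear_maps_def)
  define d where "d k = (\<lambda>j\<in>{..<n}. if j = k then \<one>\<^bsub>R\<^esub> else \<zero>\<^bsub>R\<^esub>)" for k
  have d: "d k \<in> carrier ?F" for k by (auto simp: d_def free_module_def)
  define ee where "ee k = p (d k)" for k
  have ee: "ee k \<in> carrier A" for k using pc d by (simp add: ee_def)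
  have expand: "x = (\<Oplus>\<^bsub>A\<^esub>k\<in>{..<n}. i x k \<odot>\<^bsub>A\<^esub> ee k)" if x: "x \<in> carrier A" for x
  proof -
    \<comment> \<open>The coordinate vector truncated after m entries. Since p is known to be
      additive for two summands only, the expansion is built up one coordinate at a time.\<close>
    define v where "v m = (\<lambda>j\<in>{..<n}. if j < m then i x j else \<zero>\<^bsub>R\<^esub>)" for m
    have v: "v m \<in> carrier ?F" for m using ic x by (auto simp: v_def free_module_def)
    have pv: "p (v m) = (\<Oplus>\<^bsub>A\<^esub>k\<in>{..<m}. i x k \<odot>\<^bsub>A\<^esub> ee k)" if "m \<le> n" for m
      using that
    proof (induction m)
      case 0
      have "p (v 0) = p (\<zero>\<^bsub>R\<^esub> \<odot>\<^bsub>?F\<^esub> v 0)"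
        by (rule arg_cong[of _ _ p]) (auto simp: v_def free_module_def)
      also have "\<dots> = \<zero>\<^bsub>R\<^esub> \<odot>\<^bsub>A\<^esub> p (v 0)"
        using p v by (auto simp: linear_maps_def)
      also have "\<dots> = \<zero>\<^bsub>A\<^esub>"
        using pc[OF v[of 0]] by simp
      finally show ?case by simp
    next
      case (Suc m)
      have "v (Suc m) = v m \<oplus>\<^bsub>?F\<^esub> i x m \<odot>\<^bsub>?F\<^esub> d m"
        using Suc.prems ic[OF x] by (auto simp: v_def d_def free_module_def restrict_def less_Suc_eq)
      moreover have sd: "i x m \<odot>\<^bsub>?F\<^esub> d m \<in> carrier ?F"
        using Suc.prems ic[OF x, of m] d[of m] by (auto simp: free_module_def)
      ultimately have "p (v (Suc m)) = p (v m) \<oplus>\<^bsub>A\<^esub> p (i x m \<odot>\<^bsub>?F\<^esub> d m)"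
        using v[of m] sd by (simp only: padd)
      also have "p (i x m \<odot>\<^bsub>?F\<^esub> d m) = i x m \<odot>\<^bsub>A\<^esub> ee m"
        using d ic[OF x, of m] Suc.prems by (simp add: psmult ee_def)
      finally show ?case
        using Suc ic[OF x] ee by (simp add: lessThan_Suc M.a_comm)
    qed
    have vn: "v n = i x"
      using i x by (auto simp: v_def linear_maps_def free_module_def PiE_def Pi_def extensional_def restrict_def fun_eq_iff)
    show ?thesis using pv[OF order_refl] unfolding vn pi[OF x] .
  qed
  have "\<exists>y. y \<in> carrier A \<and> (\<forall>x\<in>carrier A. T ?R (tensor R A ?R x \<one>\<^bsub>R\<^esub>) (tensor R A ?R y \<one>\<^bsub>R\<^esub>) = i x k)" if k: "k < n" for k
  proof -
    have "(\<lambda>x\<in>carrier A. i x k) \<in> linear_maps R A ?R"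
      using i k ic by (auto simp: linear_maps_def base_rring_def free_module_def)
    then have "\<exists>y. y \<in> carrier A \<and> (\<forall>x\<in>carrier A. T ?R (tensor R A ?R x \<one>\<^bsub>R\<^esub>) (tensor R A ?R y \<one>\<^bsub>R\<^esub>) = (\<lambda>x\<in>carrier A. i x k) x)"
      using albert unfolding albert_algebra_def trace_nondegenerate_def by blast
    then show ?thesis by simp
  qed
  then obtain yy where yy: "\<And>k. k < n \<Longrightarrow> yy k \<in> carrier A"
    "\<And>k x. k < n \<Longrightarrow> x \<in> carrier A \<Longrightarrow> T ?R (tensor R A ?R x \<one>\<^bsub>R\<^esub>) (tensor R A ?R (yy k) \<one>\<^bsub>R\<^esub>) = i x k"
    by metis
  have ex: "x = (\<Oplus>\<^bsub>A\<^esub>k\<in>{..<n}. T ?R (tensor R A ?R x \<one>\<^bsub>R\<^esub>) (tensor R A ?R (yy k) \<one>\<^bsub>R\<^esub>) \<odot>\<^bsub>A\<^esub> ee k)"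
    if x: "x \<in> carrier A" for x
  proof -
    have "(\<Oplus>\<^bsub>A\<^esub>k\<in>{..<n}. T ?R (tensor R A ?R x \<one>\<^bsub>R\<^esub>) (tensor R A ?R (yy k) \<one>\<^bsub>R\<^esub>) \<odot>\<^bsub>A\<^esub> ee k) =
        (\<Oplus>\<^bsub>A\<^esub>k\<in>{..<n}. i x k \<odot>\<^bsub>A\<^esub> ee k)"
      using x ic ee by (intro M.finsum_cong') (auto simp: yy)
    then show ?thesis using expand[OF x] by simp
  qed
  show thesis
    by (rule that[of n ee yy]) (use ee yy ic in auto, rule ex)
qed

text \<open>The vectors are the images x \<otimes> 1 of one family over R, so all homomorphisms of
  R-rings respect them. Both sides of the expansion are additive, and on pure tensors it reduces to
  the expansion over R.\<close>

lemma dual_basis: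
  obtains n :: nat and ee yy
  where "\<And>S k. algebra R S \<Longrightarrow> k < n \<Longrightarrow> ee S k \<in> carrier (AA S)"
    "\<And>S k. algebra R S \<Longrightarrow> k < n \<Longrightarrow> yy S k \<in> carrier (AA S)"
    "\<And>S S' \<phi> k. algebra R S \<Longrightarrow> algebra R S' \<Longrightarrow> \<phi> \<in> rring_hom R S S' \<Longrightarrow> k < n \<Longrightarrow> tm S' \<phi> (ee S k) = ee S' k"
    "\<And>S S' \<phi> k. algebra R S \<Longrightarrow> algebra R S' \<Longrightarrow> \<phi> \<in> rring_hom R S S' \<Longrightarrow> k < n \<Longrightarrow> tm S' \<phi> (yy S k) = yy S' k"
    "\<And>S x. algebra R S \<Longrightarrow> x \<in> carrier (AA S) \<Longrightarrow>
       x = (\<Oplus>\<^bsub>AA S\<^esub>k\<in>{..<n}. T S x (yy S k) \<odot>\<^bsub>AA S\<^esub> ee S k)"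
proof -
  let ?R = "base_rring R"
  have R: "algebra R ?R" by (rule base_rring_algebra) (rule R.is_cring)
  obtain n :: nat and e0 y0 where e0: "\<And>k. k < n \<Longrightarrow> e0 k \<in> carrier A" and y0: "\<And>k. k < n \<Longrightarrow> y0 k \<in> carrier A"
    and ex: "\<And>x. x \<in> carrier A \<Longrightarrow> x = (\<Oplus>\<^bsub>A\<^esub>k\<in>{..<n}. T ?R (tensor R A ?R x \<one>\<^bsub>R\<^esub>) (tensor R A ?R (y0 k) \<one>\<^bsub>R\<^esub>) \<odot>\<^bsub>A\<^esub> e0 k)"
    and c0: "\<And>x k. x \<in> carrier A \<Longrightarrow> k < n \<Longrightarrow> T ?R (tensor R A ?R x \<one>\<^bsub>R\<^esub>) (tensor R A ?R (y0 k) \<one>\<^bsub>R\<^esub>) \<in> carrier R"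
    by (rule dual_basis_base) (rule that; assumption)
  define ee where "ee S k = tensor R A S (e0 k) \<one>\<^bsub>S\<^esub>" for S k
  define yy where "yy S k = tensor R A S (y0 k) \<one>\<^bsub>S\<^esub>" for S k
  have one: "\<one>\<^bsub>S\<^esub> \<in> carrier S" if "algebra R S" for S :: "'u rring"
  proof -
    interpret S: cring S by (rule algebra.M_cring[OF that])
    show ?thesis by simp
  qed
  have ee: "ee S k \<in> carrier (AA S)" if "algebra R S" "k < n" for S k
    using e0 that by (simp add: ee_def one)
  have yy: "yy S k \<in> carrier (AA S)" if "algebra R S" "k < n" for S k
    using y0 that by (simp add: yy_def one)
  have tt: "tm S' \<phi> (tensor R A S x \<one>\<^bsub>S\<^esub>) = tensor R A S' x \<one>\<^bsub>S'\<^esub>"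
    if S: "algebra R S" and S': "algebra R S'" and \<phi>: "\<phi> \<in> rring_hom R S S'" and x: "x \<in> carrier A" for S S' \<phi> x
  proof -
    interpret phi: ring_hom_cring S S' \<phi> by (rule rring_hom_cring[OF S S' \<phi>])
    show ?thesis using tensor_map_tensor[OF S S' rring_hom_scalar_linear[OF \<phi>]] x by simp
  qed
  have main: "x = (\<Oplus>\<^bsub>AA S\<^esub>k\<in>{..<n}. T S x (yy S k) \<odot>\<^bsub>AA S\<^esub> ee S k)"
    if S: "algebra R S" and x: "x \<in> carrier (AA S)" for S x
    using S x
  proof (induction rule: base_change_induct)
    case (tensor x s)
    interpret S: algebra R S by fact
    interpret AS: module S "AA S" by (rule AA_module[OF S])
    let ?f = "\<lambda>k. T ?R (tensor R A ?R x \<one>\<^bsub>R\<^esub>) (tensor R A ?R (y0 k) \<one>\<^bsub>R\<^esub>)"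
    note [simp] = c0[OF tensor(1)]
    \<comment> \<open>The coordinates of x \<otimes> s are those of x multiplied by s: the trace
      commutes with the structure map from R to S.\<close>
    have f: "T S (tensor R A S x s) (yy S k) = ?f k \<odot>\<^bsub>S\<^esub> s" if k: "k < n" for k
    proof -
      have one_R: "\<one>\<^bsub>?R\<^esub> = \<one>\<^bsub>R\<^esub>" by (simp add: base_rring_def)
      have "tensor R A S x s = s \<odot>\<^bsub>AA S\<^esub> tensor R A S x \<one>\<^bsub>S\<^esub>"
        using tensor S by (simp add: smult_tensor)
      then have "T S (tensor R A S x s) (yy S k) = s \<otimes>\<^bsub>S\<^esub> T S (tensor R A S x \<one>\<^bsub>S\<^esub>) (yy S k)"
        using tensor S yy k by (simp add: T_smult_left)
      also have "T S (tensor R A S x \<one>\<^bsub>S\<^esub>) (yy S k) = ?f k \<odot>\<^bsub>S\<^esub> \<one>\<^bsub>S\<^esub>"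
        using T_map[OF R S base_rring_hom[OF S], of "tensor R A ?R x \<one>\<^bsub>R\<^esub>" "tensor R A ?R (y0 k) \<one>\<^bsub>R\<^esub>"]
          tt[OF R S base_rring_hom[OF S]] tensor(1) y0[OF k]
          tensor_closed[of _ "\<one>\<^bsub>R\<^esub>" ?R] by (simp add: yy_def one_R) (simp add: base_rring_def)
      also have "s \<otimes>\<^bsub>S\<^esub> (?f k \<odot>\<^bsub>S\<^esub> \<one>\<^bsub>S\<^esub>) = ?f k \<odot>\<^bsub>S\<^esub> s"
        using k tensor(2) by (simp add: S.m_comm[of s] S.smult_assoc2)
      finally show ?thesis .
    qed
    have "tensor R A S x s = tensor R A S (\<Oplus>\<^bsub>A\<^esub>k\<in>{..<n}. ?f k \<odot>\<^bsub>A\<^esub> e0 k) s"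
      using ex[OF tensor(1)] by simp
    also have "\<dots> = (\<Oplus>\<^bsub>AA S\<^esub>k\<in>{..<n}. tensor R A S (?f k \<odot>\<^bsub>A\<^esub> e0 k) s)"
      by (rule additive_finsum[where f = "\<lambda>x. tensor R A S x s"])
        (use tensor e0 S AS.abelian_group_axioms M.abelian_group_axioms in \<open>auto simp: tensor_add_left\<close>)
    also have "\<dots> = (\<Oplus>\<^bsub>AA S\<^esub>k\<in>{..<n}. T S (tensor R A S x s) (yy S k) \<odot>\<^bsub>AA S\<^esub> ee S k)"
    proof (rule AS.finsum_cong')
      fix k assume "k \<in> {..<n}"
      then have k: "k < n" by simp
      show "tensor R A S (?f k \<odot>\<^bsub>A\<^esub> e0 k) s = T S (tensor R A S x s) (yy S k) \<odot>\<^bsub>AA S\<^esub> ee S k"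
        using k tensor e0[OF k] S by (simp add: f ee_def smult_tensor tensor_smult_left)
    qed (use tensor S yy ee in auto)
    finally show ?case .
  next
    case (add x y)
    interpret S: algebra R S by fact
    interpret AS: module S "AA S" by (rule AA_module[OF S])
    have "(\<Oplus>\<^bsub>AA S\<^esub>k\<in>{..<n}. T S (x \<oplus>\<^bsub>AA S\<^esub> y) (yy S k) \<odot>\<^bsub>AA S\<^esub> ee S k) =
      (\<Oplus>\<^bsub>AA S\<^esub>k\<in>{..<n}. T S x (yy S k) \<odot>\<^bsub>AA S\<^esub> ee S k \<oplus>\<^bsub>AA S\<^esub> T S y (yy S k) \<odot>\<^bsub>AA S\<^esub> ee S k)"
      by (rule AS.finsum_cong') (use add(1,2) S yy ee in \<open>auto simp: T_add_left AS.smult_l_distr\<close>)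
    also have "\<dots> = (\<Oplus>\<^bsub>AA S\<^esub>k\<in>{..<n}. T S x (yy S k) \<odot>\<^bsub>AA S\<^esub> ee S k) \<oplus>\<^bsub>AA S\<^esub> (\<Oplus>\<^bsub>AA S\<^esub>k\<in>{..<n}. T S y (yy S k) \<odot>\<^bsub>AA S\<^esub> ee S k)"
      by (rule AS.finsum_addf) (use add(1,2) S yy ee in auto)
    finally show ?case using add(3,4) by simp
  qed
  show thesis
    by (rule that[of n ee yy]) (use ee yy e0 y0 in \<open>auto simp: ee_def[abs_def] yy_def[abs_def] tt\<close>, 
        use main in \<open>auto simp: ee_def[abs_def] yy_def[abs_def]\<close>)
qed

text \<open>The coordinates in the dual basis are values of T, so non-degeneracy survives every
  scalar extension.\<close>

lemma T_eqI:
  assumes S: "algebra R S" and x: "x \<in> carrier (AA S)" and x': "x' \<in> carrier (AA S)"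
    and eq: "\<And>y. y \<in> carrier (AA S) \<Longrightarrow> T S x y = T S x' y"
  shows "x = x'"
proof -
  interpret AS: module S "AA S" by (rule AA_module[OF S])
  obtain n :: nat and ee yy where ee: "\<And>S k. algebra R S \<Longrightarrow> k < n \<Longrightarrow> ee S k \<in> carrier (AA S)"
    and yy: "\<And>S k. algebra R S \<Longrightarrow> k < n \<Longrightarrow> yy S k \<in> carrier (AA S)"
    and ex: "\<And>S x. algebra R S \<Longrightarrow> x \<in> carrier (AA S) \<Longrightarrow>
       x = (\<Oplus>\<^bsub>AA S\<^esub>k\<in>{..<n}. T S x (yy S k) \<odot>\<^bsub>AA S\<^esub> ee S k)"
    by (rule dual_basis) (rule that; assumption)
  have "(\<Oplus>\<^bsub>AA S\<^esub>k\<in>{..<n}. T S x (yy S k) \<odot>\<^bsub>AA S\<^esub> ee S k) = (\<Oplus>\<^bsub>AA S\<^esub>k\<in>{..<n}. T S x' (yy S k) \<odot>\<^bsub>AA S\<^esub> ee S k)"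
    by (rule AS.finsum_cong') (use S x x' ee yy eq in auto)
  then show ?thesis using ex[OF S x] ex[OF S x'] by simp
qed

lemma T_represents:
  assumes S: "algebra R S" and l: "\<And>x. x \<in> carrier (AA S) \<Longrightarrow> l x \<in> carrier S"
    and l_add: "\<And>x y. x \<in> carrier (AA S) \<Longrightarrow> y \<in> carrier (AA S) \<Longrightarrow> l (x \<oplus>\<^bsub>AA S\<^esub> y) = l x \<oplus>\<^bsub>S\<^esub> l y"
    and l_smult: "\<And>s x. s \<in> carrier S \<Longrightarrow> x \<in> carrier (AA S) \<Longrightarrow> l (s \<odot>\<^bsub>AA S\<^esub> x) = s \<otimes>\<^bsub>S\<^esub> l x"
  shows "\<exists>y\<in>carrier (AA S). \<forall>x\<in>carrier (AA S). T S x y = l x"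
proof -
  interpret S: cring S by (rule algebra.M_cring[OF S])
  interpret AS: module S "AA S" by (rule AA_module[OF S])
  obtain n :: nat and ee yy where ee: "\<And>S k. algebra R S \<Longrightarrow> k < n \<Longrightarrow> ee S k \<in> carrier (AA S)"
    and yy: "\<And>S k. algebra R S \<Longrightarrow> k < n \<Longrightarrow> yy S k \<in> carrier (AA S)"
    and ex: "\<And>S x. algebra R S \<Longrightarrow> x \<in> carrier (AA S) \<Longrightarrow>
       x = (\<Oplus>\<^bsub>AA S\<^esub>k\<in>{..<n}. T S x (yy S k) \<odot>\<^bsub>AA S\<^esub> ee S k)"
    by (rule dual_basis) (rule that; assumption)
  \<comment> \<open>If x is the sum of T(x, y_k) e_k, then l(x) is the sum of T(x, y_k) l(e_k),
    which is T(x, _) at the sum of l(e_k) y_k.\<close>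
  let ?y = "\<Oplus>\<^bsub>AA S\<^esub>k\<in>{..<n}. l (ee S k) \<odot>\<^bsub>AA S\<^esub> yy S k"
  have y: "?y \<in> carrier (AA S)" using S l ee yy by (intro AS.finsum_closed) auto
  have "T S x ?y = l x" if x: "x \<in> carrier (AA S)" for x
  proof -
    have "T S x ?y = (\<Oplus>\<^bsub>S\<^esub>k\<in>{..<n}. T S x (l (ee S k) \<odot>\<^bsub>AA S\<^esub> yy S k))"
      by (rule additive_finsum[where f = "T S x"])
        (use x S l ee yy AS.abelian_group_axioms S.abelian_group_axioms in \<open>auto simp: T_add_right\<close>)
    also have "\<dots> = (\<Oplus>\<^bsub>S\<^esub>k\<in>{..<n}. l (T S x (yy S k) \<odot>\<^bsub>AA S\<^esub> ee S k))"
      by (rule S.finsum_cong') (use x S l ee yy in \<open>auto simp: T_smult_right l_smult S.m_comm\<close>)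
    also have "\<dots> = l (\<Oplus>\<^bsub>AA S\<^esub>k\<in>{..<n}. T S x (yy S k) \<odot>\<^bsub>AA S\<^esub> ee S k)"
      by (rule additive_finsum[where f = l, symmetric])
        (use x S l l_add ee yy AS.abelian_group_axioms S.abelian_group_axioms in auto)
    also have "\<dots> = l x" using ex[OF S x] by simp
    finally show ?thesis .
  qed
  then show ?thesis using y by blast
qed

text \<open>The dual basis gives the extension by the formula g(x) = sum of T(x, y_k) f(e_k). The
  target is an arbitrary S'-module, because maps from A into the Brown algebra are extended in the
  same way.\<close>

lemma extend_semilinear:
  assumes S: "algebra R S" and S': "algebra R S'" and \<phi>: "\<phi> \<in> rring_hom R S S'" and M': "module S' M'"
    and f: "\<And>x. x \<in> carrier (AA S) \<Longrightarrow> f x \<in> carrier M'"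
    and f_add: "\<And>x y. x \<in> carrier (AA S) \<Longrightarrow> y \<in> carrier (AA S) \<Longrightarrow> f (x \<oplus>\<^bsub>AA S\<^esub> y) = f x \<oplus>\<^bsub>M'\<^esub> f y"
    and f_smult: "\<And>s x. s \<in> carrier S \<Longrightarrow> x \<in> carrier (AA S) \<Longrightarrow> f (s \<odot>\<^bsub>AA S\<^esub> x) = \<phi> s \<odot>\<^bsub>M'\<^esub> f x"
  shows "\<exists>g\<in>linear_maps S' (AA S') M'. \<forall>x\<in>carrier (AA S). g (tm S' \<phi> x) = f x"
proof -
  interpret S: cring S by (rule algebra.M_cring[OF S])
  interpret S': cring S' by (rule algebra.M_cring[OF S'])
  interpret AS: module S "AA S" by (rule AA_module[OF S])
  interpret AS': module S' "AA S'" by (rule AA_module[OF S'])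
  interpret M': module S' M' by fact
  obtain n :: nat and ee yy where ee: "\<And>S k. algebra R S \<Longrightarrow> k < n \<Longrightarrow> ee S k \<in> carrier (AA S)"
    and yy: "\<And>S k. algebra R S \<Longrightarrow> k < n \<Longrightarrow> yy S k \<in> carrier (AA S)"
    and yy_map: "\<And>S S' \<phi> k. algebra R S \<Longrightarrow> algebra R S' \<Longrightarrow> \<phi> \<in> rring_hom R S S' \<Longrightarrow> k < n \<Longrightarrow> tm S' \<phi> (yy S k) = yy S' k"
    and ex: "\<And>S x. algebra R S \<Longrightarrow> x \<in> carrier (AA S) \<Longrightarrow>
       x = (\<Oplus>\<^bsub>AA S\<^esub>k\<in>{..<n}. T S x (yy S k) \<odot>\<^bsub>AA S\<^esub> ee S k)"
    by (rule dual_basis) (rule that; assumption)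
  let ?g = "\<lambda>x. \<Oplus>\<^bsub>M'\<^esub>k\<in>{..<n}. T S' x (yy S' k) \<odot>\<^bsub>M'\<^esub> f (ee S k)"
  note [simp] = ee[OF S] yy[OF S] yy[OF S'] T_closed[OF S] T_closed[OF S'] f
  have closed: "?g x \<in> carrier M'" if "x \<in> carrier (AA S')" for x
    using that by (intro M'.finsum_closed) auto
  have add: "?g (x \<oplus>\<^bsub>AA S'\<^esub> y) = ?g x \<oplus>\<^bsub>M'\<^esub> ?g y" if "x \<in> carrier (AA S')" "y \<in> carrier (AA S')" for x y
  proof -
    have "?g (x \<oplus>\<^bsub>AA S'\<^esub> y) = (\<Oplus>\<^bsub>M'\<^esub>k\<in>{..<n}. T S' x (yy S' k) \<odot>\<^bsub>M'\<^esub> f (ee S k) \<oplus>\<^bsub>M'\<^esub> T S' y (yy S' k) \<odot>\<^bsub>M'\<^esub> f (ee S k))"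
      by (rule M'.finsum_cong') (use that in \<open>auto simp: T_add_left[OF S'] M'.smult_l_distr\<close>)
    also have "\<dots> = ?g x \<oplus>\<^bsub>M'\<^esub> ?g y"
      by (rule M'.finsum_addf) (use that in auto)
    finally show ?thesis .
  qed
  have smult: "?g (s \<odot>\<^bsub>AA S'\<^esub> x) = s \<odot>\<^bsub>M'\<^esub> ?g x" if "s \<in> carrier S'" "x \<in> carrier (AA S')" for s x
  proof -
    have "?g (s \<odot>\<^bsub>AA S'\<^esub> x) = (\<Oplus>\<^bsub>M'\<^esub>k\<in>{..<n}. s \<odot>\<^bsub>M'\<^esub> (T S' x (yy S' k) \<odot>\<^bsub>M'\<^esub> f (ee S k)))"
      by (rule M'.finsum_cong') (use that in \<open>auto simp: T_smult_left[OF S'] M'.smult_assoc1\<close>)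
    also have "\<dots> = s \<odot>\<^bsub>M'\<^esub> ?g x"
      by (rule additive_finsum[where f = "\<lambda>x. s \<odot>\<^bsub>M'\<^esub> x", symmetric])
        (use that M'.abelian_group_axioms in \<open>auto simp: M'.smult_r_distr\<close>)
    finally show ?thesis .
  qed
  have ext: "?g (tm S' \<phi> x) = f x" if x: "x \<in> carrier (AA S)" for x
  proof -
    have "?g (tm S' \<phi> x) = (\<Oplus>\<^bsub>M'\<^esub>k\<in>{..<n}. f (T S x (yy S k) \<odot>\<^bsub>AA S\<^esub> ee S k))"
    proof (rule M'.finsum_cong')
      fix k assume k: "k \<in> {..<n}"
      then show "T S' (tm S' \<phi> x) (yy S' k) \<odot>\<^bsub>M'\<^esub> f (ee S k) = f (T S x (yy S k) \<odot>\<^bsub>AA S\<^esub> ee S k)"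
        using T_map[OF S S' \<phi> x, of "yy S k"] x by (simp add: f_smult yy_map[OF S S' \<phi>])
    qed (use x in auto)
    also have "\<dots> = f (\<Oplus>\<^bsub>AA S\<^esub>k\<in>{..<n}. T S x (yy S k) \<odot>\<^bsub>AA S\<^esub> ee S k)"
      by (rule additive_finsum[where f = f, symmetric])
        (use x f_add AS.abelian_group_axioms M'.abelian_group_axioms in auto)
    also have "\<dots> = f x" using ex[OF S x] by simp
    finally show ?thesis .
  qed
  have "restrict ?g (carrier (AA S')) \<in> linear_maps S' (AA S') M'"
    using closed add smult by (auto simp: linear_maps_def)
  then show ?thesis
    using ext tm_closed[OF S S' \<phi>] by (intro bexI[of _ "restrict ?g (carrier (AA S'))"]) auto
qed

text \<open>The coordinates of \<open>e\<close> are values of \<open>T(e, _)\<close>, and \<open>N(e) = 1\<close> lies in the ideal they generate.\<close>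

lemma e_unimodular:
  assumes S: "algebra R S"
  shows "\<exists>w\<in>carrier (AA S). T S (e S) w = \<one>\<^bsub>S\<^esub>"
proof -
  interpret S: cring S by (rule algebra.M_cring[OF S])
  interpret AS: module S "AA S" by (rule AA_module[OF S])
  obtain n :: nat and ee yy where ee: "\<And>S k. algebra R S \<Longrightarrow> k < n \<Longrightarrow> ee S k \<in> carrier (AA S)"
    and yy: "\<And>S k. algebra R S \<Longrightarrow> k < n \<Longrightarrow> yy S k \<in> carrier (AA S)"
    and ex: "\<And>S x. algebra R S \<Longrightarrow> x \<in> carrier (AA S) \<Longrightarrow>
       x = (\<Oplus>\<^bsub>AA S\<^esub>k\<in>{..<n}. T S x (yy S k) \<odot>\<^bsub>AA S\<^esub> ee S k)"
    by (rule dual_basis) (rule that; assumption)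
  note [simp] = ee[OF S] yy[OF S] T_closed[OF S] N_closed[OF S] D_closed[OF S] e_closed[OF S]
  \<comment> \<open>The values T(e, _) form an ideal containing all coordinates of e. Partial sums
    of e are used so that each step is a combination of two vectors, to which \<open>N_comb\<close>
    applies.\<close>
  have "\<exists>w\<in>carrier (AA S). N S (\<Oplus>\<^bsub>AA S\<^esub>k\<in>{..<m}. T S (e S) (yy S k) \<odot>\<^bsub>AA S\<^esub> ee S k) = T S (e S) w" if "m \<le> n" for m
    using that
  proof (induction m)
    case 0
    have "N S \<zero>\<^bsub>AA S\<^esub> = \<zero>\<^bsub>S\<^esub>"
      using N_smult[OF S, of "e S" "\<zero>\<^bsub>S\<^esub>"] by simp
    moreover have "T S (e S) \<zero>\<^bsub>AA S\<^esub> = \<zero>\<^bsub>S\<^esub>"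
      using T_smult_right[OF S, of "e S" "\<zero>\<^bsub>S\<^esub>" "e S"] by simp
    ultimately show ?case by (intro bexI[of _ "\<zero>\<^bsub>AA S\<^esub>"]) simp_all
  next
    case (Suc m)
    let ?u = "\<Oplus>\<^bsub>AA S\<^esub>k\<in>{..<m}. T S (e S) (yy S k) \<odot>\<^bsub>AA S\<^esub> ee S k"
    let ?c = "T S (e S) (yy S m)"
    have u: "?u \<in> carrier (AA S)" using Suc.prems by (intro AS.finsum_closed) auto
    have m: "ee S m \<in> carrier (AA S)" "yy S m \<in> carrier (AA S)" using Suc.prems by simp_all
    obtain w where w: "w \<in> carrier (AA S)" "N S ?u = T S (e S) w" using Suc by auto
    \<comment> \<open>The cofactor of c in N(u + c e_m) - N(u), read off from the cubic
      expansion.\<close>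
    let ?d = "D S ?u (ee S m) \<oplus>\<^bsub>S\<^esub> ?c \<otimes>\<^bsub>S\<^esub> D S (ee S m) ?u \<oplus>\<^bsub>S\<^esub> ?c \<otimes>\<^bsub>S\<^esub> ?c \<otimes>\<^bsub>S\<^esub> N S (ee S m)"
    have d: "?d \<in> carrier S" using u m by simp
    have f: "(\<lambda>k. T S (e S) (yy S k) \<odot>\<^bsub>AA S\<^esub> ee S k) \<in> {..<m} \<rightarrow> carrier (AA S)"
      using Suc.prems by auto
    have sum: "(\<Oplus>\<^bsub>AA S\<^esub>k\<in>{..<Suc m}. T S (e S) (yy S k) \<odot>\<^bsub>AA S\<^esub> ee S k) = \<one>\<^bsub>S\<^esub> \<odot>\<^bsub>AA S\<^esub> ?u \<oplus>\<^bsub>AA S\<^esub> ?c \<odot>\<^bsub>AA S\<^esub> ee S m"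
      using u m f by (simp add: lessThan_Suc AS.a_comm)
    have "N S (\<one>\<^bsub>S\<^esub> \<odot>\<^bsub>AA S\<^esub> ?u \<oplus>\<^bsub>AA S\<^esub> ?c \<odot>\<^bsub>AA S\<^esub> ee S m) = cubic_poly S \<one>\<^bsub>S\<^esub> ?c (N S ?u) (D S ?u (ee S m)) (D S (ee S m) ?u) (N S (ee S m))"
      by (rule N_comb[OF S u m(1)]) (use m in simp_all)
    also have "\<dots> = T S (e S) (w \<oplus>\<^bsub>AA S\<^esub> ?d \<odot>\<^bsub>AA S\<^esub> yy S m)"
      using u m w d by (simp add: T_add_right[OF S] T_smult_right[OF S] S.l_distr S.r_distr S.a_ac S.m_ac)
    finally show ?case unfolding sum using w d m by (intro bexI[of _ "w \<oplus>\<^bsub>AA S\<^esub> ?d \<odot>\<^bsub>AA S\<^esub> yy S m"]) simp_all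
  qed
  from this[of n] show ?thesis
    using ex[OF S e_closed[OF S]] N_e[OF S] by auto
qed

lemma TL_add_first:
  assumes S: "algebra R S" and "x \<in> carrier (AA S)" "x' \<in> carrier (AA S)" "y \<in> carrier (AA S)" "z \<in> carrier (AA S)"
  shows "TL S (x \<oplus>\<^bsub>AA S\<^esub> x') y z = TL S x y z \<oplus>\<^bsub>S\<^esub> TL S x' y z"
proof -
  interpret AS: module S "AA S" by (rule AA_module[OF S])
  show ?thesis using assms by (simp add: TL_swap_left[OF S, of _ y] TL_add_mid)
qed

lemma TL_smult_first:
  assumes S: "algebra R S" and "x \<in> carrier (AA S)" "s \<in> carrier S" "y \<in> carrier (AA S)" "z \<in> carrier (AA S)"
  shows "TL S (s \<odot>\<^bsub>AA S\<^esub> x) y z = s \<otimes>\<^bsub>S\<^esub> TL S x y z"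
proof -
  interpret AS: module S "AA S" by (rule AA_module[OF S])
  show ?thesis using assms by (simp add: TL_swap_left[OF S, of _ y] TL_smult_mid)
qed

text \<open>The axioms make the adjoint homogeneous of degree 2 and natural, but bilinearity of its
  polarization is not among them. It is tested against T, where \<open>T_X\<close> turns it into
  linearity of the trilinear form.\<close>

lemma X_add_left:
  assumes S: "algebra R S" and "x \<in> carrier (AA S)" "x' \<in> carrier (AA S)" "y \<in> carrier (AA S)"
  shows "X S (x \<oplus>\<^bsub>AA S\<^esub> x') y = X S x y \<oplus>\<^bsub>AA S\<^esub> X S x' y"
proof -
  interpret AS: module S "AA S" by (rule AA_module[OF S])
  show ?thesis
    by (rule T_eqI[OF S]) (use assms in \<open>simp_all add: T_X T_add_left TL_add_first\<close>)
qed

lemma X_smult_left: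
  assumes S: "algebra R S" and "x \<in> carrier (AA S)" "s \<in> carrier S" "y \<in> carrier (AA S)"
  shows "X S (s \<odot>\<^bsub>AA S\<^esub> x) y = s \<odot>\<^bsub>AA S\<^esub> X S x y"
proof -
  interpret AS: module S "AA S" by (rule AA_module[OF S])
  show ?thesis
    by (rule T_eqI[OF S]) (use assms in \<open>simp_all add: T_X T_smult_left TL_smult_first\<close>)
qed

lemma X_add_right:
  assumes S: "algebra R S" and "x \<in> carrier (AA S)" "y \<in> carrier (AA S)" "y' \<in> carrier (AA S)"
  shows "X S x (y \<oplus>\<^bsub>AA S\<^esub> y') = X S x y \<oplus>\<^bsub>AA S\<^esub> X S x y'"
proof -
  interpret AS: module S "AA S" by (rule AA_module[OF S])
  show ?thesis using assms by (simp add: X_comm[OF S, of x] X_add_left)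
qed

lemma X_smult_right:
  assumes S: "algebra R S" and "x \<in> carrier (AA S)" "s \<in> carrier S" "y \<in> carrier (AA S)"
  shows "X S x (s \<odot>\<^bsub>AA S\<^esub> y) = s \<odot>\<^bsub>AA S\<^esub> X S x y"
proof -
  interpret AS: module S "AA S" by (rule AA_module[OF S])
  show ?thesis using assms by (simp add: X_comm[OF S, of x] X_smult_left)
qed

end

section \<open>Group functors of linear automorphisms\<close>

lemma linear_maps_closed: "f \<in> linear_maps S M M' \<Longrightarrow> x \<in> carrier M \<Longrightarrow> f x \<in> carrier M'"
  by (auto simp: linear_maps_def)

lemma linear_maps_add: "f \<in> linear_maps S M M' \<Longrightarrow> x \<in> carrier M \<Longrightarrow> y \<in> carrier M \<Longrightarrow>
    f (x \<oplus>\<^bsub>M\<^esub> y) = f x \<oplus>\<^bsub>M'\<^esub> f y"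
  by (simp add: linear_maps_def)

lemma linear_maps_smult: "f \<in> linear_maps S M M' \<Longrightarrow> s \<in> carrier S \<Longrightarrow> x \<in> carrier M \<Longrightarrow>
    f (s \<odot>\<^bsub>M\<^esub> x) = s \<odot>\<^bsub>M'\<^esub> f x"
  by (simp add: linear_maps_def)

lemma linear_maps_extensional: "f \<in> linear_maps S M M' \<Longrightarrow> f \<in> extensional (carrier M)"
  by (auto simp: linear_maps_def PiE_def)

lemma linear_mapsI:
  assumes "f \<in> extensional (carrier M)" "\<And>x. x \<in> carrier M \<Longrightarrow> f x \<in> carrier M'"
    "\<And>x y. x \<in> carrier M \<Longrightarrow> y \<in> carrier M \<Longrightarrow> f (x \<oplus>\<^bsub>M\<^esub> y) = f x \<oplus>\<^bsub>M'\<^esub> f y"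
    "\<And>s x. s \<in> carrier S \<Longrightarrow> x \<in> carrier M \<Longrightarrow> f (s \<odot>\<^bsub>M\<^esub> x) = s \<odot>\<^bsub>M'\<^esub> f x"
  shows "f \<in> linear_maps S M M'"
  using assms by (auto simp: linear_maps_def PiE_def)

lemma linear_maps_compose:
  assumes "f \<in> linear_maps S M' M''" "g \<in> linear_maps S M M'" "module S M"
  shows "compose (carrier M) f g \<in> linear_maps S M M''"
proof -
  interpret module S M by fact
  show ?thesis
    using assms(1,2)
    by (intro linear_mapsI) (auto simp: compose_def linear_maps_closed linear_maps_add linear_maps_smult)
qed

lemma linear_maps_ident: "module S M \<Longrightarrow> (\<lambda>x\<in>carrier M. x) \<in> linear_maps S M M"
proof -
  assume "module S M"
  then interpret module S M .
  show ?thesis by (intro linear_mapsI) auto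
qed

lemma general_linear_linear: "f \<in> general_linear S M \<Longrightarrow> f \<in> linear_maps S M M"
  and general_linear_Bij: "f \<in> general_linear S M \<Longrightarrow> f \<in> Bij (carrier M)"
  by (simp_all add: general_linear_def)

lemma general_linearI:
  assumes f: "f \<in> linear_maps S M M" and g: "g \<in> linear_maps S M M"
    and fg: "\<And>x. x \<in> carrier M \<Longrightarrow> f (g x) = x" and gf: "\<And>x. x \<in> carrier M \<Longrightarrow> g (f x) = x"
  shows "f \<in> general_linear S M"
proof -
  have "bij_betw f (carrier M) (carrier M)"
    by (rule bij_betwI[of _ _ _ g]) (use assms in \<open>auto simp: linear_maps_closed\<close>)
  then show ?thesis
    using f by (simp add: general_linear_def Bij_def linear_maps_extensional)
qed

text \<open>Restricted to the carrier because members of \<open>Bij\<close> and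
  \<open>linear_maps\<close> are extensional; it is then the inverse in
  \<open>BijGroup\<close>.\<close>

abbreviation inverse_map :: "('u, 'a, 'n) module_scheme \<Rightarrow> ('a \<Rightarrow> 'a) \<Rightarrow> 'a \<Rightarrow> 'a" where
  "inverse_map M f \<equiv> \<lambda>x\<in>carrier M. inv_into (carrier M) f x"

lemma general_linear_inverse_map:
  assumes f: "f \<in> general_linear S M" and M: "module S M"
  shows "inverse_map M f \<in> general_linear S M"
    and "\<And>x. x \<in> carrier M \<Longrightarrow> f (inverse_map M f x) = x"
    and "\<And>x. x \<in> carrier M \<Longrightarrow> inverse_map M f (f x) = x"
proof -
  interpret module S M by fact
  note lin = general_linear_linear[OF f]
  have bij: "bij_betw f (carrier M) (carrier M)"
    using f by (simp add: general_linear_def Bij_def)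
  show a: "\<And>x. x \<in> carrier M \<Longrightarrow> f (inverse_map M f x) = x"
    using bij by (simp add: bij_betw_inv_into_right)
  show b: "\<And>x. x \<in> carrier M \<Longrightarrow> inverse_map M f (f x) = x"
    using bij lin by (simp add: bij_betw_inv_into_left linear_maps_closed)
  have c: "inverse_map M f x \<in> carrier M" if "x \<in> carrier M" for x
    using bij that bij_betw_apply[OF bij_betw_inv_into[OF bij]] by simp
  have l: "inverse_map M f \<in> linear_maps S M M"
  proof (rule linear_mapsI)
    fix x y assume xy: "x \<in> carrier M" "y \<in> carrier M"
    have "inverse_map M f (x \<oplus>\<^bsub>M\<^esub> y) = inverse_map M f (f (inverse_map M f x \<oplus>\<^bsub>M\<^esub> inverse_map M f y))"
      using xy by (simp only: linear_maps_add[OF lin] c a)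
    also have "\<dots> = inverse_map M f x \<oplus>\<^bsub>M\<^esub> inverse_map M f y"
      by (rule b) (use xy c in blast)
    finally show "inverse_map M f (x \<oplus>\<^bsub>M\<^esub> y) = inverse_map M f x \<oplus>\<^bsub>M\<^esub> inverse_map M f y" .
  next
    fix s x assume sx: "s \<in> carrier S" "x \<in> carrier M"
    have "inverse_map M f (s \<odot>\<^bsub>M\<^esub> x) = inverse_map M f (f (s \<odot>\<^bsub>M\<^esub> inverse_map M f x))"
      using sx by (simp only: linear_maps_smult[OF lin] c a)
    also have "\<dots> = s \<odot>\<^bsub>M\<^esub> inverse_map M f x"
      by (rule b) (use sx c in blast)
    finally show "inverse_map M f (s \<odot>\<^bsub>M\<^esub> x) = s \<odot>\<^bsub>M\<^esub> inverse_map M f x" .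
  qed (use c in auto)
  show "inverse_map M f \<in> general_linear S M"
    by (rule general_linearI[OF l lin b a])
qed

lemma general_linear_compose:
  assumes "f \<in> general_linear S M" "g \<in> general_linear S M" "module S M"
  shows "compose (carrier M) f g \<in> general_linear S M"
  using assms linear_maps_compose compose_Bij unfolding general_linear_def by blast

lemma general_linear_ident: "module S M \<Longrightarrow> (\<lambda>x\<in>carrier M. x) \<in> general_linear S M"
  using linear_maps_ident id_Bij by (auto simp: general_linear_def)

lemma BijGroup_subset_group:
  assumes H: "H \<subseteq> Bij X" and one: "(\<lambda>x\<in>X. x) \<in> H"
    and mult: "\<And>f g. f \<in> H \<Longrightarrow> g \<in> H \<Longrightarrow> compose X f g \<in> H"
    and inv: "\<And>f. f \<in> H \<Longrightarrow> (\<lambda>x\<in>X. inv_into X f x) \<in> H"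
  shows "group (BijGroup X\<lparr>carrier := H\<rparr>)"
proof -
  interpret group "BijGroup X" by (rule group_BijGroup)
  have "subgroup H (BijGroup X)"
  proof (rule subgroupI)
    show "H \<subseteq> carrier (BijGroup X)" using H by (simp add: BijGroup_def)
    show "H \<noteq> {}" using one by auto
    show "inv\<^bsub>BijGroup X\<^esub> f \<in> H" if "f \<in> H" for f
      using inv[OF that] H that by (simp add: inv_BijGroup subset_iff)
    show "f \<otimes>\<^bsub>BijGroup X\<^esub> g \<in> H" if "f \<in> H" "g \<in> H" for f g
      using mult[OF that] H that by (simp add: BijGroup_def subset_iff)
  qed
  then show ?thesis by (rule subgroup_imp_group)
qed

text \<open>A module \<open>M S\<close> for every \<open>S\<close>, such that \<open>I S' \<phi> : M S \<rightarrow> M S'\<close> exhibits \<open>M S'\<close> as a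
  scalar extension of \<open>M S\<close>.\<close>

locale scalar_family =
  fixes R :: "('u, 'm) ring_scheme" and M :: "'u rring \<Rightarrow> ('u, 'b) module"
    and I :: "'u rring \<Rightarrow> ('u \<Rightarrow> 'u) \<Rightarrow> 'b \<Rightarrow> 'b"
  assumes M_module: "\<And>S. algebra R S \<Longrightarrow> module S (M S)"
    and I_closed: "\<And>S S' \<phi> x. algebra R S \<Longrightarrow> algebra R S' \<Longrightarrow> \<phi> \<in> rring_hom R S S' \<Longrightarrow> x \<in> carrier (M S) \<Longrightarrow>
      I S' \<phi> x \<in> carrier (M S')"
    and I_id: "\<And>S x. algebra R S \<Longrightarrow> x \<in> carrier (M S) \<Longrightarrow> I S (\<lambda>s. s) x = x"
    and I_comp: "\<And>S S' S'' \<phi> \<psi> x. algebra R S \<Longrightarrow> algebra R S' \<Longrightarrow> algebra R S'' \<Longrightarrow> \<phi> \<in> rring_hom R S S' \<Longrightarrow>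
      \<psi> \<in> rring_hom R S' S'' \<Longrightarrow> x \<in> carrier (M S) \<Longrightarrow> I S'' \<psi> (I S' \<phi> x) = I S'' (\<lambda>s. \<psi> (\<phi> s)) x"
    and span_induct: "\<And>S S' \<phi> x P. algebra R S \<Longrightarrow> algebra R S' \<Longrightarrow> \<phi> \<in> rring_hom R S S' \<Longrightarrow> x \<in> carrier (M S') \<Longrightarrow>
      (\<And>x. x \<in> carrier (M S) \<Longrightarrow> P (I S' \<phi> x)) \<Longrightarrow>
      (\<And>x y. x \<in> carrier (M S') \<Longrightarrow> y \<in> carrier (M S') \<Longrightarrow> P x \<Longrightarrow> P y \<Longrightarrow> P (x \<oplus>\<^bsub>M S'\<^esub> y)) \<Longrightarrow>
      (\<And>s x. s \<in> carrier S' \<Longrightarrow> x \<in> carrier (M S') \<Longrightarrow> P x \<Longrightarrow> P (s \<odot>\<^bsub>M S'\<^esub> x)) \<Longrightarrow> P x"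
    and extension_exists: "\<And>S S' \<phi> f. algebra R S \<Longrightarrow> algebra R S' \<Longrightarrow> \<phi> \<in> rring_hom R S S' \<Longrightarrow>
      f \<in> linear_maps S (M S) (M S) \<Longrightarrow>
      \<exists>g\<in>linear_maps S' (M S') (M S'). \<forall>x\<in>carrier (M S). g (I S' \<phi> x) = I S' \<phi> (f x)"
begin

abbreviation "ext S S' \<phi> \<equiv> extend_endo S' (M S) (M S') (I S' \<phi>)"

text \<open>The image of \<open>M S\<close> spans \<open>M S'\<close>. This gives the uniqueness on
  which the description operator in \<open>extend_endo\<close> depends.\<close>

lemma linear_maps_eqI:
  assumes "algebra R S" "algebra R S'" "\<phi> \<in> rring_hom R S S'"
    and g: "g \<in> linear_maps S' (M S') M'" and h: "h \<in> linear_maps S' (M S') M'"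
    and eq: "\<And>x. x \<in> carrier (M S) \<Longrightarrow> g (I S' \<phi> x) = h (I S' \<phi> x)"
  shows "g = h"
proof (rule extensionalityI[OF linear_maps_extensional[OF g] linear_maps_extensional[OF h]])
  fix x assume "x \<in> carrier (M S')"
  with assms(1-3) show "g x = h x"
    by (rule span_induct)
      (simp_all add: eq linear_maps_add[OF g] linear_maps_add[OF h] linear_maps_smult[OF g] linear_maps_smult[OF h])
qed

lemma ext_eqI:
  assumes "algebra R S" "algebra R S'" "\<phi> \<in> rring_hom R S S'" "g \<in> linear_maps S' (M S') (M S')"
    "\<And>x. x \<in> carrier (M S) \<Longrightarrow> g (I S' \<phi> x) = I S' \<phi> (f x)"
  shows "ext S S' \<phi> f = g"
  unfolding extend_endo_def
  by (rule the_equality) (use assms in \<open>auto intro: linear_maps_eqI[OF assms(1-3)]\<close>)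

lemma ext_props:
  assumes "algebra R S" "algebra R S'" "\<phi> \<in> rring_hom R S S'" "f \<in> linear_maps S (M S) (M S)"
  shows ext_linear: "ext S S' \<phi> f \<in> linear_maps S' (M S') (M S')"
    and ext_apply: "\<And>x. x \<in> carrier (M S) \<Longrightarrow> ext S S' \<phi> f (I S' \<phi> x) = I S' \<phi> (f x)"
proof -
  obtain g where g: "g \<in> linear_maps S' (M S') (M S')" "\<And>x. x \<in> carrier (M S) \<Longrightarrow> g (I S' \<phi> x) = I S' \<phi> (f x)"
    using extension_exists[OF assms] by blast
  have "ext S S' \<phi> f = g" by (rule ext_eqI[OF assms(1-3) g])
  then show "ext S S' \<phi> f \<in> linear_maps S' (M S') (M S')"
    "\<And>x. x \<in> carrier (M S) \<Longrightarrow> ext S S' \<phi> f (I S' \<phi> x) = I S' \<phi> (f x)"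
    using g by auto
qed

lemma ext_compose:
  assumes h: "algebra R S" "algebra R S'" "\<phi> \<in> rring_hom R S S'"
    and f: "f \<in> linear_maps S (M S) (M S)" and g: "g \<in> linear_maps S (M S) (M S)"
  shows "ext S S' \<phi> (compose (carrier (M S)) f g) = compose (carrier (M S')) (ext S S' \<phi> f) (ext S S' \<phi> g)"
proof (rule ext_eqI[OF h])
  show "compose (carrier (M S')) (ext S S' \<phi> f) (ext S S' \<phi> g) \<in> linear_maps S' (M S') (M S')"
    using h f g by (intro linear_maps_compose[OF ext_linear ext_linear] M_module)
  show "compose (carrier (M S')) (ext S S' \<phi> f) (ext S S' \<phi> g) (I S' \<phi> x) = I S' \<phi> (compose (carrier (M S)) f g x)"
    if x: "x \<in> carrier (M S)" for x
    using x by (simp add: compose_def I_closed[OF h] ext_apply[OF h f] ext_apply[OF h g] linear_maps_closed[OF g])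
qed

lemma ext_ident:
  assumes h: "algebra R S" "algebra R S'" "\<phi> \<in> rring_hom R S S'"
  shows "ext S S' \<phi> (\<lambda>x\<in>carrier (M S). x) = (\<lambda>x\<in>carrier (M S'). x)"
  by (rule ext_eqI[OF h]) (use I_closed[OF h] linear_maps_ident M_module h in auto)

lemma ext_trans:
  assumes S: "algebra R S" and S': "algebra R S'" and S'': "algebra R S''" and \<phi>: "\<phi> \<in> rring_hom R S S'"
    and \<psi>: "\<psi> \<in> rring_hom R S' S''" and f: "f \<in> linear_maps S (M S) (M S)"
  shows "ext S S'' (\<lambda>s. \<psi> (\<phi> s)) f = ext S' S'' \<psi> (ext S S' \<phi> f)"
proof (rule ext_eqI[OF S S'' rring_hom_comp[OF \<phi> \<psi>]])
  have g: "ext S S' \<phi> f \<in> linear_maps S' (M S') (M S')" by (rule ext_linear[OF S S' \<phi> f])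
  then show "ext S' S'' \<psi> (ext S S' \<phi> f) \<in> linear_maps S'' (M S'') (M S'')"
    by (rule ext_linear[OF S' S'' \<psi>])
  show "ext S' S'' \<psi> (ext S S' \<phi> f) (I S'' (\<lambda>s. \<psi> (\<phi> s)) x) = I S'' (\<lambda>s. \<psi> (\<phi> s)) (f x)"
    if x: "x \<in> carrier (M S)" for x
    using x f by (simp add: I_closed[OF S S' \<phi>] ext_apply[OF S S' \<phi> f] ext_apply[OF S' S'' \<psi> g]
      linear_maps_closed[OF f] flip: I_comp[OF S S' S'' \<phi> \<psi>])
qed

lemma ext_id:
  assumes "algebra R S" "f \<in> linear_maps S (M S) (M S)"
  shows "ext S S (\<lambda>s. s) f = f"
  by (rule ext_eqI) (use assms I_id in \<open>auto simp: rring_hom_id linear_maps_closed\<close>)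

lemma ext_inverse:
  assumes h: "algebra R S" "algebra R S'" "\<phi> \<in> rring_hom R S S'" and f: "f \<in> general_linear S (M S)"
    and x: "x \<in> carrier (M S')"
  shows "ext S S' \<phi> f (ext S S' \<phi> (inverse_map (M S) f) x) = x"
    and "ext S S' \<phi> (inverse_map (M S) f) (ext S S' \<phi> f x) = x"
proof -
  note inv = general_linear_inverse_map[OF f M_module[OF h(1)]]
  note l = general_linear_linear[OF f] general_linear_linear[OF inv(1)]
  have "compose (carrier (M S)) f (inverse_map (M S) f) = (\<lambda>x\<in>carrier (M S). x)"
    using inv(2) by (auto simp: compose_def)
  then have "compose (carrier (M S')) (ext S S' \<phi> f) (ext S S' \<phi> (inverse_map (M S) f)) = (\<lambda>x\<in>carrier (M S'). x)"
    using ext_compose[OF h l] ext_ident[OF h] by simp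
  from fun_cong[OF this, of x] show "ext S S' \<phi> f (ext S S' \<phi> (inverse_map (M S) f) x) = x"
    using x by (simp add: compose_def)
  have "compose (carrier (M S)) (inverse_map (M S) f) f = (\<lambda>x\<in>carrier (M S). x)"
    using inv(3) by (auto simp: compose_def)
  then have "compose (carrier (M S')) (ext S S' \<phi> (inverse_map (M S) f)) (ext S S' \<phi> f) = (\<lambda>x\<in>carrier (M S'). x)"
    using ext_compose[OF h l(2,1)] ext_ident[OF h] by simp
  from fun_cong[OF this, of x] show "ext S S' \<phi> (inverse_map (M S) f) (ext S S' \<phi> f x) = x"
    using x by (simp add: compose_def)
qed

lemma ext_general_linear:
  assumes h: "algebra R S" "algebra R S'" "\<phi> \<in> rring_hom R S S'" and f: "f \<in> general_linear S (M S)"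
  shows "ext S S' \<phi> f \<in> general_linear S' (M S')"
proof (rule general_linearI[OF ext_linear[OF h general_linear_linear[OF f]]])
  show "ext S S' \<phi> (inverse_map (M S) f) \<in> linear_maps S' (M S') (M S')"
    by (rule ext_linear[OF h general_linear_linear[OF general_linear_inverse_map(1)[OF f M_module[OF h(1)]]]])
qed (use ext_inverse[OF h f] in auto)

text \<open>The common shape of \<open>Isom_norm\<close> and \<open>Aut_brown\<close>: the
  subfunctor of GL(M) cut out by a condition \<open>Q\<close>. The group functor laws are proved
  once for both.\<close>

definition linear_group_functor :: "('u rring \<Rightarrow> ('b \<Rightarrow> 'b) \<Rightarrow> bool) \<Rightarrow> ('u, 'b \<Rightarrow> 'b) group_functor" where
  "linear_group_functor Q = \<lparr>points = (\<lambda>S. BijGroup (carrier (M S))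
      \<lparr>carrier := {\<rho> \<in> general_linear S (M S). Q S \<rho>}\<rparr>), induced = ext\<rparr>"

lemma is_group_functor_linear:
  assumes one: "\<And>S. algebra R S \<Longrightarrow> Q S (\<lambda>x\<in>carrier (M S). x)"
    and mult: "\<And>S f g. algebra R S \<Longrightarrow> f \<in> general_linear S (M S) \<Longrightarrow> g \<in> general_linear S (M S) \<Longrightarrow>
      Q S f \<Longrightarrow> Q S g \<Longrightarrow> Q S (compose (carrier (M S)) f g)"
    and inv: "\<And>S f. algebra R S \<Longrightarrow> f \<in> general_linear S (M S) \<Longrightarrow> Q S f \<Longrightarrow> Q S (inverse_map (M S) f)"
    and ext: "\<And>S S' \<phi> f. algebra R S \<Longrightarrow> algebra R S' \<Longrightarrow> \<phi> \<in> rring_hom R S S' \<Longrightarrow> f \<in> general_linear S (M S) \<Longrightarrow>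
      Q S f \<Longrightarrow> Q S' (ext S S' \<phi> f)"
  shows "is_group_functor R (linear_group_functor Q)"
proof -
  have group: "group (points (linear_group_functor Q) S)" if S: "algebra R S" for S
    unfolding linear_group_functor_def group_functor.simps
  proof (rule BijGroup_subset_group)
    note M = M_module[OF S]
    show "{\<rho> \<in> general_linear S (M S). Q S \<rho>} \<subseteq> Bij (carrier (M S))"
      using general_linear_Bij by auto
    show "(\<lambda>x\<in>carrier (M S). x) \<in> {\<rho> \<in> general_linear S (M S). Q S \<rho>}"
      using one[OF S] general_linear_ident[OF M] by simp
    show "compose (carrier (M S)) f g \<in> {\<rho> \<in> general_linear S (M S). Q S \<rho>}"
      if "f \<in> {\<rho> \<in> general_linear S (M S). Q S \<rho>}" "g \<in> {\<rho> \<in> general_linear S (M S). Q S \<rho>}" for f g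
      using that mult[OF S] general_linear_compose[OF _ _ M] by simp
    show "inverse_map (M S) f \<in> {\<rho> \<in> general_linear S (M S). Q S \<rho>}"
      if "f \<in> {\<rho> \<in> general_linear S (M S). Q S \<rho>}" for f
      using that inv[OF S] general_linear_inverse_map(1)[OF _ M] by simp
  qed
  have hom: "ext S S' \<phi> \<in> hom (points (linear_group_functor Q) S) (points (linear_group_functor Q) S')"
    if h: "algebra R S" "algebra R S'" "\<phi> \<in> rring_hom R S S'" for S S' \<phi>
  proof (rule homI)
    fix f assume "f \<in> carrier (points (linear_group_functor Q) S)"
    then have f: "f \<in> general_linear S (M S)" "Q S f" by (simp_all add: linear_group_functor_def)
    show "ext S S' \<phi> f \<in> carrier (points (linear_group_functor Q) S')"
      using ext[OF h f] ext_general_linear[OF h f(1)] by (simp add: linear_group_functor_def)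
    fix g assume "g \<in> carrier (points (linear_group_functor Q) S)"
    then have g: "g \<in> general_linear S (M S)" by (simp add: linear_group_functor_def)
    have Bij: "f \<in> Bij (carrier (M S))" "g \<in> Bij (carrier (M S))"
      "ext S S' \<phi> f \<in> Bij (carrier (M S'))" "ext S S' \<phi> g \<in> Bij (carrier (M S'))"
      using general_linear_Bij[OF f(1)] general_linear_Bij[OF g]
        general_linear_Bij[OF ext_general_linear[OF h f(1)]] general_linear_Bij[OF ext_general_linear[OF h g]] by auto
    show "ext S S' \<phi> (f \<otimes>\<^bsub>points (linear_group_functor Q) S\<^esub> g) =
        ext S S' \<phi> f \<otimes>\<^bsub>points (linear_group_functor Q) S'\<^esub> ext S S' \<phi> g"
      using ext_compose[OF h general_linear_linear[OF f(1)] general_linear_linear[OF g]] Bij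
      by (simp add: linear_group_functor_def BijGroup_def)
  qed
  have lin: "f \<in> linear_maps S (M S) (M S)" if "f \<in> carrier (points (linear_group_functor Q) S)" for f S
    using that general_linear_linear by (auto simp: linear_group_functor_def)
  have ind: "induced (linear_group_functor Q) = ext" by (simp add: linear_group_functor_def)
  show ?thesis
    unfolding is_group_functor_def ind
    using group hom ext_id lin ext_trans[OF _ _ _ _ _ lin] by simp
qed

end

section \<open>The reduced Brown algebra\<close>

sublocale albert \<subseteq> FA: scalar_family R "\<lambda>S. base_change R A S" "\<lambda>S' \<phi>. tensor_map R A S' \<phi>"
proof (rule scalar_family.intro)
  fix S S' :: "'u rring" and \<phi> f
  assume S: "algebra R S" and S': "algebra R S'" and \<phi>: "\<phi> \<in> rring_hom R S S'"
    and f: "f \<in> linear_maps S (AA S) (AA S)"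
  show "\<exists>g\<in>linear_maps S' (AA S') (AA S'). \<forall>x\<in>carrier (AA S). g (tm S' \<phi> x) = tm S' \<phi> (f x)"
    by (rule extend_semilinear[OF S S' \<phi> AA_module[OF S']])
      (simp_all add: linear_maps_closed[OF f] linear_maps_add[OF f] linear_maps_smult[OF f]
        tm_closed[OF S S' \<phi>] tm_add[OF S S' \<phi>] tm_smult[OF S S' \<phi>])
qed (rule AA_module tm_closed tm_id tm_comp base_change_span_induct; assumption)+

context albert
begin

abbreviation "B S \<equiv> brown R A S"
abbreviation "bm S' \<phi> \<equiv> brown_map R A S' \<phi>"

lemma brown_carrier: "carrier (B S) = carrier S \<times> carrier (AA S) \<times> carrier (AA S) \<times> carrier S"
  by (simp add: brown_def Let_def)

lemma brown_mem [simp]: "(r, a, b, s) \<in> carrier (B S) \<longleftrightarrow>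
    r \<in> carrier S \<and> a \<in> carrier (AA S) \<and> b \<in> carrier (AA S) \<and> s \<in> carrier S"
  by (simp add: brown_carrier)

lemma brown_cases:
  assumes "x \<in> carrier (B S)"
  obtains r a b s where "x = (r, a, b, s)" "r \<in> carrier S" "a \<in> carrier (AA S)" "b \<in> carrier (AA S)" "s \<in> carrier S"
  using assms by (auto simp: brown_carrier)

lemma brown_add [simp]: "(r, a, b, s) \<oplus>\<^bsub>B S\<^esub> (r', a', b', s') =
    (r \<oplus>\<^bsub>S\<^esub> r', a \<oplus>\<^bsub>AA S\<^esub> a', b \<oplus>\<^bsub>AA S\<^esub> b', s \<oplus>\<^bsub>S\<^esub> s')"
  by (simp add: brown_def Let_def)

lemma brown_smult [simp]: "u \<odot>\<^bsub>B S\<^esub> (r, a, b, s) = (u \<otimes>\<^bsub>S\<^esub> r, u \<odot>\<^bsub>AA S\<^esub> a, u \<odot>\<^bsub>AA S\<^esub> b, u \<otimes>\<^bsub>S\<^esub> s)"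
  by (simp add: brown_def Let_def)

lemma brown_mult [simp]: "(r, a, b, s) \<otimes>\<^bsub>B S\<^esub> (r', a', b', s') =
    (r \<otimes>\<^bsub>S\<^esub> r' \<oplus>\<^bsub>S\<^esub> T S a b',
     r \<odot>\<^bsub>AA S\<^esub> a' \<oplus>\<^bsub>AA S\<^esub> s' \<odot>\<^bsub>AA S\<^esub> a \<oplus>\<^bsub>AA S\<^esub> X S b b',
     r' \<odot>\<^bsub>AA S\<^esub> b \<oplus>\<^bsub>AA S\<^esub> s \<odot>\<^bsub>AA S\<^esub> b' \<oplus>\<^bsub>AA S\<^esub> X S a a',
     s \<otimes>\<^bsub>S\<^esub> s' \<oplus>\<^bsub>S\<^esub> T S a' b)"
  by (simp add: brown_def Let_def)

lemma brown_one [simp]: "\<one>\<^bsub>B S\<^esub> = (\<one>\<^bsub>S\<^esub>, \<zero>\<^bsub>AA S\<^esub>, \<zero>\<^bsub>AA S\<^esub>, \<one>\<^bsub>S\<^esub>)"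
  by (simp add: brown_def Let_def)

lemma brown_zero [simp]: "\<zero>\<^bsub>B S\<^esub> = (\<zero>\<^bsub>S\<^esub>, \<zero>\<^bsub>AA S\<^esub>, \<zero>\<^bsub>AA S\<^esub>, \<zero>\<^bsub>S\<^esub>)"
  by (simp add: brown_def Let_def)

lemma brown_map_simp [simp]: "bm S' \<phi> (r, a, b, s) = (\<phi> r, tm S' \<phi> a, tm S' \<phi> b, \<phi> s)"
  by (simp add: brown_map_def)

lemma brown_involution_simp [simp]: "brown_involution (r, a, b, s) = (s, a, b, r)"
  by (simp add: brown_involution_def)

lemma brown_module:
  assumes S: "algebra R S"
  shows "module S (B S)"
proof -
  interpret S: cring S by (rule algebra.M_cring[OF S])
  interpret AS: module S "AA S" by (rule AA_module[OF S])
  have "abelian_group (B S)"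
  proof (rule abelian_groupI)
    fix x assume "x \<in> carrier (B S)"
    then show "\<exists>y\<in>carrier (B S). y \<oplus>\<^bsub>B S\<^esub> x = \<zero>\<^bsub>B S\<^esub>"
    proof (cases rule: brown_cases)
      case (1 r a b s)
      then show ?thesis
        by (intro bexI[of _ "(\<ominus>\<^bsub>S\<^esub> r, \<ominus>\<^bsub>AA S\<^esub> a, \<ominus>\<^bsub>AA S\<^esub> b, \<ominus>\<^bsub>S\<^esub> s)"]) (simp_all add: S.l_neg AS.l_neg)
    qed
  qed (auto elim!: brown_cases simp: S.a_ac AS.a_ac)
  then show ?thesis
    by (intro moduleI S.is_cring)
      (auto elim!: brown_cases simp: S.l_distr S.r_distr AS.smult_l_distr AS.smult_r_distr S.m_assoc AS.smult_assoc1)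
qed

lemma brown_mult_closed:
  assumes S: "algebra R S" and "x \<in> carrier (B S)" "y \<in> carrier (B S)"
  shows "x \<otimes>\<^bsub>B S\<^esub> y \<in> carrier (B S)"
proof -
  interpret S: cring S by (rule algebra.M_cring[OF S])
  interpret AS: module S "AA S" by (rule AA_module[OF S])
  show ?thesis using assms by (auto elim!: brown_cases)
qed

lemma brown_mult_add_left:
  assumes S: "algebra R S" and "x \<in> carrier (B S)" "x' \<in> carrier (B S)" "y \<in> carrier (B S)"
  shows "(x \<oplus>\<^bsub>B S\<^esub> x') \<otimes>\<^bsub>B S\<^esub> y = x \<otimes>\<^bsub>B S\<^esub> y \<oplus>\<^bsub>B S\<^esub> x' \<otimes>\<^bsub>B S\<^esub> y"
proof -
  interpret S: cring S by (rule algebra.M_cring[OF S])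
  interpret AS: module S "AA S" by (rule AA_module[OF S])
  show ?thesis using assms
    by (auto elim!: brown_cases simp: S.l_distr S.r_distr AS.smult_l_distr AS.smult_r_distr
        T_add_left T_add_right X_add_left X_add_right S.a_ac AS.a_ac)
qed

lemma brown_mult_add_right:
  assumes S: "algebra R S" and "x \<in> carrier (B S)" "y \<in> carrier (B S)" "y' \<in> carrier (B S)"
  shows "x \<otimes>\<^bsub>B S\<^esub> (y \<oplus>\<^bsub>B S\<^esub> y') = x \<otimes>\<^bsub>B S\<^esub> y \<oplus>\<^bsub>B S\<^esub> x \<otimes>\<^bsub>B S\<^esub> y'"
proof -
  interpret S: cring S by (rule algebra.M_cring[OF S])
  interpret AS: module S "AA S" by (rule AA_module[OF S])
  show ?thesis using assms
    by (auto elim!: brown_cases simp: S.l_distr S.r_distr AS.smult_l_distr AS.smult_r_distr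
        T_add_left T_add_right X_add_left X_add_right S.a_ac AS.a_ac)
qed

lemma (in module) smult_comm:
  "r \<in> carrier R \<Longrightarrow> s \<in> carrier R \<Longrightarrow> x \<in> carrier M \<Longrightarrow> r \<odot>\<^bsub>M\<^esub> (s \<odot>\<^bsub>M\<^esub> x) = s \<odot>\<^bsub>M\<^esub> (r \<odot>\<^bsub>M\<^esub> x)"
  using m_comm smult_assoc1 by metis

lemma brown_mult_smult_left:
  assumes S: "algebra R S" and "x \<in> carrier (B S)" "u \<in> carrier S" "y \<in> carrier (B S)"
  shows "(u \<odot>\<^bsub>B S\<^esub> x) \<otimes>\<^bsub>B S\<^esub> y = u \<odot>\<^bsub>B S\<^esub> (x \<otimes>\<^bsub>B S\<^esub> y)"
proof -
  interpret S: cring S by (rule algebra.M_cring[OF S])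
  interpret AS: module S "AA S" by (rule AA_module[OF S])
  show ?thesis using assms
    by (auto elim!: brown_cases simp: S.r_distr AS.smult_r_distr AS.smult_assoc1
        T_smult_left T_smult_right X_smult_left S.m_assoc AS.smult_comm[of u])
qed

lemma brown_mult_smult_right:
  assumes S: "algebra R S" and "x \<in> carrier (B S)" "u \<in> carrier S" "y \<in> carrier (B S)"
  shows "x \<otimes>\<^bsub>B S\<^esub> (u \<odot>\<^bsub>B S\<^esub> y) = u \<odot>\<^bsub>B S\<^esub> (x \<otimes>\<^bsub>B S\<^esub> y)"
proof -
  interpret S: cring S by (rule algebra.M_cring[OF S])
  interpret AS: module S "AA S" by (rule AA_module[OF S])
  show ?thesis using assms
    by (auto elim!: brown_cases simp: S.r_distr AS.smult_r_distr AS.smult_assoc1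
        T_smult_left T_smult_right X_smult_right S.m_lcomm AS.smult_comm[of u])
qed

section \<open>Scalar extension of the Brown algebra\<close>

lemma brown_map_closed:
  assumes "algebra R S" "algebra R S'" "\<phi> \<in> rring_hom R S S'" "x \<in> carrier (B S)"
  shows "bm S' \<phi> x \<in> carrier (B S')"
  using assms by (auto elim!: brown_cases simp: rring_hom_closed tm_closed)

lemma brown_map_add:
  assumes S: "algebra R S" and S': "algebra R S'" and \<phi>: "\<phi> \<in> rring_hom R S S'"
    and "x \<in> carrier (B S)" "y \<in> carrier (B S)"
  shows "bm S' \<phi> (x \<oplus>\<^bsub>B S\<^esub> y) = bm S' \<phi> x \<oplus>\<^bsub>B S'\<^esub> bm S' \<phi> y"
proof -
  interpret phi: ring_hom_cring S S' \<phi> by (rule rring_hom_cring[OF S S' \<phi>])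
  show ?thesis using assms(4-) by (auto elim!: brown_cases simp: tm_add[OF S S' \<phi>])
qed

lemma brown_map_smult:
  assumes S: "algebra R S" and S': "algebra R S'" and \<phi>: "\<phi> \<in> rring_hom R S S'"
    and "u \<in> carrier S" "x \<in> carrier (B S)"
  shows "bm S' \<phi> (u \<odot>\<^bsub>B S\<^esub> x) = \<phi> u \<odot>\<^bsub>B S'\<^esub> bm S' \<phi> x"
proof -
  interpret phi: ring_hom_cring S S' \<phi> by (rule rring_hom_cring[OF S S' \<phi>])
  show ?thesis using assms(4-) by (auto elim!: brown_cases simp: tm_smult[OF S S' \<phi>])
qed

lemma brown_map_mult:
  assumes S: "algebra R S" and S': "algebra R S'" and \<phi>: "\<phi> \<in> rring_hom R S S'"
    and "x \<in> carrier (B S)" "y \<in> carrier (B S)"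
  shows "bm S' \<phi> (x \<otimes>\<^bsub>B S\<^esub> y) = bm S' \<phi> x \<otimes>\<^bsub>B S'\<^esub> bm S' \<phi> y"
proof -
  interpret phi: ring_hom_cring S S' \<phi> by (rule rring_hom_cring[OF S S' \<phi>])
  interpret AS: module S "AA S" by (rule AA_module[OF S])
  show ?thesis using assms(4-) S
    by (auto elim!: brown_cases simp: tm_add[OF S S' \<phi>] tm_smult[OF S S' \<phi>] T_map[OF S S' \<phi>] X_map[OF S S' \<phi>])
qed

lemma tm_zero:
  assumes S: "algebra R S" and S': "algebra R S'" and \<phi>: "\<phi> \<in> rring_hom R S S'"
  shows "tm S' \<phi> \<zero>\<^bsub>AA S\<^esub> = \<zero>\<^bsub>AA S'\<^esub>"
proof -
  interpret phi: ring_hom_cring S S' \<phi> by (rule rring_hom_cring[OF S S' \<phi>])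
  interpret AS: module S "AA S" by (rule AA_module[OF S])
  interpret AS': module S' "AA S'" by (rule AA_module[OF S'])
  show ?thesis
    using tm_smult[OF S S' \<phi> phi.R.zero_closed AS.zero_closed] tm_closed[OF S S' \<phi> AS.zero_closed] by simp
qed

lemma brown_decomp:
  assumes S: "algebra R S" and "r \<in> carrier S" "a \<in> carrier (AA S)" "b \<in> carrier (AA S)" "s \<in> carrier S"
  shows "(r, a, b, s) = r \<odot>\<^bsub>B S\<^esub> (\<one>\<^bsub>S\<^esub>, \<zero>\<^bsub>AA S\<^esub>, \<zero>\<^bsub>AA S\<^esub>, \<zero>\<^bsub>S\<^esub>) \<oplus>\<^bsub>B S\<^esub> (\<zero>\<^bsub>S\<^esub>, a, \<zero>\<^bsub>AA S\<^esub>, \<zero>\<^bsub>S\<^esub>)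
    \<oplus>\<^bsub>B S\<^esub> (\<zero>\<^bsub>S\<^esub>, \<zero>\<^bsub>AA S\<^esub>, b, \<zero>\<^bsub>S\<^esub>) \<oplus>\<^bsub>B S\<^esub> s \<odot>\<^bsub>B S\<^esub> (\<zero>\<^bsub>S\<^esub>, \<zero>\<^bsub>AA S\<^esub>, \<zero>\<^bsub>AA S\<^esub>, \<one>\<^bsub>S\<^esub>)"
proof -
  interpret S: cring S by (rule algebra.M_cring[OF S])
  interpret AS: module S "AA S" by (rule AA_module[OF S])
  show ?thesis using assms by simp
qed

text \<open>The diagonal is spanned by the two diagonal units, which come from S; the off-diagonal
  summands are copies of A, where \<open>base_change_span_induct\<close> applies.\<close>

lemma brown_span_induct:
  assumes S: "algebra R S" and S': "algebra R S'" and \<phi>: "\<phi> \<in> rring_hom R S S'" and x: "x \<in> carrier (B S')"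
    and image: "\<And>x. x \<in> carrier (B S) \<Longrightarrow> P (bm S' \<phi> x)"
    and add: "\<And>x y. x \<in> carrier (B S') \<Longrightarrow> y \<in> carrier (B S') \<Longrightarrow> P x \<Longrightarrow> P y \<Longrightarrow> P (x \<oplus>\<^bsub>B S'\<^esub> y)"
    and smult: "\<And>s x. s \<in> carrier S' \<Longrightarrow> x \<in> carrier (B S') \<Longrightarrow> P x \<Longrightarrow> P (s \<odot>\<^bsub>B S'\<^esub> x)"
  shows "P x"
proof -
  interpret phi: ring_hom_cring S S' \<phi> by (rule rring_hom_cring[OF S S' \<phi>])
  interpret AS: module S "AA S" by (rule AA_module[OF S])
  interpret AS': module S' "AA S'" by (rule AA_module[OF S'])
  note [simp] = tm_zero[OF S S' \<phi>]
  have 1: "P (\<one>\<^bsub>S'\<^esub>, \<zero>\<^bsub>AA S'\<^esub>, \<zero>\<^bsub>AA S'\<^esub>, \<zero>\<^bsub>S'\<^esub>)"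
    using image[of "(\<one>\<^bsub>S\<^esub>, \<zero>\<^bsub>AA S\<^esub>, \<zero>\<^bsub>AA S\<^esub>, \<zero>\<^bsub>S\<^esub>)"] by simp
  have 4: "P (\<zero>\<^bsub>S'\<^esub>, \<zero>\<^bsub>AA S'\<^esub>, \<zero>\<^bsub>AA S'\<^esub>, \<one>\<^bsub>S'\<^esub>)"
    using image[of "(\<zero>\<^bsub>S\<^esub>, \<zero>\<^bsub>AA S\<^esub>, \<zero>\<^bsub>AA S\<^esub>, \<one>\<^bsub>S\<^esub>)"] by simp
  have 2: "P (\<zero>\<^bsub>S'\<^esub>, a, \<zero>\<^bsub>AA S'\<^esub>, \<zero>\<^bsub>S'\<^esub>)" if "a \<in> carrier (AA S')" for a
    using S S' \<phi> that
  proof (induction rule: base_change_span_induct)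
    case (image a)
    then show ?case using assms(5)[of "(\<zero>\<^bsub>S\<^esub>, a, \<zero>\<^bsub>AA S\<^esub>, \<zero>\<^bsub>S\<^esub>)"] by simp
  next
    case (add a a')
    then show ?case using assms(6)[OF _ _ add(3,4)] by simp
  next
    case (smult s a)
    then show ?case using assms(7)[OF _ _ smult(3), of s] by simp
  qed
  have 3: "P (\<zero>\<^bsub>S'\<^esub>, \<zero>\<^bsub>AA S'\<^esub>, b, \<zero>\<^bsub>S'\<^esub>)" if "b \<in> carrier (AA S')" for b
    using S S' \<phi> that
  proof (induction rule: base_change_span_induct)
    case (image b)
    then show ?case using assms(5)[of "(\<zero>\<^bsub>S\<^esub>, \<zero>\<^bsub>AA S\<^esub>, b, \<zero>\<^bsub>S\<^esub>)"] by simp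
  next
    case (add b b')
    then show ?case using assms(6)[OF _ _ add(3,4)] by simp
  next
    case (smult s b)
    then show ?case using assms(7)[OF _ _ smult(3), of s] by simp
  qed
  obtain r a b s where x': "x = (r, a, b, s)" "r \<in> carrier S'" "a \<in> carrier (AA S')" "b \<in> carrier (AA S')" "s \<in> carrier S'"
    using x by (rule brown_cases)
  show ?thesis
    unfolding x'(1) brown_decomp[OF S' x'(2-)]
    by (intro add smult 1 2 3 4) (use x' in auto)
qed

text \<open>As a module, B is S + A + A + S. On each copy of A the map is extended by
  \<open>extend_semilinear\<close> with B over S' as target, and the diagonal units go to the images
  of their values \<open>u\<close> and \<open>v\<close>.\<close>

lemma brown_extension_exists:
  assumes S: "algebra R S" and S': "algebra R S'" and \<phi>: "\<phi> \<in> rring_hom R S S'"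
    and f: "f \<in> linear_maps S (B S) (B S)"
  shows "\<exists>g\<in>linear_maps S' (B S') (B S'). \<forall>x\<in>carrier (B S). g (bm S' \<phi> x) = bm S' \<phi> (f x)"
proof -
  interpret phi: ring_hom_cring S S' \<phi> by (rule rring_hom_cring[OF S S' \<phi>])
  interpret AS: module S "AA S" by (rule AA_module[OF S])
  interpret AS': module S' "AA S'" by (rule AA_module[OF S'])
  interpret BS: module S "B S" by (rule brown_module[OF S])
  interpret BS': module S' "B S'" by (rule brown_module[OF S'])
  note fl = linear_maps_closed[OF f] linear_maps_add[OF f, symmetric] linear_maps_smult[OF f, symmetric]
  note bl = brown_map_closed[OF S S' \<phi>] brown_map_add[OF S S' \<phi>, symmetric] brown_map_smult[OF S S' \<phi>, symmetric]
  have "\<exists>g\<in>linear_maps S' (AA S') (B S'). \<forall>a\<in>carrier (AA S). g (tm S' \<phi> a) = bm S' \<phi> (f (\<zero>\<^bsub>S\<^esub>, a, \<zero>\<^bsub>AA S\<^esub>, \<zero>\<^bsub>S\<^esub>))"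
    by (rule extend_semilinear[OF S S' \<phi> brown_module[OF S']]) (simp_all add: fl bl)
  then obtain g2 where g2: "g2 \<in> linear_maps S' (AA S') (B S')"
    "\<And>a. a \<in> carrier (AA S) \<Longrightarrow> g2 (tm S' \<phi> a) = bm S' \<phi> (f (\<zero>\<^bsub>S\<^esub>, a, \<zero>\<^bsub>AA S\<^esub>, \<zero>\<^bsub>S\<^esub>))" by blast
  have "\<exists>g\<in>linear_maps S' (AA S') (B S'). \<forall>b\<in>carrier (AA S). g (tm S' \<phi> b) = bm S' \<phi> (f (\<zero>\<^bsub>S\<^esub>, \<zero>\<^bsub>AA S\<^esub>, b, \<zero>\<^bsub>S\<^esub>))"
    by (rule extend_semilinear[OF S S' \<phi> brown_module[OF S']]) (simp_all add: fl bl)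
  then obtain g3 where g3: "g3 \<in> linear_maps S' (AA S') (B S')"
    "\<And>b. b \<in> carrier (AA S) \<Longrightarrow> g3 (tm S' \<phi> b) = bm S' \<phi> (f (\<zero>\<^bsub>S\<^esub>, \<zero>\<^bsub>AA S\<^esub>, b, \<zero>\<^bsub>S\<^esub>))" by blast
  let ?e1 = "(\<one>\<^bsub>S\<^esub>, \<zero>\<^bsub>AA S\<^esub>, \<zero>\<^bsub>AA S\<^esub>, \<zero>\<^bsub>S\<^esub>)" and ?e4 = "(\<zero>\<^bsub>S\<^esub>, \<zero>\<^bsub>AA S\<^esub>, \<zero>\<^bsub>AA S\<^esub>, \<one>\<^bsub>S\<^esub>)"
  define u where "u = bm S' \<phi> (f ?e1)"
  define v where "v = bm S' \<phi> (f ?e4)"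
  have uv: "u \<in> carrier (B S')" "v \<in> carrier (B S')"
    by (simp_all add: u_def v_def fl bl)
  define g where "g = (\<lambda>(r, a, b, s)\<in>carrier (B S'). r \<odot>\<^bsub>B S'\<^esub> u \<oplus>\<^bsub>B S'\<^esub> g2 a \<oplus>\<^bsub>B S'\<^esub> g3 b \<oplus>\<^bsub>B S'\<^esub> s \<odot>\<^bsub>B S'\<^esub> v)"
  have g: "g (r, a, b, s) = r \<odot>\<^bsub>B S'\<^esub> u \<oplus>\<^bsub>B S'\<^esub> g2 a \<oplus>\<^bsub>B S'\<^esub> g3 b \<oplus>\<^bsub>B S'\<^esub> s \<odot>\<^bsub>B S'\<^esub> v"
    if "r \<in> carrier S'" "a \<in> carrier (AA S')" "b \<in> carrier (AA S')" "s \<in> carrier S'" for r a b s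
    using that by (simp add: g_def)
  note c = linear_maps_closed[OF g2(1)] linear_maps_closed[OF g3(1)]
  have "g \<in> linear_maps S' (B S') (B S')"
  proof (rule linear_mapsI)
    show "g \<in> extensional (carrier (B S'))" by (simp add: g_def)
    show "g x \<in> carrier (B S')" if "x \<in> carrier (B S')" for x
      using that by (elim brown_cases) (use uv in \<open>simp add: g c\<close>)
    show "g (x \<oplus>\<^bsub>B S'\<^esub> y) = g x \<oplus>\<^bsub>B S'\<^esub> g y" if "x \<in> carrier (B S')" "y \<in> carrier (B S')" for x y
      using that
      by (elim brown_cases) (use uv in \<open>simp add: g c linear_maps_add[OF g2(1)] linear_maps_add[OF g3(1)]
        BS'.smult_l_distr BS'.a_ac\<close>)
    show "g (s \<odot>\<^bsub>B S'\<^esub> x) = s \<odot>\<^bsub>B S'\<^esub> g x" if "s \<in> carrier S'" "x \<in> carrier (B S')" for s x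
      using that
      by (elim brown_cases) (use uv in \<open>simp add: g c linear_maps_smult[OF g2(1)] linear_maps_smult[OF g3(1)]
        BS'.smult_r_distr BS'.smult_assoc1\<close>)
  qed
  moreover have "g (bm S' \<phi> x) = bm S' \<phi> (f x)" if "x \<in> carrier (B S)" for x
    using that
  proof (cases rule: brown_cases)
    case (1 r a b s)
    have "g (bm S' \<phi> x) = bm S' \<phi> (r \<odot>\<^bsub>B S\<^esub> f ?e1 \<oplus>\<^bsub>B S\<^esub> f (\<zero>\<^bsub>S\<^esub>, a, \<zero>\<^bsub>AA S\<^esub>, \<zero>\<^bsub>S\<^esub>)
        \<oplus>\<^bsub>B S\<^esub> f (\<zero>\<^bsub>S\<^esub>, \<zero>\<^bsub>AA S\<^esub>, b, \<zero>\<^bsub>S\<^esub>) \<oplus>\<^bsub>B S\<^esub> s \<odot>\<^bsub>B S\<^esub> f ?e4)"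
      using 1 by (simp add: g tm_closed[OF S S' \<phi>] g2(2) g3(2) brown_map_add[OF S S' \<phi>] brown_map_smult[OF S S' \<phi>]
          fl(1) u_def v_def del: brown_add brown_smult)
    also have "\<dots> = bm S' \<phi> (f (r \<odot>\<^bsub>B S\<^esub> ?e1 \<oplus>\<^bsub>B S\<^esub> (\<zero>\<^bsub>S\<^esub>, a, \<zero>\<^bsub>AA S\<^esub>, \<zero>\<^bsub>S\<^esub>)
        \<oplus>\<^bsub>B S\<^esub> (\<zero>\<^bsub>S\<^esub>, \<zero>\<^bsub>AA S\<^esub>, b, \<zero>\<^bsub>S\<^esub>) \<oplus>\<^bsub>B S\<^esub> s \<odot>\<^bsub>B S\<^esub> ?e4))"
      using 1 by (simp add: linear_maps_add[OF f] linear_maps_smult[OF f] del: brown_add brown_smult)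
    also have "\<dots> = bm S' \<phi> (f x)"
      unfolding 1(1) brown_decomp[OF S 1(2-)] ..
    finally show ?thesis .
  qed
  ultimately show ?thesis by blast
qed

end

sublocale albert \<subseteq> FB: scalar_family R "\<lambda>S. brown R A S" "\<lambda>S' \<phi>. brown_map R A S' \<phi>"
proof (rule scalar_family.intro)
  fix S :: "'u rring" and x
  assume "algebra R S" "x \<in> carrier (B S)"
  then show "bm S (\<lambda>s. s) x = x" by (auto elim!: brown_cases simp: tm_id)
next
  fix S S' S'' :: "'u rring" and \<phi> \<psi> x
  assume "algebra R S" "algebra R S'" "algebra R S''" "\<phi> \<in> rring_hom R S S'" "\<psi> \<in> rring_hom R S' S''"
    "x \<in> carrier (B S)"
  then show "bm S'' \<psi> (bm S' \<phi> x) = bm S'' (\<lambda>s. \<psi> (\<phi> s)) x" by (auto elim!: brown_cases simp: tm_comp)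
qed (rule brown_module brown_map_closed brown_span_induct brown_extension_exists; assumption)+

section \<open>The functors Isom and Aut\<close>

text \<open>\<open>linear_coeff_unique\<close> reads off the coefficient of t only; multiplying and
  dividing by t moves the neighbouring coefficients into that position.\<close>

lemma (in polynomial_ext) quadratic_coeffs_unique:
  assumes "a \<in> carrier S" "b \<in> carrier S" "c \<in> carrier S" "f \<in> carrier P"
    "a' \<in> carrier S" "b' \<in> carrier S" "c' \<in> carrier S" "f' \<in> carrier P"
    and eq: "i a \<oplus>\<^bsub>P\<^esub> t \<otimes>\<^bsub>P\<^esub> i b \<oplus>\<^bsub>P\<^esub> t \<otimes>\<^bsub>P\<^esub> t \<otimes>\<^bsub>P\<^esub> i c \<oplus>\<^bsub>P\<^esub> t \<otimes>\<^bsub>P\<^esub> t \<otimes>\<^bsub>P\<^esub> t \<otimes>\<^bsub>P\<^esub> f =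
      i a' \<oplus>\<^bsub>P\<^esub> t \<otimes>\<^bsub>P\<^esub> i b' \<oplus>\<^bsub>P\<^esub> t \<otimes>\<^bsub>P\<^esub> t \<otimes>\<^bsub>P\<^esub> i c' \<oplus>\<^bsub>P\<^esub> t \<otimes>\<^bsub>P\<^esub> t \<otimes>\<^bsub>P\<^esub> t \<otimes>\<^bsub>P\<^esub> f'"
  shows "b = b'" "c = c'"
proof -
  have 1: "i a \<oplus>\<^bsub>P\<^esub> i b \<otimes>\<^bsub>P\<^esub> t \<oplus>\<^bsub>P\<^esub> t \<otimes>\<^bsub>P\<^esub> t \<otimes>\<^bsub>P\<^esub> (i c \<oplus>\<^bsub>P\<^esub> t \<otimes>\<^bsub>P\<^esub> f) =
      i a' \<oplus>\<^bsub>P\<^esub> i b' \<otimes>\<^bsub>P\<^esub> t \<oplus>\<^bsub>P\<^esub> t \<otimes>\<^bsub>P\<^esub> t \<otimes>\<^bsub>P\<^esub> (i c' \<oplus>\<^bsub>P\<^esub> t \<otimes>\<^bsub>P\<^esub> f')"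
    using assms by (simp add: P.r_distr P.m_ac P.a_ac)
  show b: "b = b'" by (rule linear_coeff_unique[OF _ _ _ _ _ _ 1]) (use assms in auto)
  \<comment> \<open>Multiplication by t moves the constant term a to the linear position.\<close>
  have "t \<otimes>\<^bsub>P\<^esub> (i a \<oplus>\<^bsub>P\<^esub> i b \<otimes>\<^bsub>P\<^esub> t \<oplus>\<^bsub>P\<^esub> t \<otimes>\<^bsub>P\<^esub> t \<otimes>\<^bsub>P\<^esub> (i c \<oplus>\<^bsub>P\<^esub> t \<otimes>\<^bsub>P\<^esub> f)) =
      t \<otimes>\<^bsub>P\<^esub> (i a' \<oplus>\<^bsub>P\<^esub> i b' \<otimes>\<^bsub>P\<^esub> t \<oplus>\<^bsub>P\<^esub> t \<otimes>\<^bsub>P\<^esub> t \<otimes>\<^bsub>P\<^esub> (i c' \<oplus>\<^bsub>P\<^esub> t \<otimes>\<^bsub>P\<^esub> f'))"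
    unfolding 1 ..
  then have 2: "i \<zero>\<^bsub>S\<^esub> \<oplus>\<^bsub>P\<^esub> i a \<otimes>\<^bsub>P\<^esub> t \<oplus>\<^bsub>P\<^esub> t \<otimes>\<^bsub>P\<^esub> t \<otimes>\<^bsub>P\<^esub> (i b \<oplus>\<^bsub>P\<^esub> t \<otimes>\<^bsub>P\<^esub> (i c \<oplus>\<^bsub>P\<^esub> t \<otimes>\<^bsub>P\<^esub> f)) =
      i \<zero>\<^bsub>S\<^esub> \<oplus>\<^bsub>P\<^esub> i a' \<otimes>\<^bsub>P\<^esub> t \<oplus>\<^bsub>P\<^esub> t \<otimes>\<^bsub>P\<^esub> t \<otimes>\<^bsub>P\<^esub> (i b' \<oplus>\<^bsub>P\<^esub> t \<otimes>\<^bsub>P\<^esub> (i c' \<oplus>\<^bsub>P\<^esub> t \<otimes>\<^bsub>P\<^esub> f'))"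
    using assms by (simp add: P.r_distr P.m_ac P.a_ac)
  have a: "a = a'" by (rule linear_coeff_unique[OF _ _ _ _ _ _ 2]) (use assms in auto)
  \<comment> \<open>With a and b identified, the common lower terms cancel; dividing by t then moves
    c to the linear position.\<close>
  have "t \<otimes>\<^bsub>P\<^esub> t \<otimes>\<^bsub>P\<^esub> (i c \<oplus>\<^bsub>P\<^esub> t \<otimes>\<^bsub>P\<^esub> f) = t \<otimes>\<^bsub>P\<^esub> t \<otimes>\<^bsub>P\<^esub> (i c' \<oplus>\<^bsub>P\<^esub> t \<otimes>\<^bsub>P\<^esub> f')"
    by (rule P.sum_left_cancel[OF 1[unfolded a b]]) (use assms in auto)
  then have "t [^]\<^bsub>P\<^esub> (1::nat) \<otimes>\<^bsub>P\<^esub> (t \<otimes>\<^bsub>P\<^esub> (i c \<oplus>\<^bsub>P\<^esub> t \<otimes>\<^bsub>P\<^esub> f)) = t [^]\<^bsub>P\<^esub> (1::nat) \<otimes>\<^bsub>P\<^esub> (t \<otimes>\<^bsub>P\<^esub> (i c' \<oplus>\<^bsub>P\<^esub> t \<otimes>\<^bsub>P\<^esub> f'))"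
    using assms by (simp add: P.m_assoc)
  then have "t \<otimes>\<^bsub>P\<^esub> (i c \<oplus>\<^bsub>P\<^esub> t \<otimes>\<^bsub>P\<^esub> f) = t \<otimes>\<^bsub>P\<^esub> (i c' \<oplus>\<^bsub>P\<^esub> t \<otimes>\<^bsub>P\<^esub> f')"
    by (rule power_cancel[rotated 2]) (use assms in auto)
  then have 3: "i \<zero>\<^bsub>S\<^esub> \<oplus>\<^bsub>P\<^esub> i c \<otimes>\<^bsub>P\<^esub> t \<oplus>\<^bsub>P\<^esub> t \<otimes>\<^bsub>P\<^esub> t \<otimes>\<^bsub>P\<^esub> f = i \<zero>\<^bsub>S\<^esub> \<oplus>\<^bsub>P\<^esub> i c' \<otimes>\<^bsub>P\<^esub> t \<oplus>\<^bsub>P\<^esub> t \<otimes>\<^bsub>P\<^esub> t \<otimes>\<^bsub>P\<^esub> f'"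
    using assms by (simp add: P.r_distr P.m_ac P.a_ac)
  show "c = c'" by (rule linear_coeff_unique[OF _ _ _ _ _ _ 3]) (use assms in auto)
qed

context albert
begin

text \<open>Pairing with vectors w over S turns vector coefficients into scalar ones, and by
  non-degeneracy over S these determine the vectors.\<close>

lemma quadratic_coeffs_vector:
  assumes P': "polynomial_ext R S P i t"
    and cl: "a \<in> carrier (AA S)" "b \<in> carrier (AA S)" "c \<in> carrier (AA S)" "v \<in> carrier (AA P)"
    "a' \<in> carrier (AA S)" "b' \<in> carrier (AA S)" "c' \<in> carrier (AA S)" "v' \<in> carrier (AA P)"
    and eq: "tm P i a \<oplus>\<^bsub>AA P\<^esub> t \<odot>\<^bsub>AA P\<^esub> tm P i b \<oplus>\<^bsub>AA P\<^esub> (t \<otimes>\<^bsub>P\<^esub> t) \<odot>\<^bsub>AA P\<^esub> tm P i c \<oplus>\<^bsub>AA P\<^esub> (t \<otimes>\<^bsub>P\<^esub> t \<otimes>\<^bsub>P\<^esub> t) \<odot>\<^bsub>AA P\<^esub> v =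
      tm P i a' \<oplus>\<^bsub>AA P\<^esub> t \<odot>\<^bsub>AA P\<^esub> tm P i b' \<oplus>\<^bsub>AA P\<^esub> (t \<otimes>\<^bsub>P\<^esub> t) \<odot>\<^bsub>AA P\<^esub> tm P i c' \<oplus>\<^bsub>AA P\<^esub> (t \<otimes>\<^bsub>P\<^esub> t \<otimes>\<^bsub>P\<^esub> t) \<odot>\<^bsub>AA P\<^esub> v'"
  shows "b = b'" "c = c'"
proof -
  interpret P: polynomial_ext R S P i t by fact
  note S = P.S_algebra and P = P.P_algebra
  interpret AP: module P "AA P" by (rule AA_module[OF P])
  have expand: "T P (tm P i a \<oplus>\<^bsub>AA P\<^esub> t \<odot>\<^bsub>AA P\<^esub> tm P i b \<oplus>\<^bsub>AA P\<^esub> (t \<otimes>\<^bsub>P\<^esub> t) \<odot>\<^bsub>AA P\<^esub> tm P i c \<oplus>\<^bsub>AA P\<^esub> (t \<otimes>\<^bsub>P\<^esub> t \<otimes>\<^bsub>P\<^esub> t) \<odot>\<^bsub>AA P\<^esub> v) (tm P i w) =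
      i (T S a w) \<oplus>\<^bsub>P\<^esub> t \<otimes>\<^bsub>P\<^esub> i (T S b w) \<oplus>\<^bsub>P\<^esub> t \<otimes>\<^bsub>P\<^esub> t \<otimes>\<^bsub>P\<^esub> i (T S c w) \<oplus>\<^bsub>P\<^esub> t \<otimes>\<^bsub>P\<^esub> t \<otimes>\<^bsub>P\<^esub> t \<otimes>\<^bsub>P\<^esub> T P v (tm P i w)"
    if "a \<in> carrier (AA S)" "b \<in> carrier (AA S)" "c \<in> carrier (AA S)" "v \<in> carrier (AA P)" "w \<in> carrier (AA S)" for a b c v w
    using that by (simp add: T_add_left[OF P] T_smult_left[OF P] T_map[OF S P P.i_hom] tm_closed[OF S P P.i_hom])
  have coeffs: "T S b w = T S b' w" "T S c w = T S c' w" if w: "w \<in> carrier (AA S)" for w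
    using P.quadratic_coeffs_unique[of "T S a w" "T S b w" "T S c w" "T P v (tm P i w)"
      "T S a' w" "T S b' w" "T S c' w" "T P v' (tm P i w)"]
      arg_cong[OF eq, of "\<lambda>x. T P x (tm P i w)"] expand[OF cl(1-4) w] expand[OF cl(5-8) w] cl w S P
    by (simp_all add: tm_closed[OF S P P.i_hom])
  show "b = b'" by (rule T_eqI[OF S cl(2,6) coeffs(1)])
  show "c = c'" by (rule T_eqI[OF S cl(3,7) coeffs(2)])
qed

text \<open>Substitute x + t y into the adjoint identity over S[t]; the coefficients of t and of t^2
  give the two identities.\<close>

lemma adjoint_identity_linearized:
  assumes S: "algebra R S" and x: "x \<in> carrier (AA S)" and y: "y \<in> carrier (AA S)"
  shows "X S (sharp S x) (X S x y) = N S x \<odot>\<^bsub>AA S\<^esub> y \<oplus>\<^bsub>AA S\<^esub> D S x y \<odot>\<^bsub>AA S\<^esub> x"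
    and "sharp S (X S x y) \<oplus>\<^bsub>AA S\<^esub> X S (sharp S x) (sharp S y) = D S x y \<odot>\<^bsub>AA S\<^esub> y \<oplus>\<^bsub>AA S\<^esub> D S y x \<odot>\<^bsub>AA S\<^esub> x"
proof -
  obtain P i t where P': "polynomial_ext R S P i t"
    using polynomial_extI[OF infinite_universe S] by blast
  then interpret P: polynomial_ext R S P i t .
  note P = P.P_algebra
  interpret AS: module S "AA S" by (rule AA_module[OF S])
  interpret AP: module P "AA P" by (rule AA_module[OF P])
  let ?x = "tm P i x" and ?y = "tm P i y"
  note tc = tm_closed[OF S P P.i_hom]
  have xy: "?x \<in> carrier (AA P)" "?y \<in> carrier (AA P)" using x y by (simp_all add: tc)
  note pc [simp] = sharp_closed[OF P] X_closed[OF P] N_closed[OF P] D_closed[OF P]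
  let ?u = "sharp P ?x" and ?v = "X P ?x ?y" and ?w = "sharp P ?y"
  \<comment> \<open>\<open>?L\<close>, and \<open>?M\<close> on the other side, collect all terms
    divisible by t^3; the comparison leaves them arbitrary.\<close>
  let ?L = "X P ?v ?w \<oplus>\<^bsub>AA P\<^esub> t \<odot>\<^bsub>AA P\<^esub> sharp P ?w"
  have s1: "sharp P (?x \<oplus>\<^bsub>AA P\<^esub> t \<odot>\<^bsub>AA P\<^esub> ?y) = ?u \<oplus>\<^bsub>AA P\<^esub> t \<odot>\<^bsub>AA P\<^esub> (?v \<oplus>\<^bsub>AA P\<^esub> t \<odot>\<^bsub>AA P\<^esub> ?w)"
    using xy by (simp add: sharp_add[OF P] sharp_smult[OF P] X_smult_right[OF P] AP.smult_r_distr AP.smult_assoc1 AP.a_assoc)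
  have "sharp P (sharp P (?x \<oplus>\<^bsub>AA P\<^esub> t \<odot>\<^bsub>AA P\<^esub> ?y)) =
      sharp P ?u \<oplus>\<^bsub>AA P\<^esub> t \<odot>\<^bsub>AA P\<^esub> X P ?u ?v \<oplus>\<^bsub>AA P\<^esub> (t \<otimes>\<^bsub>P\<^esub> t) \<odot>\<^bsub>AA P\<^esub> (sharp P ?v \<oplus>\<^bsub>AA P\<^esub> X P ?u ?w)
      \<oplus>\<^bsub>AA P\<^esub> (t \<otimes>\<^bsub>P\<^esub> t \<otimes>\<^bsub>P\<^esub> t) \<odot>\<^bsub>AA P\<^esub> ?L"
    unfolding s1 using xy
    by (simp add: sharp_add[OF P] sharp_smult[OF P] X_smult_left[OF P] X_smult_right[OF P] X_add_right[OF P]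
      X_comm[OF P] AP.smult_r_distr AP.smult_assoc1 AP.a_ac)
  then have left: "sharp P (sharp P (?x \<oplus>\<^bsub>AA P\<^esub> t \<odot>\<^bsub>AA P\<^esub> ?y)) =
      tm P i (sharp S (sharp S x)) \<oplus>\<^bsub>AA P\<^esub> t \<odot>\<^bsub>AA P\<^esub> tm P i (X S (sharp S x) (X S x y)) \<oplus>\<^bsub>AA P\<^esub>
      (t \<otimes>\<^bsub>P\<^esub> t) \<odot>\<^bsub>AA P\<^esub> tm P i (sharp S (X S x y) \<oplus>\<^bsub>AA S\<^esub> X S (sharp S x) (sharp S y))
      \<oplus>\<^bsub>AA P\<^esub> (t \<otimes>\<^bsub>P\<^esub> t \<otimes>\<^bsub>P\<^esub> t) \<odot>\<^bsub>AA P\<^esub> ?L"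
    using x y S by (simp add: sharp_map[OF S P P.i_hom] X_map[OF S P P.i_hom] tm_add[OF S P P.i_hom])
  let ?M = "i (N S y) \<odot>\<^bsub>AA P\<^esub> ?x \<oplus>\<^bsub>AA P\<^esub> i (D S y x) \<odot>\<^bsub>AA P\<^esub> ?y \<oplus>\<^bsub>AA P\<^esub> t \<odot>\<^bsub>AA P\<^esub> (i (N S y) \<odot>\<^bsub>AA P\<^esub> ?y)"
  have ND: "N S x \<in> carrier S" "N S y \<in> carrier S" "D S x y \<in> carrier S" "D S y x \<in> carrier S"
    using x y S by simp_all
  have "N P (?x \<oplus>\<^bsub>AA P\<^esub> t \<odot>\<^bsub>AA P\<^esub> ?y) = cubic_poly P \<one>\<^bsub>P\<^esub> t (i (N S x)) (i (D S x y)) (i (D S y x)) (i (N S y))"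
    using N_linear_comb[OF S x y P P.i_hom P.P.one_closed P.t_closed] xy by simp
  then have "sharp P (sharp P (?x \<oplus>\<^bsub>AA P\<^esub> t \<odot>\<^bsub>AA P\<^esub> ?y)) =
      cubic_poly P \<one>\<^bsub>P\<^esub> t (i (N S x)) (i (D S x y)) (i (D S y x)) (i (N S y)) \<odot>\<^bsub>AA P\<^esub> (?x \<oplus>\<^bsub>AA P\<^esub> t \<odot>\<^bsub>AA P\<^esub> ?y)"
    using xy by (simp add: sharp_sharp[OF P])
  also have "\<dots> = i (N S x) \<odot>\<^bsub>AA P\<^esub> ?x \<oplus>\<^bsub>AA P\<^esub> t \<odot>\<^bsub>AA P\<^esub> (i (N S x) \<odot>\<^bsub>AA P\<^esub> ?y \<oplus>\<^bsub>AA P\<^esub> i (D S x y) \<odot>\<^bsub>AA P\<^esub> ?x) \<oplus>\<^bsub>AA P\<^esub>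
      (t \<otimes>\<^bsub>P\<^esub> t) \<odot>\<^bsub>AA P\<^esub> (i (D S x y) \<odot>\<^bsub>AA P\<^esub> ?y \<oplus>\<^bsub>AA P\<^esub> i (D S y x) \<odot>\<^bsub>AA P\<^esub> ?x)
      \<oplus>\<^bsub>AA P\<^esub> (t \<otimes>\<^bsub>P\<^esub> t \<otimes>\<^bsub>P\<^esub> t) \<odot>\<^bsub>AA P\<^esub> ?M"
    using xy ND by (simp add: AP.smult_l_distr AP.smult_r_distr AP.smult_assoc1[symmetric] P.P.r_distr P.P.m_ac AP.a_ac)
  also have "\<dots> = tm P i (N S x \<odot>\<^bsub>AA S\<^esub> x) \<oplus>\<^bsub>AA P\<^esub> t \<odot>\<^bsub>AA P\<^esub> tm P i (N S x \<odot>\<^bsub>AA S\<^esub> y \<oplus>\<^bsub>AA S\<^esub> D S x y \<odot>\<^bsub>AA S\<^esub> x) \<oplus>\<^bsub>AA P\<^esub>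
      (t \<otimes>\<^bsub>P\<^esub> t) \<odot>\<^bsub>AA P\<^esub> tm P i (D S x y \<odot>\<^bsub>AA S\<^esub> y \<oplus>\<^bsub>AA S\<^esub> D S y x \<odot>\<^bsub>AA S\<^esub> x)
      \<oplus>\<^bsub>AA P\<^esub> (t \<otimes>\<^bsub>P\<^esub> t \<otimes>\<^bsub>P\<^esub> t) \<odot>\<^bsub>AA P\<^esub> ?M"
    using x y ND by (simp add: tm_smult[OF S P P.i_hom] tm_add[OF S P P.i_hom])
  finally have right: "sharp P (sharp P (?x \<oplus>\<^bsub>AA P\<^esub> t \<odot>\<^bsub>AA P\<^esub> ?y)) = \<dots>" .
  note uniq = quadratic_coeffs_vector[OF P' _ _ _ _ _ _ _ _ trans[OF left[symmetric] right]]
  show "X S (sharp S x) (X S x y) = N S x \<odot>\<^bsub>AA S\<^esub> y \<oplus>\<^bsub>AA S\<^esub> D S x y \<odot>\<^bsub>AA S\<^esub> x"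
    by (rule uniq(1)) (use x y xy ND S in simp_all)
  show "sharp S (X S x y) \<oplus>\<^bsub>AA S\<^esub> X S (sharp S x) (sharp S y) = D S x y \<odot>\<^bsub>AA S\<^esub> y \<oplus>\<^bsub>AA S\<^esub> D S y x \<odot>\<^bsub>AA S\<^esub> x"
    by (rule uniq(2)) (use x y xy ND S in simp_all)
qed

section \<open>Isometries and automorphisms as subgroup functors\<close>

definition preserves_norm :: "'u rring \<Rightarrow> (('a, 'u) tensor \<Rightarrow> ('a, 'u) tensor) \<Rightarrow> bool" where
  "preserves_norm S \<rho> \<longleftrightarrow> (\<forall>S' \<phi>. algebra R S' \<and> \<phi> \<in> rring_hom R S S' \<longrightarrow>
     (\<forall>x\<in>carrier (AA S'). N S' (FA.ext S S' \<phi> \<rho> x) = N S' x))"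

lemma Isom_norm_eq: "Isom_norm R A = FA.linear_group_functor preserves_norm"
  by (simp add: Isom_norm_def FA.linear_group_functor_def preserves_norm_def fun_eq_iff)

lemma Isom_norm_carrier: "carrier (points (Isom_norm R A) S) = {\<rho> \<in> general_linear S (AA S). preserves_norm S \<rho>}"
  by (simp add: Isom_norm_eq FA.linear_group_functor_def)

lemma Isom_norm_group_functor: "is_group_functor R (Isom_norm R A)"
  unfolding Isom_norm_eq
proof (rule FA.is_group_functor_linear)
  fix S :: "'u rring" assume S: "algebra R S"
  show "preserves_norm S (\<lambda>x\<in>carrier (AA S). x)"
    unfolding preserves_norm_def using FA.ext_ident[OF S] by simp
  fix f assume f: "f \<in> general_linear S (AA S)" and pf: "preserves_norm S f"
  note fl = general_linear_linear[OF f]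
  show "preserves_norm S (inverse_map (AA S) f)"
    unfolding preserves_norm_def
  proof (intro allI impI ballI, elim conjE)
    fix S' \<phi> x assume S': "algebra R S'" and \<phi>: "\<phi> \<in> rring_hom R S S'" and x: "x \<in> carrier (AA S')"
    let ?g = "FA.ext S S' \<phi> (inverse_map (AA S) f)"
    have "?g x \<in> carrier (AA S')"
      using general_linear_inverse_map(1)[OF f AA_module[OF S], THEN general_linear_linear] x
      by (intro linear_maps_closed[OF FA.ext_linear[OF S S' \<phi>]])
    then have "N S' (?g x) = N S' (FA.ext S S' \<phi> f (?g x))"
      using pf S' \<phi> by (simp add: preserves_norm_def)
    then show "N S' (?g x) = N S' x"
      using FA.ext_inverse(1)[OF S S' \<phi> f x] by simp
  qed
  fix g assume g: "g \<in> general_linear S (AA S)" and pg: "preserves_norm S g"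
  note gl = general_linear_linear[OF g]
  show "preserves_norm S (compose (carrier (AA S)) f g)"
    unfolding preserves_norm_def
  proof (intro allI impI ballI, elim conjE)
    fix S' \<phi> x assume S': "algebra R S'" and \<phi>: "\<phi> \<in> rring_hom R S S'" and x: "x \<in> carrier (AA S')"
    then show "N S' (FA.ext S S' \<phi> (compose (carrier (AA S)) f g) x) = N S' x"
      using pf pg linear_maps_closed[OF FA.ext_linear[OF S S' \<phi> gl] x]
      by (simp add: FA.ext_compose[OF S S' \<phi> fl gl] compose_eq preserves_norm_def)
  qed
next
  fix S S' :: "'u rring" and \<phi> f
  assume S: "algebra R S" and S': "algebra R S'" and \<phi>: "\<phi> \<in> rring_hom R S S'"
    and f: "f \<in> general_linear S (AA S)" and pf: "preserves_norm S f"
  show "preserves_norm S' (FA.ext S S' \<phi> f)"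
    unfolding preserves_norm_def
    using pf rring_hom_comp[OF \<phi>] FA.ext_trans[OF S S' _ \<phi> _ general_linear_linear[OF f], symmetric]
    by (simp add: preserves_norm_def)
qed

definition preserves_brown :: "'u rring \<Rightarrow> (('a, 'u) brown_matrix \<Rightarrow> ('a, 'u) brown_matrix) \<Rightarrow> bool" where
  "preserves_brown S \<rho> \<longleftrightarrow> (\<forall>x\<in>carrier (B S). \<forall>y\<in>carrier (B S). \<rho> (x \<otimes>\<^bsub>B S\<^esub> y) = \<rho> x \<otimes>\<^bsub>B S\<^esub> \<rho> y) \<and>
     \<rho> \<one>\<^bsub>B S\<^esub> = \<one>\<^bsub>B S\<^esub> \<and> (\<forall>x\<in>carrier (B S). \<rho> (brown_involution x) = brown_involution (\<rho> x))"

lemma Aut_brown_eq: "Aut_brown R A = FB.linear_group_functor preserves_brown"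
  by (simp add: Aut_brown_def FB.linear_group_functor_def preserves_brown_def fun_eq_iff)

lemma Aut_brown_carrier: "carrier (points (Aut_brown R A) S) = {\<rho> \<in> general_linear S (B S). preserves_brown S \<rho>}"
  by (simp add: Aut_brown_eq FB.linear_group_functor_def)

lemma brown_involution_closed: "x \<in> carrier (B S) \<Longrightarrow> brown_involution x \<in> carrier (B S)"
  by (auto elim!: brown_cases)

lemma brown_one_closed: "algebra R S \<Longrightarrow> \<one>\<^bsub>B S\<^esub> \<in> carrier (B S)"
proof -
  assume S: "algebra R S"
  interpret S: cring S by (rule algebra.M_cring[OF S])
  interpret AS: module S "AA S" by (rule AA_module[OF S])
  show ?thesis by simp
qed

lemma Aut_brown_group_functor: "is_group_functor R (Aut_brown R A)"
  unfolding Aut_brown_eq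
proof (rule FB.is_group_functor_linear)
  fix S :: "'u rring" assume S: "algebra R S"
  interpret BS: module S "B S" by (rule brown_module[OF S])
  note mc = brown_mult_closed[OF S] and ic = brown_involution_closed and oc = brown_one_closed[OF S]
  show "preserves_brown S (\<lambda>x\<in>carrier (B S). x)"
    unfolding preserves_brown_def using mc ic oc by (simp del: brown_one)
  fix f assume f: "f \<in> general_linear S (B S)" and pf: "preserves_brown S f"
  note fl = general_linear_linear[OF f]
  note inv = general_linear_inverse_map[OF f brown_module[OF S]]
  let ?g = "inverse_map (B S) f"
  have gc: "?g x \<in> carrier (B S)" if "x \<in> carrier (B S)" for x
    by (rule linear_maps_closed[OF general_linear_linear[OF inv(1)] that])
  show "preserves_brown S ?g"
    unfolding preserves_brown_def
  proof (intro conjI ballI)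
    fix x y assume xy: "x \<in> carrier (B S)" "y \<in> carrier (B S)"
    have "?g (x \<otimes>\<^bsub>B S\<^esub> y) = ?g (f (?g x) \<otimes>\<^bsub>B S\<^esub> f (?g y))"
      by (simp only: inv(2) xy)
    also have "f (?g x) \<otimes>\<^bsub>B S\<^esub> f (?g y) = f (?g x \<otimes>\<^bsub>B S\<^esub> ?g y)"
      using pf gc[OF xy(1)] gc[OF xy(2)] unfolding preserves_brown_def by metis
    also have "?g \<dots> = ?g x \<otimes>\<^bsub>B S\<^esub> ?g y"
      by (rule inv(3)[OF mc[OF gc gc]]) (rule xy)+
    finally show "?g (x \<otimes>\<^bsub>B S\<^esub> y) = ?g x \<otimes>\<^bsub>B S\<^esub> ?g y" .
  next
    show "?g \<one>\<^bsub>B S\<^esub> = \<one>\<^bsub>B S\<^esub>"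
      using inv(3)[OF oc] pf unfolding preserves_brown_def by metis
  next
    fix x assume x: "x \<in> carrier (B S)"
    have "?g (brown_involution x) = ?g (brown_involution (f (?g x)))"
      by (simp only: inv(2) x)
    also have "brown_involution (f (?g x)) = f (brown_involution (?g x))"
      using pf gc[OF x] unfolding preserves_brown_def by metis
    also have "?g \<dots> = brown_involution (?g x)"
      by (rule inv(3)[OF ic[OF gc[OF x]]])
    finally show "?g (brown_involution x) = brown_involution (?g x)" .
  qed
  fix g assume g: "g \<in> general_linear S (B S)" and pg: "preserves_brown S g"
  note gl = linear_maps_closed[OF general_linear_linear[OF g]]
  show "preserves_brown S (compose (carrier (B S)) f g)"
    using pf pg gl mc ic oc by (simp add: preserves_brown_def compose_def del: brown_one)
next
  fix S S' :: "'u rring" and \<phi> f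
  assume S: "algebra R S" and S': "algebra R S'" and \<phi>: "\<phi> \<in> rring_hom R S S'"
    and f: "f \<in> general_linear S (B S)" and pf: "preserves_brown S f"
  interpret phi: ring_hom_cring S S' \<phi> by (rule rring_hom_cring[OF S S' \<phi>])
  note fl = general_linear_linear[OF f]
  let ?g = "FB.ext S S' \<phi> f"
  have gl: "?g \<in> linear_maps S' (B S') (B S')" by (rule FB.ext_linear[OF S S' \<phi> fl])
  note g = linear_maps_closed[OF gl] linear_maps_add[OF gl] linear_maps_smult[OF gl]
  note ap = FB.ext_apply[OF S S' \<phi> fl]
  interpret BS': module S' "B S'" by (rule brown_module[OF S'])
  note mc = brown_mult_closed[OF S] brown_mult_closed[OF S'] brown_map_closed[OF S S' \<phi>]
  note bil = brown_mult_add_left[OF S'] brown_mult_add_right[OF S'] brown_mult_smult_left[OF S'] brown_mult_smult_right[OF S']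
  have fm: "f (x \<otimes>\<^bsub>B S\<^esub> y) = f x \<otimes>\<^bsub>B S\<^esub> f y" if "x \<in> carrier (B S)" "y \<in> carrier (B S)" for x y
    using pf that unfolding preserves_brown_def by blast
  \<comment> \<open>Both sides are bilinear and agree on the image of B over S, which spans. The
    second argument is extended here, the first one in \<open>mult\<close>.\<close>
  have mult1: "?g (bm S' \<phi> x \<otimes>\<^bsub>B S'\<^esub> y) = ?g (bm S' \<phi> x) \<otimes>\<^bsub>B S'\<^esub> ?g y"
    if x: "x \<in> carrier (B S)" and y: "y \<in> carrier (B S')" for x y
  proof (rule brown_span_induct[OF S S' \<phi> y])
    fix y assume y: "y \<in> carrier (B S)"
    show "?g (bm S' \<phi> x \<otimes>\<^bsub>B S'\<^esub> bm S' \<phi> y) = ?g (bm S' \<phi> x) \<otimes>\<^bsub>B S'\<^esub> ?g (bm S' \<phi> y)"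
      using x y by (simp add: ap fm mc linear_maps_closed[OF fl] flip: brown_map_mult[OF S S' \<phi>])
  next
    fix y z assume "y \<in> carrier (B S')" "z \<in> carrier (B S')"
      "?g (bm S' \<phi> x \<otimes>\<^bsub>B S'\<^esub> y) = ?g (bm S' \<phi> x) \<otimes>\<^bsub>B S'\<^esub> ?g y"
      "?g (bm S' \<phi> x \<otimes>\<^bsub>B S'\<^esub> z) = ?g (bm S' \<phi> x) \<otimes>\<^bsub>B S'\<^esub> ?g z"
    then show "?g (bm S' \<phi> x \<otimes>\<^bsub>B S'\<^esub> (y \<oplus>\<^bsub>B S'\<^esub> z)) = ?g (bm S' \<phi> x) \<otimes>\<^bsub>B S'\<^esub> ?g (y \<oplus>\<^bsub>B S'\<^esub> z)"
      using x by (simp add: bil g mc)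
  next
    fix s y assume "s \<in> carrier S'" "y \<in> carrier (B S')"
      "?g (bm S' \<phi> x \<otimes>\<^bsub>B S'\<^esub> y) = ?g (bm S' \<phi> x) \<otimes>\<^bsub>B S'\<^esub> ?g y"
    then show "?g (bm S' \<phi> x \<otimes>\<^bsub>B S'\<^esub> (s \<odot>\<^bsub>B S'\<^esub> y)) = ?g (bm S' \<phi> x) \<otimes>\<^bsub>B S'\<^esub> ?g (s \<odot>\<^bsub>B S'\<^esub> y)"
      using x by (simp add: bil g mc)
  qed
  have mult: "?g (x \<otimes>\<^bsub>B S'\<^esub> y) = ?g x \<otimes>\<^bsub>B S'\<^esub> ?g y" if x: "x \<in> carrier (B S')" and y: "y \<in> carrier (B S')" for x y
  proof (rule brown_span_induct[OF S S' \<phi> x])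
    show "?g (bm S' \<phi> x \<otimes>\<^bsub>B S'\<^esub> y) = ?g (bm S' \<phi> x) \<otimes>\<^bsub>B S'\<^esub> ?g y" if "x \<in> carrier (B S)" for x
      by (rule mult1[OF that y])
  qed (use y in \<open>simp_all add: bil g mc\<close>)
  have one: "?g \<one>\<^bsub>B S'\<^esub> = \<one>\<^bsub>B S'\<^esub>"
  proof -
    have b1: "bm S' \<phi> \<one>\<^bsub>B S\<^esub> = \<one>\<^bsub>B S'\<^esub>" using tm_zero[OF S S' \<phi>] by simp
    have "?g (bm S' \<phi> \<one>\<^bsub>B S\<^esub>) = bm S' \<phi> \<one>\<^bsub>B S\<^esub>"
      using pf ap[OF brown_one_closed[OF S]] by (simp add: preserves_brown_def del: brown_one)
    then show ?thesis unfolding b1 .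
  qed
  have inv_map: "brown_involution (bm S' \<phi> x) = bm S' \<phi> (brown_involution x)" if "x \<in> carrier (B S)" for x
    using that by (auto elim!: brown_cases)
  have inv_add: "brown_involution (x \<oplus>\<^bsub>B S'\<^esub> y) = brown_involution x \<oplus>\<^bsub>B S'\<^esub> brown_involution y"
    if "x \<in> carrier (B S')" "y \<in> carrier (B S')" for x y
    using that by (auto elim!: brown_cases)
  have inv_smult: "brown_involution (s \<odot>\<^bsub>B S'\<^esub> x) = s \<odot>\<^bsub>B S'\<^esub> brown_involution x"
    if "x \<in> carrier (B S')" for s x
    using that by (auto elim!: brown_cases)
  have inv: "?g (brown_involution x) = brown_involution (?g x)" if x: "x \<in> carrier (B S')" for x
  proof (rule brown_span_induct[OF S S' \<phi> x])
    fix x assume x: "x \<in> carrier (B S)"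
    have "f (brown_involution x) = brown_involution (f x)"
      using pf x by (simp add: preserves_brown_def)
    then show "?g (brown_involution (bm S' \<phi> x)) = brown_involution (?g (bm S' \<phi> x))"
      using x by (simp add: inv_map ap brown_involution_closed linear_maps_closed[OF fl])
  qed (simp_all add: inv_add inv_smult g brown_involution_closed)
  show "preserves_brown S' ?g"
    unfolding preserves_brown_def using mult one inv by blast
qed

end

section \<open>The embedding of isometries\<close>

lemma linear_maps_zero:
  assumes "f \<in> linear_maps S M M'" "module S M" "module S M'"
  shows "f \<zero>\<^bsub>M\<^esub> = \<zero>\<^bsub>M'\<^esub>"
proof -
  interpret M: module S M by fact
  interpret M': module S M' by fact
  show ?thesis
    using linear_maps_smult[OF assms(1) M.R.zero_closed M.M.zero_closed] linear_maps_closed[OF assms(1) M.M.zero_closed]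
    by simp
qed

context albert
begin

section \<open>The inverse adjoint of a linear automorphism\<close>

lemma T_eqI_right:
  assumes "algebra R S" "y \<in> carrier (AA S)" "y' \<in> carrier (AA S)"
    "\<And>x. x \<in> carrier (AA S) \<Longrightarrow> T S x y = T S x y'"
  shows "y = y'"
  by (rule T_eqI[OF assms(1-3)]) (simp add: T_comm[OF assms(1)] assms)

text \<open>The dagger is the inverse of the adjoint: its value at y represents the linear form
  sending x to T(\<rho>^-1 x, y). Linearity in y follows from the uniqueness of representing
  vectors.\<close>

lemma dagger_linear_exists:
  assumes S: "algebra R S" and \<rho>: "\<rho> \<in> general_linear S (AA S)"
  shows "\<exists>\<rho>'\<in>linear_maps S (AA S) (AA S). \<forall>x\<in>carrier (AA S). \<forall>y\<in>carrier (AA S). T S (\<rho> x) (\<rho>' y) = T S x y"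
proof -
  interpret S: cring S by (rule algebra.M_cring[OF S])
  interpret AS: module S "AA S" by (rule AA_module[OF S])
  note inv = general_linear_inverse_map[OF \<rho> AA_module[OF S]]
  let ?g = "inverse_map (AA S) \<rho>"
  note gl = general_linear_linear[OF inv(1)]
  note \<rho>c = linear_maps_closed[OF general_linear_linear[OF \<rho>]]
  have "\<exists>z\<in>carrier (AA S). \<forall>x\<in>carrier (AA S). T S x z = T S (?g x) y" if y: "y \<in> carrier (AA S)" for y
    by (rule T_represents[OF S])
      (use y in \<open>simp_all add: S linear_maps_closed[OF gl] linear_maps_add[OF gl] linear_maps_smult[OF gl]
        T_add_left[OF S] T_smult_left[OF S] del: restrict_apply restrict_apply'\<close>)
  then obtain f where f: "\<And>y. y \<in> carrier (AA S) \<Longrightarrow> f y \<in> carrier (AA S)"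
    "\<And>x y. y \<in> carrier (AA S) \<Longrightarrow> x \<in> carrier (AA S) \<Longrightarrow> T S x (f y) = T S (?g x) y"
    by metis
  have gc: "?g x \<in> carrier (AA S)" if "x \<in> carrier (AA S)" for x
    by (rule linear_maps_closed[OF gl that])
  have add: "f (x \<oplus>\<^bsub>AA S\<^esub> y) = f x \<oplus>\<^bsub>AA S\<^esub> f y" if "x \<in> carrier (AA S)" "y \<in> carrier (AA S)" for x y
    by (rule T_eqI_right[OF S]) (use that f gc in \<open>simp_all add: T_add_right[OF S] del: restrict_apply restrict_apply'\<close>)
  have smult: "f (s \<odot>\<^bsub>AA S\<^esub> x) = s \<odot>\<^bsub>AA S\<^esub> f x" if "s \<in> carrier S" "x \<in> carrier (AA S)" for s x
    by (rule T_eqI_right[OF S]) (use that f gc in \<open>simp_all add: T_smult_right[OF S] del: restrict_apply restrict_apply'\<close>)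
  have "restrict f (carrier (AA S)) \<in> linear_maps S (AA S) (AA S)"
    using f(1) add smult by (intro linear_mapsI) auto
  moreover have "T S (\<rho> x) (restrict f (carrier (AA S)) y) = T S x y" if "x \<in> carrier (AA S)" "y \<in> carrier (AA S)" for x y
    using that f(2)[OF that(2) \<rho>c[OF that(1)]] inv(3)[OF that(1)] by simp
  ultimately show ?thesis by blast
qed

text \<open>As \<rho> is surjective, the condition determines T(_, f y) on all of A.\<close>

lemma dagger_unique:
  assumes S: "algebra R S" and \<rho>: "\<rho> \<in> general_linear S (AA S)"
    and f: "f \<in> linear_maps S (AA S) (AA S)" and g: "g \<in> linear_maps S (AA S) (AA S)"
    and fT: "\<And>x y. x \<in> carrier (AA S) \<Longrightarrow> y \<in> carrier (AA S) \<Longrightarrow> T S (\<rho> x) (f y) = T S x y"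
    and gT: "\<And>x y. x \<in> carrier (AA S) \<Longrightarrow> y \<in> carrier (AA S) \<Longrightarrow> T S (\<rho> x) (g y) = T S x y"
  shows "f = g"
proof (rule extensionalityI[OF linear_maps_extensional[OF f] linear_maps_extensional[OF g]])
  fix y assume y: "y \<in> carrier (AA S)"
  note inv = general_linear_inverse_map[OF \<rho> AA_module[OF S]]
  let ?g = "inverse_map (AA S) \<rho>"
  show "f y = g y"
  proof (rule T_eqI_right[OF S linear_maps_closed[OF f y] linear_maps_closed[OF g y]])
    fix x assume x: "x \<in> carrier (AA S)"
    have "?g x \<in> carrier (AA S)"
      by (rule linear_maps_closed[OF general_linear_linear[OF inv(1)] x])
    then have "T S (\<rho> (?g x)) (f y) = T S (\<rho> (?g x)) (g y)"
      using fT gT y by metis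
    then show "T S x (f y) = T S x (g y)" unfolding inv(2)[OF x] .
  qed
qed

lemma dagger_props:
  assumes S: "algebra R S" and \<rho>: "\<rho> \<in> general_linear S (AA S)"
  shows dagger_general_linear: "dagger R A S \<rho> \<in> general_linear S (AA S)"
    and T_dagger: "\<And>x y. x \<in> carrier (AA S) \<Longrightarrow> y \<in> carrier (AA S) \<Longrightarrow> T S (\<rho> x) (dagger R A S \<rho> y) = T S x y"
proof -
  note inv = general_linear_inverse_map[OF \<rho> AA_module[OF S]]
  let ?g = "inverse_map (AA S) \<rho>"
  have gc: "?g x \<in> carrier (AA S)" if "x \<in> carrier (AA S)" for x
    by (rule linear_maps_closed[OF general_linear_linear[OF inv(1)] that])
  note \<rho>c = linear_maps_closed[OF general_linear_linear[OF \<rho>]]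
  obtain f where f: "f \<in> linear_maps S (AA S) (AA S)"
    "\<And>x y. x \<in> carrier (AA S) \<Longrightarrow> y \<in> carrier (AA S) \<Longrightarrow> T S (\<rho> x) (f y) = T S x y"
    using dagger_linear_exists[OF S \<rho>] by blast
  \<comment> \<open>The map belonging to the inverse of \<rho> in the same way; it will be the
    inverse of \<open>f\<close>.\<close>
  obtain h where h: "h \<in> linear_maps S (AA S) (AA S)"
    "\<And>x y. x \<in> carrier (AA S) \<Longrightarrow> y \<in> carrier (AA S) \<Longrightarrow> T S (?g x) (h y) = T S x y"
    using dagger_linear_exists[OF S inv(1)] by blast
  have "f \<in> general_linear S (AA S)"
  proof (rule general_linearI[OF f(1) h(1)])
    fix y assume y: "y \<in> carrier (AA S)"
    note hy = linear_maps_closed[OF h(1) y] and fy = linear_maps_closed[OF f(1) y]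
    show "f (h y) = y"
    proof (rule T_eqI_right[OF S linear_maps_closed[OF f(1) hy] y])
      fix x assume x: "x \<in> carrier (AA S)"
      have "T S (\<rho> (?g x)) (f (h y)) = T S x y"
        using f(2)[OF gc[OF x] hy] h(2)[OF x y] by simp
      then show "T S x (f (h y)) = T S x y" unfolding inv(2)[OF x] .
    qed
    show "h (f y) = y"
    proof (rule T_eqI_right[OF S linear_maps_closed[OF h(1) fy] y])
      fix x assume x: "x \<in> carrier (AA S)"
      have "T S (?g (\<rho> x)) (h (f y)) = T S x y"
        using h(2)[OF \<rho>c[OF x] fy] f(2)[OF x y] by simp
      then show "T S x (h (f y)) = T S x y" unfolding inv(3)[OF x] .
    qed
  qed
  moreover from this have "dagger R A S \<rho> = f"
    unfolding dagger_def
    by (intro the_equality) (use f in \<open>auto intro: dagger_unique[OF S \<rho> _ f(1)] general_linear_linear\<close>)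
  ultimately show "dagger R A S \<rho> \<in> general_linear S (AA S)"
    "\<And>x y. x \<in> carrier (AA S) \<Longrightarrow> y \<in> carrier (AA S) \<Longrightarrow> T S (\<rho> x) (dagger R A S \<rho> y) = T S x y"
    using f by simp_all
qed

lemma dagger_eqI:
  assumes "algebra R S" "\<rho> \<in> general_linear S (AA S)" "f \<in> linear_maps S (AA S) (AA S)"
    "\<And>x y. x \<in> carrier (AA S) \<Longrightarrow> y \<in> carrier (AA S) \<Longrightarrow> T S (\<rho> x) (f y) = T S x y"
  shows "dagger R A S \<rho> = f"
  by (rule dagger_unique[OF assms(1,2) _ assms(3)])
    (use assms dagger_props[OF assms(1,2)] general_linear_linear in auto)

text \<open>Polarization: apply the relation to x + y and cancel the two outer terms. It serves for
  \<rho> with its dagger and again with the roles exchanged.\<close>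

lemma X_of_sharp:
  assumes S: "algebra R S" and f: "f \<in> linear_maps S (AA S) (AA S)" and g: "g \<in> linear_maps S (AA S) (AA S)"
    and fg: "\<And>x. x \<in> carrier (AA S) \<Longrightarrow> sharp S (f x) = g (sharp S x)"
    and x: "x \<in> carrier (AA S)" and y: "y \<in> carrier (AA S)"
  shows "X S (f x) (f y) = g (X S x y)"
proof -
  interpret AS: module S "AA S" by (rule AA_module[OF S])
  have c: "f x \<in> carrier (AA S)" "f y \<in> carrier (AA S)" "g (X S x y) \<in> carrier (AA S)"
    using x y S by (simp_all add: linear_maps_closed[OF f] linear_maps_closed[OF g])
  have "sharp S (f x) \<oplus>\<^bsub>AA S\<^esub> X S (f x) (f y) \<oplus>\<^bsub>AA S\<^esub> sharp S (f y) = sharp S (f (x \<oplus>\<^bsub>AA S\<^esub> y))"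
    using c S x y by (simp add: linear_maps_add[OF f] sharp_add)
  also have "\<dots> = g (sharp S x \<oplus>\<^bsub>AA S\<^esub> X S x y \<oplus>\<^bsub>AA S\<^esub> sharp S y)"
    using x y S by (simp add: fg sharp_add)
  also have "\<dots> = sharp S (f x) \<oplus>\<^bsub>AA S\<^esub> g (X S x y) \<oplus>\<^bsub>AA S\<^esub> sharp S (f y)"
    using x y S by (simp add: fg linear_maps_add[OF g])
  finally show ?thesis using c S by simp
qed

text \<open>Homogeneity gives (2 x)^# = 4 x^#, while the expansion of (x + x)^# is 2 x^# plus the
  cross square. Sums stand in for numerals.\<close>

lemma X_self:
  assumes S: "algebra R S" and x: "x \<in> carrier (AA S)"
  shows "X S x x = sharp S x \<oplus>\<^bsub>AA S\<^esub> sharp S x"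
proof -
  interpret S: cring S by (rule algebra.M_cring[OF S])
  interpret AS: module S "AA S" by (rule AA_module[OF S])
  have two: "x \<oplus>\<^bsub>AA S\<^esub> x = (\<one>\<^bsub>S\<^esub> \<oplus>\<^bsub>S\<^esub> \<one>\<^bsub>S\<^esub>) \<odot>\<^bsub>AA S\<^esub> x" using x by (simp add: AS.smult_l_distr)
  have "(sharp S x \<oplus>\<^bsub>AA S\<^esub> sharp S x) \<oplus>\<^bsub>AA S\<^esub> X S x x = sharp S (x \<oplus>\<^bsub>AA S\<^esub> x)"
    using x S by (simp add: sharp_add AS.a_ac)
  also have "\<dots> = (sharp S x \<oplus>\<^bsub>AA S\<^esub> sharp S x) \<oplus>\<^bsub>AA S\<^esub> (sharp S x \<oplus>\<^bsub>AA S\<^esub> sharp S x)"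
    unfolding two sharp_smult[OF S x S.a_closed[OF S.one_closed S.one_closed]]
    using x S by (simp add: S.l_distr AS.smult_l_distr AS.a_ac)
  finally show ?thesis by (rule AS.sum_left_cancel) (use x S in simp_all)
qed

section \<open>Isometries and the adjoint\<close>

context
  fixes S and \<rho>
  assumes S: "algebra R S" and \<rho>: "\<rho> \<in> general_linear S (AA S)" and pn: "preserves_norm S \<rho>"
begin

lemmas isom_lin = general_linear_linear[OF \<rho>]
lemmas isom_dagger_lin = general_linear_linear[OF dagger_general_linear[OF S \<rho>]]
lemmas isom_closed = linear_maps_closed[OF isom_lin] linear_maps_closed[OF isom_dagger_lin]

lemma isom_N:
  assumes x: "x \<in> carrier (AA S)"
  shows "N S (\<rho> x) = N S x"
  using pn S x rring_hom_id FA.ext_id[OF S isom_lin] unfolding preserves_norm_def by metis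

text \<open>An isometry preserves the norm over all S-rings, in particular over S[t]. So the
  expansion of N(x + t y) is preserved, and with it the coefficient of t.\<close>

lemma isom_D:
  assumes x: "x \<in> carrier (AA S)" and y: "y \<in> carrier (AA S)"
  shows "D S (\<rho> x) (\<rho> y) = D S x y"
proof -
  obtain P i t where P': "polynomial_ext R S P i t"
    using polynomial_extI[OF infinite_universe S] by blast
  then interpret P: polynomial_ext R S P i t .
  note P = P.P_algebra
  interpret AP: module P "AA P" by (rule AA_module[OF P])
  note tc = tm_closed[OF S P P.i_hom]
  have c: "N S x \<in> carrier S" "N S y \<in> carrier S" "D S x y \<in> carrier S" "D S y x \<in> carrier S"
    using S x y by simp_all
  let ?g = "FA.ext S P i \<rho>"
  note gl = FA.ext_linear[OF S P P.i_hom isom_lin]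
  let ?v = "tm P i x \<oplus>\<^bsub>AA P\<^esub> t \<odot>\<^bsub>AA P\<^esub> tm P i y"
  show ?thesis
  proof (rule D_eqI[OF P' isom_closed(1)[OF x] isom_closed(1)[OF y] c(1,3)])
    have "tm P i (\<rho> x) \<oplus>\<^bsub>AA P\<^esub> t \<odot>\<^bsub>AA P\<^esub> tm P i (\<rho> y) = ?g ?v"
      using x y by (simp add: linear_maps_add[OF gl] linear_maps_smult[OF gl] FA.ext_apply[OF S P P.i_hom isom_lin] tc)
    moreover have "N P (?g ?v) = N P ?v"
      using pn P P.i_hom x y unfolding preserves_norm_def by (simp add: tc)
    moreover have "N P ?v = cubic_poly P \<one>\<^bsub>P\<^esub> t (i (N S x)) (i (D S x y)) (i (D S y x)) (i (N S y))"
      using N_linear_comb[OF S x y P P.i_hom P.P.one_closed P.t_closed] x by (simp add: tc)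
    ultimately show "N P (tm P i (\<rho> x) \<oplus>\<^bsub>AA P\<^esub> t \<odot>\<^bsub>AA P\<^esub> tm P i (\<rho> y)) =
      i (N S x) \<oplus>\<^bsub>P\<^esub> i (D S x y) \<otimes>\<^bsub>P\<^esub> t \<oplus>\<^bsub>P\<^esub> t \<otimes>\<^bsub>P\<^esub> t \<otimes>\<^bsub>P\<^esub> (i (D S y x) \<oplus>\<^bsub>P\<^esub> t \<otimes>\<^bsub>P\<^esub> i (N S y))"
      using c by (simp add: P.P.r_distr P.P.a_assoc P.P.m_ac)
  qed (use c in simp)
qed

lemma isom_sharp:
  assumes x: "x \<in> carrier (AA S)"
  shows "sharp S (\<rho> x) = dagger R A S \<rho> (sharp S x)"
proof (rule T_eqI[OF S])
  fix w assume w: "w \<in> carrier (AA S)"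
  note inv = general_linear_inverse_map[OF \<rho> AA_module[OF S]]
  \<comment> \<open>By surjectivity of \<rho> the test vector is \<rho> of something, to which both
    the invariance of D and the identity for the dagger apply.\<close>
  let ?w = "inverse_map (AA S) \<rho> w"
  have w': "?w \<in> carrier (AA S)"
    by (rule linear_maps_closed[OF general_linear_linear[OF inv(1)] w])
  have "T S (sharp S (\<rho> x)) (\<rho> ?w) = T S (dagger R A S \<rho> (sharp S x)) (\<rho> ?w)"
    using T_dagger[OF S \<rho> w', of "sharp S x"] x w' S T_comm[OF S, of "\<rho> ?w"] T_comm[OF S, of ?w]
    by (simp add: gradient isom_D isom_closed del: restrict_apply restrict_apply')
  then show "T S (sharp S (\<rho> x)) w = T S (dagger R A S \<rho> (sharp S x)) w"
    unfolding inv(2)[OF w] .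
qed (use x S in \<open>simp_all add: isom_closed\<close>)

lemma isom_X:
  assumes "x \<in> carrier (AA S)" "y \<in> carrier (AA S)"
  shows "X S (\<rho> x) (\<rho> y) = dagger R A S \<rho> (X S x y)"
  by (rule X_of_sharp[OF S isom_lin isom_dagger_lin isom_sharp assms])

text \<open>The two linearizations of the adjoint identity express \<open>b\<^sup>\<sharp>\<close>, for \<open>b\<close> in the image of
  \<open>e \<times> _\<close>, through operations already known to be compatible with \<open>\<rho>\<close>; a general \<open>b\<close> is
  \<open>T(b, e) e - e \<times> b\<close>.\<close>

lemma isom_sharp_dagger:
  assumes z: "z \<in> carrier (AA S)"
  shows "sharp S (dagger R A S \<rho> z) = \<rho> (sharp S z)"
proof -
  interpret S: cring S by (rule algebra.M_cring[OF S])
  interpret AS: module S "AA S" by (rule AA_module[OF S])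
  let ?d = "dagger R A S \<rho>"
  note e = e_closed[OF S]
  note rl = linear_maps_add[OF isom_lin] linear_maps_smult[OF isom_lin]
  note dl = linear_maps_add[OF isom_dagger_lin] linear_maps_smult[OF isom_dagger_lin]
  note [simp] = isom_closed sharp_closed[OF S] X_closed[OF S] D_closed[OF S] N_closed[OF S] e T_closed[OF S]
  \<comment> \<open>Since e is its own adjoint, the dagger sends e to (\<rho> e)^#, and the adjoint
    identity with N(\<rho> e) = 1 applies.\<close>
  have a: "sharp S (?d (e S)) = \<rho> (e S)"
  proof -
    have "?d (e S) = sharp S (\<rho> (e S))" using isom_sharp[OF e] by (simp add: sharp_e[OF S])
    then show ?thesis using sharp_sharp[OF S, of "\<rho> (e S)"] by (simp add: isom_N N_e[OF S])
  qed
  have b: "X S (?d (sharp S x)) (?d (X S x y)) = \<rho> (X S (sharp S x) (X S x y))"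
    if "x \<in> carrier (AA S)" "y \<in> carrier (AA S)" for x y
    using adjoint_identity_linearized(1)[OF S, of "\<rho> x" "\<rho> y"] adjoint_identity_linearized(1)[OF S that] that
    by (simp add: isom_N isom_D isom_sharp isom_X rl)
  have c: "sharp S (?d (X S x y)) \<oplus>\<^bsub>AA S\<^esub> X S (?d (sharp S x)) (?d (sharp S y)) =
      \<rho> (sharp S (X S x y)) \<oplus>\<^bsub>AA S\<^esub> \<rho> (X S (sharp S x) (sharp S y))"
    if "x \<in> carrier (AA S)" "y \<in> carrier (AA S)" for x y
  proof -
    have "sharp S (?d (X S x y)) \<oplus>\<^bsub>AA S\<^esub> X S (?d (sharp S x)) (?d (sharp S y)) =
        \<rho> (sharp S (X S x y) \<oplus>\<^bsub>AA S\<^esub> X S (sharp S x) (sharp S y))"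
      using adjoint_identity_linearized(2)[OF S, of "\<rho> x" "\<rho> y"] adjoint_identity_linearized(2)[OF S that] that
      by (simp add: isom_N isom_D isom_sharp isom_X rl(1)[of "D S x y \<odot>\<^bsub>AA S\<^esub> y"] rl(2))
    then show ?thesis using that by (simp add: rl)
  qed
  have ee: "X S (?d (e S)) (?d (e S)) = \<rho> (X S (e S) (e S))"
    by (simp add: X_self[OF S] a rl sharp_e[OF S])
  \<comment> \<open>\<open>b\<close> at x = e settles the vectors of the form e cross y, and
    \<open>ee\<close> settles multiples of e. As e cross y plus y is a multiple of e, additivity
    gives every y.\<close>
  have Xe: "X S (?d (e S)) (?d y) = \<rho> (X S (e S) y)" if y: "y \<in> carrier (AA S)" for y
  proof -
    have sum: "X S (e S) y \<oplus>\<^bsub>AA S\<^esub> y = T S y (e S) \<odot>\<^bsub>AA S\<^esub> e S"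
      using y by (simp add: X_e[OF S] AS.minus_eq AS.a_assoc AS.l_neg)
    have "X S (?d (e S)) (?d (X S (e S) y)) \<oplus>\<^bsub>AA S\<^esub> X S (?d (e S)) (?d y) =
        X S (?d (e S)) (?d (T S y (e S) \<odot>\<^bsub>AA S\<^esub> e S))"
      using y by (simp add: dl X_add_right[OF S] flip: sum)
    also have "\<dots> = \<rho> (X S (e S) (T S y (e S) \<odot>\<^bsub>AA S\<^esub> e S))"
      using y by (simp add: dl rl X_smult_right[OF S] ee)
    also have "\<dots> = X S (?d (e S)) (?d (X S (e S) y)) \<oplus>\<^bsub>AA S\<^esub> \<rho> (X S (e S) y)"
      using y b[OF e y] by (simp add: rl X_add_right[OF S] sharp_e[OF S] flip: sum)
    finally show ?thesis by (rule AS.sum_left_cancel) (use y in simp_all)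
  qed
  \<comment> \<open>Abbreviations for the decomposition z = T(z, e) e - (e cross z). The sign is
    kept as the scalar -1, so that the rules for scalar multiples inside the adjoint and the cross
    product apply to it.\<close>
  let ?v = "X S (e S) z" and ?\<tau> = "T S z (e S)" and ?m = "\<ominus>\<^bsub>S\<^esub> \<one>\<^bsub>S\<^esub>"
  \<comment> \<open>In \<open>c\<close> at x = e the second summands agree by \<open>Xe\<close> for
    z^# and cancel.\<close>
  have v: "sharp S (?d ?v) = \<rho> (sharp S ?v)"
    using c[OF e z] z Xe[of "sharp S z"] by (simp add: sharp_e[OF S])
  have zv: "z = ?\<tau> \<odot>\<^bsub>AA S\<^esub> e S \<oplus>\<^bsub>AA S\<^esub> ?m \<odot>\<^bsub>AA S\<^esub> ?v"
    using z by (simp add: X_e[OF S] AS.smult_l_minus AS.minus_eq AS.minus_add AS.minus_minus AS.a_ac AS.r_neg AS.r_neg1)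
  have expand: "sharp S (?\<tau> \<odot>\<^bsub>AA S\<^esub> x \<oplus>\<^bsub>AA S\<^esub> ?m \<odot>\<^bsub>AA S\<^esub> y) = (?\<tau> \<otimes>\<^bsub>S\<^esub> ?\<tau>) \<odot>\<^bsub>AA S\<^esub> sharp S x
      \<oplus>\<^bsub>AA S\<^esub> ?m \<odot>\<^bsub>AA S\<^esub> (?\<tau> \<odot>\<^bsub>AA S\<^esub> X S x y) \<oplus>\<^bsub>AA S\<^esub> (?m \<otimes>\<^bsub>S\<^esub> ?m) \<odot>\<^bsub>AA S\<^esub> sharp S y"
    if "x \<in> carrier (AA S)" "y \<in> carrier (AA S)" for x y
    using that z by (simp add: sharp_add[OF S] sharp_smult[OF S] X_smult_left[OF S] X_smult_right[OF S] del: S.l_minus S.r_minus)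
  have "sharp S (?d z) = sharp S (?\<tau> \<odot>\<^bsub>AA S\<^esub> ?d (e S) \<oplus>\<^bsub>AA S\<^esub> ?m \<odot>\<^bsub>AA S\<^esub> ?d ?v)"
    using z by (subst zv) (simp add: dl)
  also have "\<dots> = \<rho> ((?\<tau> \<otimes>\<^bsub>S\<^esub> ?\<tau>) \<odot>\<^bsub>AA S\<^esub> sharp S (e S)
      \<oplus>\<^bsub>AA S\<^esub> ?m \<odot>\<^bsub>AA S\<^esub> (?\<tau> \<odot>\<^bsub>AA S\<^esub> X S (e S) ?v) \<oplus>\<^bsub>AA S\<^esub> (?m \<otimes>\<^bsub>S\<^esub> ?m) \<odot>\<^bsub>AA S\<^esub> sharp S ?v)"
    using z by (simp add: expand a v Xe rl sharp_e[OF S] del: S.l_minus S.r_minus)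
  also have "\<dots> = \<rho> (sharp S (?\<tau> \<odot>\<^bsub>AA S\<^esub> e S \<oplus>\<^bsub>AA S\<^esub> ?m \<odot>\<^bsub>AA S\<^esub> ?v))"
    using z by (subst expand) simp_all
  also have "\<dots> = \<rho> (sharp S z)"
    using zv by simp
  finally show ?thesis .
qed

lemma isom_X_dagger:
  assumes "x \<in> carrier (AA S)" "y \<in> carrier (AA S)"
  shows "X S (dagger R A S \<rho> x) (dagger R A S \<rho> y) = \<rho> (X S x y)"
  by (rule X_of_sharp[OF S isom_dagger_lin isom_lin isom_sharp_dagger assms])

end

text \<open>Unlike in \<open>brown_iota\<close>, the second map is not tied to the first. An
  automorphism fixing j is first found in this form, and only afterwards is \<open>g\<close>
  recognized as the dagger of \<open>f\<close>.\<close>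

definition brown_diag :: "'u rring \<Rightarrow> (('a, 'u) tensor \<Rightarrow> ('a, 'u) tensor) \<Rightarrow> (('a, 'u) tensor \<Rightarrow> ('a, 'u) tensor) \<Rightarrow>
    ('a, 'u) brown_matrix \<Rightarrow> ('a, 'u) brown_matrix" where
  "brown_diag S f g = (\<lambda>(r, a, b, s)\<in>carrier (B S). (r, f a, g b, s))"

lemma brown_diag_apply [simp]:
  "r \<in> carrier S \<Longrightarrow> a \<in> carrier (AA S) \<Longrightarrow> b \<in> carrier (AA S) \<Longrightarrow> s \<in> carrier S \<Longrightarrow>
    brown_diag S f g (r, a, b, s) = (r, f a, g b, s)"
  by (simp add: brown_diag_def)

lemma brown_iota_eq: "brown_iota R A S \<rho> = brown_diag S \<rho> (dagger R A S \<rho>)"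
  by (simp add: brown_iota_def brown_diag_def)

lemma brown_diag_linear:
  assumes f: "f \<in> linear_maps S (AA S) (AA S)" and g: "g \<in> linear_maps S (AA S) (AA S)" and S: "algebra R S"
  shows "brown_diag S f g \<in> linear_maps S (B S) (B S)"
proof -
  interpret S: cring S by (rule algebra.M_cring[OF S])
  interpret AS: module S "AA S" by (rule AA_module[OF S])
  show ?thesis
    by (rule linear_mapsI)
      (auto elim!: brown_cases simp: linear_maps_closed[OF f] linear_maps_closed[OF g] linear_maps_add[OF f]
        linear_maps_add[OF g] linear_maps_smult[OF f] linear_maps_smult[OF g], simp add: brown_diag_def)
qed

lemma brown_diag_general_linear:
  assumes f: "f \<in> general_linear S (AA S)" and g: "g \<in> general_linear S (AA S)" and S: "algebra R S"
  shows "brown_diag S f g \<in> general_linear S (B S)"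
proof -
  note fi = general_linear_inverse_map[OF f AA_module[OF S]]
  note gi = general_linear_inverse_map[OF g AA_module[OF S]]
  note lin = f[THEN general_linear_linear] g[THEN general_linear_linear] fi(1)[THEN general_linear_linear] gi(1)[THEN general_linear_linear]
  show ?thesis
    by (rule general_linearI[OF brown_diag_linear[OF lin(1,2) S] brown_diag_linear[OF lin(3,4) S]])
      (auto elim!: brown_cases simp: lin[THEN linear_maps_closed] fi gi simp del: restrict_apply restrict_apply')
qed

text \<open>Multiplicativity is checked by entries: the diagonal ones require invariance of T, the
  off-diagonal ones the two cross product relations. Unit and involution are respected by the
  diagonal shape and linearity.\<close>

lemma brown_diag_preserves:
  assumes S: "algebra R S" and f: "f \<in> linear_maps S (AA S) (AA S)" and g: "g \<in> linear_maps S (AA S) (AA S)"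
    and T: "\<And>x y. x \<in> carrier (AA S) \<Longrightarrow> y \<in> carrier (AA S) \<Longrightarrow> T S (f x) (g y) = T S x y"
    and Xf: "\<And>x y. x \<in> carrier (AA S) \<Longrightarrow> y \<in> carrier (AA S) \<Longrightarrow> X S (f x) (f y) = g (X S x y)"
    and Xg: "\<And>x y. x \<in> carrier (AA S) \<Longrightarrow> y \<in> carrier (AA S) \<Longrightarrow> X S (g x) (g y) = f (X S x y)"
  shows "preserves_brown S (brown_diag S f g)"
proof -
  interpret S: cring S by (rule algebra.M_cring[OF S])
  interpret AS: module S "AA S" by (rule AA_module[OF S])
  note cl = X_closed[OF S] T_closed[OF S] linear_maps_closed[OF f] linear_maps_closed[OF g]
  show ?thesis
    unfolding preserves_brown_def
    using linear_maps_zero[OF f AA_module[OF S] AA_module[OF S]] linear_maps_zero[OF g AA_module[OF S] AA_module[OF S]]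
    by (auto elim!: brown_cases simp: cl linear_maps_add[OF f] linear_maps_add[OF g] linear_maps_smult[OF f]
        linear_maps_smult[OF g] T Xf Xg)
qed

lemma brown_diag_compose:
  assumes "f' \<in> linear_maps S (AA S) (AA S)" "g' \<in> linear_maps S (AA S) (AA S)"
  shows "compose (carrier (B S)) (brown_diag S f g) (brown_diag S f' g') =
    brown_diag S (compose (carrier (AA S)) f f') (compose (carrier (AA S)) g g')"
proof (rule extensionalityI[of _ "carrier (B S)"])
  fix x assume "x \<in> carrier (B S)"
  then show "compose (carrier (B S)) (brown_diag S f g) (brown_diag S f' g') x =
      brown_diag S (compose (carrier (AA S)) f f') (compose (carrier (AA S)) g g') x"
    by (elim brown_cases)
      (simp add: compose_eq linear_maps_closed[OF assms(1)] linear_maps_closed[OF assms(2)])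
qed (simp_all add: brown_diag_def)

lemma brown_diag_ext:
  assumes S: "algebra R S" and S': "algebra R S'" and \<phi>: "\<phi> \<in> rring_hom R S S'"
    and f: "f \<in> linear_maps S (AA S) (AA S)" and g: "g \<in> linear_maps S (AA S) (AA S)"
  shows "FB.ext S S' \<phi> (brown_diag S f g) = brown_diag S' (FA.ext S S' \<phi> f) (FA.ext S S' \<phi> g)"
proof (rule FB.ext_eqI[OF S S' \<phi>])
  show "brown_diag S' (FA.ext S S' \<phi> f) (FA.ext S S' \<phi> g) \<in> linear_maps S' (B S') (B S')"
    by (rule brown_diag_linear[OF FA.ext_linear[OF S S' \<phi> f] FA.ext_linear[OF S S' \<phi> g] S'])
  fix x assume "x \<in> carrier (B S)"
  then show "brown_diag S' (FA.ext S S' \<phi> f) (FA.ext S S' \<phi> g) (bm S' \<phi> x) = bm S' \<phi> (brown_diag S f g x)"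
    by (elim brown_cases)
      (simp add: rring_hom_closed[OF \<phi>] tm_closed[OF S S' \<phi>] FA.ext_apply[OF S S' \<phi> f] FA.ext_apply[OF S S' \<phi> g])
qed

text \<open>The defining identity of the dagger holds on the image of A over S, because T is
  natural. This image spans, and bilinearity extends the identity, first in y and then in x.\<close>

lemma dagger_ext:
  assumes S: "algebra R S" and S': "algebra R S'" and \<phi>: "\<phi> \<in> rring_hom R S S'" and \<rho>: "\<rho> \<in> general_linear S (AA S)"
  shows "dagger R A S' (FA.ext S S' \<phi> \<rho>) = FA.ext S S' \<phi> (dagger R A S \<rho>)"
proof (rule dagger_eqI[OF S' FA.ext_general_linear[OF S S' \<phi> \<rho>]])
  interpret AS': module S' "AA S'" by (rule AA_module[OF S'])
  note rl = general_linear_linear[OF \<rho>] and dl = general_linear_linear[OF dagger_general_linear[OF S \<rho>]]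
  let ?r = "FA.ext S S' \<phi> \<rho>" and ?d = "FA.ext S S' \<phi> (dagger R A S \<rho>)"
  show dl': "?d \<in> linear_maps S' (AA S') (AA S')" by (rule FA.ext_linear[OF S S' \<phi> dl])
  have rl': "?r \<in> linear_maps S' (AA S') (AA S')" by (rule FA.ext_linear[OF S S' \<phi> rl])
  note l = linear_maps_closed[OF rl'] linear_maps_closed[OF dl'] linear_maps_add[OF rl'] linear_maps_add[OF dl']
    linear_maps_smult[OF rl'] linear_maps_smult[OF dl']
  note T_bil = T_add_left[OF S'] T_add_right[OF S'] T_smult_left[OF S'] T_smult_right[OF S']
  note tc = tm_closed[OF S S' \<phi>]
  have 1: "T S' (?r (tm S' \<phi> x)) (?d y) = T S' (tm S' \<phi> x) y" if x: "x \<in> carrier (AA S)" and y: "y \<in> carrier (AA S')" for x y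
    using S S' \<phi> y
  proof (induction rule: base_change_span_induct)
    case (image y)
    then show ?case
      using x T_dagger[OF S \<rho> x image] linear_maps_closed[OF rl] linear_maps_closed[OF dl]
      by (simp add: FA.ext_apply[OF S S' \<phi> rl] FA.ext_apply[OF S S' \<phi> dl] T_map[OF S S' \<phi>])
  qed (use x in \<open>simp_all add: l tc T_bil\<close>)
  fix x y assume x: "x \<in> carrier (AA S')" and y: "y \<in> carrier (AA S')"
  show "T S' (?r x) (?d y) = T S' x y"
    using S S' \<phi> x
    by (induction rule: base_change_span_induct) (use y 1 in \<open>simp_all add: l tc T_bil\<close>)
qed

lemma iota_in_Aut:
  assumes S: "algebra R S" and \<rho>: "\<rho> \<in> general_linear S (AA S)" "preserves_norm S \<rho>"
  shows "brown_iota R A S \<rho> \<in> carrier (points (Aut_brown R A) S)"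
  unfolding brown_iota_eq Aut_brown_carrier
  using brown_diag_general_linear[OF \<rho>(1) dagger_general_linear[OF S \<rho>(1)] S]
    brown_diag_preserves[OF S isom_lin[OF S \<rho>] isom_dagger_lin[OF S \<rho>] T_dagger[OF S \<rho>(1)] isom_X[OF S \<rho>] isom_X_dagger[OF S \<rho>]]
  by simp

lemma iota_group_functor_hom:
  "group_functor_hom R (Isom_norm R A) (Aut_brown R A) (brown_iota R A)"
  unfolding group_functor_hom_def
proof (intro conjI allI impI ballI Isom_norm_group_functor Aut_brown_group_functor; (elim conjE)?)
  fix S :: "'u rring" assume S: "algebra R S"
  show "brown_iota R A S \<in> hom (points (Isom_norm R A) S) (points (Aut_brown R A) S)"
  proof (rule homI)
    fix \<rho> assume "\<rho> \<in> carrier (points (Isom_norm R A) S)"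
    then have \<rho>: "\<rho> \<in> general_linear S (AA S)" "preserves_norm S \<rho>" by (simp_all add: Isom_norm_carrier)
    show i\<rho>: "brown_iota R A S \<rho> \<in> carrier (points (Aut_brown R A) S)"
      by (rule iota_in_Aut[OF S \<rho>])
    fix \<rho>' assume "\<rho>' \<in> carrier (points (Isom_norm R A) S)"
    then have \<rho>': "\<rho>' \<in> general_linear S (AA S)" "preserves_norm S \<rho>'" by (simp_all add: Isom_norm_carrier)
    have i\<rho>': "brown_iota R A S \<rho>' \<in> carrier (points (Aut_brown R A) S)"
      by (rule iota_in_Aut[OF S \<rho>'])
    note lin = general_linear_linear[OF \<rho>(1)] general_linear_linear[OF \<rho>'(1)]
      general_linear_linear[OF dagger_general_linear[OF S \<rho>(1)]] general_linear_linear[OF dagger_general_linear[OF S \<rho>'(1)]]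
    \<comment> \<open>The dagger combines two order-reversing operations, adjoint and inverse, so it
      keeps the order of composition.\<close>
    have dag: "dagger R A S (compose (carrier (AA S)) \<rho> \<rho>') = compose (carrier (AA S)) (dagger R A S \<rho>) (dagger R A S \<rho>')"
      by (rule dagger_eqI[OF S general_linear_compose[OF \<rho>(1) \<rho>'(1) AA_module[OF S]] linear_maps_compose[OF lin(3,4) AA_module[OF S]]])
        (simp add: compose_eq T_dagger[OF S \<rho>(1)] T_dagger[OF S \<rho>'(1)] linear_maps_closed[OF lin(2)] linear_maps_closed[OF lin(4)])
    have "\<rho> \<otimes>\<^bsub>points (Isom_norm R A) S\<^esub> \<rho>' = compose (carrier (AA S)) \<rho> \<rho>'"
      using general_linear_Bij[OF \<rho>(1)] general_linear_Bij[OF \<rho>'(1)] by (simp add: Isom_norm_def BijGroup_def)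
    moreover have "brown_iota R A S \<rho> \<otimes>\<^bsub>points (Aut_brown R A) S\<^esub> brown_iota R A S \<rho>' =
        compose (carrier (B S)) (brown_iota R A S \<rho>) (brown_iota R A S \<rho>')"
      using i\<rho> i\<rho>' general_linear_Bij unfolding Aut_brown_carrier by (auto simp: Aut_brown_def BijGroup_def)
    ultimately show "brown_iota R A S (\<rho> \<otimes>\<^bsub>points (Isom_norm R A) S\<^esub> \<rho>') =
        brown_iota R A S \<rho> \<otimes>\<^bsub>points (Aut_brown R A) S\<^esub> brown_iota R A S \<rho>'"
      by (simp add: brown_iota_eq dag brown_diag_compose[OF lin(2,4)])
  qed
next
  fix S S' :: "'u rring" and \<phi> \<rho>
  assume S: "algebra R S" and S': "algebra R S'" and \<phi>: "\<phi> \<in> rring_hom R S S'"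
    and "\<rho> \<in> carrier (points (Isom_norm R A) S)"
  then have \<rho>: "\<rho> \<in> general_linear S (AA S)" by (simp add: Isom_norm_carrier)
  note lin = general_linear_linear[OF \<rho>] general_linear_linear[OF dagger_general_linear[OF S \<rho>]]
  show "brown_iota R A S' (induced (Isom_norm R A) S S' \<phi> \<rho>) = induced (Aut_brown R A) S S' \<phi> (brown_iota R A S \<rho>)"
    by (simp add: Isom_norm_def Aut_brown_def brown_iota_eq dagger_ext[OF S S' \<phi> \<rho>] brown_diag_ext[OF S S' \<phi> lin])
qed

end

section \<open>The sign of an automorphism\<close>

lemma (in abelian_group) add_cancel_mid:
  assumes "a \<in> carrier G" "b \<in> carrier G" "c \<in> carrier G"
  shows "(a \<oplus> b) \<oplus> (c \<oplus> \<ominus> b) = a \<oplus> c"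
proof -
  have "(a \<oplus> b) \<oplus> (c \<oplus> \<ominus> b) = (a \<oplus> c) \<oplus> (b \<oplus> \<ominus> b)"
    using assms by (simp only: a_ac a_closed a_inv_closed)
  then show ?thesis using assms by (simp add: r_neg)
qed

lemma mu2_carrier: "cring S \<Longrightarrow> carrier (points mu2 S) = {\<epsilon> \<in> carrier S. \<epsilon> \<otimes>\<^bsub>S\<^esub> \<epsilon> = \<one>\<^bsub>S\<^esub>}"
proof -
  assume "cring S"
  then interpret S: cring S .
  show ?thesis by (auto simp: mu2_def numeral_2_eq_2)
qed

lemma mu2_mult [simp]: "x \<otimes>\<^bsub>points mu2 S\<^esub> y = x \<otimes>\<^bsub>S\<^esub> y"
  and mu2_one [simp]: "\<one>\<^bsub>points mu2 S\<^esub> = \<one>\<^bsub>S\<^esub>"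
  and mu2_induced [simp]: "induced mu2 S S' \<phi> = \<phi>"
  by (simp_all add: mu2_def)

lemma mu2_group_functor: "is_group_functor R mu2"
proof -
  have group: "group (points mu2 S)" if S: "algebra R S" for S :: "'a rring"
  proof -
    interpret S: cring S by (rule algebra.M_cring[OF S])
    show ?thesis
    proof (rule groupI)
      show "x \<otimes>\<^bsub>points mu2 S\<^esub> y \<in> carrier (points mu2 S)"
        if "x \<in> carrier (points mu2 S)" "y \<in> carrier (points mu2 S)" for x y
      proof -
        have "x \<otimes>\<^bsub>S\<^esub> y \<otimes>\<^bsub>S\<^esub> (x \<otimes>\<^bsub>S\<^esub> y) = (x \<otimes>\<^bsub>S\<^esub> x) \<otimes>\<^bsub>S\<^esub> (y \<otimes>\<^bsub>S\<^esub> y)"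
          using that by (simp add: mu2_carrier S.is_cring S.m_ac)
        then show ?thesis using that by (simp add: mu2_carrier S.is_cring)
      qed
    qed (auto simp: mu2_carrier S.is_cring S.m_assoc)
  qed
  have hom: "\<phi> \<in> hom (points mu2 S) (points mu2 S')"
    if S: "algebra R S" and S': "algebra R S'" and \<phi>: "\<phi> \<in> rring_hom R S S'" for S S' :: "'a rring" and \<phi>
  proof -
    interpret phi: ring_hom_cring S S' \<phi> by (rule rring_hom_cring[OF S S' \<phi>])
    show ?thesis
      by (rule homI) (auto simp: mu2_carrier phi.R.is_cring phi.S.is_cring simp flip: phi.hom_mult)
  qed
  show ?thesis
    unfolding is_group_functor_def using group hom by simp
qed

definition half :: "('u, 'm) ring_scheme \<Rightarrow> 'u" where
  "half S = inv\<^bsub>S\<^esub> (\<one>\<^bsub>S\<^esub> \<oplus>\<^bsub>S\<^esub> \<one>\<^bsub>S\<^esub>)"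

context albert
begin

section \<open>The sign homomorphism when 2 is invertible\<close>

context
  assumes two: "\<one>\<^bsub>R\<^esub> \<oplus>\<^bsub>R\<^esub> \<one>\<^bsub>R\<^esub> \<in> Units R"
begin

lemma two_unit:
  assumes S: "algebra R S"
  shows "\<one>\<^bsub>S\<^esub> \<oplus>\<^bsub>S\<^esub> \<one>\<^bsub>S\<^esub> \<in> Units S"
proof -
  interpret S: cring S by (rule algebra.M_cring[OF S])
  interpret f: ring_hom_cring R S "\<lambda>r. r \<odot>\<^bsub>S\<^esub> \<one>\<^bsub>S\<^esub>"
    by (rule ring_hom_cringI[OF R.is_cring S.is_cring algebra_ring_hom[OF S]])
  obtain h where h: "h \<in> carrier R" "h \<otimes>\<^bsub>R\<^esub> (\<one>\<^bsub>R\<^esub> \<oplus>\<^bsub>R\<^esub> \<one>\<^bsub>R\<^esub>) = \<one>\<^bsub>R\<^esub>"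
    using two by (auto simp: Units_def)
  have "(h \<odot>\<^bsub>S\<^esub> \<one>\<^bsub>S\<^esub>) \<otimes>\<^bsub>S\<^esub> (\<one>\<^bsub>S\<^esub> \<oplus>\<^bsub>S\<^esub> \<one>\<^bsub>S\<^esub>) = \<one>\<^bsub>S\<^esub>"
    using arg_cong[OF h(2), of "\<lambda>r. r \<odot>\<^bsub>S\<^esub> \<one>\<^bsub>S\<^esub>"] h(1) by (simp only: f.hom_mult f.hom_add f.hom_one R.one_closed R.a_closed)
  then show ?thesis
    using h(1) S.m_comm[of "h \<odot>\<^bsub>S\<^esub> \<one>\<^bsub>S\<^esub>" "\<one>\<^bsub>S\<^esub> \<oplus>\<^bsub>S\<^esub> \<one>\<^bsub>S\<^esub>"] f.hom_closed[OF h(1)] by (auto simp: Units_def)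
qed

lemma half_closed [simp]: "algebra R S \<Longrightarrow> half S \<in> carrier S"
proof -
  assume S: "algebra R S"
  interpret S: cring S by (rule algebra.M_cring[OF S])
  show ?thesis unfolding half_def by (rule S.Units_inv_closed[OF two_unit[OF S]])
qed

lemma half_two:
  assumes S: "algebra R S"
  shows "half S \<oplus>\<^bsub>S\<^esub> half S = \<one>\<^bsub>S\<^esub>"
proof -
  interpret S: cring S by (rule algebra.M_cring[OF S])
  have "half S \<otimes>\<^bsub>S\<^esub> (\<one>\<^bsub>S\<^esub> \<oplus>\<^bsub>S\<^esub> \<one>\<^bsub>S\<^esub>) = \<one>\<^bsub>S\<^esub>"
    unfolding half_def by (rule S.Units_l_inv[OF two_unit[OF S]])
  then show ?thesis using S by (simp add: S.r_distr)
qed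

lemma half_map:
  assumes S: "algebra R S" and S': "algebra R S'" and \<phi>: "\<phi> \<in> rring_hom R S S'"
  shows "\<phi> (half S) = half S'"
proof -
  interpret phi: ring_hom_cring S S' \<phi> by (rule rring_hom_cring[OF S S' \<phi>])
  have d: "\<phi> (half S) \<oplus>\<^bsub>S'\<^esub> \<phi> (half S) = \<one>\<^bsub>S'\<^esub>"
    using arg_cong[OF half_two[OF S], of \<phi>] S by simp
  have "\<phi> (half S) = \<phi> (half S) \<otimes>\<^bsub>S'\<^esub> (half S' \<oplus>\<^bsub>S'\<^esub> half S')"
    using S half_two[OF S'] by simp
  also have "\<dots> = (\<phi> (half S) \<oplus>\<^bsub>S'\<^esub> \<phi> (half S)) \<otimes>\<^bsub>S'\<^esub> half S'"
    using S S' by (simp add: phi.S.r_distr phi.S.l_distr)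
  also have "\<dots> = half S'" using S' by (simp add: d)
  finally show ?thesis .
qed

lemma double_cancel:
  assumes S: "algebra R S" and M: "module S M" and x: "x \<in> carrier M" and y: "y \<in> carrier M"
    and eq: "x \<oplus>\<^bsub>M\<^esub> x = y \<oplus>\<^bsub>M\<^esub> y"
  shows "x = y"
proof -
  interpret M: module S M by fact
  have "half S \<odot>\<^bsub>M\<^esub> (z \<oplus>\<^bsub>M\<^esub> z) = z" if "z \<in> carrier M" for z
    using that S half_two[OF S] by (simp add: M.smult_r_distr flip: M.smult_l_distr)
  then show ?thesis using x y eq by metis
qed

lemma brown_j_closed:
  assumes S: "algebra R S"
  shows "brown_j R A S \<in> carrier (B S)"
proof -
  interpret S: cring S by (rule algebra.M_cring[OF S])
  interpret AS: module S "AA S" by (rule AA_module[OF S])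
  show ?thesis by (simp add: brown_j_def)
qed

lemma X_zero:
  assumes S: "algebra R S" and x: "x \<in> carrier (AA S)"
  shows "X S \<zero>\<^bsub>AA S\<^esub> x = \<zero>\<^bsub>AA S\<^esub>" "X S x \<zero>\<^bsub>AA S\<^esub> = \<zero>\<^bsub>AA S\<^esub>"
proof -
  interpret S: cring S by (rule algebra.M_cring[OF S])
  interpret AS: module S "AA S" by (rule AA_module[OF S])
  show "X S \<zero>\<^bsub>AA S\<^esub> x = \<zero>\<^bsub>AA S\<^esub>"
    using X_smult_left[OF S AS.zero_closed S.zero_closed x] x S by simp
  then show "X S x \<zero>\<^bsub>AA S\<^esub> = \<zero>\<^bsub>AA S\<^esub>" using X_comm[OF S x AS.zero_closed] by simp
qed

lemma T_zero:
  assumes S: "algebra R S" and x: "x \<in> carrier (AA S)"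
  shows "T S \<zero>\<^bsub>AA S\<^esub> x = \<zero>\<^bsub>S\<^esub>" "T S x \<zero>\<^bsub>AA S\<^esub> = \<zero>\<^bsub>S\<^esub>"
proof -
  interpret S: cring S by (rule algebra.M_cring[OF S])
  interpret AS: module S "AA S" by (rule AA_module[OF S])
  show "T S \<zero>\<^bsub>AA S\<^esub> x = \<zero>\<^bsub>S\<^esub>"
    using T_smult_left[OF S AS.zero_closed S.zero_closed x] x S by simp
  then show "T S x \<zero>\<^bsub>AA S\<^esub> = \<zero>\<^bsub>S\<^esub>" using T_comm[OF S x AS.zero_closed] by simp
qed

lemma Aut_brownD:
  assumes "\<rho> \<in> carrier (points (Aut_brown R A) S)"
  shows "\<rho> \<in> general_linear S (B S)" "\<rho> \<in> linear_maps S (B S) (B S)" "preserves_brown S \<rho>"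
    "\<And>x y. x \<in> carrier (B S) \<Longrightarrow> y \<in> carrier (B S) \<Longrightarrow> \<rho> (x \<otimes>\<^bsub>B S\<^esub> y) = \<rho> x \<otimes>\<^bsub>B S\<^esub> \<rho> y"
    "\<rho> \<one>\<^bsub>B S\<^esub> = \<one>\<^bsub>B S\<^esub>"
    "\<And>x. x \<in> carrier (B S) \<Longrightarrow> \<rho> (brown_involution x) = brown_involution (\<rho> x)"
  using assms general_linear_linear unfolding Aut_brown_carrier preserves_brown_def by blast+

lemma Aut_brown_ext:
  assumes "algebra R S" "algebra R S'" "\<phi> \<in> rring_hom R S S'" "\<rho> \<in> carrier (points (Aut_brown R A) S)"
  shows "FB.ext S S' \<phi> \<rho> \<in> carrier (points (Aut_brown R A) S')"
proof -
  have "induced (Aut_brown R A) S S' \<phi> \<in> hom (points (Aut_brown R A) S) (points (Aut_brown R A) S')"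
    using Aut_brown_group_functor assms(1-3) unfolding is_group_functor_def by blast
  from hom_in_carrier[OF this assms(4)] show ?thesis by (simp add: Aut_brown_def)
qed

text \<open>As 2 is invertible, the skew elements of \<open>B\<close> are the multiples of \<open>j\<close>.\<close>

lemma Aut_brown_j:
  assumes S: "algebra R S" and \<rho>: "\<rho> \<in> carrier (points (Aut_brown R A) S)"
  shows "\<exists>\<epsilon>. \<epsilon> \<in> carrier (points mu2 S) \<and> \<rho> (brown_j R A S) = \<epsilon> \<odot>\<^bsub>B S\<^esub> brown_j R A S"
proof -
  interpret S: cring S by (rule algebra.M_cring[OF S])
  interpret AS: module S "AA S" by (rule AA_module[OF S])
  note \<rho>' = Aut_brownD[OF \<rho>] and jc = brown_j_closed[OF S]
  let ?j = "brown_j R A S"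
  obtain r a b s where j: "\<rho> ?j = (r, a, b, s)" "r \<in> carrier S" "a \<in> carrier (AA S)" "b \<in> carrier (AA S)" "s \<in> carrier S"
    by (rule brown_cases[OF linear_maps_closed[OF \<rho>'(2) jc]])
  \<comment> \<open>j is skew for the involution, and automorphisms preserve skewness.\<close>
  have ij: "brown_involution ?j = (\<ominus>\<^bsub>S\<^esub> \<one>\<^bsub>S\<^esub>) \<odot>\<^bsub>B S\<^esub> ?j"
    by (simp add: brown_j_def S.l_minus)
  have "brown_involution (\<rho> ?j) = (\<ominus>\<^bsub>S\<^esub> \<one>\<^bsub>S\<^esub>) \<odot>\<^bsub>B S\<^esub> \<rho> ?j"
    unfolding \<rho>'(6)[OF jc, symmetric] ij by (rule linear_maps_smult[OF \<rho>'(2) _ jc]) simp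
  then have p: "s = (\<ominus>\<^bsub>S\<^esub> \<one>\<^bsub>S\<^esub>) \<otimes>\<^bsub>S\<^esub> r \<and> a = (\<ominus>\<^bsub>S\<^esub> \<one>\<^bsub>S\<^esub>) \<odot>\<^bsub>AA S\<^esub> a \<and>
      b = (\<ominus>\<^bsub>S\<^esub> \<one>\<^bsub>S\<^esub>) \<odot>\<^bsub>AA S\<^esub> b \<and> r = (\<ominus>\<^bsub>S\<^esub> \<one>\<^bsub>S\<^esub>) \<otimes>\<^bsub>S\<^esub> s"
    unfolding j(1) brown_involution_simp brown_smult prod.inject .
  have "(\<ominus>\<^bsub>S\<^esub> \<one>\<^bsub>S\<^esub>) \<otimes>\<^bsub>S\<^esub> r = \<ominus>\<^bsub>S\<^esub> r" "(\<ominus>\<^bsub>S\<^esub> \<one>\<^bsub>S\<^esub>) \<odot>\<^bsub>AA S\<^esub> a = \<ominus>\<^bsub>AA S\<^esub> a"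
    "(\<ominus>\<^bsub>S\<^esub> \<one>\<^bsub>S\<^esub>) \<odot>\<^bsub>AA S\<^esub> b = \<ominus>\<^bsub>AA S\<^esub> b"
    using j by (simp_all add: S.l_minus AS.smult_l_minus)
  then have eqs: "s = \<ominus>\<^bsub>S\<^esub> r" "a = \<ominus>\<^bsub>AA S\<^esub> a" "b = \<ominus>\<^bsub>AA S\<^esub> b"
    using p by metis+
  have zero: "x = \<zero>\<^bsub>AA S\<^esub>" if "x \<in> carrier (AA S)" "x = \<ominus>\<^bsub>AA S\<^esub> x" for x
  proof (rule double_cancel[OF S AA_module[OF S] that(1) AS.zero_closed])
    have "x \<oplus>\<^bsub>AA S\<^esub> x = x \<oplus>\<^bsub>AA S\<^esub> \<ominus>\<^bsub>AA S\<^esub> x" by (rule arg_cong[OF that(2)])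
    then show "x \<oplus>\<^bsub>AA S\<^esub> x = \<zero>\<^bsub>AA S\<^esub> \<oplus>\<^bsub>AA S\<^esub> \<zero>\<^bsub>AA S\<^esub>" using that(1) by (simp add: AS.r_neg)
  qed
  have \<rho>j: "\<rho> ?j = r \<odot>\<^bsub>B S\<^esub> ?j"
    using j zero[OF j(3) eqs(2)] zero[OF j(4) eqs(3)] eqs(1) by (simp add: brown_j_def S.r_minus)
  \<comment> \<open>The square of j is 1, hence so is the square of its image r j; comparing with
    the unit gives r^2 = 1.\<close>
  have jj: "?j \<otimes>\<^bsub>B S\<^esub> ?j = \<one>\<^bsub>B S\<^esub>"
    by (simp add: brown_j_def X_zero[OF S] T_zero[OF S] S.l_minus S.r_minus)
  interpret BS: module S "B S" by (rule brown_module[OF S])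
  have "\<one>\<^bsub>B S\<^esub> = \<rho> (?j \<otimes>\<^bsub>B S\<^esub> ?j)" unfolding jj by (rule \<rho>'(5)[symmetric])
  also have "\<dots> = (r \<odot>\<^bsub>B S\<^esub> ?j) \<otimes>\<^bsub>B S\<^esub> (r \<odot>\<^bsub>B S\<^esub> ?j)"
    unfolding \<rho>'(4)[OF jc jc] \<rho>j ..
  also have "\<dots> = (r \<otimes>\<^bsub>S\<^esub> r) \<odot>\<^bsub>B S\<^esub> (?j \<otimes>\<^bsub>B S\<^esub> ?j)"
    by (simp only: brown_mult_smult_left[OF S] brown_mult_smult_right[OF S] BS.smult_closed brown_mult_closed[OF S]
      BS.smult_assoc1 j(2) jc)
  finally have "\<one>\<^bsub>B S\<^esub> = (r \<otimes>\<^bsub>S\<^esub> r) \<odot>\<^bsub>B S\<^esub> \<one>\<^bsub>B S\<^esub>" unfolding jj .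
  then have "r \<otimes>\<^bsub>S\<^esub> r = \<one>\<^bsub>S\<^esub>" using j by simp
  then show ?thesis using j \<rho>j by (auto simp: mu2_carrier S.is_cring)
qed

text \<open>The upper left entry of j is 1, so \<epsilon> is the upper left entry of \<epsilon> j.
  This makes the description in \<open>brown_pi\<close> unique.\<close>

lemma brown_pi_eqI:
  assumes S: "algebra R S" and \<epsilon>: "\<epsilon> \<in> carrier (points mu2 S)" and eq: "\<rho> (brown_j R A S) = \<epsilon> \<odot>\<^bsub>B S\<^esub> brown_j R A S"
  shows "brown_pi R A S \<rho> = \<epsilon>"
proof -
  interpret S: cring S by (rule algebra.M_cring[OF S])
  show ?thesis
    unfolding brown_pi_def using \<epsilon> eq
    by (intro the_equality) (auto simp: brown_j_def mu2_carrier S.is_cring)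
qed

lemma brown_pi_props:
  assumes S: "algebra R S" and \<rho>: "\<rho> \<in> carrier (points (Aut_brown R A) S)"
  shows "brown_pi R A S \<rho> \<in> carrier (points mu2 S)"
    "\<rho> (brown_j R A S) = brown_pi R A S \<rho> \<odot>\<^bsub>B S\<^esub> brown_j R A S"
  using Aut_brown_j[OF S \<rho>] brown_pi_eqI[OF S] by auto

lemma Aut_brown_mult:
  assumes "\<rho> \<in> carrier (points (Aut_brown R A) S)" "\<sigma> \<in> carrier (points (Aut_brown R A) S)"
  shows "\<rho> \<otimes>\<^bsub>points (Aut_brown R A) S\<^esub> \<sigma> = compose (carrier (B S)) \<rho> \<sigma>"
  using general_linear_Bij[OF Aut_brownD(1)[OF assms(1)]] general_linear_Bij[OF Aut_brownD(1)[OF assms(2)]]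
  by (simp add: Aut_brown_def BijGroup_def)

lemma pi_group_functor_hom: "group_functor_hom R (Aut_brown R A) mu2 (brown_pi R A)"
  unfolding group_functor_hom_def
proof (intro conjI allI impI ballI mu2_group_functor Aut_brown_group_functor; (elim conjE)?)
  fix S :: "'u rring" assume S: "algebra R S"
  interpret S: cring S by (rule algebra.M_cring[OF S])
  interpret BS: module S "B S" by (rule brown_module[OF S])
  show "brown_pi R A S \<in> hom (points (Aut_brown R A) S) (points mu2 S)"
  proof (rule homI)
    fix \<rho> \<sigma> assume \<rho>: "\<rho> \<in> carrier (points (Aut_brown R A) S)" and \<sigma>: "\<sigma> \<in> carrier (points (Aut_brown R A) S)"
    note p = brown_pi_props[OF S \<rho>] and q = brown_pi_props[OF S \<sigma>] and jc = brown_j_closed[OF S]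
    have c: "brown_pi R A S \<rho> \<in> carrier S" "brown_pi R A S \<sigma> \<in> carrier S"
      using p q by (simp_all add: mu2_carrier S.is_cring)
    interpret mu: group "points mu2 S"
      using mu2_group_functor[of R] S by (simp add: is_group_functor_def)
    have "brown_pi R A S (compose (carrier (B S)) \<rho> \<sigma>) = brown_pi R A S \<rho> \<otimes>\<^bsub>S\<^esub> brown_pi R A S \<sigma>"
    proof (rule brown_pi_eqI[OF S])
      show "brown_pi R A S \<rho> \<otimes>\<^bsub>S\<^esub> brown_pi R A S \<sigma> \<in> carrier (points mu2 S)"
        using mu.m_closed[OF p(1) q(1)] by simp
      have "compose (carrier (B S)) \<rho> \<sigma> (brown_j R A S) = \<rho> (brown_pi R A S \<sigma> \<odot>\<^bsub>B S\<^esub> brown_j R A S)"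
        by (simp only: compose_eq jc q(2))
      also have "\<dots> = brown_pi R A S \<sigma> \<odot>\<^bsub>B S\<^esub> (brown_pi R A S \<rho> \<odot>\<^bsub>B S\<^esub> brown_j R A S)"
        by (simp only: linear_maps_smult[OF Aut_brownD(2)[OF \<rho>] c(2) jc] p(2))
      also have "\<dots> = (brown_pi R A S \<rho> \<otimes>\<^bsub>S\<^esub> brown_pi R A S \<sigma>) \<odot>\<^bsub>B S\<^esub> brown_j R A S"
        by (simp only: BS.smult_assoc1[symmetric] S.m_comm c jc)
      finally show "compose (carrier (B S)) \<rho> \<sigma> (brown_j R A S) =
        (brown_pi R A S \<rho> \<otimes>\<^bsub>S\<^esub> brown_pi R A S \<sigma>) \<odot>\<^bsub>B S\<^esub> brown_j R A S" .
    qed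
    then show "brown_pi R A S (\<rho> \<otimes>\<^bsub>points (Aut_brown R A) S\<^esub> \<sigma>) =
        brown_pi R A S \<rho> \<otimes>\<^bsub>points mu2 S\<^esub> brown_pi R A S \<sigma>"
      by (simp add: Aut_brown_mult[OF \<rho> \<sigma>])
  qed (rule brown_pi_props(1)[OF S])
next
  fix S S' :: "'u rring" and \<phi> \<rho>
  assume S: "algebra R S" and S': "algebra R S'" and \<phi>: "\<phi> \<in> rring_hom R S S'"
    and \<rho>: "\<rho> \<in> carrier (points (Aut_brown R A) S)"
  interpret phi: ring_hom_cring S S' \<phi> by (rule rring_hom_cring[OF S S' \<phi>])
  note p = brown_pi_props[OF S \<rho>] and jc = brown_j_closed[OF S]
  have c: "brown_pi R A S \<rho> \<in> carrier S" using p by (simp add: mu2_carrier phi.R.is_cring)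
  have j: "bm S' \<phi> (brown_j R A S) = brown_j R A S'"
    by (simp add: brown_j_def tm_zero[OF S S' \<phi>])
  have "brown_pi R A S' (FB.ext S S' \<phi> \<rho>) = \<phi> (brown_pi R A S \<rho>)"
  proof (rule brown_pi_eqI[OF S'])
    show "\<phi> (brown_pi R A S \<rho>) \<in> carrier (points mu2 S')"
      using p(1) by (auto simp: mu2_carrier phi.R.is_cring phi.S.is_cring simp flip: phi.hom_mult)
    show "FB.ext S S' \<phi> \<rho> (brown_j R A S') = \<phi> (brown_pi R A S \<rho>) \<odot>\<^bsub>B S'\<^esub> brown_j R A S'"
      using FB.ext_apply[OF S S' \<phi> Aut_brownD(2)[OF \<rho>] jc] brown_map_smult[OF S S' \<phi> c jc]
      unfolding j p(2) by simp
  qed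
  then show "brown_pi R A S' (induced (Aut_brown R A) S S' \<phi> \<rho>) = induced mu2 S S' \<phi> (brown_pi R A S \<rho>)"
    by (simp add: Aut_brown_def)
qed

section \<open>Injectivity of the embedding and the kernel of the sign\<close>

lemma iota_injective:
  assumes S: "algebra R S"
  shows "inj_on (brown_iota R A S) (carrier (points (Isom_norm R A) S))"
proof (rule inj_onI)
  interpret S: cring S by (rule algebra.M_cring[OF S])
  interpret AS: module S "AA S" by (rule AA_module[OF S])
  fix f g assume "f \<in> carrier (points (Isom_norm R A) S)" "g \<in> carrier (points (Isom_norm R A) S)"
    and eq: "brown_iota R A S f = brown_iota R A S g"
  then have fg: "f \<in> linear_maps S (AA S) (AA S)" "g \<in> linear_maps S (AA S) (AA S)"
    using general_linear_linear by (auto simp: Isom_norm_carrier)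
  show "f = g"
  proof (rule extensionalityI[OF linear_maps_extensional[OF fg(1)] linear_maps_extensional[OF fg(2)]])
    fix x assume "x \<in> carrier (AA S)"
    then show "f x = g x"
      using fun_cong[OF eq, of "(\<zero>\<^bsub>S\<^esub>, x, \<zero>\<^bsub>AA S\<^esub>, \<zero>\<^bsub>S\<^esub>)"] by (simp add: brown_iota_eq)
  qed
qed

text \<open>An automorphism fixing the idempotent \<open>diag(1, 0)\<close> preserves its Peirce spaces.\<close>

lemma brown_diag_decomposition:
  assumes S: "algebra R S" and \<rho>: "\<rho> \<in> carrier (points (Aut_brown R A) S)"
    and fixed: "\<rho> (brown_j R A S) = brown_j R A S"
  obtains f g where "f \<in> linear_maps S (AA S) (AA S)" "g \<in> linear_maps S (AA S) (AA S)" "\<rho> = brown_diag S f g"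
proof -
  interpret S: cring S by (rule algebra.M_cring[OF S])
  interpret AS: module S "AA S" by (rule AA_module[OF S])
  interpret BS: module S "B S" by (rule brown_module[OF S])
  note \<rho>' = Aut_brownD[OF \<rho>] and jc = brown_j_closed[OF S] and oc = brown_one_closed[OF S]
  let ?j = "brown_j R A S" and ?m = "\<ominus>\<^bsub>S\<^esub> \<one>\<^bsub>S\<^esub>"
  note \<rho>l = linear_maps_closed[OF \<rho>'(2)] linear_maps_add[OF \<rho>'(2)] linear_maps_smult[OF \<rho>'(2)]
  let ?e1 = "(\<one>\<^bsub>S\<^esub>, \<zero>\<^bsub>AA S\<^esub>, \<zero>\<^bsub>AA S\<^esub>, \<zero>\<^bsub>S\<^esub>)" and ?e4 = "(\<zero>\<^bsub>S\<^esub>, \<zero>\<^bsub>AA S\<^esub>, \<zero>\<^bsub>AA S\<^esub>, \<one>\<^bsub>S\<^esub>)"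
  note h = half_closed[OF S] half_two[OF S]
  \<comment> \<open>The diagonal idempotents are (1 + j)/2 and (1 - j)/2, so an automorphism fixing
    j fixes both.\<close>
  have e1_eq: "?e1 = half S \<odot>\<^bsub>B S\<^esub> (\<one>\<^bsub>B S\<^esub> \<oplus>\<^bsub>B S\<^esub> ?j)"
    using h by (simp add: brown_j_def S.r_neg S.r_distr)
  have e4_eq: "?e4 = half S \<odot>\<^bsub>B S\<^esub> (\<one>\<^bsub>B S\<^esub> \<oplus>\<^bsub>B S\<^esub> ?m \<odot>\<^bsub>B S\<^esub> ?j)"
    using h by (simp add: brown_j_def S.r_neg S.r_distr S.l_minus)
  have e1: "\<rho> ?e1 = ?e1"
    unfolding e1_eq using h oc jc by (simp only: \<rho>l BS.a_closed \<rho>'(5) fixed)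
  have e4: "\<rho> ?e4 = ?e4"
    unfolding e4_eq using h oc jc by (simp only: \<rho>l BS.a_closed BS.smult_closed S.a_inv_closed S.one_closed \<rho>'(5) fixed)
  have e1c: "?e1 \<in> carrier (B S)" by simp
  \<comment> \<open>Left multiplication by the idempotent keeps the first row, right multiplication
    the first column.\<close>
  have left: "?e1 \<otimes>\<^bsub>B S\<^esub> (r, a, b, s) = (r, a, \<zero>\<^bsub>AA S\<^esub>, \<zero>\<^bsub>S\<^esub>)"
    if "r \<in> carrier S" "a \<in> carrier (AA S)" "b \<in> carrier (AA S)" "s \<in> carrier S" for r a b s
    using that by (simp add: X_zero[OF S] T_zero[OF S])
  have right: "(r, a, b, s) \<otimes>\<^bsub>B S\<^esub> ?e1 = (r, \<zero>\<^bsub>AA S\<^esub>, b, \<zero>\<^bsub>S\<^esub>)"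
    if "r \<in> carrier S" "a \<in> carrier (AA S)" "b \<in> carrier (AA S)" "s \<in> carrier S" for r a b s
    using that by (simp add: X_zero[OF S] T_zero[OF S])
  have \<rho>0: "\<rho> (\<zero>\<^bsub>S\<^esub>, \<zero>\<^bsub>AA S\<^esub>, \<zero>\<^bsub>AA S\<^esub>, \<zero>\<^bsub>S\<^esub>) = (\<zero>\<^bsub>S\<^esub>, \<zero>\<^bsub>AA S\<^esub>, \<zero>\<^bsub>AA S\<^esub>, \<zero>\<^bsub>S\<^esub>)"
    using linear_maps_zero[OF \<rho>'(2) brown_module[OF S] brown_module[OF S]] by simp
  \<comment> \<open>Upper right elements satisfy e1 x = x and x e1 = 0, and these equations pass to
    the image. The first kills the lower entries of the image, the second the upper left
    one.\<close>
  have A: "\<exists>a'\<in>carrier (AA S). \<rho> (\<zero>\<^bsub>S\<^esub>, a, \<zero>\<^bsub>AA S\<^esub>, \<zero>\<^bsub>S\<^esub>) = (\<zero>\<^bsub>S\<^esub>, a', \<zero>\<^bsub>AA S\<^esub>, \<zero>\<^bsub>S\<^esub>)" if a: "a \<in> carrier (AA S)" for a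
  proof -
    let ?x = "(\<zero>\<^bsub>S\<^esub>, a, \<zero>\<^bsub>AA S\<^esub>, \<zero>\<^bsub>S\<^esub>)"
    have xc: "?x \<in> carrier (B S)" using a by simp
    obtain r a' b s where x: "\<rho> ?x = (r, a', b, s)" "r \<in> carrier S" "a' \<in> carrier (AA S)" "b \<in> carrier (AA S)" "s \<in> carrier S"
      by (rule brown_cases[OF \<rho>l(1)[OF xc]])
    have "(r, a', \<zero>\<^bsub>AA S\<^esub>, \<zero>\<^bsub>S\<^esub>) = (r, a', b, s)"
      using \<rho>'(4)[OF e1c xc] a x(2-5) by (simp only: left right e1 x(1) S.zero_closed AS.zero_closed)
    moreover have "(\<zero>\<^bsub>S\<^esub>, \<zero>\<^bsub>AA S\<^esub>, \<zero>\<^bsub>AA S\<^esub>, \<zero>\<^bsub>S\<^esub>) = (r, \<zero>\<^bsub>AA S\<^esub>, b, \<zero>\<^bsub>S\<^esub>)"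
      using \<rho>'(4)[OF xc e1c] a x(2-5) by (simp only: left right e1 x(1) S.zero_closed AS.zero_closed \<rho>0)
    ultimately show ?thesis using x by auto
  qed
  have Bb: "\<exists>b'\<in>carrier (AA S). \<rho> (\<zero>\<^bsub>S\<^esub>, \<zero>\<^bsub>AA S\<^esub>, b, \<zero>\<^bsub>S\<^esub>) = (\<zero>\<^bsub>S\<^esub>, \<zero>\<^bsub>AA S\<^esub>, b', \<zero>\<^bsub>S\<^esub>)" if b: "b \<in> carrier (AA S)" for b
  proof -
    let ?x = "(\<zero>\<^bsub>S\<^esub>, \<zero>\<^bsub>AA S\<^esub>, b, \<zero>\<^bsub>S\<^esub>)"
    have xc: "?x \<in> carrier (B S)" using b by simp
    obtain r a b' s where x: "\<rho> ?x = (r, a, b', s)" "r \<in> carrier S" "a \<in> carrier (AA S)" "b' \<in> carrier (AA S)" "s \<in> carrier S"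
      by (rule brown_cases[OF \<rho>l(1)[OF xc]])
    have "(\<zero>\<^bsub>S\<^esub>, \<zero>\<^bsub>AA S\<^esub>, \<zero>\<^bsub>AA S\<^esub>, \<zero>\<^bsub>S\<^esub>) = (r, a, \<zero>\<^bsub>AA S\<^esub>, \<zero>\<^bsub>S\<^esub>)"
      using \<rho>'(4)[OF e1c xc] b x(2-5) by (simp only: left right e1 x(1) S.zero_closed AS.zero_closed \<rho>0)
    moreover have "(r, \<zero>\<^bsub>AA S\<^esub>, b', \<zero>\<^bsub>S\<^esub>) = (r, a, b', s)"
      using \<rho>'(4)[OF xc e1c] b x(2-5) by (simp only: left right e1 x(1) S.zero_closed AS.zero_closed)
    ultimately show ?thesis using x by auto
  qed
  obtain f0 where f0: "\<And>a. a \<in> carrier (AA S) \<Longrightarrow> f0 a \<in> carrier (AA S)"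
    "\<And>a. a \<in> carrier (AA S) \<Longrightarrow> \<rho> (\<zero>\<^bsub>S\<^esub>, a, \<zero>\<^bsub>AA S\<^esub>, \<zero>\<^bsub>S\<^esub>) = (\<zero>\<^bsub>S\<^esub>, f0 a, \<zero>\<^bsub>AA S\<^esub>, \<zero>\<^bsub>S\<^esub>)"
    using A by metis
  obtain g0 where g0: "\<And>b. b \<in> carrier (AA S) \<Longrightarrow> g0 b \<in> carrier (AA S)"
    "\<And>b. b \<in> carrier (AA S) \<Longrightarrow> \<rho> (\<zero>\<^bsub>S\<^esub>, \<zero>\<^bsub>AA S\<^esub>, b, \<zero>\<^bsub>S\<^esub>) = (\<zero>\<^bsub>S\<^esub>, \<zero>\<^bsub>AA S\<^esub>, g0 b, \<zero>\<^bsub>S\<^esub>)"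
    using Bb by metis
  have f: "restrict f0 (carrier (AA S)) \<in> linear_maps S (AA S) (AA S)"
  proof (rule linear_mapsI)
    fix x y assume xy: "x \<in> carrier (AA S)" "y \<in> carrier (AA S)"
    then show "restrict f0 (carrier (AA S)) (x \<oplus>\<^bsub>AA S\<^esub> y) = restrict f0 (carrier (AA S)) x \<oplus>\<^bsub>AA S\<^esub> restrict f0 (carrier (AA S)) y"
      using \<rho>l(2)[of "(\<zero>\<^bsub>S\<^esub>, x, \<zero>\<^bsub>AA S\<^esub>, \<zero>\<^bsub>S\<^esub>)" "(\<zero>\<^bsub>S\<^esub>, y, \<zero>\<^bsub>AA S\<^esub>, \<zero>\<^bsub>S\<^esub>)"] by (simp add: f0)
  next
    fix s x assume "s \<in> carrier S" "x \<in> carrier (AA S)"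
    then show "restrict f0 (carrier (AA S)) (s \<odot>\<^bsub>AA S\<^esub> x) = s \<odot>\<^bsub>AA S\<^esub> restrict f0 (carrier (AA S)) x"
      using \<rho>l(3)[of s "(\<zero>\<^bsub>S\<^esub>, x, \<zero>\<^bsub>AA S\<^esub>, \<zero>\<^bsub>S\<^esub>)"] by (simp add: f0)
  qed (use f0 in auto)
  have g: "restrict g0 (carrier (AA S)) \<in> linear_maps S (AA S) (AA S)"
  proof (rule linear_mapsI)
    fix x y assume xy: "x \<in> carrier (AA S)" "y \<in> carrier (AA S)"
    then show "restrict g0 (carrier (AA S)) (x \<oplus>\<^bsub>AA S\<^esub> y) = restrict g0 (carrier (AA S)) x \<oplus>\<^bsub>AA S\<^esub> restrict g0 (carrier (AA S)) y"
      using \<rho>l(2)[of "(\<zero>\<^bsub>S\<^esub>, \<zero>\<^bsub>AA S\<^esub>, x, \<zero>\<^bsub>S\<^esub>)" "(\<zero>\<^bsub>S\<^esub>, \<zero>\<^bsub>AA S\<^esub>, y, \<zero>\<^bsub>S\<^esub>)"] by (simp add: g0)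
  next
    fix s x assume "s \<in> carrier S" "x \<in> carrier (AA S)"
    then show "restrict g0 (carrier (AA S)) (s \<odot>\<^bsub>AA S\<^esub> x) = s \<odot>\<^bsub>AA S\<^esub> restrict g0 (carrier (AA S)) x"
      using \<rho>l(3)[of s "(\<zero>\<^bsub>S\<^esub>, \<zero>\<^bsub>AA S\<^esub>, x, \<zero>\<^bsub>S\<^esub>)"] by (simp add: g0)
  qed (use g0 in auto)
  have "\<rho> = brown_diag S (restrict f0 (carrier (AA S))) (restrict g0 (carrier (AA S)))"
  proof (rule extensionalityI[OF linear_maps_extensional[OF \<rho>'(2)] linear_maps_extensional[OF brown_diag_linear[OF f g S]]])
    fix x assume "x \<in> carrier (B S)"
    then show "\<rho> x = brown_diag S (restrict f0 (carrier (AA S))) (restrict g0 (carrier (AA S))) x"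
    proof (cases rule: brown_cases)
      case (1 r a b s)
      have "\<rho> x = r \<odot>\<^bsub>B S\<^esub> \<rho> ?e1 \<oplus>\<^bsub>B S\<^esub> \<rho> (\<zero>\<^bsub>S\<^esub>, a, \<zero>\<^bsub>AA S\<^esub>, \<zero>\<^bsub>S\<^esub>)
        \<oplus>\<^bsub>B S\<^esub> \<rho> (\<zero>\<^bsub>S\<^esub>, \<zero>\<^bsub>AA S\<^esub>, b, \<zero>\<^bsub>S\<^esub>) \<oplus>\<^bsub>B S\<^esub> s \<odot>\<^bsub>B S\<^esub> \<rho> ?e4"
        unfolding 1(1) brown_decomp[OF S 1(2-5)] using 1 by (simp add: \<rho>l del: brown_add brown_smult)
      then show ?thesis using 1 f0 g0 by (simp add: e1 e4)
    qed
  qed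
  then show thesis by (rule that[OF f g])
qed

text \<open>Off-diagonal products isolate the operations: upper right times lower left has the trace
  in a corner, and two elements in the same corner multiply to their cross product in the opposite
  one.\<close>

lemma brown_diag_Aut_relations:
  assumes S: "algebra R S" and f: "f \<in> linear_maps S (AA S) (AA S)" and g: "g \<in> linear_maps S (AA S) (AA S)"
    and \<rho>: "preserves_brown S (brown_diag S f g)" and a: "a \<in> carrier (AA S)" and b: "b \<in> carrier (AA S)"
  shows "T S (f a) (g b) = T S a b" "X S (f a) (f b) = g (X S a b)" "X S (g a) (g b) = f (X S a b)"
proof -
  interpret S: cring S by (rule algebra.M_cring[OF S])
  interpret AS: module S "AA S" by (rule AA_module[OF S])
  have mult: "brown_diag S f g (x \<otimes>\<^bsub>B S\<^esub> y) = brown_diag S f g x \<otimes>\<^bsub>B S\<^esub> brown_diag S f g y"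
    if "x \<in> carrier (B S)" "y \<in> carrier (B S)" for x y
    using \<rho> that unfolding preserves_brown_def by blast
  note z = linear_maps_zero[OF f AA_module[OF S] AA_module[OF S]] linear_maps_zero[OF g AA_module[OF S] AA_module[OF S]]
  note c = linear_maps_closed[OF f] linear_maps_closed[OF g] X_closed[OF S] T_closed[OF S]
  show "T S (f a) (g b) = T S a b"
    using mult[of "(\<zero>\<^bsub>S\<^esub>, a, \<zero>\<^bsub>AA S\<^esub>, \<zero>\<^bsub>S\<^esub>)" "(\<zero>\<^bsub>S\<^esub>, \<zero>\<^bsub>AA S\<^esub>, b, \<zero>\<^bsub>S\<^esub>)"] a b
    by (simp add: z c X_zero[OF S] T_zero[OF S])
  show "X S (f a) (f b) = g (X S a b)"
    using mult[of "(\<zero>\<^bsub>S\<^esub>, a, \<zero>\<^bsub>AA S\<^esub>, \<zero>\<^bsub>S\<^esub>)" "(\<zero>\<^bsub>S\<^esub>, b, \<zero>\<^bsub>AA S\<^esub>, \<zero>\<^bsub>S\<^esub>)"] a b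
    by (simp add: z c X_zero[OF S] T_zero[OF S])
  show "X S (g a) (g b) = f (X S a b)"
    using mult[of "(\<zero>\<^bsub>S\<^esub>, \<zero>\<^bsub>AA S\<^esub>, a, \<zero>\<^bsub>S\<^esub>)" "(\<zero>\<^bsub>S\<^esub>, \<zero>\<^bsub>AA S\<^esub>, b, \<zero>\<^bsub>S\<^esub>)"] a b
    by (simp add: z c X_zero[OF S] T_zero[OF S])
qed

text \<open>Halving the cross square shows that f and g intertwine the adjoint in both directions,
  whence N(f x) f x = (f x)^## = f(x^##) = N(x) f x. Pairing with g w replaces the uncancellable
  vector f x by T(f x, g w) = T(x, w).\<close>

lemma brown_diag_norm_weighted:
  assumes S: "algebra R S" and f: "f \<in> linear_maps S (AA S) (AA S)" and g: "g \<in> linear_maps S (AA S) (AA S)"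
    and \<rho>: "preserves_brown S (brown_diag S f g)" and x: "x \<in> carrier (AA S)" and w: "w \<in> carrier (AA S)"
  shows "N S (f x) \<otimes>\<^bsub>S\<^esub> T S x w = N S x \<otimes>\<^bsub>S\<^esub> T S x w"
proof -
  interpret AS: module S "AA S" by (rule AA_module[OF S])
  note rel = brown_diag_Aut_relations[OF S f g \<rho>]
  note c = linear_maps_closed[OF f] linear_maps_closed[OF g]
  have sf: "sharp S (f y) = g (sharp S y)" if y: "y \<in> carrier (AA S)" for y
    by (rule double_cancel[OF S AA_module[OF S]])
      (use rel(2)[OF y y] y S in \<open>simp_all add: X_self c linear_maps_add[OF g]\<close>)
  have sg: "sharp S (g y) = f (sharp S y)" if y: "y \<in> carrier (AA S)" for y
    by (rule double_cancel[OF S AA_module[OF S]])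
      (use rel(3)[OF y y] y S in \<open>simp_all add: X_self c linear_maps_add[OF f]\<close>)
  have "N S (f x) \<odot>\<^bsub>AA S\<^esub> f x = N S x \<odot>\<^bsub>AA S\<^esub> f x"
    using x S by (simp add: sf sg c linear_maps_smult[OF f] flip: sharp_sharp)
      (simp add: sharp_sharp linear_maps_smult[OF f])
  from arg_cong[OF this, of "\<lambda>y. T S y (g w)"] show ?thesis
    using x w S by (simp add: T_smult_left c rel)
qed

text \<open>The previous lemma says \<open>(N(f z) - N(z)) T(z, w) = 0\<close>. For \<open>z = t e + x\<close> over \<open>S[t]\<close> and
  \<open>T(e, w) = 1\<close> the second factor is not a zero divisor; then put \<open>t = 0\<close>.\<close>

lemma brown_diag_norm:
  assumes S: "algebra R S" and f: "f \<in> linear_maps S (AA S) (AA S)" and g: "g \<in> linear_maps S (AA S) (AA S)"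
    and \<rho>: "brown_diag S f g \<in> carrier (points (Aut_brown R A) S)" and x: "x \<in> carrier (AA S)"
  shows "N S (f x) = N S x"
proof -
  obtain w where w: "w \<in> carrier (AA S)" "T S (e S) w = \<one>\<^bsub>S\<^esub>"
    using e_unimodular[OF S] by blast
  obtain P i t where P': "polynomial_ext R S P i t"
    using polynomial_extI[OF infinite_universe S] by blast
  then interpret P: polynomial_ext R S P i t .
  note P = P.P_algebra
  interpret AP: module P "AA P" by (rule AA_module[OF P])
  note tc = tm_closed[OF S P P.i_hom]
  interpret AS: module S "AA S" by (rule AA_module[OF S])
  let ?f = "FA.ext S P i f" and ?g = "FA.ext S P i g"
  have fl: "?f \<in> linear_maps P (AA P) (AA P)" by (rule FA.ext_linear[OF S P P.i_hom f])
  have gl: "?g \<in> linear_maps P (AA P) (AA P)" by (rule FA.ext_linear[OF S P P.i_hom g])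
  \<comment> \<open>The weighted identity is wanted over S[t]. It holds there because the extension
    of the automorphism is again a diagonal automorphism.\<close>
  have "FB.ext S P i (brown_diag S f g) \<in> carrier (points (Aut_brown R A) P)"
    by (rule Aut_brown_ext[OF S P P.i_hom \<rho>])
  then have pres: "preserves_brown P (brown_diag P ?f ?g)"
    unfolding brown_diag_ext[OF S P P.i_hom f g] by (rule Aut_brownD(3))
  let ?z = "t \<odot>\<^bsub>AA P\<^esub> e P \<oplus>\<^bsub>AA P\<^esub> tm P i x"
  have z: "?z \<in> carrier (AA P)" using x P by (simp add: tc)
  have fz: "?f ?z \<in> carrier (AA P)" by (rule linear_maps_closed[OF fl z])
  have Tw: "T P ?z (tm P i w) = t \<oplus>\<^bsub>P\<^esub> i (T S x w)"
    using x w P S T_map[OF S P P.i_hom e_closed[OF S] w(1)]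
    by (simp add: T_add_left T_smult_left tc T_map[OF S P P.i_hom] tm_e[OF S P P.i_hom])
  have "N P (?f ?z) \<otimes>\<^bsub>P\<^esub> (t \<oplus>\<^bsub>P\<^esub> i (T S x w)) = N P ?z \<otimes>\<^bsub>P\<^esub> (t \<oplus>\<^bsub>P\<^esub> i (T S x w))"
    using brown_diag_norm_weighted[OF P fl gl pres z tc[OF w(1)]] unfolding Tw .
  then have "(t \<oplus>\<^bsub>P\<^esub> i (T S x w)) \<otimes>\<^bsub>P\<^esub> (N P (?f ?z) \<ominus>\<^bsub>P\<^esub> N P ?z) = \<zero>\<^bsub>P\<^esub>"
    using z fz P x w S by (simp add: P.P.r_distr_minus P.P.m_comm[of "t \<oplus>\<^bsub>P\<^esub> i (T S x w)"] P.P.minus_zero_iff)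
  then have "N P (?f ?z) \<ominus>\<^bsub>P\<^esub> N P ?z = \<zero>\<^bsub>P\<^esub>"
    by (rule P.linear_nonzerodivisor[rotated 2]) (use z fz P x w S in auto)
  then have eq: "N P (?f ?z) = N P ?z" using z fz P by (simp add: P.P.minus_zero_iff)
  obtain \<psi> where \<psi>: "\<psi> \<in> rring_hom R P S" "\<And>s. s \<in> carrier S \<Longrightarrow> \<psi> (i s) = s" "\<psi> t = \<zero>\<^bsub>S\<^esub>"
    using P.poly_hom[OF S rring_hom_id P.S.zero_closed] by blast
  have tm: "tm S \<psi> (tm P i y) = y" if y: "y \<in> carrier (AA S)" for y
  proof -
    have "tm S \<psi> (tm P i y) = tm S (\<lambda>s. s) y"
      unfolding tm_comp[OF S P S P.i_hom \<psi>(1) y]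
      by (rule tm_cong[OF S S rring_hom_comp[OF P.i_hom \<psi>(1)] rring_hom_id \<psi>(2) y])
    then show ?thesis by (simp add: tm_id[OF S y])
  qed
  have fz_eq: "?f ?z = t \<odot>\<^bsub>AA P\<^esub> ?f (e P) \<oplus>\<^bsub>AA P\<^esub> tm P i (f x)"
    using x P by (simp add: linear_maps_add[OF fl] linear_maps_smult[OF fl] tc FA.ext_apply[OF S P P.i_hom f])
  have fe: "?f (e P) \<in> carrier (AA P)" using linear_maps_closed[OF fl] P by simp
  have "tm S \<psi> (?f ?z) = f x"
    unfolding fz_eq using x fe linear_maps_closed[OF f x] tm_closed[OF P S \<psi>(1) fe]
    by (simp add: tm_add[OF P S \<psi>(1)] tm_smult[OF P S \<psi>(1)] tc \<psi>(3) tm)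
  moreover have "tm S \<psi> ?z = x"
    using x P S tm_closed[OF P S \<psi>(1) e_closed[OF P]]
    by (simp add: tm_add[OF P S \<psi>(1)] tm_smult[OF P S \<psi>(1)] tc \<psi>(3) tm)
  ultimately show ?thesis
    using arg_cong[OF eq, of \<psi>] N_map[OF P S \<psi>(1) fz] N_map[OF P S \<psi>(1) z] by simp
qed

text \<open>With \<rho> = diag(f, g), bijectivity of f is that of \<rho> on the upper right corner,
  invariance of T identifies g as the dagger of f, and the norm is handled by
  \<open>brown_diag_norm\<close>.\<close>

lemma kernel_pi_subset:
  assumes S: "algebra R S" and \<rho>: "\<rho> \<in> carrier (points (Aut_brown R A) S)"
    and fixed: "\<rho> (brown_j R A S) = brown_j R A S"
  shows "\<rho> \<in> brown_iota R A S ` carrier (points (Isom_norm R A) S)"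
proof -
  interpret S: cring S by (rule algebra.M_cring[OF S])
  interpret AS: module S "AA S" by (rule AA_module[OF S])
  obtain f g where fg: "f \<in> linear_maps S (AA S) (AA S)" "g \<in> linear_maps S (AA S) (AA S)" "\<rho> = brown_diag S f g"
    by (rule brown_diag_decomposition[OF S \<rho> fixed])
  note inv = general_linear_inverse_map[OF Aut_brownD(1)[OF \<rho>] brown_module[OF S]]
  have inj: "a = a'" if "a \<in> carrier (AA S)" "a' \<in> carrier (AA S)" "f a = f a'" for a a'
  proof -
    let ?x = "(\<zero>\<^bsub>S\<^esub>, a, \<zero>\<^bsub>AA S\<^esub>, \<zero>\<^bsub>S\<^esub>)" and ?x' = "(\<zero>\<^bsub>S\<^esub>, a', \<zero>\<^bsub>AA S\<^esub>, \<zero>\<^bsub>S\<^esub>)"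
    have c: "?x \<in> carrier (B S)" "?x' \<in> carrier (B S)" using that by simp_all
    have eq: "\<rho> ?x = \<rho> ?x'" unfolding fg(3) using that by simp
    have "inverse_map (B S) \<rho> (\<rho> ?x) = inverse_map (B S) \<rho> (\<rho> ?x')" unfolding eq ..
    then have "?x = ?x'" unfolding inv(3)[OF c(1)] inv(3)[OF c(2)] .
    then show ?thesis by simp
  qed
  have surj: "\<exists>a\<in>carrier (AA S). f a = a'" if a': "a' \<in> carrier (AA S)" for a'
  proof -
    let ?y = "(\<zero>\<^bsub>S\<^esub>, a', \<zero>\<^bsub>AA S\<^esub>, \<zero>\<^bsub>S\<^esub>)"
    have yc: "?y \<in> carrier (B S)" using a' by simp
    obtain r a b s where x: "inverse_map (B S) \<rho> ?y = (r, a, b, s)" "r \<in> carrier S" "a \<in> carrier (AA S)" "b \<in> carrier (AA S)" "s \<in> carrier S"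
      by (rule brown_cases[OF linear_maps_closed[OF general_linear_linear[OF inv(1)] yc]])
    have "\<rho> (r, a, b, s) = ?y"
      using inv(2)[OF yc] unfolding x(1) .
    then show ?thesis unfolding fg(3) using x(2-) by auto
  qed
  have "bij_betw f (carrier (AA S)) (carrier (AA S))"
    unfolding bij_betw_def
  proof (intro conjI equalityI subsetI)
    fix a' assume "a' \<in> carrier (AA S)"
    then obtain a where "a \<in> carrier (AA S)" "f a = a'" using surj by blast
    then show "a' \<in> f ` carrier (AA S)" by blast
  qed (use inj linear_maps_closed[OF fg(1)] in \<open>auto simp: inj_on_def\<close>)
  then have fGL: "f \<in> general_linear S (AA S)"
    using fg(1) linear_maps_extensional[OF fg(1)] by (simp add: general_linear_def Bij_def)
  have "preserves_norm S f"
    unfolding preserves_norm_def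
  proof (intro allI impI ballI, elim conjE)
    fix S' \<phi> x assume S': "algebra R S'" and \<phi>: "\<phi> \<in> rring_hom R S S'" and x: "x \<in> carrier (AA S')"
    \<comment> \<open>The norm has to be preserved over every S-ring, so
      \<open>brown_diag_norm\<close> is applied to the extended automorphism.\<close>
    have "FB.ext S S' \<phi> \<rho> \<in> carrier (points (Aut_brown R A) S')"
      by (rule Aut_brown_ext[OF S S' \<phi> \<rho>])
    then show "N S' (FA.ext S S' \<phi> f x) = N S' x"
      unfolding fg(3) brown_diag_ext[OF S S' \<phi> fg(1,2)]
      by (rule brown_diag_norm[OF S' FA.ext_linear[OF S S' \<phi> fg(1)] FA.ext_linear[OF S S' \<phi> fg(2)] _ x])
  qed
  moreover have "dagger R A S f = g"
    using brown_diag_Aut_relations(1)[OF S fg(1,2)] Aut_brownD(3)[OF \<rho>] unfolding fg(3)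
    by (intro dagger_eqI[OF S fGL fg(2)]) auto
  ultimately show ?thesis
    using fGL by (intro image_eqI[of _ _ f]) (simp_all add: brown_iota_eq fg(3) Isom_norm_carrier)
qed

lemma iota_image:
  assumes S: "algebra R S"
  shows "brown_iota R A S ` carrier (points (Isom_norm R A) S) =
    kernel (points (Aut_brown R A) S) (points mu2 S) (brown_pi R A S)"
proof (intro equalityI subsetI)
  interpret S: cring S by (rule algebra.M_cring[OF S])
  interpret AS: module S "AA S" by (rule AA_module[OF S])
  interpret BS: module S "B S" by (rule brown_module[OF S])
  fix \<rho> assume "\<rho> \<in> brown_iota R A S ` carrier (points (Isom_norm R A) S)"
  then obtain f where f: "\<rho> = brown_iota R A S f" "f \<in> general_linear S (AA S)" "preserves_norm S f"
    by (auto simp: Isom_norm_carrier)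
  have "brown_pi R A S \<rho> = \<one>\<^bsub>S\<^esub>"
  proof (rule brown_pi_eqI[OF S])
    show "\<rho> (brown_j R A S) = \<one>\<^bsub>S\<^esub> \<odot>\<^bsub>B S\<^esub> brown_j R A S"
      unfolding f(1) brown_iota_eq
      using linear_maps_zero[OF isom_lin[OF S f(2,3)] AA_module[OF S] AA_module[OF S]]
        linear_maps_zero[OF isom_dagger_lin[OF S f(2,3)] AA_module[OF S] AA_module[OF S]]
      by (simp add: brown_j_def)
  qed (simp add: mu2_carrier S.is_cring)
  then show "\<rho> \<in> kernel (points (Aut_brown R A) S) (points mu2 S) (brown_pi R A S)"
    using iota_in_Aut[OF S f(2,3)] f(1) by (simp add: kernel_def)
next
  interpret BS: module S "B S" by (rule brown_module[OF S])
  fix \<rho> assume "\<rho> \<in> kernel (points (Aut_brown R A) S) (points mu2 S) (brown_pi R A S)"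
  then have \<rho>: "\<rho> \<in> carrier (points (Aut_brown R A) S)" "brown_pi R A S \<rho> = \<one>\<^bsub>S\<^esub>"
    by (simp_all add: kernel_def)
  then show "\<rho> \<in> brown_iota R A S ` carrier (points (Isom_norm R A) S)"
    using brown_pi_props(2)[OF S \<rho>(1)] brown_j_closed[OF S] by (intro kernel_pi_subset[OF S \<rho>(1)]) simp
qed

section \<open>The splitting\<close>

definition brown_swap :: "('a, 'u) brown_matrix \<Rightarrow> ('a, 'u) brown_matrix" where
  "brown_swap = (\<lambda>(r, a, b, s). (s, b, a, r))"

lemma brown_swap_simp [simp]: "brown_swap (r, a, b, s) = (s, b, a, r)"
  by (simp add: brown_swap_def)

lemma brown_swap_closed [simp]: "x \<in> carrier (B S) \<Longrightarrow> brown_swap x \<in> carrier (B S)"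
  by (auto elim!: brown_cases)

lemma brown_swap_swap [simp]: "brown_swap (brown_swap x) = x"
  by (simp add: brown_swap_def split: prod.splits)

lemma brown_swap_add: "x \<in> carrier (B S) \<Longrightarrow> y \<in> carrier (B S) \<Longrightarrow>
    brown_swap (x \<oplus>\<^bsub>B S\<^esub> y) = brown_swap x \<oplus>\<^bsub>B S\<^esub> brown_swap y"
  by (auto elim!: brown_cases)

lemma brown_swap_smult: "x \<in> carrier (B S) \<Longrightarrow> brown_swap (u \<odot>\<^bsub>B S\<^esub> x) = u \<odot>\<^bsub>B S\<^esub> brown_swap x"
  by (auto elim!: brown_cases)

text \<open>The multiplication formula is symmetric under exchanging r with s and a with b, given
  that T is symmetric.\<close>

lemma brown_swap_mult:
  assumes S: "algebra R S" and "x \<in> carrier (B S)" "y \<in> carrier (B S)"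
  shows "brown_swap (x \<otimes>\<^bsub>B S\<^esub> y) = brown_swap x \<otimes>\<^bsub>B S\<^esub> brown_swap y"
proof -
  interpret S: cring S by (rule algebra.M_cring[OF S])
  interpret AS: module S "AA S" by (rule AA_module[OF S])
  show ?thesis using assms by (auto elim!: brown_cases simp: T_comm[OF S] AS.a_comm)
qed

definition plus_part :: "'u rring \<Rightarrow> 'u \<Rightarrow> 'u" where
  "plus_part S \<epsilon> = half S \<otimes>\<^bsub>S\<^esub> (\<one>\<^bsub>S\<^esub> \<oplus>\<^bsub>S\<^esub> \<epsilon>)"

definition minus_part :: "'u rring \<Rightarrow> 'u \<Rightarrow> 'u" where
  "minus_part S \<epsilon> = half S \<otimes>\<^bsub>S\<^esub> (\<one>\<^bsub>S\<^esub> \<oplus>\<^bsub>S\<^esub> \<ominus>\<^bsub>S\<^esub> \<epsilon>)"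

text \<open>\<open>double_cancel\<close> does not cover S as a module over itself, because the
  \<open>smult\<close> of the record S is the action of R.\<close>

lemma double_cancel_ring:
  assumes S: "algebra R S" and x: "x \<in> carrier S" and y: "y \<in> carrier S" and eq: "x \<oplus>\<^bsub>S\<^esub> x = y \<oplus>\<^bsub>S\<^esub> y"
  shows "x = y"
proof -
  interpret S: cring S by (rule algebra.M_cring[OF S])
  have "half S \<otimes>\<^bsub>S\<^esub> (z \<oplus>\<^bsub>S\<^esub> z) = z" if "z \<in> carrier S" for z
    using that half_two[OF S] S by (simp add: S.r_distr flip: S.l_distr)
  then show ?thesis using x y eq by metis
qed

context
  fixes S :: "'u rring" and \<epsilon>
  assumes S: "algebra R S" and \<epsilon>: "\<epsilon> \<in> carrier (points mu2 S)"
begin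

interpretation S: cring S by (rule algebra.M_cring[OF S])

lemma sign_closed: "\<epsilon> \<in> carrier S" and sign_square: "\<epsilon> \<otimes>\<^bsub>S\<^esub> \<epsilon> = \<one>\<^bsub>S\<^esub>"
  using \<epsilon> by (simp_all add: mu2_carrier S.is_cring)

lemma parts_closed: "plus_part S \<epsilon> \<in> carrier S" "minus_part S \<epsilon> \<in> carrier S"
  using sign_closed S by (simp_all add: plus_part_def minus_part_def)

text \<open>Doubling removes \<open>half\<close>. \<open>parts_difference\<close> and the first
  identity of \<open>plus_part_mult\<close> are verified in doubled form.\<close>

lemma plus_double: "plus_part S \<epsilon> \<oplus>\<^bsub>S\<^esub> plus_part S \<epsilon> = \<one>\<^bsub>S\<^esub> \<oplus>\<^bsub>S\<^esub> \<epsilon>"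
  using sign_closed S half_two[OF S] by (simp add: plus_part_def flip: S.l_distr)

lemma minus_double: "minus_part S \<epsilon> \<oplus>\<^bsub>S\<^esub> minus_part S \<epsilon> = \<one>\<^bsub>S\<^esub> \<oplus>\<^bsub>S\<^esub> \<ominus>\<^bsub>S\<^esub> \<epsilon>"
  using sign_closed S half_two[OF S] by (simp add: minus_part_def flip: S.l_distr)

lemma parts_sum: "plus_part S \<epsilon> \<oplus>\<^bsub>S\<^esub> minus_part S \<epsilon> = \<one>\<^bsub>S\<^esub>"
proof -
  have "plus_part S \<epsilon> \<oplus>\<^bsub>S\<^esub> minus_part S \<epsilon> = half S \<otimes>\<^bsub>S\<^esub> ((\<one>\<^bsub>S\<^esub> \<oplus>\<^bsub>S\<^esub> \<epsilon>) \<oplus>\<^bsub>S\<^esub> (\<one>\<^bsub>S\<^esub> \<oplus>\<^bsub>S\<^esub> \<ominus>\<^bsub>S\<^esub> \<epsilon>))"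
    unfolding plus_part_def minus_part_def using sign_closed S by (intro S.r_distr[symmetric]) simp_all
  also have "(\<one>\<^bsub>S\<^esub> \<oplus>\<^bsub>S\<^esub> \<epsilon>) \<oplus>\<^bsub>S\<^esub> (\<one>\<^bsub>S\<^esub> \<oplus>\<^bsub>S\<^esub> \<ominus>\<^bsub>S\<^esub> \<epsilon>) = \<one>\<^bsub>S\<^esub> \<oplus>\<^bsub>S\<^esub> \<one>\<^bsub>S\<^esub>"
    by (rule S.add_cancel_mid) (use sign_closed in auto)
  also have "half S \<otimes>\<^bsub>S\<^esub> (\<one>\<^bsub>S\<^esub> \<oplus>\<^bsub>S\<^esub> \<one>\<^bsub>S\<^esub>) = \<one>\<^bsub>S\<^esub>"
    using S half_two[OF S] by (simp add: S.r_distr)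
  finally show ?thesis .
qed

lemma parts_orthogonal: "plus_part S \<epsilon> \<otimes>\<^bsub>S\<^esub> minus_part S \<epsilon> = \<zero>\<^bsub>S\<^esub>"
proof -
  have "plus_part S \<epsilon> \<otimes>\<^bsub>S\<^esub> minus_part S \<epsilon> = (half S \<otimes>\<^bsub>S\<^esub> half S) \<otimes>\<^bsub>S\<^esub> ((\<one>\<^bsub>S\<^esub> \<oplus>\<^bsub>S\<^esub> \<epsilon>) \<otimes>\<^bsub>S\<^esub> (\<one>\<^bsub>S\<^esub> \<oplus>\<^bsub>S\<^esub> \<ominus>\<^bsub>S\<^esub> \<epsilon>))"
    unfolding plus_part_def minus_part_def using sign_closed S by (simp add: S.m_ac)
  also have "(\<one>\<^bsub>S\<^esub> \<oplus>\<^bsub>S\<^esub> \<epsilon>) \<otimes>\<^bsub>S\<^esub> (\<one>\<^bsub>S\<^esub> \<oplus>\<^bsub>S\<^esub> \<ominus>\<^bsub>S\<^esub> \<epsilon>) = \<zero>\<^bsub>S\<^esub>"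
    using sign_closed sign_square by (simp add: S.l_distr S.r_distr S.r_minus S.a_comm S.r_neg)
  finally show ?thesis using S by simp
qed

lemma parts_idempotent:
  "plus_part S \<epsilon> \<otimes>\<^bsub>S\<^esub> plus_part S \<epsilon> = plus_part S \<epsilon>" "minus_part S \<epsilon> \<otimes>\<^bsub>S\<^esub> minus_part S \<epsilon> = minus_part S \<epsilon>"
proof -
  note c = parts_closed
  have "plus_part S \<epsilon> \<otimes>\<^bsub>S\<^esub> (plus_part S \<epsilon> \<oplus>\<^bsub>S\<^esub> minus_part S \<epsilon>) = plus_part S \<epsilon> \<otimes>\<^bsub>S\<^esub> plus_part S \<epsilon>"
    using c by (simp only: S.r_distr parts_orthogonal) simp
  then show "plus_part S \<epsilon> \<otimes>\<^bsub>S\<^esub> plus_part S \<epsilon> = plus_part S \<epsilon>" using c by (simp add: parts_sum)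
  have "(plus_part S \<epsilon> \<oplus>\<^bsub>S\<^esub> minus_part S \<epsilon>) \<otimes>\<^bsub>S\<^esub> minus_part S \<epsilon> = minus_part S \<epsilon> \<otimes>\<^bsub>S\<^esub> minus_part S \<epsilon>"
    using c by (simp only: S.l_distr parts_orthogonal) simp
  then show "minus_part S \<epsilon> \<otimes>\<^bsub>S\<^esub> minus_part S \<epsilon> = minus_part S \<epsilon>" using c by (simp add: parts_sum)
qed

lemma parts_difference: "plus_part S \<epsilon> \<oplus>\<^bsub>S\<^esub> \<ominus>\<^bsub>S\<^esub> minus_part S \<epsilon> = \<epsilon>"
proof (rule double_cancel_ring[OF S])
  note c = parts_closed sign_closed
  have "(plus_part S \<epsilon> \<oplus>\<^bsub>S\<^esub> \<ominus>\<^bsub>S\<^esub> minus_part S \<epsilon>) \<oplus>\<^bsub>S\<^esub> (plus_part S \<epsilon> \<oplus>\<^bsub>S\<^esub> \<ominus>\<^bsub>S\<^esub> minus_part S \<epsilon>) =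
      (plus_part S \<epsilon> \<oplus>\<^bsub>S\<^esub> plus_part S \<epsilon>) \<oplus>\<^bsub>S\<^esub> \<ominus>\<^bsub>S\<^esub> (minus_part S \<epsilon> \<oplus>\<^bsub>S\<^esub> minus_part S \<epsilon>)"
    using c by (simp add: S.minus_add S.a_ac)
  also have "\<dots> = \<epsilon> \<oplus>\<^bsub>S\<^esub> \<epsilon>"
    unfolding plus_double minus_double
    using c S.add_cancel_mid[of \<epsilon> "\<one>\<^bsub>S\<^esub>" \<epsilon>] by (simp add: S.minus_add S.a_comm)
  finally show "(plus_part S \<epsilon> \<oplus>\<^bsub>S\<^esub> \<ominus>\<^bsub>S\<^esub> minus_part S \<epsilon>) \<oplus>\<^bsub>S\<^esub> (plus_part S \<epsilon> \<oplus>\<^bsub>S\<^esub> \<ominus>\<^bsub>S\<^esub> minus_part S \<epsilon>) = \<epsilon> \<oplus>\<^bsub>S\<^esub> \<epsilon>" .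
qed (use parts_closed sign_closed in auto)

end

text \<open>For an involution s, (p + q s)(p' + q' s) has the coefficients p p' + q q' and p q' + q
  p'; so these belong to the composite of two section values. The identities follow from p + q = 1
  and p - q = \<epsilon>, and likewise for \<delta>.\<close>

lemma plus_part_mult:
  assumes S: "algebra R S" and \<epsilon>: "\<epsilon> \<in> carrier (points mu2 S)" and \<delta>: "\<delta> \<in> carrier (points mu2 S)"
    and \<epsilon>\<delta>: "\<epsilon> \<otimes>\<^bsub>S\<^esub> \<delta> \<in> carrier (points mu2 S)"
  shows "plus_part S \<epsilon> \<otimes>\<^bsub>S\<^esub> plus_part S \<delta> \<oplus>\<^bsub>S\<^esub> minus_part S \<epsilon> \<otimes>\<^bsub>S\<^esub> minus_part S \<delta> = plus_part S (\<epsilon> \<otimes>\<^bsub>S\<^esub> \<delta>)"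
    and "plus_part S \<epsilon> \<otimes>\<^bsub>S\<^esub> minus_part S \<delta> \<oplus>\<^bsub>S\<^esub> minus_part S \<epsilon> \<otimes>\<^bsub>S\<^esub> plus_part S \<delta> = minus_part S (\<epsilon> \<otimes>\<^bsub>S\<^esub> \<delta>)"
proof -
  interpret S: cring S by (rule algebra.M_cring[OF S])
  let ?p = "plus_part S \<epsilon>" and ?q = "minus_part S \<epsilon>" and ?p' = "plus_part S \<delta>" and ?q' = "minus_part S \<delta>"
  note c = parts_closed[OF S \<epsilon>] parts_closed[OF S \<delta>] parts_closed[OF S \<epsilon>\<delta>] sign_closed[OF S \<epsilon>] sign_closed[OF S \<delta>]
  show 1: "?p \<otimes>\<^bsub>S\<^esub> ?p' \<oplus>\<^bsub>S\<^esub> ?q \<otimes>\<^bsub>S\<^esub> ?q' = plus_part S (\<epsilon> \<otimes>\<^bsub>S\<^esub> \<delta>)"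
  proof (rule double_cancel_ring[OF S])
    have "(?p \<otimes>\<^bsub>S\<^esub> ?p' \<oplus>\<^bsub>S\<^esub> ?q \<otimes>\<^bsub>S\<^esub> ?q') \<oplus>\<^bsub>S\<^esub> (?p \<otimes>\<^bsub>S\<^esub> ?p' \<oplus>\<^bsub>S\<^esub> ?q \<otimes>\<^bsub>S\<^esub> ?q') =
        ?p \<otimes>\<^bsub>S\<^esub> (?p' \<oplus>\<^bsub>S\<^esub> ?p') \<oplus>\<^bsub>S\<^esub> ?q \<otimes>\<^bsub>S\<^esub> (?q' \<oplus>\<^bsub>S\<^esub> ?q')"
      using c by (simp add: S.r_distr S.a_ac)
    also have "\<dots> = (?p \<oplus>\<^bsub>S\<^esub> ?q) \<oplus>\<^bsub>S\<^esub> (?p \<oplus>\<^bsub>S\<^esub> \<ominus>\<^bsub>S\<^esub> ?q) \<otimes>\<^bsub>S\<^esub> \<delta>"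
      unfolding plus_double[OF S \<delta>] minus_double[OF S \<delta>]
      using c by (simp add: S.r_distr S.l_distr S.l_minus S.r_minus S.a_ac)
    also have "\<dots> = plus_part S (\<epsilon> \<otimes>\<^bsub>S\<^esub> \<delta>) \<oplus>\<^bsub>S\<^esub> plus_part S (\<epsilon> \<otimes>\<^bsub>S\<^esub> \<delta>)"
      unfolding parts_sum[OF S \<epsilon>] parts_difference[OF S \<epsilon>] plus_double[OF S \<epsilon>\<delta>] ..
    finally show "(?p \<otimes>\<^bsub>S\<^esub> ?p' \<oplus>\<^bsub>S\<^esub> ?q \<otimes>\<^bsub>S\<^esub> ?q') \<oplus>\<^bsub>S\<^esub> (?p \<otimes>\<^bsub>S\<^esub> ?p' \<oplus>\<^bsub>S\<^esub> ?q \<otimes>\<^bsub>S\<^esub> ?q') =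
      plus_part S (\<epsilon> \<otimes>\<^bsub>S\<^esub> \<delta>) \<oplus>\<^bsub>S\<^esub> plus_part S (\<epsilon> \<otimes>\<^bsub>S\<^esub> \<delta>)" .
  qed (use c in auto)
  \<comment> \<open>The four products add up to (p + q)(p' + q') = 1, so the second identity is the
    complement of the first.\<close>
  have "plus_part S (\<epsilon> \<otimes>\<^bsub>S\<^esub> \<delta>) \<oplus>\<^bsub>S\<^esub> (?p \<otimes>\<^bsub>S\<^esub> ?q' \<oplus>\<^bsub>S\<^esub> ?q \<otimes>\<^bsub>S\<^esub> ?p') = (?p \<oplus>\<^bsub>S\<^esub> ?q) \<otimes>\<^bsub>S\<^esub> (?p' \<oplus>\<^bsub>S\<^esub> ?q')"
    unfolding 1[symmetric] using c by (simp add: S.r_distr S.l_distr S.a_ac)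
  also have "\<dots> = plus_part S (\<epsilon> \<otimes>\<^bsub>S\<^esub> \<delta>) \<oplus>\<^bsub>S\<^esub> minus_part S (\<epsilon> \<otimes>\<^bsub>S\<^esub> \<delta>)"
    by (simp add: parts_sum[OF S \<epsilon>] parts_sum[OF S \<delta>] parts_sum[OF S \<epsilon>\<delta>])
  finally show "?p \<otimes>\<^bsub>S\<^esub> ?q' \<oplus>\<^bsub>S\<^esub> ?q \<otimes>\<^bsub>S\<^esub> ?p' = minus_part S (\<epsilon> \<otimes>\<^bsub>S\<^esub> \<delta>)"
    by (rule S.sum_left_cancel) (use c in auto)
qed

text \<open>For \<open>\<epsilon> = -1\<close> this is the swap; in general, \<open>\<epsilon>\<close> splits \<open>S\<close> by the orthogonal idempotents
  \<open>(1 + \<epsilon>)/2\<close> and \<open>(1 - \<epsilon>)/2\<close>, on which it is \<open>1\<close> and \<open>-1\<close>.\<close>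

definition brown_section :: "'u rring \<Rightarrow> 'u \<Rightarrow> ('a, 'u) brown_matrix \<Rightarrow> ('a, 'u) brown_matrix" where
  "brown_section S \<epsilon> = (\<lambda>x\<in>carrier (B S). plus_part S \<epsilon> \<odot>\<^bsub>B S\<^esub> x \<oplus>\<^bsub>B S\<^esub> minus_part S \<epsilon> \<odot>\<^bsub>B S\<^esub> brown_swap x)"

lemma brown_section_apply:
  "x \<in> carrier (B S) \<Longrightarrow> brown_section S \<epsilon> x = plus_part S \<epsilon> \<odot>\<^bsub>B S\<^esub> x \<oplus>\<^bsub>B S\<^esub> minus_part S \<epsilon> \<odot>\<^bsub>B S\<^esub> brown_swap x"
  by (simp add: brown_section_def)

lemma brown_section_linear:
  assumes S: "algebra R S" and \<epsilon>: "\<epsilon> \<in> carrier (points mu2 S)"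
  shows "brown_section S \<epsilon> \<in> linear_maps S (B S) (B S)"
proof -
  interpret BS: module S "B S" by (rule brown_module[OF S])
  note c = parts_closed[OF S \<epsilon>]
  show ?thesis
  proof (rule linear_mapsI)
    show "brown_section S \<epsilon> \<in> extensional (carrier (B S))" by (simp add: brown_section_def)
    show "brown_section S \<epsilon> x \<in> carrier (B S)" if "x \<in> carrier (B S)" for x
      using that c by (simp add: brown_section_apply)
    show "brown_section S \<epsilon> (x \<oplus>\<^bsub>B S\<^esub> y) = brown_section S \<epsilon> x \<oplus>\<^bsub>B S\<^esub> brown_section S \<epsilon> y"
      if "x \<in> carrier (B S)" "y \<in> carrier (B S)" for x y
      using that c by (simp add: brown_section_apply brown_swap_add BS.smult_r_distr BS.a_ac)
    show "brown_section S \<epsilon> (s \<odot>\<^bsub>B S\<^esub> x) = s \<odot>\<^bsub>B S\<^esub> brown_section S \<epsilon> x"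
      if "s \<in> carrier S" "x \<in> carrier (B S)" for s x
      using that c by (simp add: brown_section_apply brown_swap_smult BS.smult_r_distr BS.smult_comm[of s])
  qed
qed

lemma brown_section_compose:
  assumes S: "algebra R S" and \<epsilon>: "\<epsilon> \<in> carrier (points mu2 S)" and \<delta>: "\<delta> \<in> carrier (points mu2 S)"
    and \<epsilon>\<delta>: "\<epsilon> \<otimes>\<^bsub>S\<^esub> \<delta> \<in> carrier (points mu2 S)" and x: "x \<in> carrier (B S)"
  shows "brown_section S \<epsilon> (brown_section S \<delta> x) = brown_section S (\<epsilon> \<otimes>\<^bsub>S\<^esub> \<delta>) x"
proof -
  interpret BS: module S "B S" by (rule brown_module[OF S])
  let ?p = "plus_part S \<epsilon>" and ?q = "minus_part S \<epsilon>" and ?p' = "plus_part S \<delta>" and ?q' = "minus_part S \<delta>"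
  note c = parts_closed[OF S \<epsilon>] parts_closed[OF S \<delta>]
  have "brown_section S \<epsilon> (brown_section S \<delta> x) =
      (?p \<otimes>\<^bsub>S\<^esub> ?p' \<oplus>\<^bsub>S\<^esub> ?q \<otimes>\<^bsub>S\<^esub> ?q') \<odot>\<^bsub>B S\<^esub> x \<oplus>\<^bsub>B S\<^esub> (?p \<otimes>\<^bsub>S\<^esub> ?q' \<oplus>\<^bsub>S\<^esub> ?q \<otimes>\<^bsub>S\<^esub> ?p') \<odot>\<^bsub>B S\<^esub> brown_swap x"
    using x c by (simp add: brown_section_apply brown_swap_add brown_swap_smult BS.smult_l_distr BS.smult_r_distr
        BS.smult_assoc1 BS.a_ac)
  then show ?thesis
    unfolding plus_part_mult[OF S \<epsilon> \<delta> \<epsilon>\<delta>] by (simp add: brown_section_apply x)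
qed

text \<open>A linear combination of two automorphisms is rarely multiplicative. Here the
  coefficients are orthogonal idempotents, so the mixed terms vanish and the squares reproduce the
  coefficients.\<close>

lemma brown_section_Aut:
  assumes S: "algebra R S" and \<epsilon>: "\<epsilon> \<in> carrier (points mu2 S)"
  shows "brown_section S \<epsilon> \<in> carrier (points (Aut_brown R A) S)"
proof -
  interpret S: cring S by (rule algebra.M_cring[OF S])
  interpret AS: module S "AA S" by (rule AA_module[OF S])
  interpret BS: module S "B S" by (rule brown_module[OF S])
  let ?p = "plus_part S \<epsilon>" and ?q = "minus_part S \<epsilon>"
  note c = parts_closed[OF S \<epsilon>] and lin = brown_section_linear[OF S \<epsilon>]
  have one_mu: "\<one>\<^bsub>S\<^esub> \<in> carrier (points mu2 S)" by (simp add: mu2_carrier S.is_cring)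
  have p1: "plus_part S \<one>\<^bsub>S\<^esub> = \<one>\<^bsub>S\<^esub>" using half_two[OF S] S by (simp add: plus_part_def S.r_distr)
  have q1: "minus_part S \<one>\<^bsub>S\<^esub> = \<zero>\<^bsub>S\<^esub>" using S by (simp add: minus_part_def S.r_neg)
  \<comment> \<open>\<epsilon> squares to 1, so the map is its own inverse.\<close>
  have invol: "brown_section S \<epsilon> (brown_section S \<epsilon> x) = x" if x: "x \<in> carrier (B S)" for x
    using brown_section_compose[OF S \<epsilon> \<epsilon> _ x] one_mu x
    by (simp add: sign_square[OF S \<epsilon>] brown_section_apply p1 q1 del: brown_smult brown_add)
  have GL: "brown_section S \<epsilon> \<in> general_linear S (B S)"
    by (rule general_linearI[OF lin lin invol invol])
  have "preserves_brown S (brown_section S \<epsilon>)"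
    unfolding preserves_brown_def
  proof (intro conjI ballI)
    fix x y assume x: "x \<in> carrier (B S)" and y: "y \<in> carrier (B S)"
    note bm = brown_mult_closed[OF S]
    have "brown_section S \<epsilon> x \<otimes>\<^bsub>B S\<^esub> brown_section S \<epsilon> y =
        (?p \<otimes>\<^bsub>S\<^esub> ?p) \<odot>\<^bsub>B S\<^esub> (x \<otimes>\<^bsub>B S\<^esub> y) \<oplus>\<^bsub>B S\<^esub> (?p \<otimes>\<^bsub>S\<^esub> ?q) \<odot>\<^bsub>B S\<^esub> (brown_swap x \<otimes>\<^bsub>B S\<^esub> y) \<oplus>\<^bsub>B S\<^esub>
        ((?q \<otimes>\<^bsub>S\<^esub> ?p) \<odot>\<^bsub>B S\<^esub> (x \<otimes>\<^bsub>B S\<^esub> brown_swap y) \<oplus>\<^bsub>B S\<^esub> (?q \<otimes>\<^bsub>S\<^esub> ?q) \<odot>\<^bsub>B S\<^esub> (brown_swap x \<otimes>\<^bsub>B S\<^esub> brown_swap y))"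
      using x y c by (simp add: brown_section_apply brown_mult_add_left[OF S] brown_mult_add_right[OF S]
          brown_mult_smult_left[OF S] brown_mult_smult_right[OF S] bm BS.smult_r_distr BS.smult_assoc1)
    also have "\<dots> = ?p \<odot>\<^bsub>B S\<^esub> (x \<otimes>\<^bsub>B S\<^esub> y) \<oplus>\<^bsub>B S\<^esub> ?q \<odot>\<^bsub>B S\<^esub> brown_swap (x \<otimes>\<^bsub>B S\<^esub> y)"
      unfolding S.m_comm[OF c(2,1)] parts_idempotent[OF S \<epsilon>] parts_orthogonal[OF S \<epsilon>] brown_swap_mult[OF S x y]
      using x y c bm by (simp add: BS.smult_l_null del: brown_zero)
    finally show "brown_section S \<epsilon> (x \<otimes>\<^bsub>B S\<^esub> y) = brown_section S \<epsilon> x \<otimes>\<^bsub>B S\<^esub> brown_section S \<epsilon> y"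
      using bm[OF x y] by (simp add: brown_section_apply)
  next
    show "brown_section S \<epsilon> \<one>\<^bsub>B S\<^esub> = \<one>\<^bsub>B S\<^esub>"
      using c parts_sum[OF S \<epsilon>] by (simp add: brown_section_apply)
  next
    fix x assume "x \<in> carrier (B S)"
    then show "brown_section S \<epsilon> (brown_involution x) = brown_involution (brown_section S \<epsilon> x)"
      by (elim brown_cases) (simp add: brown_section_apply)
  qed
  then show ?thesis using GL by (simp add: Aut_brown_carrier)
qed

text \<open>The swap sends j to -j, so the section at \<epsilon> multiplies j by p - q, which is
  \<epsilon>.\<close>

lemma brown_pi_section:
  assumes S: "algebra R S" and \<epsilon>: "\<epsilon> \<in> carrier (points mu2 S)"
  shows "brown_pi R A S (brown_section S \<epsilon>) = \<epsilon>"
proof (rule brown_pi_eqI[OF S \<epsilon>])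
  interpret S: cring S by (rule algebra.M_cring[OF S])
  interpret AS: module S "AA S" by (rule AA_module[OF S])
  note c = parts_closed[OF S \<epsilon>] sign_closed[OF S \<epsilon>] and d = parts_difference[OF S \<epsilon>]
  have "minus_part S \<epsilon> \<oplus>\<^bsub>S\<^esub> \<ominus>\<^bsub>S\<^esub> plus_part S \<epsilon> = \<ominus>\<^bsub>S\<^esub> \<epsilon>"
    using c by (subst d[symmetric]) (simp add: S.minus_add S.a_comm)
  then show "brown_section S \<epsilon> (brown_j R A S) = \<epsilon> \<odot>\<^bsub>B S\<^esub> brown_j R A S"
    using c d by (simp add: brown_section_apply[OF brown_j_closed[OF S]]) (simp add: brown_j_def S.r_minus S.a_comm)
qed

lemma section_group_functor_hom: "group_functor_hom R mu2 (Aut_brown R A) brown_section"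
  unfolding group_functor_hom_def
proof (intro conjI allI impI ballI mu2_group_functor Aut_brown_group_functor; (elim conjE)?)
  fix S :: "'u rring" assume S: "algebra R S"
  interpret mu: group "points mu2 S"
    using mu2_group_functor[of R] S by (simp add: is_group_functor_def)
  show "brown_section S \<in> hom (points mu2 S) (points (Aut_brown R A) S)"
  proof (rule homI)
    fix \<epsilon> \<delta> assume \<epsilon>: "\<epsilon> \<in> carrier (points mu2 S)" and \<delta>: "\<delta> \<in> carrier (points mu2 S)"
    have \<epsilon>\<delta>: "\<epsilon> \<otimes>\<^bsub>S\<^esub> \<delta> \<in> carrier (points mu2 S)" using mu.m_closed[OF \<epsilon> \<delta>] by simp
    have "compose (carrier (B S)) (brown_section S \<epsilon>) (brown_section S \<delta>) = brown_section S (\<epsilon> \<otimes>\<^bsub>S\<^esub> \<delta>)"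
      by (rule extensionalityI[of _ "carrier (B S)"])
        (simp_all add: compose_eq brown_section_compose[OF S \<epsilon> \<delta> \<epsilon>\<delta>] linear_maps_extensional[OF brown_section_linear[OF S \<epsilon>\<delta>]])
    then show "brown_section S (\<epsilon> \<otimes>\<^bsub>points mu2 S\<^esub> \<delta>) =
        brown_section S \<epsilon> \<otimes>\<^bsub>points (Aut_brown R A) S\<^esub> brown_section S \<delta>"
      by (simp add: Aut_brown_mult[OF brown_section_Aut[OF S \<epsilon>] brown_section_Aut[OF S \<delta>]])
  qed (rule brown_section_Aut[OF S])
next
  fix S S' :: "'u rring" and \<phi> \<epsilon>
  assume S: "algebra R S" and S': "algebra R S'" and \<phi>: "\<phi> \<in> rring_hom R S S'" and \<epsilon>: "\<epsilon> \<in> carrier (points mu2 S)"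
  interpret phi: ring_hom_cring S S' \<phi> by (rule rring_hom_cring[OF S S' \<phi>])
  interpret BS: module S "B S" by (rule brown_module[OF S])
  have \<phi>\<epsilon>: "\<phi> \<epsilon> \<in> carrier (points mu2 S')"
    using \<epsilon> by (auto simp: mu2_carrier phi.R.is_cring phi.S.is_cring simp flip: phi.hom_mult)
  have parts: "plus_part S' (\<phi> \<epsilon>) = \<phi> (plus_part S \<epsilon>)" "minus_part S' (\<phi> \<epsilon>) = \<phi> (minus_part S \<epsilon>)"
    using sign_closed[OF S \<epsilon>] S by (simp_all add: plus_part_def minus_part_def half_map[OF S S' \<phi>])
  have "FB.ext S S' \<phi> (brown_section S \<epsilon>) = brown_section S' (\<phi> \<epsilon>)"
  proof (rule FB.ext_eqI[OF S S' \<phi> brown_section_linear[OF S' \<phi>\<epsilon>]])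
    fix x assume x: "x \<in> carrier (B S)"
    have swap: "brown_swap (bm S' \<phi> x) = bm S' \<phi> (brown_swap x)"
      using x by (auto elim!: brown_cases)
    show "brown_section S' (\<phi> \<epsilon>) (bm S' \<phi> x) = bm S' \<phi> (brown_section S \<epsilon> x)"
      using x parts_closed[OF S \<epsilon>]
      by (simp add: brown_section_apply brown_map_closed[OF S S' \<phi>] parts swap brown_map_add[OF S S' \<phi>]
        brown_map_smult[OF S S' \<phi>])
  qed
  then show "brown_section S' (induced mu2 S S' \<phi> \<epsilon>) = induced (Aut_brown R A) S S' \<phi> (brown_section S \<epsilon>)"
    by (simp add: Aut_brown_def)
qed

lemma brown_split_exact:
  "split_exact R (Isom_norm R A) (Aut_brown R A) mu2 (brown_iota R A) (brown_pi R A)"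
proof -
  \<comment> \<open>Surjectivity on S-points is read off from the section.\<close>
  have "brown_pi R A S ` carrier (points (Aut_brown R A) S) = carrier (points mu2 S)" if S: "algebra R S" for S
  proof (intro equalityI subsetI)
    fix \<epsilon> assume \<epsilon>: "\<epsilon> \<in> carrier (points mu2 S)"
    then show "\<epsilon> \<in> brown_pi R A S ` carrier (points (Aut_brown R A) S)"
      using brown_pi_section[OF S \<epsilon>] brown_section_Aut[OF S \<epsilon>] by (intro image_eqI[of _ _ "brown_section S \<epsilon>"]) simp_all
  qed (use brown_pi_props(1)[OF S] in auto)
  then show ?thesis
    unfolding split_exact_def
    using iota_group_functor_hom pi_group_functor_hom iota_injective iota_image section_group_functor_hom brown_pi_section
    by (intro conjI allI impI exI[of _ brown_section]) auto
qed

end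

end

theorem proposition3p9:
  fixes R :: "'u ring" and A :: "('u, 'a) cubic_algebra"
  assumes "infinite (UNIV :: 'u set)"
    and "cring R"
    and "albert_algebra R A"
  shows "group_functor_hom R (Isom_norm R A) (Aut_brown R A) (brown_iota R A) \<and>
    (\<one>\<^bsub>R\<^esub> \<oplus>\<^bsub>R\<^esub> \<one>\<^bsub>R\<^esub> \<in> Units R \<longrightarrow>
       split_exact R (Isom_norm R A) (Aut_brown R A) mu2 (brown_iota R A) (brown_pi R A))"
proof -
  interpret albert R A by (rule albert.intro) (rule assms)+
  show ?thesis using iota_group_functor_hom brown_split_exact by blast
qed

end
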